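(* Let $\nu,\nu^*$ be L\'evy measures on $\mathbb R^d$ such that $\nu\ll\nu^*$ with density $g_\nu$, and let $g:\mathbb R^d\to\mathbb R$ be measurable. Assume that $$\int(1-g_\nu)^2\,\mathrm d\nu^*<\infty,\quad\int g^2\,\mathrm d\nu^*<\infty,\quad\int(|x|\wedge1)|g(x)|\,\nu^*(\mathrm dx)<\infty,\quad\int_{|x|\le1}|x|\,|1-g_\nu(x)|\,\nu^*(\mathrm dx)<\infty.$$ Let $b,b^*\in\mathbb R^d$ satisfy $b=b^*+\int_{|x|\le1}x(g_\nu(x)-1)\,\nu^*(\mathrm dx)$. Let $\theta_0\in\mathbb R$ and let $I\subset\mathbb R$ be an interval with non-empty interior such that $\theta_0\in I$ and $g_\theta:=g_\nu+(\theta-\theta_0)g\ge0$ $\nu^*$-a.e. for every $\theta\in I$. For $\theta\in I$ let $$b_\theta:=b+(\theta-\theta_0)\int_{|x|\le1}xg(x)\,\nu^*(\mathrm dx)$$ and let $\nu_\theta$ denote the measure with density $g_\theta$ with respect to $\nu^*$. Let $f:\mathbf D\to\mathbb R$ be $\mathcal A_{t_0}$-measurable for some $t_0>0$ and assume that $\mathbb E_{b^*,\nu^*}f(X)^2<\infty$. Then $$\mathbb E_{b_\theta,\nu_\theta}f(X)=\mathbb E_{b,\nu}f(X)+\sum_{n=1}^\infty\frac{(\theta-\theta_0)^n}{n!}\int\big(\mathbb E_{b,\nu}\Delta^nf(X)\big)g^{\otimes n}\,\mathrm d(\lambda_1\otimes\nu^* )^n,\qquad\theta\in I,$$ where the series converges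 absolutely. In particular, $$\frac{\mathrm d}{\mathrm d\theta}\mathbb E_{b_\theta,\nu_\theta}f(X)\Big|_{\theta=\theta_0}=\int_{\mathbb R^d}\int_0^\infty\big(\mathbb E_{b,\nu}\Delta_{t,x}f(X)\big)g(x)\,\mathrm dt\,\nu^*(\mathrm dx).$$
   Context: A L\'evy measure on $\mathbb R^d$ is a measure $\nu$ with $\nu(\{0\})=0$ and $\int(|x|^2\wedge1)\,\nu(\mathrm dx)<\infty$. $\lambda_1$ is Lebesgue measure on $[0,\infty)$. A covariance matrix $\Sigma\in\mathbb R^{d\times d}$ is fixed. $\mathbf D$ is the space of $\mathbb R^d$-valued right-continuous functions on $[0,\infty)$ with left-hand limits on $(0,\infty)$, with the Kolmogorov product $\sigma$-field. For $b\in\mathbb R^d$ and a L\'evy measure $\nu$, $\mathbb P_{b,\nu}$ (expectation $\mathbb E_{b,\nu}$) is a probability measure under which the $\mathbf D$-valued random element $X=(X_t)_{t\ge0}$ is a L\'evy process with characteristic triplet $(\Sigma,b,\nu)$, i.e. has the law of $$bt+W_t+\int_{|x|\le1}\int_0^tx\,(\Phi(\mathrm ds,\mathrm dx)-\mathrm ds\,\nu(\mathrm dx))+\int_{|x|>1}\int_0^tx\,\Phi(\mathrm ds,\mathrm dx),\quad t\ge0,$$ with $W$ a $d$-dimensional Wiener process with covariance matrix $\Sigma$ and $\Phi$ an independent Poisson process on $[0,\infty)\times\mathbb R^d$ with intensity measure $\lambda_1\otimes\nu$ (integrals as limits in probability). For $s>0$, $\mathcal A_s$ is the $\sigma$-field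 on $\mathbf D$ generated by $w\mapsto w^{(s)}$, $w^{(s)}(t):=w(t\wedge s)$. For a path $w$ and $(t_1,x_1)\in[0,\infty)\times\mathbb R^d$ let $w^{t_1,x_1}_t:=w_t+\mathbf 1\{t\ge t_1\}x_1$, and $\Delta_{t_1,x_1}f(w):=f(w^{t_1,x_1})-f(w)$; inductively $\Delta^n_{t_1,x_1,\ldots,t_n,x_n}f:=\Delta_{t_1,x_1}(\Delta^{n-1}_{t_2,x_2,\ldots,t_n,x_n}f)$, $\Delta^1:=\Delta$. $\mathbb E_{b,\nu}\Delta^nf(X)$ denotes the function $(t_1,x_1,\ldots,t_n,x_n)\mapsto\mathbb E_{b,\nu}\Delta^n_{t_1,x_1,\ldots,t_n,x_n}f(X)$, understood almost everywhere with respect to the (total variation of the) measure against which it is integrated. For $g:\mathbb R^d\to\mathbb R$, $g^{\otimes n}$ is regarded as the function $(t_1,x_1,\ldots,t_n,x_n)\mapsto\prod_{j=1}^ng(x_j)$ on $([0,\infty)\times\mathbb R^d)^n$. If $\theta_0$ is an endpoint of $I$, the derivative is one-sided. *)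

theory Defs
  imports "HOL-Probability.Probability"
begin

section \<open>Path space\<close>

text \<open>A function on $[0,\infty)$ is represented by a function on the reals that is extensional
  on \<open>{0..}\<close>, so that paths are equal iff they agree on $[0,\infty)$.\<close>

definition cadlag :: "(real \<Rightarrow> 'a::topological_space) set" where
  "cadlag = {w \<in> extensional {0..}.
     (\<forall>t\<ge>0. (w \<longlongrightarrow> w t) (at_right t)) \<and> (\<forall>t>0. \<exists>l. (w \<longlongrightarrow> l) (at_left t))}"

definition path_space :: "(real \<Rightarrow> 'a::topological_space) measure" where
  "path_space = restrict_space (Pi\<^sub>M {0..} (\<lambda>_. borel)) cadlag"

definition stopped :: "real \<Rightarrow> (real \<Rightarrow> 'a) \<Rightarrow> real \<Rightarrow> 'a" where
  "stopped s w = (\<lambda>t\<in>{0..}. w (min t s))"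

definition stopped_algebra :: "real \<Rightarrow> (real \<Rightarrow> 'a::topological_space) measure" where
  "stopped_algebra s = vimage_algebra cadlag (stopped s) path_space"


section \<open>Difference operators\<close>

definition add_jump :: "real \<times> 'a \<Rightarrow> (real \<Rightarrow> 'a) \<Rightarrow> real \<Rightarrow> 'a::monoid_add" where
  "add_jump p w = (\<lambda>t\<in>{0..}. w t + (if fst p \<le> t then snd p else 0))"

definition jump_diff ::
    "real \<times> 'a::monoid_add \<Rightarrow> ((real \<Rightarrow> 'a) \<Rightarrow> real) \<Rightarrow> (real \<Rightarrow> 'a) \<Rightarrow> real" where
  "jump_diff p f w = f (add_jump p w) - f w"

primrec jump_diffs ::
    "(real \<times> 'a::monoid_add) list \<Rightarrow> ((real \<Rightarrow> 'a) \<Rightarrow> real) \<Rightarrow> (real \<Rightarrow> 'a) \<Rightarrow> real" where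
  "jump_diffs [] f = f"
| "jump_diffs (p # ps) f = jump_diff p (jump_diffs ps f)"

text \<open>Points of $([0,\infty)\times\mathbb{R}^d)^n$ are functions \<open>z\<close> on \<open>{..<n}\<close>; here
  \<open>z i\<close> is the pair $(t_{i+1},x_{i+1})$.\<close>

definition jump_diff_n ::
    "nat \<Rightarrow> (nat \<Rightarrow> real \<times> 'a::monoid_add) \<Rightarrow> ((real \<Rightarrow> 'a) \<Rightarrow> real) \<Rightarrow> (real \<Rightarrow> 'a) \<Rightarrow> real" where
  "jump_diff_n n z f = jump_diffs (map z [0..<n]) f"

definition tensor_power :: "('a \<Rightarrow> real) \<Rightarrow> nat \<Rightarrow> (nat \<Rightarrow> real \<times> 'a) \<Rightarrow> real" where
  "tensor_power g n z = (\<Prod>i<n. g (snd (z i)))"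


section \<open>Levy processes\<close>

definition levy_measure :: "'a::euclidean_space measure \<Rightarrow> bool" where
  "levy_measure \<nu> \<longleftrightarrow> sets \<nu> = sets borel \<and> emeasure \<nu> {0} = 0 \<and>
     (\<integral>\<^sup>+x. ennreal (min ((norm x)\<^sup>2) 1) \<partial>\<nu>) < \<infinity>"

definition covariance_matrix :: "real^'d^'d \<Rightarrow> bool" where
  "covariance_matrix S \<longleftrightarrow> transpose S = S \<and> (\<forall>u. 0 \<le> u \<bullet> (S *v u))"

definition half_line_lebesgue :: "real measure" where
  "half_line_lebesgue = restrict_space lborel {0..}"

definition jump_intensity :: "'a::euclidean_space measure \<Rightarrow> (real \<times> 'a) measure" where
  "jump_intensity \<nu> = half_line_lebesgue \<Otimes>\<^sub>M \<nu>"

definition jump_intensity_power ::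
    "nat \<Rightarrow> 'a::euclidean_space measure \<Rightarrow> (nat \<Rightarrow> real \<times> 'a) measure" where
  "jump_intensity_power n \<nu> = Pi\<^sub>M {..<n} (\<lambda>_. jump_intensity \<nu>)"

text \<open>The centred normal law is specified by its characteristic function, since \<open>S\<close> may be
  singular.\<close>

definition centred_normal :: "'w measure \<Rightarrow> real^'d^'d \<Rightarrow> ('w \<Rightarrow> real^'d) \<Rightarrow> bool" where
  "centred_normal M S Y \<longleftrightarrow> Y \<in> borel_measurable M \<and>
     (\<forall>u. (\<integral>\<omega>. cis (u \<bullet> Y \<omega>) \<partial>M) = of_real (exp (- (u \<bullet> (S *v u)) / 2)))"

text \<open>\<open>prob_space.indep_var\<close> requires both random elements to have values of the same type.\<close>

definition independent_elements ::
    "'w measure \<Rightarrow> 'a measure \<Rightarrow> ('w \<Rightarrow> 'a) \<Rightarrow> 'b measure \<Rightarrow> ('w \<Rightarrow> 'b) \<Rightarrow> bool" where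
  "independent_elements M A U B V \<longleftrightarrow> U \<in> measurable M A \<and> V \<in> measurable M B \<and>
     prob_space.indep_set M (sets (vimage_algebra (space M) U A)) (sets (vimage_algebra (space M) V B))"

definition wiener_process :: "'w measure \<Rightarrow> real^'d^'d \<Rightarrow> (real \<Rightarrow> 'w \<Rightarrow> real^'d) \<Rightarrow> bool" where
  "wiener_process M S W \<longleftrightarrow>
     (\<forall>t\<ge>0. W t \<in> borel_measurable M) \<and>
     (AE \<omega> in M. W 0 \<omega> = 0) \<and>
     (AE \<omega> in M. continuous_on {0..} (\<lambda>t. W t \<omega>)) \<and>
     (\<forall>s t. 0 \<le> s \<and> s \<le> t \<longrightarrow>
        centred_normal M ((t - s) *\<^sub>R S) (\<lambda>\<omega>. W t \<omega> - W s \<omega>) \<and>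
        independent_elements M borel (\<lambda>\<omega>. W t \<omega> - W s \<omega>)
          (Pi\<^sub>M {0..s} (\<lambda>_. borel)) (\<lambda>\<omega>. \<lambda>r\<in>{0..s}. W r \<omega>))"

definition poisson_process :: "'w measure \<Rightarrow> 'y measure \<Rightarrow> ('w \<Rightarrow> 'y measure) \<Rightarrow> bool" where
  "poisson_process M L \<Phi> \<longleftrightarrow>
     (\<forall>\<omega>\<in>space M. sets (\<Phi> \<omega>) = sets L \<and>
        (\<forall>B\<in>sets L. emeasure (\<Phi> \<omega>) B \<in> insert \<infinity> (range of_nat))) \<and>
     (\<forall>B\<in>sets L. (\<lambda>\<omega>. emeasure (\<Phi> \<omega>) B) \<in> borel_measurable M) \<and>
     (\<forall>B\<in>sets L. emeasure L B < \<infinity> \<longrightarrow>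
        (\<forall>k. measure M {\<omega>\<in>space M. emeasure (\<Phi> \<omega>) B = of_nat k} =
               measure L B ^ k / fact k * exp (- measure L B))) \<and>
     (\<forall>B\<in>sets L. emeasure L B = \<infinity> \<longrightarrow> (AE \<omega> in M. emeasure (\<Phi> \<omega>) B = \<infinity>)) \<and>
     (\<forall>B::nat \<Rightarrow> 'y set. range B \<subseteq> sets L \<and> disjoint_family B \<longrightarrow>
        prob_space.indep_vars M (\<lambda>_. borel) (\<lambda>i \<omega>. emeasure (\<Phi> \<omega>) (B i)) UNIV)"

definition converges_in_probability ::
    "'w measure \<Rightarrow> ('i \<Rightarrow> 'w \<Rightarrow> 'a::real_normed_vector) \<Rightarrow> ('w \<Rightarrow> 'a) \<Rightarrow> 'i filter \<Rightarrow> bool" where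
  "converges_in_probability M Y Z F \<longleftrightarrow> Z \<in> borel_measurable M \<and>
     (\<forall>\<delta>>0. ((\<lambda>i. measure M {\<omega>\<in>space M. \<delta> < norm (Y i \<omega> - Z \<omega>)}) \<longlongrightarrow> 0) F)"

text \<open>The Levy--Ito representation with ingredients \<open>W\<close> and \<open>\<Phi>\<close> on the probability space
  \<open>M\<close>; \<open>J t\<close> is the compensated integral over $|x|\le 1$, the limit in probability of
  the integrals over $\varepsilon<|x|\le 1$ as $\varepsilon\to 0$.\<close>

definition levy_ito_process ::
    "'w measure \<Rightarrow> real^'d^'d \<Rightarrow> real^'d \<Rightarrow> (real^'d) measure \<Rightarrow> (real \<Rightarrow> 'w \<Rightarrow> real^'d) \<Rightarrow> bool" where
  "levy_ito_process M S b \<nu> Y \<longleftrightarrow> prob_space M \<and>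
     (\<exists>W \<Phi> J. wiener_process M S W \<and>
        poisson_process M (jump_intensity \<nu>) \<Phi> \<and>
        independent_elements M
          (Pi\<^sub>M {0..} (\<lambda>_. borel)) (\<lambda>\<omega>. \<lambda>t\<in>{0..}. W t \<omega>)
          (Pi\<^sub>M (sets (jump_intensity \<nu>)) (\<lambda>_. borel))
            (\<lambda>\<omega>. \<lambda>B\<in>sets (jump_intensity \<nu>). emeasure (\<Phi> \<omega>) B) \<and>
        (\<forall>t\<ge>0. converges_in_probability M
           (\<lambda>\<epsilon> \<omega>. (LINT p:{0..t} \<times> {x. \<epsilon> < norm x \<and> norm x \<le> 1}|\<Phi> \<omega>. snd p)
                  - (LINT p:{0..t} \<times> {x. \<epsilon> < norm x \<and> norm x \<le> 1}|jump_intensity \<nu>. snd p))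
           (J t) (at_right 0)) \<and>
        (\<forall>t\<ge>0. \<forall>\<omega>\<in>space M.
           Y t \<omega> = t *\<^sub>R b + W t \<omega> + J t \<omega> + (LINT p:{0..t} \<times> {x. 1 < norm x}|\<Phi> \<omega>. snd p)))"

text \<open>A random element \<open>X\<close> of the path space is a Levy process with triplet $(S,b,\nu)$ if it
  has the law, on the Kolmogorov product, of a process as above. A definition cannot quantify over
  the type of the sample space, so the representation is taken on the reals, with an arbitrary
  sigma-field and probability measure. Nothing is lost: the representing pair $(W,\Phi)$ can be
  realised on $[0,1]$ with Lebesgue measure, and the law of \<open>Y\<close> does not depend on the
  realisation.\<close>

definition levy_process ::
    "'w measure \<Rightarrow> ('w \<Rightarrow> real \<Rightarrow> real^'d) \<Rightarrow> real^'d^'d \<Rightarrow> real^'d \<Rightarrow> (real^'d) measure \<Rightarrow> bool" where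
  "levy_process P X S b \<nu> \<longleftrightarrow> prob_space P \<and> X \<in> measurable P path_space \<and>
     (\<exists>(M::real measure) Y. levy_ito_process M S b \<nu> Y \<and>
        distr P (Pi\<^sub>M {0..} (\<lambda>_. borel)) X =
        distr M (Pi\<^sub>M {0..} (\<lambda>_. borel)) (\<lambda>\<omega>. \<lambda>t\<in>{0..}. Y t \<omega>))"

end

theory Submission
  imports Defs
begin

text \<open>Let $Q_v$ be the law of the process stopped at time $t_0$ whose Levy measure has density $1+v$ with
  respect to the reference measure and whose drift is compensated accordingly. By the
  Levy-Khintchine formula the trigonometric moments of $Q_v$ are those of $Q_0$, multiplied by the
  exponential of an expression linear in $v$. For integrable $h$ this means
  $Q_{v+h} f = Q_v(\exp(A_h) f)$, where $A_h f$ is the integral of the differences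
  $\Delta_{t,x} f$ against $h$, a bounded operator; expanding the exponential gives the series.
  The general case follows by cutting off small jumps and large values of $f$: a Cauchy-Schwarz
  inequality for $\exp(A_h)$ yields $(Q_v f)^2 \le C Q_0(f^2)$ with a constant that depends on $v$ only
  through its norm in $L^2$, and a similar bound for the coefficients of the series.\<close>

text \<open>The obstacle is that \<open>g\<close> is only square integrable, with weighted control
  near 0: small jumps have infinite activity, the operator is unbounded, and no operator norm is
  uniform in the cutoff. What is uniform is second-moment control relative to the reference law. On
  a region of finite activity the exponential is an expectation over a Poisson configuration, and
  likelihood ratios of such configurations have inner products that are exponentials of inner
  products of the relative densities. The coefficients are harder, because the differences are
  averaged under the perturbed law while the bound must involve the reference law only.
  Differentiating the Cauchy-Schwarz inequality controls one difference; for n of them the truncated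
  intensity is divided into n equal pieces and each difference consumes one. This costs the factor
  n^n, which is harmless: only its square root enters, n^n is at most n! e^n, and the series carries
  1/n!. Stopping at \<open>t0\<close> makes the range of jump times finite, so that square
  integrability in space passes to space-time.\<close>

text \<open>Without qualification the names of the library refer to the Henstock-Kurzweil integral.\<close>

lemmas lint_cong = Bochner_Integration.integral_cong
  and lint_add = Bochner_Integration.integral_add
  and integrable_le = Bochner_Integration.integrable_bound
  and integrable_plus = Bochner_Integration.integrable_add

abbreviation PiN :: "nat => 'a measure => (nat => 'a) measure" where
  "PiN n M \<equiv> Pi\<^sub>M {..<n} (\<lambda>_. M)"

section \<open>Rearrangement of double series\<close>

lemma suminf_suminf_eq_antidiagonal:
 fixes t :: "nat => nat => real"
 assumes le: "\<And>j l. \<bar>t j l\<bar> \<le> p j * q l" and p: "summable p" and q: "summable q"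
  and p0: "\<And>j. 0 \<le> p j" and q0: "\<And>l. 0 \<le> q l"
 shows "(\<Sum>j. \<Sum>l. t j l) = (\<Sum>n. \<Sum>k\<le>n. t k (n - k))"
proof -
 have S: "(\<lambda>(j,l). t j l) summable_on (UNIV \<times> UNIV)"
 proof (rule abs_summable_summable)
  show "(\<lambda>x. norm (case x of (j,l) => t j l)) summable_on (UNIV \<times> UNIV)"
  proof (rule summable_on_comparison_test)
   show "(\<lambda>(j,l). p j * q l) summable_on (UNIV \<times> UNIV)"
   proof (rule summable_on_SigmaI)
    show "((\<lambda>l. case (j, l) of (j, l) => p j * q l) has_sum p j * suminf q) UNIV" for j
     using sums_nonneg_imp_has_sum[OF sums_mult[OF summable_sums[OF q], of "p j"]] p0 q0 by simp
    show "(\<lambda>j. p j * suminf q) summable_on UNIV"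
     using suminf_nonneg[OF q q0] p0 by (subst summable_on_UNIV_nonneg_real_iff) (auto intro: summable_mult2[OF p])
   qed (auto intro!: mult_nonneg_nonneg p0 q0)
  qed (use le in auto)
 qed
 have row: "(\<Sum>\<^sub>\<infinity>l. t j l) = (\<Sum>l. t j l)" for j
 proof -
  have "(\<lambda>l. t j l) summable_on UNIV"
   by (rule norm_summable_imp_summable_on, rule summable_comparison_test')
    (use le in \<open>auto intro: summable_mult[OF q]\<close>)
  then show ?thesis by (rule sums_unique[OF has_sum_imp_sums[OF has_sum_infsum]])
 qed
 have "(\<Sum>\<^sub>\<infinity>j. \<Sum>\<^sub>\<infinity>l. t j l) = infsum (\<lambda>(j,l). t j l) (UNIV \<times> UNIV)"
  by (rule infsum_Sigma'_banach[OF S])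
 moreover have "(\<lambda>j. \<Sum>\<^sub>\<infinity>l. t j l) summable_on UNIV"
  using summable_on_Sigma_banach[OF S] by simp
 ultimately have L: "(\<Sum>j. \<Sum>l. t j l) = infsum (\<lambda>(j,l). t j l) (UNIV \<times> UNIV)"
  using sums_unique[OF has_sum_imp_sums[OF has_sum_infsum], of "\<lambda>j. \<Sum>l. t j l"] unfolding row by argo
 \<comment> \<open>The antidiagonal n consists of the pairs (k, n - k) with k \<le> n; absolute
   summability, inherited from \<open>p j * q l\<close>, allows the infinite sum to be carried along
   this bijection.\<close>
 have bij: "bij_betw (\<lambda>(n,k). (k, n - k)) (Sigma UNIV (\<lambda>n::nat. {..n})) (UNIV \<times> UNIV)"
  by (rule bij_betwI[where g = "\<lambda>(j,l). (j + l, j)"]) auto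
 have S': "(\<lambda>(n,k). t k (n - k)) summable_on (Sigma UNIV (\<lambda>n. {..n}))"
  using summable_on_reindex_bij_betw[OF bij, of "\<lambda>(j,l). t j l"] S
  by (simp add: case_prod_unfold)
 have "infsum (\<lambda>(j,l). t j l) (UNIV \<times> UNIV) = infsum (\<lambda>(n,k). t k (n - k)) (Sigma UNIV (\<lambda>n. {..n}))"
  by (subst infsum_reindex_bij_betw[OF bij, symmetric]) (auto intro!: infsum_cong)
 also have "\<dots> = (\<Sum>\<^sub>\<infinity>n. \<Sum>\<^sub>\<infinity>k\<in>{..n}. t k (n - k))"
  by (rule infsum_Sigma'_banach[OF S', symmetric])
 also have "\<dots> = (\<Sum>n. \<Sum>k\<le>n. t k (n - k))"
  using sums_unique[OF has_sum_imp_sums[OF has_sum_infsum[OF summable_on_Sigma_banach[OF S']]]] by simp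
 finally show ?thesis using L by simp
qed

text \<open>Pascal's rule. With \<open>a k l\<close> standing for a product of k factors of one kind
  and l of another, multiplication by a sum of two commuting factors raises either the first or the
  second index.\<close>

lemma binomial_sum_Suc:
 fixes a :: "nat => nat => real"
 shows "(\<Sum>k\<le>n. of_nat (n choose k) * (a (Suc k) (n - k) + a k (Suc (n - k))))
   = (\<Sum>k\<le>Suc n. of_nat (Suc n choose k) * a k (Suc n - k))"
proof -
 have 1: "(\<Sum>k\<le>n. of_nat (n choose k) * a k (Suc (n - k))) = (\<Sum>k\<le>Suc n. of_nat (n choose k) * a k (Suc n - k))"
  by (simp add: Suc_diff_le)
 have "(\<Sum>k\<le>Suc n. of_nat (Suc n choose k) * a k (Suc n - k))
  = a 0 (Suc n) + (\<Sum>k\<le>n. of_nat (n choose k) * a (Suc k) (n - k) + of_nat (n choose Suc k) * a (Suc k) (n - k))"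
  by (subst sum.atMost_Suc_shift) (simp add: algebra_simps)
 moreover have "(\<Sum>k\<le>Suc n. of_nat (n choose k) * a k (Suc n - k)) =
   a 0 (Suc n) + (\<Sum>k\<le>n. of_nat (n choose Suc k) * a (Suc k) (n - k))"
  by (subst sum.atMost_Suc_shift) simp
 ultimately show ?thesis using 1 by (simp add: algebra_simps sum.distrib)
qed

section \<open>Exponentials of bounded operators on bounded measurable functions\<close>

text \<open>The bound is required at every point of the space, not almost everywhere: adding a jump
  can carry a path from a set of full measure into a null set, so classes modulo null sets would not
  be stable under the operators used here.\<close>

definition bmf :: "'w measure => ('w => real) set" where
 "bmf M = {f \<in> borel_measurable M. \<exists>C. \<forall>w\<in>space M. \<bar>f w\<bar> \<le> C}"

text \<open>Linear maps on the bounded measurable functions with sup norm at most \<open>c\<close>.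
  All clauses speak of values on \<open>space M\<close> only, since a function is unconstrained
  elsewhere.\<close>

definition bounded_op :: "'w measure => real => (('w => real) => 'w => real) => bool" where
 "bounded_op M c A \<longleftrightarrow> 0 \<le> c \<and> (\<forall>f\<in>bmf M. A f \<in> bmf M) \<and>
  (\<forall>f\<in>bmf M. \<forall>g\<in>bmf M. \<forall>a b. \<forall>w\<in>space M. A (\<lambda>w. a * f w + b * g w) w = a * A f w + b * A g w) \<and>
  (\<forall>f\<in>bmf M. \<forall>C. (\<forall>w\<in>space M. \<bar>f w\<bar> \<le> C) \<longrightarrow> (\<forall>w\<in>space M. \<bar>A f w\<bar> \<le> c * C))"

definition opexp :: "(('w => real) => 'w => real) => ('w => real) => 'w => real" where
 "opexp A f w = (\<Sum>n. (A ^^ n) f w / fact n)"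

definition commuting_ops :: "'w measure => (('w => real) => 'w => real) => (('w => real) => 'w => real) => bool" where
 "commuting_ops M A B \<longleftrightarrow> (\<forall>f\<in>bmf M. \<forall>w\<in>space M. A (B f) w = B (A f) w)"

section \<open>Bounded measurable functions\<close>

lemma bmf_measurable[dest]: "f \<in> bmf M ==> f \<in> borel_measurable M"
 by (simp add: bmf_def)

lemma bmfE:
 assumes "f \<in> bmf M"
 obtains C where "0 \<le> C" "\<And>w. w \<in> space M ==> \<bar>f w\<bar> \<le> C"
proof -
 obtain C where "\<forall>w\<in>space M. \<bar>f w\<bar> \<le> C" using assms by (auto simp: bmf_def)
 then show ?thesis by (intro that[of "max C 0"]) force+
qed

lemma bmfI: "f \<in> borel_measurable M ==> (\<And>w. w \<in> space M ==> \<bar>f w\<bar> \<le> C) ==> f \<in> bmf M"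
 by (auto simp: bmf_def)

lemma bmf_const[simp]: "(\<lambda>w. c) \<in> bmf M"
 by (rule bmfI[of _ _ "\<bar>c\<bar>"]) auto

lemma bmf_add: assumes "f \<in> bmf M" "g \<in> bmf M" shows "(\<lambda>w. f w + g w) \<in> bmf M"
proof -
 obtain C D where "\<And>w. w \<in> space M ==> \<bar>f w\<bar> \<le> C" "\<And>w. w \<in> space M ==> \<bar>g w\<bar> \<le> D"
  using assms by (metis bmfE)
 then show ?thesis using assms
  by (intro bmfI[of _ _ "C + D"]) (auto intro!: borel_measurable_add order_trans[OF abs_triangle_ineq] add_mono)
qed

lemma bmf_mult: assumes "f \<in> bmf M" "g \<in> bmf M" shows "(\<lambda>w. f w * g w) \<in> bmf M"
proof -
 obtain C D where "0 \<le> C" "\<And>w. w \<in> space M ==> \<bar>f w\<bar> \<le> C" "\<And>w. w \<in> space M ==> \<bar>g w\<bar> \<le> D"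
  using assms by (metis bmfE)
 then show ?thesis using assms
  by (intro bmfI[of _ _ "C * D"]) (auto intro!: borel_measurable_times mult_mono simp: abs_mult)
qed

lemma bmf_cmult: "f \<in> bmf M ==> (\<lambda>w. c * f w) \<in> bmf M"
 by (rule bmf_mult[OF bmf_const])

lemma bmf_diff: "f \<in> bmf M ==> g \<in> bmf M ==> (\<lambda>w. f w - g w) \<in> bmf M"
 using bmf_add[of f M "\<lambda>w. (-1) * g w"] bmf_cmult[of g M "-1"] by simp

lemma bmf_power2: "f \<in> bmf M ==> (\<lambda>w. (f w)\<^sup>2) \<in> bmf M"
 unfolding power2_eq_square by (rule bmf_mult)

lemma bmf_abs: "f \<in> bmf M ==> (\<lambda>w. \<bar>f w\<bar>) \<in> bmf M"
 by (auto simp: bmf_def)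

lemma bmf_sum: "finite I ==> (\<And>i. i \<in> I ==> f i \<in> bmf M) ==> (\<lambda>w. \<Sum>i\<in>I. f i w) \<in> bmf M"
 by (induction I rule: finite_induct) (auto intro: bmf_add)

lemma bmf_indicator: "A \<in> sets M ==> indicator A \<in> bmf M"
 by (rule bmfI[of _ _ 1]) (auto simp: indicator_def)

lemma bmf_integrable:
 assumes "finite_measure Q" "sets Q = sets M" "f \<in> bmf M" shows "integrable Q f"
proof -
 interpret finite_measure Q by fact
 obtain C where "\<And>w. w \<in> space M ==> \<bar>f w\<bar> \<le> C" using assms by (metis bmfE)
 then show ?thesis using assms(2) bmf_measurable[OF assms(3)] sets_eq_imp_space_eq[OF assms(2)]
  by (intro integrable_const_bound[where B = C]) (auto cong: measurable_cong_sets)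
qed

text \<open>The Weierstrass test: a summable sequence of sup bounds makes the pointwise sum bounded
  and measurable.\<close>

lemma bmf_suminf:
 assumes f: "\<And>i::nat. f i \<in> bmf M" and le: "\<And>i w. w \<in> space M ==> \<bar>f i w\<bar> \<le> C i" and C: "summable C"
 shows "(\<lambda>w. \<Sum>i. f i w) \<in> bmf M" "w \<in> space M ==> summable (\<lambda>i. \<bar>f i w\<bar>)" "w \<in> space M ==> summable (\<lambda>i. f i w)"
  "w \<in> space M ==> \<bar>\<Sum>i. f i w\<bar> \<le> suminf C"
proof -
 show *: "summable (\<lambda>i. \<bar>f i w\<bar>)" if "w \<in> space M" for w
  by (rule summable_comparison_test'[OF C]) (use le[OF that] in auto)
 then show "w \<in> space M ==> summable (\<lambda>i. f i w)" by (rule summable_rabs_cancel)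
 show **: "\<bar>\<Sum>i. f i w\<bar> \<le> suminf C" if "w \<in> space M" for w
  using summable_rabs[OF *[OF that]] suminf_le[OF le *[OF that] C] that by fastforce
 have [measurable]: "\<And>i. f i \<in> borel_measurable M" using f by auto
 show "(\<lambda>w. \<Sum>i. f i w) \<in> bmf M"
  by (rule bmfI[of _ _ "suminf C"]) (use ** in auto)
qed

section \<open>Bounded operators\<close>

lemma
 assumes "bounded_op M c A"
 shows bounded_op_nonneg: "0 \<le> c"
  and bounded_op_bmf: "f \<in> bmf M ==> A f \<in> bmf M"
  and bounded_op_lin: "f \<in> bmf M ==> g \<in> bmf M ==> w \<in> space M ==> A (\<lambda>w. a * f w + b * g w) w = a * A f w + b * A g w"
  and bounded_op_le: "f \<in> bmf M ==> (\<And>w. w \<in> space M ==> \<bar>f w\<bar> \<le> C) ==> w \<in> space M ==> \<bar>A f w\<bar> \<le> c * C"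
 using assms by (auto simp: bounded_op_def)

lemma bounded_op_cmult:
 assumes "bounded_op M c A" "f \<in> bmf M" "w \<in> space M"
 shows "A (\<lambda>w. a * f w) w = a * A f w"
 using bounded_op_lin[OF assms(1,2,2,3), of a 0] by simp

lemma bounded_op_add:
 assumes "bounded_op M c A" "f \<in> bmf M" "g \<in> bmf M" "w \<in> space M"
 shows "A (\<lambda>w. f w + g w) w = A f w + A g w"
 using bounded_op_lin[OF assms(1-4), of 1 1] by simp

lemma bounded_op_diff:
 assumes "bounded_op M c A" "f \<in> bmf M" "g \<in> bmf M" "w \<in> space M"
 shows "A (\<lambda>w. f w - g w) w = A f w - A g w"
 using bounded_op_lin[OF assms(1-4), of 1 "-1"] by simp

text \<open>Functions that agree on the space may differ off it and are then different arguments of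
  A; the bound with constant 0, applied to their difference, shows that A does not see this.\<close>

lemma bounded_op_cong:
 assumes A: "bounded_op M c A" and fg: "f \<in> bmf M" "g \<in> bmf M" "\<And>w. w \<in> space M ==> f w = g w" and w: "w \<in> space M"
 shows "A f w = A g w"
proof -
 have "\<bar>A (\<lambda>w. f w - g w) w\<bar> \<le> c * 0"
  by (rule bounded_op_le[OF A bmf_diff[OF fg(1,2)] _ w]) (use fg(3) in simp)
 then show ?thesis using bounded_op_diff[OF A fg(1,2) w] by simp
qed

lemma bounded_op_sum:
 assumes A: "bounded_op M c A" and "finite I" "\<And>i. i \<in> I ==> f i \<in> bmf M" "w \<in> space M"
 shows "A (\<lambda>w. \<Sum>i\<in>I. f i w) w = (\<Sum>i\<in>I. A (f i) w)"
 using assms(2,3)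
proof (induction I rule: finite_induct)
 case empty
 show ?case using bounded_op_cmult[OF A bmf_const assms(4), of 0 0] by simp
next
 case (insert i I)
 then show ?case using bounded_op_add[OF A _ _ assms(4), of "f i" "\<lambda>w. \<Sum>i\<in>I. f i w"] bmf_sum[of I f] by simp
qed

text \<open>The partial sums converge uniformly, with error at most the tail of \<open>C\<close>;
  the operator bound carries this error over to the images.\<close>

lemma bounded_op_sums:
 assumes A: "bounded_op M c A" and f: "\<And>i::nat. f i \<in> bmf M"
  and le: "\<And>i w. w \<in> space M ==> \<bar>f i w\<bar> \<le> C i" and C: "summable C" and w: "w \<in> space M"
 shows "(\<lambda>i. A (f i) w) sums A (\<lambda>w. \<Sum>i. f i w) w"
proof -
 have S: "(\<lambda>w. \<Sum>i. f i w) \<in> bmf M" "\<And>w. w \<in> space M ==> summable (\<lambda>i. \<bar>f i w\<bar>)" "\<And>w. w \<in> space M ==> summable (\<lambda>i. f i w)"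
  by (rule bmf_suminf[of f M C, OF f _ C]; simp add: le)+
 have *: "\<bar>(\<Sum>i<n. A (f i) w) - A (\<lambda>w. \<Sum>i. f i w) w\<bar> \<le> c * (\<Sum>i. C (i + n))" for n
 proof -
  have 1: "(\<lambda>w. \<Sum>i<n. f i w) \<in> bmf M" using f by (intro bmf_sum) auto
  have "A (\<lambda>w. \<Sum>i. f i w) w - (\<Sum>i<n. A (f i) w) = A (\<lambda>w. (\<Sum>i. f i w) - (\<Sum>i<n. f i w)) w"
   using bounded_op_diff[OF A S(1) 1 w] bounded_op_sum[OF A _ f w, of "{..<n}"] by simp
  moreover have "\<bar>A (\<lambda>w. (\<Sum>i. f i w) - (\<Sum>i<n. f i w)) w\<bar> \<le> c * (\<Sum>i. C (i + n))"
  proof (rule bounded_op_le[OF A bmf_diff[OF S(1) 1] _ w])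
   fix v assume v: "v \<in> space M"
   have Sn: "summable (\<lambda>i. \<bar>f (i + n) v\<bar>)" using S(2)[OF v] by (subst summable_iff_shift)
   have "\<bar>\<Sum>i. f (i + n) v\<bar> \<le> (\<Sum>i. \<bar>f (i + n) v\<bar>)" by (rule summable_rabs[OF Sn])
   also have "\<dots> \<le> (\<Sum>i. C (i + n))"
    by (rule suminf_le) (use le[OF v] Sn C in \<open>auto simp: summable_iff_shift\<close>)
   finally show "\<bar>(\<Sum>i. f i v) - (\<Sum>i<n. f i v)\<bar> \<le> (\<Sum>i. C (i + n))"
    using suminf_minus_initial_segment[OF S(3)[OF v], of n] by simp
  qed
  ultimately show ?thesis by linarith
 qed
 have "(\<lambda>n. c * (\<Sum>i. C (i + n))) \<longlonglongrightarrow> c * 0"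
  by (intro tendsto_mult tendsto_const suminf_exist_split2[OF C])
 then have "(\<lambda>n. (\<Sum>i<n. A (f i) w) - A (\<lambda>w. \<Sum>i. f i w) w) \<longlonglongrightarrow> 0"
  using * by (intro Lim_null_comparison[OF _ \<open>_ \<longlonglongrightarrow> c * 0\<close>[simplified]]) auto
 then show ?thesis unfolding sums_def using LIM_zero_iff by blast
qed

lemma bounded_op_comp:
 assumes A: "bounded_op M c A" and B: "bounded_op M d B"
 shows "bounded_op M (c * d) (\<lambda>f. A (B f))"
 unfolding bounded_op_def
proof (intro conjI ballI allI impI)
 show "0 \<le> c * d" using A B by (simp add: bounded_op_nonneg)
next
 fix f assume "f \<in> bmf M" then show "A (B f) \<in> bmf M" using A B bounded_op_bmf by blast
next
 fix f g a b w assume f: "f \<in> bmf M" and g: "g \<in> bmf M" and w: "w \<in> space M"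
 have "A (B (\<lambda>w. a * f w + b * g w)) w = A (\<lambda>w. a * B f w + b * B g w) w"
  by (rule bounded_op_cong[OF A _ _ _ w])
   (use f g in \<open>auto intro!: bounded_op_bmf[OF B] bmf_add bmf_cmult simp: bounded_op_lin[OF B]\<close>)
 also have "\<dots> = a * A (B f) w + b * A (B g) w"
  using f g w by (intro bounded_op_lin[OF A] bounded_op_bmf[OF B])
 finally show "A (B (\<lambda>w. a * f w + b * g w)) w = a * A (B f) w + b * A (B g) w" .
next
 fix f C w assume f: "f \<in> bmf M" and C: "\<forall>w\<in>space M. \<bar>f w\<bar> \<le> C" and w: "w \<in> space M"
 have "\<bar>A (B f) w\<bar> \<le> c * (d * C)"
  using C by (intro bounded_op_le[OF A bounded_op_bmf[OF B f] _ w] bounded_op_le[OF B f]) auto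
 then show "\<bar>A (B f) w\<bar> \<le> c * d * C" by (simp add: mult.assoc)
qed

lemma bounded_op_id: "bounded_op M 1 (\<lambda>f. f)"
 by (auto simp: bounded_op_def)

lemma bounded_op_funpow: "bounded_op M c A ==> bounded_op M (c ^ n) (A ^^ n)"
proof (induction n)
 case (Suc n)
 then show ?case using bounded_op_comp[of M c A "c ^ n" "A ^^ n"] by (simp add: comp_def)
qed (auto simp: bounded_op_def)

lemma bounded_op_lincomb:
 assumes A: "bounded_op M c A" and B: "bounded_op M d B"
 shows "bounded_op M (\<bar>a\<bar> * c + \<bar>b\<bar> * d) (\<lambda>f w. a * A f w + b * B f w)"
 unfolding bounded_op_def
proof (intro conjI ballI allI impI)
 show "0 \<le> \<bar>a\<bar> * c + \<bar>b\<bar> * d" using A B by (simp add: bounded_op_nonneg)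
next
 fix f assume "f \<in> bmf M" then show "(\<lambda>w. a * A f w + b * B f w) \<in> bmf M"
  using A B bounded_op_bmf by (intro bmf_add bmf_cmult) auto
next
 fix f g x y w assume f: "f \<in> bmf M" and g: "g \<in> bmf M" and w: "w \<in> space M"
 show "a * A (\<lambda>w. x * f w + y * g w) w + b * B (\<lambda>w. x * f w + y * g w) w =
   x * (a * A f w + b * B f w) + y * (a * A g w + b * B g w)"
  using bounded_op_lin[OF A f g w, of x y] bounded_op_lin[OF B f g w, of x y] by (simp add: algebra_simps)
next
 fix f C w assume f: "f \<in> bmf M" and C: "\<forall>w\<in>space M. \<bar>f w\<bar> \<le> C" and w: "w \<in> space M"
 have "\<bar>a * A f w + b * B f w\<bar> \<le> \<bar>a\<bar> * \<bar>A f w\<bar> + \<bar>b\<bar> * \<bar>B f w\<bar>"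
  by (metis abs_mult abs_triangle_ineq)
 also have "\<dots> \<le> \<bar>a\<bar> * (c * C) + \<bar>b\<bar> * (d * C)"
  using C by (intro add_mono mult_left_mono bounded_op_le[OF A f _ w] bounded_op_le[OF B f _ w]) auto
 finally show "\<bar>a * A f w + b * B f w\<bar> \<le> (\<bar>a\<bar> * c + \<bar>b\<bar> * d) * C" by (simp add: algebra_simps)
qed

section \<open>Exponentials of bounded operators\<close>

lemma opexp_term_le:
 assumes A: "bounded_op M c A" and f: "f \<in> bmf M" and C: "\<And>w. w \<in> space M ==> \<bar>f w\<bar> \<le> C" and w: "w \<in> space M"
 shows "\<bar>(A ^^ n) f w / fact n\<bar> \<le> c ^ n / fact n * C"
 using bounded_op_le[OF bounded_op_funpow[OF A] f C w, of n] by (simp add: divide_simps)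

lemma summable_exp_series: "summable (\<lambda>n. c ^ n / fact n * C :: real)"
 using summable_mult2[OF summable_exp[of c], of C] by (simp add: divide_inverse mult.commute)

lemma exp_series: "(\<Sum>n. c ^ n / fact n :: real) = exp c"
 by (simp add: exp_def scaleR_conv_of_real field_simps)

lemma bounded_op_opexp:
 assumes A: "bounded_op M c A" shows "bounded_op M (exp c) (opexp A)"
  and summable_opexp: "f \<in> bmf M ==> w \<in> space M ==> summable (\<lambda>n. (A ^^ n) f w / fact n)"
proof -
 have bm: "(\<lambda>w. (A ^^ n) f w / fact n) \<in> bmf M" if "f \<in> bmf M" for f n
  using bmf_cmult[OF bounded_op_bmf[OF bounded_op_funpow[OF A] that], of "1 / fact n" n] by simp
 have s: "summable (\<lambda>n. (A ^^ n) f w / fact n)" if f: "f \<in> bmf M" and w: "w \<in> space M" for f w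
 proof -
  obtain C where "\<And>w. w \<in> space M ==> \<bar>f w\<bar> \<le> C" using f by (metis bmfE)
  from bmf_suminf(3)[of "\<lambda>n w. (A ^^ n) f w / fact n", OF bm[OF f] opexp_term_le[OF A f this] summable_exp_series w]
  show ?thesis by simp
 qed
 then show "f \<in> bmf M ==> w \<in> space M ==> summable (\<lambda>n. (A ^^ n) f w / fact n)" .
 show "bounded_op M (exp c) (opexp A)"
  unfolding bounded_op_def
 proof (intro conjI ballI allI impI)
  fix f assume f: "f \<in> bmf M"
  then obtain C where C: "\<And>w. w \<in> space M ==> \<bar>f w\<bar> \<le> C" by (metis bmfE)
  from bmf_suminf(1)[of "\<lambda>n w. (A ^^ n) f w / fact n", OF bm[OF f] opexp_term_le[OF A f C] summable_exp_series]
  show "opexp A f \<in> bmf M" by (simp add: opexp_def[abs_def])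
 next
  fix f g a b w assume f: "f \<in> bmf M" and g: "g \<in> bmf M" and w: "w \<in> space M"
  have "(A ^^ n) (\<lambda>w. a * f w + b * g w) w / fact n = a * ((A ^^ n) f w / fact n) + b * ((A ^^ n) g w / fact n)" for n
   using bounded_op_lin[OF bounded_op_funpow[OF A] f g w, of n a b] by (simp add: add_divide_distrib)
  then show "opexp A (\<lambda>w. a * f w + b * g w) w = a * opexp A f w + b * opexp A g w"
   unfolding opexp_def
   using sums_add[OF sums_mult[OF summable_sums[OF s[OF f w]], of a] sums_mult[OF summable_sums[OF s[OF g w]], of b]]
   by (simp add: sums_iff)
 next
  fix f C w assume f: "f \<in> bmf M" and C: "\<forall>w\<in>space M. \<bar>f w\<bar> \<le> C" and w: "w \<in> space M"
  have "\<bar>opexp A f w\<bar> \<le> (\<Sum>n. c ^ n / fact n * C)" unfolding opexp_def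
   using C by (intro bmf_suminf(4)[of "\<lambda>n w. (A ^^ n) f w / fact n", OF bm[OF f] opexp_term_le[OF A f] summable_exp_series w]) auto
  also have "\<dots> = exp c * C"
   using suminf_mult2[OF summable_exp_series[of c 1], of C] exp_series[of c] by simp
  finally show "\<bar>opexp A f w\<bar> \<le> exp c * C" .
 qed simp
qed

lemma opexp_cong:
 assumes A: "bounded_op M c A" and B: "bounded_op M d B"
  and eq: "\<And>f w. f \<in> bmf M ==> w \<in> space M ==> A f w = B f w" and f: "f \<in> bmf M" and w: "w \<in> space M"
 shows "opexp A f w = opexp B f w"
proof -
 have "(A ^^ n) f w = (B ^^ n) f w" if "w \<in> space M" for n w
  using that
 proof (induction n arbitrary: w)
  case (Suc n)
  have "A ((A ^^ n) f) w = A ((B ^^ n) f) w"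
   by (rule bounded_op_cong[OF A bounded_op_bmf[OF bounded_op_funpow[OF A] f] bounded_op_bmf[OF bounded_op_funpow[OF B] f] Suc])
  then show ?case using eq[OF bounded_op_bmf[OF bounded_op_funpow[OF B] f] Suc.prems] by simp
 qed simp
 then show ?thesis using w by (simp add: opexp_def)
qed

lemma commuting_ops_funpow:
 assumes A: "bounded_op M c A" and B: "bounded_op M d B" and AB: "commuting_ops M A B"
 shows "commuting_ops M A (B ^^ n)"
proof (induction n)
 case (Suc n)
 show ?case unfolding commuting_ops_def
 proof (intro ballI)
  fix f w assume f: "f \<in> bmf M" and w: "w \<in> space M"
  note Bn = bounded_op_bmf[OF bounded_op_funpow[OF B]]
  have "A ((B ^^ Suc n) f) w = B (A ((B ^^ n) f)) w"
   using AB Bn[OF f] w by (simp add: commuting_ops_def)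
  also have "\<dots> = B ((B ^^ n) (A f)) w"
   by (rule bounded_op_cong[OF B _ _ _ w])
    (use Suc f in \<open>auto intro!: Bn bounded_op_bmf[OF A] simp: commuting_ops_def\<close>)
  finally show "A ((B ^^ Suc n) f) w = (B ^^ Suc n) (A f) w" by simp
 qed
qed (simp add: commuting_ops_def)

text \<open>The exponential series converges uniformly, with terms bounded by
  \<open>d ^ n / fact n * C\<close>, so another bounded operator may be applied term by
  term.\<close>

lemma opexp_sums:
 assumes A: "bounded_op M c A" and B: "bounded_op M d B" and f: "f \<in> bmf M" and w: "w \<in> space M"
 shows "(\<lambda>n. A ((B ^^ n) f) w / fact n) sums A (opexp B f) w"
proof -
 obtain C where C: "\<And>w. w \<in> space M ==> \<bar>f w\<bar> \<le> C" using f by (metis bmfE)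
 have bm: "(\<lambda>w. (1 / fact n) * (B ^^ n) f w) \<in> bmf M" for n
  using bmf_cmult[OF bounded_op_bmf[OF bounded_op_funpow[OF B] f]] .
 have "(\<lambda>n. A (\<lambda>w. (1 / fact n) * (B ^^ n) f w) w) sums A (\<lambda>w. \<Sum>n. (1 / fact n) * (B ^^ n) f w) w"
  using opexp_term_le[OF B f C] by (intro bounded_op_sums[OF A bm _ summable_exp_series[of d C] w]) auto
 then show ?thesis
  by (subst (asm) bounded_op_cmult[OF A bounded_op_bmf[OF bounded_op_funpow[OF B] f] w])
   (simp add: opexp_def[abs_def])
qed

lemma commuting_ops_opexp:
 assumes A: "bounded_op M c A" and B: "bounded_op M d B" and AB: "commuting_ops M A B"
 shows "commuting_ops M A (opexp B)"
 unfolding commuting_ops_def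
proof (intro ballI)
 fix f w assume f: "f \<in> bmf M" and w: "w \<in> space M"
 have "A (opexp B f) w = (\<Sum>n. A ((B ^^ n) f) w / fact n)"
  using opexp_sums[OF A B f w] by (simp add: sums_iff)
 also have "\<dots> = opexp B (A f) w"
  using commuting_ops_funpow[OF A B AB] f w by (simp add: commuting_ops_def opexp_def)
 finally show "A (opexp B f) w = opexp B (A f) w" .
qed

text \<open>The binomial theorem for commuting operators. The innermost factor is distributed over
  the two summands, and the power of \<open>B\<close> standing to its left is moved past
  \<open>A\<close>.\<close>

lemma funpow_add_ops:
 assumes A: "bounded_op M c A" and B: "bounded_op M d B" and AB: "commuting_ops M A B"
  and f: "f \<in> bmf M" and w: "w \<in> space M"
 shows "((\<lambda>f w. A f w + B f w) ^^ n) f w = (\<Sum>k\<le>n. of_nat (n choose k) * (A ^^ k) ((B ^^ (n - k)) f) w)"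
 using f w
proof (induction n arbitrary: f w)
 case (Suc n)
 let ?F = "\<lambda>f w. A f w + B f w"
 note f = Suc.prems(1) and w = Suc.prems(2)
 note An = bounded_op_funpow[OF A] and Bn = bounded_op_funpow[OF B]
 note b = bounded_op_bmf[OF A] bounded_op_bmf[OF B] bounded_op_bmf[OF An] bounded_op_bmf[OF Bn]
 have "(?F ^^ Suc n) f w = (?F ^^ n) (?F f) w" by (simp only: funpow_Suc_right comp_def)
 also have "\<dots> = (\<Sum>k\<le>n. of_nat (n choose k) * (A ^^ k) ((B ^^ (n - k)) (?F f)) w)"
  using Suc f w by (intro Suc.IH) (auto intro!: bmf_add b)
 also have "\<dots> = (\<Sum>k\<le>n. of_nat (n choose k) * ((A ^^ Suc k) ((B ^^ (n - k)) f) w + (A ^^ k) ((B ^^ Suc (n - k)) f) w))"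
 proof (intro sum.cong refl arg_cong2[where f = "(*)"])
  fix k
  have "(A ^^ k) ((B ^^ (n - k)) (?F f)) w = (A ^^ k) (\<lambda>w. A ((B ^^ (n - k)) f) w + B ((B ^^ (n - k)) f) w) w"
  proof (rule bounded_op_cong[OF An _ _ _ w])
   fix v assume v: "v \<in> space M"
   have "(B ^^ (n - k)) (?F f) v = (B ^^ (n - k)) (A f) v + (B ^^ (n - k)) (B f) v"
    by (rule bounded_op_add[OF Bn _ _ v]) (use f b in auto)
   then show "(B ^^ (n - k)) (?F f) v = A ((B ^^ (n - k)) f) v + B ((B ^^ (n - k)) f) v"
    using commuting_ops_funpow[OF A B AB, of "n - k"] f v by (simp add: commuting_ops_def funpow_swap1)
  qed (use f b in \<open>auto intro!: bmf_add b(4)\<close>)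
  also have "\<dots> = (A ^^ k) (A ((B ^^ (n - k)) f)) w + (A ^^ k) (B ((B ^^ (n - k)) f)) w"
   by (rule bounded_op_add[OF An _ _ w]) (use f b in auto)
  finally show "(A ^^ k) ((B ^^ (n - k)) (?F f)) w = (A ^^ Suc k) ((B ^^ (n - k)) f) w + (A ^^ k) ((B ^^ Suc (n - k)) f) w"
   by (simp add: funpow_swap1)
 qed
 also have "\<dots> = (\<Sum>k\<le>Suc n. of_nat (Suc n choose k) * (A ^^ k) ((B ^^ (Suc n - k)) f) w)"
  by (rule binomial_sum_Suc)
 finally show ?case .
qed simp

text \<open>The exponential law: the double series of \<open>A ^^ k\<close> applied to
  \<open>B ^^ l\<close> is dominated by a product of two exponential series and is summed along
  antidiagonals, where the binomial theorem applies.\<close>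

lemma opexp_add:
 assumes A: "bounded_op M c A" and B: "bounded_op M d B" and AB: "commuting_ops M A B"
  and f: "f \<in> bmf M" and w: "w \<in> space M"
 shows "opexp (\<lambda>f w. A f w + B f w) f w = opexp A (opexp B f) w"
proof -
 obtain C where C0: "0 \<le> C" and C: "\<And>w. w \<in> space M ==> \<bar>f w\<bar> \<le> C" using f by (metis bmfE)
 note An = bounded_op_funpow[OF A] and Bn = bounded_op_funpow[OF B]
 have c: "0 \<le> c" and d: "0 \<le> d" using A B by (simp_all add: bounded_op_nonneg)
 have "opexp A (opexp B f) w = (\<Sum>k. (\<Sum>l. (A ^^ k) ((B ^^ l) f) w / fact l) / fact k)"
  unfolding opexp_def[of A] using opexp_sums[OF An B f w] by (simp add: sums_iff)
 also have "\<dots> = (\<Sum>k. \<Sum>l. (A ^^ k) ((B ^^ l) f) w / (fact k * fact l))"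
  using opexp_sums[OF An B f w] by (subst suminf_divide[symmetric]) (auto simp: sums_iff mult.commute)
 also have "\<dots> = (\<Sum>n. \<Sum>k\<le>n. (A ^^ k) ((B ^^ (n - k)) f) w / (fact k * fact (n - k)))"
 proof (rule suminf_suminf_eq_antidiagonal[where p = "\<lambda>k. c ^ k / fact k" and q = "\<lambda>l. d ^ l / fact l * C"])
  fix k l
  have "\<bar>(A ^^ k) ((B ^^ l) f) w\<bar> \<le> c ^ k * (d ^ l * C)"
   by (intro bounded_op_le[OF An _ _ w] bounded_op_le[OF Bn] bounded_op_bmf[OF Bn] f C)
  then show "\<bar>(A ^^ k) ((B ^^ l) f) w / (fact k * fact l)\<bar> \<le> c ^ k / fact k * (d ^ l / fact l * C)"
   by (simp add: divide_simps)
 qed (use c d C0 summable_exp_series[of c 1] summable_exp_series[of d C] in auto)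
 also have "\<dots> = opexp (\<lambda>f w. A f w + B f w) f w"
  unfolding opexp_def funpow_add_ops[OF A B AB f w] sum_divide_distrib
  by (intro suminf_cong sum.cong refl) (simp add: binomial_fact)
 finally show ?thesis by simp
qed

lemma funpow_scale_op:
 assumes A: "bounded_op M c A" and f: "f \<in> bmf M" and w: "w \<in> space M"
 shows "((\<lambda>f w. t * A f w) ^^ n) f w = t ^ n * (A ^^ n) f w"
 using w
proof (induction n arbitrary: w)
 case (Suc n)
 have 1: "bounded_op M (\<bar>t\<bar> * c) (\<lambda>f w. t * A f w)"
  using bounded_op_lincomb[OF A A, of t 0] by simp
 have "A (((\<lambda>f w. t * A f w) ^^ n) f) w = A (\<lambda>w. t ^ n * (A ^^ n) f w) w"
  by (rule bounded_op_cong[OF A _ _ Suc.IH Suc.prems])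
   (intro bmf_cmult bounded_op_bmf[OF bounded_op_funpow[OF A]] bounded_op_bmf[OF bounded_op_funpow[OF 1]] f)+
 also have "\<dots> = t ^ n * A ((A ^^ n) f) w"
  by (rule bounded_op_cmult[OF A bounded_op_bmf[OF bounded_op_funpow[OF A] f] Suc.prems])
 finally show ?case by simp
qed simp

lemma opexp_scale:
 assumes A: "bounded_op M c A" and f: "f \<in> bmf M" and w: "w \<in> space M"
 shows "opexp (\<lambda>f w. t * A f w) f w = (\<Sum>n. t ^ n * (A ^^ n) f w / fact n)"
 using funpow_scale_op[OF assms] by (simp add: opexp_def)

lemma opexp_const: "opexp (\<lambda>f w. t * f w) f w = exp t * f w"
proof -
 have *: "((\<lambda>f w. t * f w) ^^ n) f w = t ^ n * f w" for n
  by (induction n) simp_all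
 have "(\<lambda>n. t ^ n / fact n * f w) sums (exp t * f w)"
  using sums_mult2[OF exp_converges[of t], of "f w"] by (simp add: scaleR_conv_of_real field_simps)
 then show ?thesis unfolding opexp_def * by (simp add: sums_iff)
qed

section \<open>Measures from functionals and from trigonometric moments\<close>

text \<open>A Daniell-type construction. Continuity along sets decreasing to the empty set makes
  \<Phi> countably additive on indicators; positivity then extends the identity from step functions
  to bounded functions by uniform approximation. New laws on the path space are produced in this way
  from linear functionals.\<close>

lemma functional_measureE:
 fixes \<Phi> :: "('w => real) => real"
 assumes add: "\<And>f g. f \<in> bmf M ==> g \<in> bmf M ==> \<Phi> (\<lambda>w. f w + g w) = \<Phi> f + \<Phi> g"
  and cmult: "\<And>f a. f \<in> bmf M ==> \<Phi> (\<lambda>w. a * f w) = a * \<Phi> f"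
  and nonneg: "\<And>f. f \<in> bmf M ==> (\<And>w. w \<in> space M ==> 0 \<le> f w) ==> 0 \<le> \<Phi> f"
  and one: "\<Phi> (\<lambda>_. 1) = 1"
  and cont: "\<And>A. range A \<subseteq> sets M ==> decseq A ==> (\<Inter>i. A i) = {} ==> (\<lambda>i::nat. \<Phi> (indicator (A i))) \<longlonglongrightarrow> 0"
 obtains Q where "prob_space Q" "sets Q = sets M" "\<And>f. f \<in> bmf M ==> integral\<^sup>L Q f = \<Phi> f"
proof -
 define Q where "Q = measure_of (space M) (sets M) (\<lambda>A. ennreal (\<Phi> (indicator A)))"
 have diff: "\<Phi> (\<lambda>w. f w - g w) = \<Phi> f - \<Phi> g" if "f \<in> bmf M" "g \<in> bmf M" for f g
  using add[OF that(1) bmf_cmult[OF that(2), of "-1"]] cmult[OF that(2), of "-1"] by simp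
 have mono: "\<Phi> f \<le> \<Phi> g" if "f \<in> bmf M" "g \<in> bmf M" "\<And>w. w \<in> space M ==> f w \<le> g w" for f g
  using nonneg[OF bmf_diff[OF that(2,1)]] that diff[OF that(2,1)] by simp
 have cong: "\<Phi> f = \<Phi> g" if "f \<in> bmf M" "g \<in> bmf M" "\<And>w. w \<in> space M ==> f w = g w" for f g
  using mono[OF that(1,2)] mono[OF that(2,1)] that(3) by fastforce
 have const: "\<Phi> (\<lambda>_. c) = c" for c using cmult[OF bmf_const, of c 1] one by simp
 have ind0: "0 \<le> \<Phi> (indicator A)" if "A \<in> sets M" for A
  using that by (intro nonneg bmf_indicator) auto
 have i0: "indicator {} = (\<lambda>w. 0::real)" by (simp add: fun_eq_iff)
 have s: "sets Q = sets M" "space Q = space M"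
  by (simp_all add: Q_def sets.space_closed sets.sigma_sets_eq)
 have ca: "countably_additive (sets M) (\<lambda>A. ennreal (\<Phi> (indicator A)))"
 proof (rule sets.empty_continuous_imp_countably_additive)
  show "positive (sets M) (\<lambda>A. ennreal (\<Phi> (indicator A)))"
   using const[of 0] by (simp add: positive_def i0)
  show "additive (sets M) (\<lambda>A. ennreal (\<Phi> (indicator A)))"
   unfolding additive_def
  proof (intro ballI impI)
   fix A B assume A: "A \<in> sets M" and B: "B \<in> sets M" and "A \<inter> B = {}"
   then have "indicator (A \<union> B) = (\<lambda>w. indicator A w + indicator B w :: real)"
    by (auto simp: indicator_def fun_eq_iff)
   then show "ennreal (\<Phi> (indicator (A \<union> B))) = ennreal (\<Phi> (indicator A)) + ennreal (\<Phi> (indicator B))"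
    using add[OF bmf_indicator[OF A] bmf_indicator[OF B]] ind0 A B by (simp add: ennreal_plus)
  qed
  show "(\<lambda>i. ennreal (\<Phi> (indicator (A i)))) \<longlonglongrightarrow> 0"
   if "range A \<subseteq> sets M" "decseq A" "(\<Inter>i. A i) = {}" for A :: "nat => 'w set"
   using tendsto_ennrealI[OF cont[OF that]] by simp
 qed simp
 have eQ: "emeasure Q A = ennreal (\<Phi> (indicator A))" if "A \<in> sets M" for A
  unfolding Q_def using that ca const[of 0]
  by (intro emeasure_measure_of_sigma sets.sigma_algebra_axioms) (auto simp: positive_def i0)
 have mQ: "measure Q A = \<Phi> (indicator A)" if "A \<in> sets M" for A
  using eQ[OF that] ind0[OF that] by (simp add: measure_def)
 have prob: "prob_space Q"
  by (rule prob_spaceI) (use eQ[OF sets.top] cong[OF bmf_indicator[OF sets.top] bmf_const, of 1] one s in simp)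
 interpret prob_space Q by fact
 have "integral\<^sup>L Q f = \<Phi> f" if f: "f \<in> bmf M" for f
 proof -
  obtain C where C: "0 \<le> C" "\<And>w. w \<in> space M ==> \<bar>f w\<bar> \<le> C" using f by (metis bmfE)
  note [measurable] = bmf_measurable[OF f]
  have *: "\<bar>integral\<^sup>L Q f - \<Phi> f\<bar> \<le> 2 / real (Suc m)" for m
  proof -
   define n where "n = real (Suc m)"
   have n: "0 < n" by (simp add: n_def)
   define A where "A k = {w \<in> space M. \<lfloor>n * f w\<rfloor> = k}" for k
   have A[measurable]: "A k \<in> sets M" for k unfolding A_def by measurable
   \<comment> \<open>The values of \<open>n * f\<close> on the space lie between - n C and n C, so
     every integer part that occurs belongs to this finite range and the step function s is within 1
     / n of f.\<close>
   define K where "K = {- (\<lceil>n * C\<rceil> + 1) .. \<lceil>n * C\<rceil> + 1}"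
   define s where "s w = (\<Sum>k\<in>K. (of_int k / n) * indicator (A k) w)" for w
   have fin: "finite K" by (simp add: K_def)
   have sb: "s \<in> bmf M" unfolding s_def[abs_def] by (intro bmf_sum fin bmf_cmult bmf_indicator A)
   have "\<Phi> (\<lambda>w. \<Sum>k\<in>L. (of_int k / n) * indicator (A k) w) = (\<Sum>k\<in>L. (of_int k / n) * \<Phi> (indicator (A k)))" if "finite L" for L
    using that
   proof (induction L rule: finite_induct)
    case (insert k L)
    have "(\<lambda>w. \<Sum>k\<in>L. (of_int k / n) * indicator (A k) w) \<in> bmf M"
     by (intro bmf_sum insert bmf_cmult bmf_indicator A)
    from add[OF bmf_cmult[OF bmf_indicator[OF A]] this, of "of_int k / n" k] show ?case
     using insert cmult[OF bmf_indicator[OF A], of "of_int k / n" k] by simp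
   qed (simp add: const)
   then have 1: "\<Phi> s = (\<Sum>k\<in>K. (of_int k / n) * \<Phi> (indicator (A k)))" using fin by (simp add: s_def[abs_def])
   have 2: "integral\<^sup>L Q s = (\<Sum>k\<in>K. (of_int k / n) * \<Phi> (indicator (A k)))"
    unfolding s_def[abs_def] using s A
    by (subst Bochner_Integration.integral_sum) (auto intro!: integrable_mult_right simp: mQ less_top[symmetric])
   have close: "\<bar>f w - s w\<bar> \<le> 1 / n" if w: "w \<in> space M" for w
   proof -
    define k where "k = \<lfloor>n * f w\<rfloor>"
    have "n * \<bar>f w\<bar> \<le> n * C" using C(2)[OF w] n by simp
    then have "\<bar>n * f w\<bar> \<le> n * C" using n by (simp add: abs_mult)
    then have k: "k \<in> K" unfolding K_def k_def atLeastAtMost_iff by linarith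
    have "s w = (\<Sum>j\<in>K. if j = k then of_int k / n else 0)"
     unfolding s_def using w by (intro sum.cong) (auto simp: A_def k_def)
    then have "s w = of_int k / n" using k fin by simp
    moreover have "of_int k \<le> n * f w" "n * f w < of_int k + 1" unfolding k_def by linarith+
    then have "of_int k / n \<le> f w" "f w \<le> (of_int k + 1) / n" using n by (simp_all add: field_simps)
    ultimately show ?thesis by (simp add: add_divide_distrib)
   qed
   have "\<bar>integral\<^sup>L Q f - integral\<^sup>L Q s\<bar> \<le> 1 / n"
   proof -
    have i: "integrable Q f" "integrable Q s" using bmf_integrable[OF _ s(1)] f sb finite_measure_axioms by auto
    have "\<bar>integral\<^sup>L Q f - integral\<^sup>L Q s\<bar> = \<bar>\<integral>w. f w - s w \<partial>Q\<bar>" using i by simp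
    also have "\<dots> \<le> (LINT w|Q. \<bar>f w - s w\<bar>)" by (rule integral_abs_bound)
    also have "\<dots> \<le> (LINT w|Q. 1 / n)" using i close s by (intro integral_mono) auto
    finally show ?thesis using prob_space by simp
   qed
   moreover have "\<bar>\<Phi> f - \<Phi> s\<bar> \<le> 1 / n"
   proof -
    have "\<Phi> (\<lambda>w. f w - s w) \<le> \<Phi> (\<lambda>_. 1 / n)" "\<Phi> (\<lambda>w. s w - f w) \<le> \<Phi> (\<lambda>_. 1 / n)"
     using close by (intro mono bmf_diff f sb bmf_const; fastforce simp: abs_le_iff)+
    then show ?thesis using diff[OF f sb] diff[OF sb f] const by simp
   qed
   ultimately have "\<bar>integral\<^sup>L Q f - \<Phi> f\<bar> \<le> 1 / n + 1 / n" using 1 2 by linarith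
   then show ?thesis by (simp add: n_def)
  qed
  have "(\<lambda>m. 2 / real (Suc m)) \<longlonglongrightarrow> 0" using LIMSEQ_Suc[OF lim_const_over_n[of "2::real"]] .
  then have "\<bar>integral\<^sup>L Q f - \<Phi> f\<bar> \<le> 0"
   by (rule LIMSEQ_le_const) (use * in auto)
  then show ?thesis by simp
 qed
 then show ?thesis using that prob s by blast
qed

text \<open>After division by the total mass m, the law of Z under the weight \<rho> is a
  probability on the line. The cosine and sine integrals are the real and imaginary parts of its
  characteristic function, so Levy's uniqueness theorem applies.\<close>

lemma weighted_distribution_unique:
 assumes Q: "prob_space Q1" "prob_space Q2" and s: "sets Q1 = sets M" "sets Q2 = sets M"
  and \<rho>: "\<rho> \<in> bmf M" "\<And>w. w \<in> space M ==> 0 \<le> \<rho> w" and Z: "Z \<in> borel_measurable M"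
  and c: "\<And>s. (LINT w|Q1. \<rho> w * cos (s * Z w)) = (LINT w|Q2. \<rho> w * cos (s * Z w))"
  and sn: "\<And>s. (LINT w|Q1. \<rho> w * sin (s * Z w)) = (LINT w|Q2. \<rho> w * sin (s * Z w))"
 shows "(LINT w|Q1. \<rho> w * indicator {w \<in> space M. Z w \<le> a} w) = (LINT w|Q2. \<rho> w * indicator {w \<in> space M. Z w \<le> a} w)"
proof -
 define m where "m = (LINT w|Q1. \<rho> w)"
 have m2: "m = (LINT w|Q2. \<rho> w)" using c[of 0] by (simp add: m_def)
 note [measurable] = bmf_measurable[OF \<rho>(1)] Z
 have sp: "space Q1 = space M" "space Q2 = space M" using s[THEN sets_eq_imp_space_eq] by auto
 have int: "integrable Q \<rho>" if "Q = Q1 \<or> Q = Q2" for Q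
  using that Q s bmf_integrable[OF prob_space.finite_measure] \<rho>(1) by metis
 show ?thesis
 proof (cases "m = 0")
  \<comment> \<open>With total mass zero the nonnegative weight vanishes almost everywhere under
    both laws.\<close>
  case True
  have "(LINT w|Q. \<rho> w * indicator {w \<in> space M. Z w \<le> a} w) = 0" if "Q = Q1 \<or> Q = Q2" for Q
  proof -
   have "AE w in Q. \<rho> w = 0"
    using that True m2 m_def int[OF that] \<rho>(2) sp
    by (subst integral_nonneg_eq_0_iff_AE[symmetric]) auto
   then have "AE w in Q. \<rho> w * indicator {w \<in> space M. Z w \<le> a} w = 0" by auto
   then show ?thesis by (rule integral_eq_zero_AE)
  qed
  then show ?thesis by metis
 next
  case False
  have m0: "0 < m" using False unfolding m_def
   by (metis (mono_tags, lifting) \<rho>(2) integral_nonneg_AE AE_I2 less_eq_real_def sp(1))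
  define N where "N Q = distr (density Q (\<lambda>w. ennreal (\<rho> w / m))) borel Z" for Q
  have meas: "sets Q = sets M" if "Q = Q1 \<or> Q = Q2" for Q using that s by auto
  have nn: "AE w in Q. 0 \<le> \<rho> w / m" if "Q = Q1 \<or> Q = Q2" for Q
   using that sp \<rho>(2) m0 by (intro AE_I2) auto
  have ms: "f \<in> borel_measurable Q"
   if "f \<in> borel_measurable M" "Q = Q1 \<or> Q = Q2" for Q and f :: "_ => 'x :: topological_space"
   using measurable_cong_sets[OF meas[OF that(2)] refl, of "borel :: 'x measure"] that(1) by simp
  have rep: "integral\<^sup>L (N Q) h = (LINT w|Q. (\<rho> w / m) *\<^sub>R h (Z w))"
   if "h \<in> borel_measurable borel" "Q = Q1 \<or> Q = Q2" for Q and h :: "real => 'x :: {banach, second_countable_topology}"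
  proof -
   have [measurable]: "Z \<in> borel_measurable Q" "\<rho> \<in> borel_measurable Q"
    using ms[OF Z that(2)] ms[OF bmf_measurable[OF \<rho>(1)] that(2)] by simp_all
   note [measurable] = that(1)
   have Zd: "Z \<in> measurable (density Q (\<lambda>w. ennreal (\<rho> w / m))) borel" by simp
   have hZ: "(\<lambda>w. h (Z w)) \<in> borel_measurable Q" and \<rho>m: "(\<lambda>w. \<rho> w / m) \<in> borel_measurable Q" by measurable
   show ?thesis unfolding N_def integral_distr[OF Zd that(1)]
    by (rule integral_density[OF hZ \<rho>m nn[OF that(2)]])
  qed
  have rd: "real_distribution (N Q)" if q: "Q = Q1 \<or> Q = Q2" for Q
  proof -
   have "emeasure (density Q (\<lambda>w. ennreal (\<rho> w / m))) (space Q) = (\<integral>\<^sup>+w. ennreal (\<rho> w / m) \<partial>Q)"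
    using ms[OF bmf_measurable[OF \<rho>(1)] q] by (subst emeasure_density) (auto intro!: nn_integral_cong simp: indicator_def)
   also have "\<dots> = ennreal (LINT w|Q. \<rho> w / m)"
    using int[OF q] nn[OF q] by (intro nn_integral_eq_integral) auto
   also have "(LINT w|Q. \<rho> w / m) = 1" using q m2 m_def m0 by auto
   finally have "prob_space (density Q (\<lambda>w. ennreal (\<rho> w / m)))" by (intro prob_spaceI) simp
   then show ?thesis unfolding N_def real_distribution_def real_distribution_axioms_def
    using ms[OF Z q] by (auto intro!: prob_space.prob_space_distr)
  qed
  have ch: "char (N Q) t = Complex ((LINT w|Q. \<rho> w * cos (t * Z w)) / m) ((LINT w|Q. \<rho> w * sin (t * Z w)) / m)"
   if q: "Q = Q1 \<or> Q = Q2" for Q t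
  proof -
   have "(\<lambda>w. (\<rho> w / m) *\<^sub>R iexp (t * Z w)) \<in> borel_measurable M" by measurable
   then have mm: "(\<lambda>w. (\<rho> w / m) *\<^sub>R iexp (t * Z w)) \<in> borel_measurable Q" using ms q by blast
   have i: "integrable Q (\<lambda>w. (\<rho> w / m) *\<^sub>R iexp (t * Z w))"
    by (rule integrable_le[OF integrable_divide[OF int[OF q], of m] mm]) (auto simp: norm_mult)
   have "char (N Q) t = (LINT w|Q. (\<rho> w / m) *\<^sub>R iexp (t * Z w))"
    unfolding char_def by (rule rep[OF _ q]) measurable
   then have "Re (char (N Q) t) = (LINT w|Q. Re ((\<rho> w / m) *\<^sub>R iexp (t * Z w)))"
    "Im (char (N Q) t) = (LINT w|Q. Im ((\<rho> w / m) *\<^sub>R iexp (t * Z w)))" by (simp_all only: integral_Re[OF i] integral_Im[OF i])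
   then show ?thesis by (intro complex_eqI) (simp_all add: Re_exp Im_exp)
  qed
  have "N Q1 = N Q2"
   by (rule Levy_uniqueness) (auto simp: rd ch c sn fun_eq_iff)
  then have "measure (N Q1) {..a} = measure (N Q2) {..a}" by simp
  moreover have "measure (N Q) {..a} = (LINT w|Q. \<rho> w * indicator {w \<in> space M. Z w \<le> a} w) / m" if q: "Q = Q1 \<or> Q = Q2" for Q
  proof -
   interpret real_distribution "N Q" by (rule rd[OF q])
   have "measure (N Q) {..a} = integral\<^sup>L (N Q) (indicator {..a})" by simp
   also have "\<dots> = (LINT w|Q. (\<rho> w / m) *\<^sub>R indicator {..a} (Z w))" by (rule rep[OF _ q]) simp
   also have "\<dots> = (LINT w|Q. \<rho> w * indicator {w \<in> space M. Z w \<le> a} w / m)"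
    using q sp by (intro lint_cong) (auto simp: indicator_def)
   finally show ?thesis by simp
  qed
  ultimately show ?thesis using m0 by simp
 qed
qed

section \<open>The path space\<close>

lemma space_path_space: "space path_space = cadlag"
 by (auto simp: path_space_def space_restrict_space space_PiM cadlag_def PiE_def)

lemma cadlag_extensional: "w \<in> cadlag ==> t < 0 ==> w t = undefined"
 by (auto simp: cadlag_def extensional_def)

text \<open>At negative times the value of an extensional path is the constant
  \<open>undefined\<close>, so evaluation is measurable at every real t.\<close>

lemma measurable_path_eval[measurable]: "(\<lambda>w::real => 'a::topological_space. w t) \<in> measurable path_space borel"
proof (cases "0 \<le> t")
 case True
 then show ?thesis unfolding path_space_def
  by (intro measurable_restrict_space1 measurable_component_singleton) auto
next
 case False
 then have "(\<lambda>w::real => 'a. w t) \<in> measurable path_space borel \<longleftrightarrow> (\<lambda>w::real => 'a. undefined::'a) \<in> measurable path_space borel"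
  by (intro measurable_cong) (simp add: space_path_space cadlag_extensional)
 then show ?thesis by simp
qed

lemma measurable_path_spaceI:
 assumes "\<And>x. x \<in> space M ==> g x \<in> cadlag" "\<And>t. 0 \<le> t ==> (\<lambda>x. g x t) \<in> borel_measurable M"
 shows "g \<in> measurable M path_space"
 unfolding path_space_def
proof (rule measurable_restrict_space2)
 show "g \<in> space M \<rightarrow> cadlag" using assms by auto
 show "g \<in> measurable M (Pi\<^sub>M {0..} (\<lambda>_. borel))"
  by (rule measurable_PiM_single') (use assms in \<open>auto simp: cadlag_def PiE_def\<close>)
qed

lemma add_jump_cadlag:
 fixes w :: "real => 'a :: real_normed_vector"
 assumes w: "w \<in> cadlag" shows "add_jump p w \<in> cadlag"
proof -
 obtain s x where p: "p = (s, x)" by force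
 show ?thesis unfolding cadlag_def p
 proof (intro CollectI conjI allI impI)
  fix t :: real assume t: "0 \<le> t"
  have "\<forall>\<^sub>F r in at_right t. w r + (if s \<le> t then x else 0) = add_jump (s, x) w r"
  proof (cases "s \<le> t")
   case True then show ?thesis using t
    by (auto simp: eventually_at_right_field add_jump_def intro!: exI[of _ "t + 1"])
  next
   case False then show ?thesis using t
    by (auto simp: eventually_at_right_field add_jump_def intro!: exI[of _ s])
  qed
  moreover have "((\<lambda>r. w r + (if s \<le> t then x else 0)) \<longlongrightarrow> w t + (if s \<le> t then x else 0)) (at_right t)"
   using w t by (intro tendsto_add tendsto_const) (auto simp: cadlag_def)
  ultimately show "(add_jump (s, x) w \<longlongrightarrow> add_jump (s, x) w t) (at_right t)"
   using t by (auto intro: Lim_transform_eventually simp: add_jump_def[of _ w, THEN fun_cong, of _ t])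
 next
  fix t :: real assume t: "0 < t"
  then obtain l where l: "(w \<longlongrightarrow> l) (at_left t)" using w by (auto simp: cadlag_def)
  have "\<forall>\<^sub>F r in at_left t. w r + (if s < t then x else 0) = add_jump (s, x) w r"
   \<comment> \<open>To the left of t a jump at s is present only if s < t strictly. The witness
     starts an interval on which the added term is constant; the maximum with 0 keeps it inside the
     half-line.\<close>
   using t by (auto simp: eventually_at_left_field add_jump_def intro!: exI[of _ "if s < t then max 0 s else 0"])
  moreover have "((\<lambda>r. w r + (if s < t then x else 0)) \<longlongrightarrow> l + (if s < t then x else 0)) (at_left t)"
   by (intro tendsto_add tendsto_const l)
  ultimately show "\<exists>l. (add_jump (s, x) w \<longlongrightarrow> l) (at_left t)"
   by (blast intro: Lim_transform_eventually)
 qed (auto simp: add_jump_def)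
qed

lemma stopped_cadlag:
 fixes w :: "real => 'a :: real_normed_vector"
 assumes w: "w \<in> cadlag" and s: "0 \<le> s" shows "stopped s w \<in> cadlag"
 unfolding cadlag_def
proof (intro CollectI conjI allI impI)
 fix t :: real assume t: "0 \<le> t"
 show "(stopped s w \<longlongrightarrow> stopped s w t) (at_right t)"
 proof (cases "t < s")
  case True
  then have "\<forall>\<^sub>F r in at_right t. w r = stopped s w r"
   using t by (auto simp: eventually_at_right_field stopped_def intro!: exI[of _ s])
  moreover have "(w \<longlongrightarrow> w t) (at_right t)" using w t by (auto simp: cadlag_def)
  moreover have "stopped s w t = w t" using t True by (simp add: stopped_def)
  ultimately show ?thesis by (auto intro: Lim_transform_eventually)
 next
  case False
  then have "\<forall>\<^sub>F r in at_right t. w s = stopped s w r"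
   using t by (auto simp: eventually_at_right_field stopped_def min_def intro!: exI[of _ "t + 1"])
  moreover have "((\<lambda>r. w s) \<longlongrightarrow> w s) (at_right t)" by simp
  moreover have "stopped s w t = w s" using t False by (simp add: stopped_def min_def)
  ultimately show ?thesis by (auto intro: Lim_transform_eventually)
 qed
next
 fix t :: real assume t: "0 < t"
 then obtain l where l: "(w \<longlongrightarrow> l) (at_left t)" using w by (auto simp: cadlag_def)
 show "\<exists>l. (stopped s w \<longlongrightarrow> l) (at_left t)"
 proof (cases "t \<le> s")
  case True
  then have "\<forall>\<^sub>F r in at_left t. w r = stopped s w r"
   using t by (auto simp: eventually_at_left_field stopped_def min_def intro!: exI[of _ 0])
  then show ?thesis using l by (blast intro: Lim_transform_eventually)
 next
  case False
  then have "\<forall>\<^sub>F r in at_left t. w s = stopped s w r"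
   using s t by (auto simp: eventually_at_left_field stopped_def min_def intro!: exI[of _ s])
  moreover have "((\<lambda>r. w s) \<longlongrightarrow> w s) (at_left t)" by simp
  ultimately show ?thesis by (blast intro: Lim_transform_eventually)
 qed
qed (auto simp: stopped_def)

lemma stopped_measurable: "0 \<le> s ==> stopped s \<in> measurable path_space (path_space :: (real => 'a :: real_normed_vector) measure)"
 by (rule measurable_path_spaceI) (auto simp: space_path_space stopped_cadlag, simp add: stopped_def)

lemma measurable_add_jump[measurable (raw)]:
 fixes W :: "'b => real => 'a :: euclidean_space"
 assumes [measurable]: "p \<in> measurable M (borel \<Otimes>\<^sub>M borel)" and W[measurable]: "W \<in> measurable M path_space"
 shows "(\<lambda>x. add_jump (p x) (W x)) \<in> measurable M path_space"
proof (rule measurable_path_spaceI)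
 fix x assume "x \<in> space M"
 then show "add_jump (p x) (W x) \<in> cadlag"
  using measurable_space[OF W] by (intro add_jump_cadlag) (auto simp: space_path_space)
next
 fix t :: real assume t: "0 \<le> t"
 have [measurable]: "(\<lambda>x. W x t) \<in> borel_measurable M"
  by (rule measurable_compose[OF W measurable_path_eval])
 show "(\<lambda>x. add_jump (p x) (W x) t) \<in> borel_measurable M"
  using t by (simp add: add_jump_def)
qed

lemma add_jump_commute:
 fixes w :: "real => 'a :: comm_monoid_add"
 shows "add_jump p (add_jump q w) = add_jump q (add_jump p w)"
 by (auto simp: add_jump_def fun_eq_iff add_ac)

text \<open>Real parts of characters of finitely many path values. The free phase \<open>c\<close>
  covers cosine and sine at once and lets multiplication by a complex number act as scaling and
  phase shift. Up to linear combinations the class is closed under products.\<close>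

definition trig :: "(real => 'a::euclidean_space) => real set => real => (real => 'a) => real" where
 "trig u F c w = cos ((\<Sum>t\<in>F. u t \<bullet> w t) + c)"

lemma trig_bmf: "trig u F c \<in> bmf path_space"
proof (rule bmfI[of _ _ 1])
 have [measurable]: "(\<lambda>w. \<Sum>t\<in>F. u t \<bullet> w t) \<in> borel_measurable path_space"
  by (intro borel_measurable_sum borel_measurable_inner borel_measurable_const measurable_path_eval)
 show "trig u F c \<in> borel_measurable path_space" unfolding trig_def[abs_def] by measurable
qed (simp add: trig_def)

text \<open>Product-to-sum formula. The new frequency is added to the one that r may already carry,
  so that the result is again indexed by a finite set of times.\<close>

lemma trig_mult_cos:
 assumes "finite F" "0 \<le> r"
 shows "trig u F c w * cos (s * (w r \<bullet> i) + d) =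
  (trig (u(r := (if r \<in> F then u r else 0) + (- s) *\<^sub>R i)) (insert r F) (c - d) w + trig (u(r := (if r \<in> F then u r else 0) + s *\<^sub>R i)) (insert r F) (c + d) w) / 2"
proof -
 have *: "(\<Sum>t\<in>insert r F. (u(r := (if r \<in> F then u r else 0) + y)) t \<bullet> w t) = (\<Sum>t\<in>F. u t \<bullet> w t) + y \<bullet> w r" for y
 proof (cases "r \<in> F")
  case True
  have "(\<Sum>t\<in>F. (u(r := u r + y)) t \<bullet> w t) = (u r + y) \<bullet> w r + (\<Sum>t\<in>F - {r}. u t \<bullet> w t)"
   using True assms by (subst sum.remove[of _ r]) (auto intro!: sum.cong)
  also have "\<dots> = (\<Sum>t\<in>F. u t \<bullet> w t) + y \<bullet> w r"
   using True assms by (subst (2) sum.remove[of _ r]) (auto simp: inner_add_left)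
  finally show ?thesis using True by (simp add: insert_absorb)
 next
  case False
  then have "(\<Sum>t\<in>F. (u(r := y)) t \<bullet> w t) = (\<Sum>t\<in>F. u t \<bullet> w t)" by (intro sum.cong) auto
  then show ?thesis using False assms by simp
 qed
 show ?thesis
  unfolding trig_def * cos_times_cos by (simp add: inner_commute algebra_simps)
qed

text \<open>One constraint at a time is converted from trigonometric functions to the indicator of a
  half-space: the induction keeps a trigonometric factor for the values not yet treated, and the
  one-dimensional uniqueness result is applied with everything else as weight. The finite
  intersections of half-spaces obtained at the end are a generator stable under
  intersection.\<close>

theorem path_measure_eqI:
 fixes Q1 Q2 :: "(real => 'a::euclidean_space) measure"
 assumes Q: "prob_space Q1" "prob_space Q2" and s: "sets Q1 = sets path_space" "sets Q2 = sets path_space"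
  and eq: "\<And>u F c. finite F ==> F \<subseteq> {0..} ==> (LINT w|Q1. trig u F c w) = (LINT w|Q2. trig u F c w)"
 shows "Q1 = Q2"
proof -
 interpret Q1: prob_space Q1 by fact
 interpret Q2: prob_space Q2 by fact
 have sp: "space Q1 = cadlag" "space Q2 = cadlag" using s sets_eq_imp_space_eq space_path_space by metis+
 define H :: "(real \<times> 'a \<times> real) set => (real => 'a) set"
  where "H J = {w \<in> cadlag. \<forall>(t,i,a)\<in>J. w t \<bullet> i \<le> a}" for J
 define \<J> :: "(real \<times> 'a \<times> real) set set" where "\<J> = {J. finite J \<and> (\<forall>(t,i,a)\<in>J. 0 \<le> t)}"
 have Hins: "H (insert (t,i,a) J) = {w \<in> space path_space. w t \<bullet> i \<le> a} \<inter> H J" for t i a J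
  by (auto simp: H_def space_path_space)
 have Hm: "finite J ==> H J \<in> sets path_space" for J
 proof (induction J rule: finite_induct)
  case empty then show ?case using sets.top[of path_space] by (simp add: H_def space_path_space)
 next
  case (insert x J)
  obtain t i a where x: "x = (t,i,a)" by (cases x) auto
  have "{w \<in> space path_space. w t \<bullet> i \<le> a} \<in> sets (path_space :: (real => 'a) measure)" by measurable
  then show ?case using insert unfolding x Hins by blast
 qed
 have main: "(LINT w|Q1. indicator (H J) w * trig u F c w) = (LINT w|Q2. indicator (H J) w * trig u F c w)"
  if "finite J" "\<forall>(t,i,a)\<in>J. 0 \<le> t" "finite F" "F \<subseteq> {0..}" for J u F c
  using that
 proof (induction J arbitrary: u F c rule: finite_induct)
  case empty
  have "(LINT w|Q. indicator (H {}) w * trig u F c w) = (LINT w|Q. trig u F c w)" if "space Q = cadlag" for Q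
   using that by (intro lint_cong) (auto simp: H_def)
  then show ?case using eq empty sp by simp
 next
  case (insert x J)
  obtain r i a where x: "x = (r,i,a)" by (cases x) auto
  have r: "0 \<le> r" and IH: "\<And>F u c. finite F ==> F \<subseteq> {0..} ==>
    (LINT w|Q1. indicator (H J) w * trig u F c w) = (LINT w|Q2. indicator (H J) w * trig u F c w)"
   using insert by (auto simp: x)
  note Hb = bmf_indicator[OF Hm[OF insert(1)]]
  \<comment> \<open>A weight has to be nonnegative, so \<open>trig\<close> is replaced by
    \<open>1 + trig\<close>; the contribution of the constant is removed afterwards.\<close>
  have step: "(LINT w|Q1. indicator (H J) w * (1 + trig u F c w) * indicator {w \<in> space path_space. w r \<bullet> i \<le> a} w) =
     (LINT w|Q2. indicator (H J) w * (1 + trig u F c w) * indicator {w \<in> space path_space. w r \<bullet> i \<le> a} w)"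
   if F: "finite F" "F \<subseteq> {0..}" for u F c
  proof -
   have cs: "(LINT w|Q1. indicator (H J) w * (1 + trig u F c w) * cos (s * (w r \<bullet> i) + d)) =
        (LINT w|Q2. indicator (H J) w * (1 + trig u F c w) * cos (s * (w r \<bullet> i) + d))" for s d
   proof -
    define u' where "u' y = u(r := (if r \<in> F then u r else 0) + y)" for y
    have "(LINT w|Q. indicator (H J) w * (1 + trig u F c w) * cos (s * (w r \<bullet> i) + d))
      = (LINT w|Q. indicator (H J) w * trig (\<lambda>_. s *\<^sub>R i) {r} d w)
      + ((LINT w|Q. indicator (H J) w * trig (u' ((- s) *\<^sub>R i)) (insert r F) (c - d) w)
      + (LINT w|Q. indicator (H J) w * trig (u' (s *\<^sub>R i)) (insert r F) (c + d) w)) / 2"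
     if "prob_space Q" "sets Q = sets path_space" for Q
    proof -
     have i: "integrable Q (\<lambda>w. indicator (H J) w * trig v G e w)" for v G e
      using that by (intro bmf_integrable[of _ path_space] bmf_mult Hb trig_bmf prob_space.finite_measure)
     have "(\<lambda>w. indicator (H J) w * (1 + trig u F c w) * cos (s * (w r \<bullet> i) + d)) =
      (\<lambda>w. indicator (H J) w * trig (\<lambda>_. s *\<^sub>R i) {r} d w
       + (indicator (H J) w * trig (u' ((- s) *\<^sub>R i)) (insert r F) (c - d) w
       + indicator (H J) w * trig (u' (s *\<^sub>R i)) (insert r F) (c + d) w) / 2)"
     proof
      fix w
      have "trig (\<lambda>_. s *\<^sub>R i) {r} d w = cos (s * (w r \<bullet> i) + d)" by (simp add: trig_def inner_commute)
      moreover have "trig u F c w * cos (s * (w r \<bullet> i) + d) =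
       (trig (u' ((- s) *\<^sub>R i)) (insert r F) (c - d) w + trig (u' (s *\<^sub>R i)) (insert r F) (c + d) w) / 2"
       unfolding u'_def by (rule trig_mult_cos[OF F(1) r])
      moreover have "x * (1 + y) * z = x * z + x * (y * z)" for x y z :: real by (simp add: algebra_simps)
      ultimately show "indicator (H J) w * (1 + trig u F c w) * cos (s * (w r \<bullet> i) + d) =
       indicator (H J) w * trig (\<lambda>_. s *\<^sub>R i) {r} d w
       + (indicator (H J) w * trig (u' ((- s) *\<^sub>R i)) (insert r F) (c - d) w
       + indicator (H J) w * trig (u' (s *\<^sub>R i)) (insert r F) (c + d) w) / 2"
       by (simp only:) (simp add: algebra_simps)
     qed
     then show ?thesis using i by simp
    qed
    from this[OF Q(1) s(1)] this[OF Q(2) s(2)] show ?thesis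
     using IH[of "{r}"] IH[of "insert r F"] F r by simp
   qed
   \<comment> \<open>The sine moments are cosine moments with phase shifted by - pi / 2, so the one
     family \<open>cs\<close> supplies both hypotheses of the uniqueness lemma.\<close>
   have sin: "sin z = cos (z + (- pi / 2))" for z :: real by (simp add: cos_diff)
   show ?thesis
    using weighted_distribution_unique[OF Q s, of "\<lambda>w. indicator (H J) w * (1 + trig u F c w)" "\<lambda>w. w r \<bullet> i" a]
     cs[of _ 0] cs[of _ "- pi / 2"] unfolding sin
    by (simp add: bmf_mult Hb bmf_add trig_bmf)
     (smt (verit) cos_ge_minus_one indicator_pos_le mult_nonneg_nonneg trig_def)
  qed
  \<comment> \<open>Since cos (pi / 2) = 0, the zero function is itself of the form
    \<open>trig\<close>; the term to be subtracted is therefore another instance of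
    \<open>step\<close>.\<close>
  have tr0: "trig (\<lambda>_. 0) {} (pi / 2) = (\<lambda>w. 0)" by (simp add: trig_def fun_eq_iff)
  have "(LINT w|Q. indicator (H (insert x J)) w * trig u F c w) =
   (LINT w|Q. indicator (H J) w * (1 + trig u F c w) * indicator {w \<in> space path_space. w r \<bullet> i \<le> a} w) -
   (LINT w|Q. indicator (H J) w * (1 + trig (\<lambda>_. 0) {} (pi / 2) w) * indicator {w \<in> space path_space. w r \<bullet> i \<le> a} w)"
   if "prob_space Q" "sets Q = sets path_space" for Q
  proof -
   have m: "{w \<in> space path_space. w r \<bullet> i \<le> a} \<in> sets path_space" by measurable
   have i: "integrable Q (\<lambda>w. indicator (H J) w * (1 + trig v G e w) * indicator {w \<in> space path_space. w r \<bullet> i \<le> a} w)" for v G e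
    using that by (intro bmf_integrable[of _ path_space] bmf_mult bmf_add bmf_const Hb trig_bmf prob_space.finite_measure bmf_indicator m)
   show ?thesis unfolding x Hins
    by (subst Bochner_Integration.integral_diff[OF i i, symmetric])
     (auto intro!: lint_cong simp: tr0 indicator_def)
  qed
  then show ?case using step[OF insert.prems(2,3)] step[of "{}"] Q s by simp
 qed
 have em: "emeasure Q1 (H J) = emeasure Q2 (H J)" if "J \<in> \<J>" for J
 proof -
  have "(\<lambda>w. indicator (H J) w * trig (\<lambda>_. 0) {} 0 w) = (indicator (H J) :: _ => real)" by (simp add: trig_def fun_eq_iff)
  then have "measure Q1 (H J) = measure Q2 (H J)"
   using main[of J "{}" "\<lambda>_. 0" 0] that Hm[of J] s by (simp add: \<J>_def)
  then show ?thesis by (simp add: Q1.emeasure_eq_measure Q2.emeasure_eq_measure)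
 qed
 have gen: "sets path_space = sigma_sets cadlag (H ` \<J>)"
 proof
  have "H ` \<J> \<subseteq> sets path_space" using Hm by (auto simp: \<J>_def)
  then show "sigma_sets cadlag (H ` \<J>) \<subseteq> sets path_space"
   by (metis sets.sigma_sets_subset space_path_space)
  have HP: "H ` \<J> \<subseteq> Pow cadlag" by (auto simp: H_def)
  have "(\<lambda>w. w) \<in> measurable (sigma cadlag (H ` \<J>)) path_space"
  proof (rule measurable_path_spaceI)
   show "w \<in> space (sigma cadlag (H ` \<J>)) ==> w \<in> cadlag" for w using HP by (simp add: space_measure_of)
   fix t :: real assume t: "0 \<le> t"
   show "(\<lambda>w. w t) \<in> borel_measurable (sigma cadlag (H ` \<J>))"
    unfolding borel_measurable_iff_halfspace_le
   proof (intro ballI allI)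
    fix i :: 'a and a
    have "{(t,i,a)} \<in> \<J>" using t by (simp add: \<J>_def)
    then have "H {(t,i,a)} \<in> sigma_sets cadlag (H ` \<J>)" by blast
    moreover have "H {(t,i,a)} = {w \<in> space (sigma cadlag (H ` \<J>)). w t \<bullet> i \<le> a}"
     using HP by (auto simp: H_def space_measure_of)
    ultimately show "{w \<in> space (sigma cadlag (H ` \<J>)). w t \<bullet> i \<le> a} \<in> sets (sigma cadlag (H ` \<J>))"
     using HP by simp
   qed
  qed
  then show "sets path_space \<subseteq> sigma_sets cadlag (H ` \<J>)"
  proof (intro subsetI)
   fix A :: "(real => 'a) set" assume A: "A \<in> sets path_space" and m: "(\<lambda>w::real => 'a. w) \<in> measurable (sigma cadlag (H ` \<J>)) path_space"
   have "(\<lambda>w::real => 'a. w) -` A \<inter> space (sigma cadlag (H ` \<J>)) = A"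
    using sets.sets_into_space[OF A] HP by (auto simp: space_measure_of space_path_space)
   then show "A \<in> sigma_sets cadlag (H ` \<J>)" using measurable_sets[OF m A] HP by simp
  qed
 qed
 have top: "{} \<in> \<J>" "H {} = cadlag" by (auto simp: \<J>_def H_def)
 show ?thesis
 proof (rule measure_eqI_generator_eq)
  show "Int_stable (H ` \<J>)"
  proof (rule Int_stableI)
   fix A B assume "A \<in> H ` \<J>" "B \<in> H ` \<J>"
   then obtain J K where "A = H J" "B = H K" "J \<in> \<J>" "K \<in> \<J>" by auto
   moreover have "H (J \<union> K) = H J \<inter> H K" unfolding H_def ball_Un by blast
   ultimately have "A \<inter> B = H (J \<union> K)" "J \<union> K \<in> \<J>" by (auto simp: \<J>_def)
   then show "A \<inter> B \<in> H ` \<J>" by blast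
  qed
  show "H ` \<J> \<subseteq> Pow cadlag" by (auto simp: H_def)
  show "range (\<lambda>_. cadlag) \<subseteq> H ` \<J>" using top by force
  show "(\<Union>i::nat. cadlag) = cadlag" by simp
 qed (use em gen s in auto)
qed

section \<open>Jump operators\<close>

text \<open>The increment of the sum of \<open>u t \<bullet> w t\<close> over F when the jump p is
  added: a jump of size \<open>snd p\<close> is felt at all times of F not earlier than
  \<open>fst p\<close>.\<close>

abbreviation phase :: "(real => 'a::real_inner) => real set => real \<times> 'a => real" where
 "phase u F p \<equiv> (\<Sum>t | t \<in> F \<and> fst p \<le> t. u t) \<bullet> snd p"

lemma phase_eq_sum:
 assumes "finite F" shows "phase u F p = (\<Sum>t\<in>F. if fst p \<le> t then u t \<bullet> snd p else 0)"
 using assms by (auto simp: sum.inter_filter inner_sum_left intro!: sum.cong)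

lemma phase_le:
 assumes F: "finite F" shows "\<bar>phase u F p\<bar> \<le> (\<Sum>t\<in>F. norm (u t)) * norm (snd p)"
proof -
 have "\<bar>phase u F p\<bar> \<le> norm (\<Sum>t | t \<in> F \<and> fst p \<le> t. u t) * norm (snd p)" by (rule Cauchy_Schwarz_ineq2)
 also have "norm (\<Sum>t | t \<in> F \<and> fst p \<le> t. u t) \<le> (\<Sum>t | t \<in> F \<and> fst p \<le> t. norm (u t))" by (rule norm_sum)
 also have "\<dots> \<le> (\<Sum>t\<in>F. norm (u t))" using F by (intro sum_mono2) auto
 finally show ?thesis by (simp add: mult_right_mono)
qed

text \<open>Measurability of the identity says that the \<sigma>-field of K contains the traces of
  the Borel sets of the product; the space of K may be smaller, as for jump times in the
  half-line.\<close>

locale jump_measure = sigma_finite_measure K for K :: "(real \<times> 'a::euclidean_space) measure" +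
 assumes measurable_jump_id: "(\<lambda>z. z) \<in> measurable K (borel \<Otimes>\<^sub>M borel)"

text \<open>A third value of the parameter is used for domination: \<open>c = -1\<close> gives the
  sum of the two values, and its iterates applied to the absolute value of f majorise the iterated
  differences of f.\<close>

definition shift_diff :: "real => real \<times> 'a::monoid_add => ((real => 'a) => real) => (real => 'a) => real" where
 "shift_diff c p f w = f (add_jump p w) - c * f w"

text \<open>The last coordinate acts on f first, so that \<open>z n\<close> can be split off when a
  product over \<open>{..<Suc n}\<close> is integrated.\<close>

primrec shift_diffs :: "real => nat => (nat => real \<times> 'a::monoid_add) => ((real => 'a) => real) => (real => 'a) => real" where
 "shift_diffs c 0 z f = f"
| "shift_diffs c (Suc n) z f = shift_diffs c n z (shift_diff c (z n) f)"

text \<open>The case \<open>c = 1\<close> is the operator generating the perturbation, the case \<open>c = 0\<close> keeps only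
 the positive part.\<close>

definition jump_op :: "real => (real \<times> 'a::euclidean_space) measure => (real \<times> 'a => real) => ((real => 'a) => real) => (real => 'a) => real" where
 "jump_op c K a f w = (LINT z|K. a z * shift_diff c z f w)"

lemma jump_diffs_append: "jump_diffs (ps @ qs) f = jump_diffs ps (jump_diffs qs f)"
 by (induction ps) auto

text \<open>One recursion starts at the first point of the list, the other at the last coordinate;
  both put the last point innermost.\<close>

lemma jump_diff_n_eq_shift_diffs: "jump_diff_n n z f = shift_diffs 1 n z f"
proof (induction n arbitrary: f)
 case (Suc n)
 have "jump_diff (z n) f = shift_diff 1 (z n) f" by (simp add: fun_eq_iff jump_diff_def shift_diff_def)
 then show ?case using Suc[of "shift_diff 1 (z n) f"] by (simp add: jump_diff_n_def jump_diffs_append)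
qed (simp add: jump_diff_n_def)

lemma shift_diffs_cong_cadlag:
 fixes f :: "(real => 'a::real_normed_vector) => real"
 assumes "\<And>w. w \<in> cadlag ==> f w = g w" "w \<in> cadlag" "\<And>i. i < n ==> z i = y i"
 shows "shift_diffs c n z f w = shift_diffs c n y g w"
 using assms
proof (induction n arbitrary: f g)
 case (Suc n)
 show ?case unfolding shift_diffs.simps
  by (rule Suc.IH) (use Suc.prems in \<open>auto simp: shift_diff_def add_jump_cadlag\<close>)
qed auto

lemma shift_diffs_linear:
 "shift_diffs c n z (\<lambda>w. a * f w + b * g w) w = a * shift_diffs c n z f w + b * shift_diffs c n z g w"
proof (induction n arbitrary: f g)
 case (Suc n)
 have "shift_diff c (z n) (\<lambda>w. a * f w + b * g w) = (\<lambda>w. a * shift_diff c (z n) f w + b * shift_diff c (z n) g w)"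
  by (auto simp: shift_diff_def algebra_simps)
 then show ?case using Suc by simp
qed simp

lemma shift_diff_commute:
 fixes f :: "(real => 'a::comm_monoid_add) => real"
 shows "shift_diff c p (shift_diff d q f) = shift_diff d q (shift_diff c p f)"
 by (auto simp: shift_diff_def fun_eq_iff algebra_simps add_jump_commute[of p q])

lemma shift_diffs_le:
 fixes f :: "(real => 'a::real_normed_vector) => real"
 assumes "\<And>w. w \<in> cadlag ==> \<bar>f w\<bar> \<le> C" "w \<in> cadlag"
 shows "\<bar>shift_diffs c n z f w\<bar> \<le> (1 + \<bar>c\<bar>) ^ n * C"
 using assms
proof (induction n arbitrary: f C)
 case (Suc n)
 have "\<bar>shift_diffs c n z (shift_diff c (z n) f) w\<bar> \<le> (1 + \<bar>c\<bar>) ^ n * ((1 + \<bar>c\<bar>) * C)"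
 proof (rule Suc.IH)
  fix v :: "real => 'a" assume v: "v \<in> cadlag"
  have "\<bar>shift_diff c (z n) f v\<bar> \<le> \<bar>f (add_jump (z n) v)\<bar> + \<bar>c\<bar> * \<bar>f v\<bar>"
   unfolding shift_diff_def by (metis abs_mult abs_triangle_ineq4)
  also have "\<dots> \<le> C + \<bar>c\<bar> * C" by (intro add_mono mult_left_mono Suc.prems add_jump_cadlag v) auto
  finally show "\<bar>shift_diff c (z n) f v\<bar> \<le> (1 + \<bar>c\<bar>) * C" by (simp add: algebra_simps)
 qed fact
 then show ?case by (simp add: mult_ac)
qed simp

lemma measurable_shift_diff[measurable (raw)]:
 fixes f :: "'b => (real => 'a::euclidean_space) => real"
 assumes f: "(\<lambda>(x, w). f x w) \<in> borel_measurable (N \<Otimes>\<^sub>M path_space)"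
  and p: "p \<in> measurable N (borel \<Otimes>\<^sub>M borel)"
 shows "(\<lambda>(x, w). shift_diff c (p x) (f x) w) \<in> borel_measurable (N \<Otimes>\<^sub>M path_space)"
proof -
 have "(\<lambda>y. (fst y, add_jump (p (fst y)) (snd y))) \<in> measurable (N \<Otimes>\<^sub>M path_space) (N \<Otimes>\<^sub>M path_space)"
  using measurable_compose[OF measurable_fst p] by (intro measurable_Pair measurable_fst measurable_add_jump measurable_snd)
 from measurable_compose[OF this f] f show ?thesis
  by (simp add: shift_diff_def case_prod_beta')
qed

text \<open>The function may depend on the parameter x; this lets the induction absorb
  \<open>shift_diff c (z x n) (f x)\<close> into the next parametrised function.\<close>

lemma measurable_shift_diffs:
 fixes f :: "'b => (real => 'a::euclidean_space) => real"
 assumes "(\<lambda>(x, w). f x w) \<in> borel_measurable (N \<Otimes>\<^sub>M path_space)"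
  and "\<And>i. i < n ==> (\<lambda>x. z x i) \<in> measurable N (borel \<Otimes>\<^sub>M borel)"
 shows "(\<lambda>(x, w). shift_diffs c n (z x) (f x) w) \<in> borel_measurable (N \<Otimes>\<^sub>M path_space)"
 using assms
proof (induction n arbitrary: f)
 case (Suc n)
 show ?case unfolding shift_diffs.simps
  by (rule Suc.IH, rule measurable_shift_diff) (use Suc.prems in auto)
qed simp

lemma measurable_const_fun_path:
 "f \<in> borel_measurable path_space ==> (\<lambda>(x, w). f w) \<in> borel_measurable (N \<Otimes>\<^sub>M path_space)"
 by (simp add: case_prod_beta' measurable_compose[OF measurable_snd])

lemma shift_diff_bmf:
 assumes f: "f \<in> bmf path_space" shows "shift_diff c p f \<in> bmf (path_space :: (real => 'a::euclidean_space) measure)"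
proof -
 obtain C where C: "\<And>w. w \<in> cadlag ==> \<bar>f w\<bar> \<le> C" using f by (metis bmfE space_path_space)
 have "add_jump p \<in> measurable path_space (path_space :: (real => 'a::euclidean_space) measure)"
  by (rule measurable_add_jump[OF measurable_const measurable_ident_sets[OF refl]]) (simp add: space_pair_measure)
 then have "(\<lambda>w. f (add_jump p w)) \<in> bmf path_space"
  using C f by (intro bmfI[of _ _ C]) (auto simp: space_path_space add_jump_cadlag intro: measurable_compose)
 then show ?thesis unfolding shift_diff_def[abs_def] by (intro bmf_diff bmf_cmult f)
qed

lemma shift_diffs_bmf:
 assumes "f \<in> bmf path_space" shows "shift_diffs c n z f \<in> bmf (path_space :: (real => 'a::euclidean_space) measure)"
 using assms by (induction n arbitrary: f) (auto intro: shift_diff_bmf)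

context jump_measure
begin

lemma shift_diff_integrable:
 assumes f: "f \<in> bmf path_space" and a: "integrable K a" and w: "w \<in> cadlag"
 shows "integrable K (\<lambda>z. a z * shift_diff c z f w)"
proof -
 obtain C where C0: "0 \<le> C" and C: "\<And>w. w \<in> cadlag ==> \<bar>f w\<bar> \<le> C" using f by (metis bmfE space_path_space)
 have le: "\<bar>shift_diff c z f w\<bar> \<le> (1 + \<bar>c\<bar>) * C" for z
  using shift_diffs_le[of f C w c 1 "\<lambda>_. z"] C w by simp
 have "(\<lambda>z. case (z, w) of (z, w) => shift_diff c z f w) \<in> borel_measurable K"
  by (rule measurable_compose[OF _ measurable_shift_diff[OF measurable_const_fun_path[OF bmf_measurable[OF f]] measurable_jump_id]])
   (use w in \<open>auto simp: space_path_space\<close>)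
 then have [measurable]: "(\<lambda>z. shift_diff c z f w) \<in> borel_measurable K" by simp
 show ?thesis
  by (rule integrable_le[OF integrable_mult_left[OF integrable_abs[OF a], of "(1 + \<bar>c\<bar>) * C"]])
   (use a le C0 in \<open>simp_all add: abs_mult mult_left_mono\<close>)
qed

lemma measurable_jump_op:
 assumes f: "(\<lambda>(x, w). f x w) \<in> borel_measurable (N \<Otimes>\<^sub>M path_space)" and a: "integrable K a"
 shows "(\<lambda>(x, w). jump_op c K a (f x) w) \<in> borel_measurable (N \<Otimes>\<^sub>M path_space)"
proof -
 have g1: "(\<lambda>p. ((fst (fst p), snd p), snd (fst p))) \<in> measurable ((N \<Otimes>\<^sub>M path_space) \<Otimes>\<^sub>M K) ((N \<Otimes>\<^sub>M K) \<Otimes>\<^sub>M path_space)"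
  by measurable
 have "(\<lambda>(x, w). f (fst x) w) \<in> borel_measurable ((N \<Otimes>\<^sub>M K) \<Otimes>\<^sub>M path_space)"
  using measurable_compose[OF _ f, of "\<lambda>p. (fst (fst p), snd p)" "(N \<Otimes>\<^sub>M K) \<Otimes>\<^sub>M path_space"] by (simp add: case_prod_beta')
 then have g2: "(\<lambda>(x, w). shift_diff c (snd x) (f (fst x)) w) \<in> borel_measurable ((N \<Otimes>\<^sub>M K) \<Otimes>\<^sub>M path_space)"
  by (rule measurable_shift_diff) (rule measurable_compose[OF measurable_snd measurable_jump_id])
 have [measurable]: "(\<lambda>p. shift_diff c (snd p) (f (fst (fst p))) (snd (fst p))) \<in> borel_measurable ((N \<Otimes>\<^sub>M path_space) \<Otimes>\<^sub>M K)"
  using measurable_compose[OF g1 g2] by simp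
 note [measurable] = borel_measurable_integrable[OF a]
 show ?thesis unfolding jump_op_def case_prod_beta'
  by (rule borel_measurable_lebesgue_integral) (simp add: case_prod_beta')
qed

lemma bounded_op_jump_op:
 assumes a: "integrable K a"
 shows "bounded_op path_space ((1 + \<bar>c\<bar>) * (LINT z|K. \<bar>a z\<bar>)) (jump_op c K a)"
 unfolding bounded_op_def
proof (intro conjI ballI allI impI)
 show "0 \<le> (1 + \<bar>c\<bar>) * (LINT z|K. \<bar>a z\<bar>)" by simp
next
 fix f g :: "(real => 'a) => real" and x y and w :: "real => 'a" assume f: "f \<in> bmf path_space" and g: "g \<in> bmf path_space" and w: "w \<in> space path_space"
 have "(\<lambda>z. a z * shift_diff c z (\<lambda>w. x * f w + y * g w) w) = (\<lambda>z. x * (a z * shift_diff c z f w) + y * (a z * shift_diff c z g w))"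
  by (auto simp: shift_diff_def algebra_simps)
 then show "jump_op c K a (\<lambda>w. x * f w + y * g w) w = x * jump_op c K a f w + y * jump_op c K a g w"
  using shift_diff_integrable[OF f a] shift_diff_integrable[OF g a] w by (simp add: jump_op_def space_path_space)
next
 have le: "\<bar>jump_op c K a f w\<bar> \<le> (1 + \<bar>c\<bar>) * (LINT z|K. \<bar>a z\<bar>) * C"
  if f: "f \<in> bmf path_space" and C: "\<forall>w\<in>space path_space. \<bar>f w\<bar> \<le> C" and w: "w \<in> space path_space" for f :: "(real => 'a) => real" and C w
 proof -
  have "\<bar>jump_op c K a f w\<bar> \<le> (LINT z|K. \<bar>a z * shift_diff c z f w\<bar>)"
   unfolding jump_op_def by (rule integral_abs_bound)
  also have "\<dots> \<le> (LINT z|K. \<bar>a z\<bar> * ((1 + \<bar>c\<bar>) * C))"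
   using shift_diffs_le[of f C w c 1 "\<lambda>_. z" for z] C w integrable_abs[OF shift_diff_integrable[OF f a, of w c]] a
   by (intro integral_mono) (auto simp: space_path_space abs_mult intro!: mult_left_mono integrable_mult_left)
  finally show ?thesis by (simp add: mult_ac)
 qed
 then show "f \<in> bmf path_space ==> \<forall>w\<in>space path_space. \<bar>f w\<bar> \<le> C ==> w \<in> space path_space ==>
  \<bar>jump_op c K a f w\<bar> \<le> (1 + \<bar>c\<bar>) * (LINT z|K. \<bar>a z\<bar>) * C" for f :: "(real => 'a) => real" and C w .
 fix f assume f: "f \<in> (bmf path_space :: ((real => 'a) => real) set)"
 then obtain C where C: "\<forall>w\<in>space path_space. \<bar>f w\<bar> \<le> C" by (metis bmfE)
 have "(\<lambda>w. (\<lambda>(x, w). jump_op c K a f w) ((), w)) \<in> borel_measurable path_space"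
  by (rule measurable_compose[OF _ measurable_jump_op[OF measurable_const_fun_path[OF bmf_measurable[OF f]] a, where N = "count_space (UNIV :: unit set)"]]) simp
 then show "jump_op c K a f \<in> bmf path_space" using le[OF f C] by (intro bmfI) auto
qed

text \<open>Translations by jumps commute, hence so do the pointwise difference operators; Fubini
  interchanges the two integrals, the integrand being dominated by a constant times the product of
  two integrable functions.\<close>

lemma commuting_jump_op:
 assumes a: "integrable K a" and b: "integrable K b"
 shows "commuting_ops path_space (jump_op c K a) (jump_op d K b)"
 unfolding commuting_ops_def
proof (intro ballI)
 fix f :: "(real => 'a) => real" and w :: "real => 'a" assume f: "f \<in> bmf path_space" and w: "w \<in> space path_space"
 interpret P: pair_sigma_finite K K ..
 obtain C where C0: "0 \<le> C" and C: "\<And>w. w \<in> cadlag ==> \<bar>f w\<bar> \<le> C" using f by (metis bmfE space_path_space)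
 note [measurable] = borel_measurable_integrable[OF a] borel_measurable_integrable[OF b]
 let ?g = "\<lambda>z y. a z * (b y * shift_diff c z (shift_diff d y f) w)"
 have le1: "\<bar>shift_diff d y f w\<bar> \<le> (1 + \<bar>d\<bar>) * C" if "w \<in> cadlag" for y w
  using shift_diffs_le[of f C w d 1 "\<lambda>_. y"] C that by simp
 have le: "\<bar>shift_diff c z (shift_diff d y f) w\<bar> \<le> (1 + \<bar>c\<bar>) * ((1 + \<bar>d\<bar>) * C)" for z y
  using shift_diffs_le[of "shift_diff d y f" "(1 + \<bar>d\<bar>) * C" w c 1 "\<lambda>_. z"] le1 w by (simp add: space_path_space)
 have "(\<lambda>(x, w). shift_diff d (snd x) f w) \<in> borel_measurable ((K \<Otimes>\<^sub>M K) \<Otimes>\<^sub>M path_space)"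
  by (rule measurable_shift_diff[OF measurable_const_fun_path[OF bmf_measurable[OF f]] measurable_compose[OF measurable_snd measurable_jump_id]])
 then have *: "(\<lambda>(x, w). shift_diff c (fst x) (shift_diff d (snd x) f) w) \<in> borel_measurable ((K \<Otimes>\<^sub>M K) \<Otimes>\<^sub>M path_space)"
  by (rule measurable_shift_diff[OF _ measurable_compose[OF measurable_fst measurable_jump_id]])
 have [measurable]: "(\<lambda>x. shift_diff c (fst x) (shift_diff d (snd x) f) w) \<in> borel_measurable (K \<Otimes>\<^sub>M K)"
  using measurable_compose[OF _ *, of "\<lambda>x. (x, w)"] w by simp
 have "integrable (K \<Otimes>\<^sub>M K) (\<lambda>x. (a (fst x) * b (snd x)) * ((1 + \<bar>c\<bar>) * ((1 + \<bar>d\<bar>) * C)))"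
  by (intro integrable_mult_left P.Fubini_integrable) (use a b in \<open>auto simp: abs_mult\<close>)
 then have i: "integrable (K \<Otimes>\<^sub>M K) (\<lambda>(z, y). ?g z y)"
  by (rule integrable_le)
   (use le C0 in \<open>simp_all add: abs_mult case_prod_beta' mult.assoc mult_left_mono\<close>)
 have 1: "jump_op c K a (jump_op d K b f) w = (\<integral>z. \<integral>y. ?g z y \<partial>K \<partial>K)"
  unfolding jump_op_def[of c]
 proof (intro lint_cong refl)
  fix z
  have "integrable K (\<lambda>y. b y * shift_diff d y f v)" if "v \<in> cadlag" for v
   by (rule shift_diff_integrable[OF f b that])
  then have "shift_diff c z (jump_op d K b f) w = (LINT y|K. b y * shift_diff d y f (add_jump z w) - c * (b y * shift_diff d y f w))"
   using w add_jump_cadlag[of w z] unfolding shift_diff_def[of c] jump_op_def by (simp add: space_path_space)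
  also have "\<dots> = (LINT y|K. b y * shift_diff c z (shift_diff d y f) w)"
   by (intro lint_cong refl) (simp add: shift_diff_def algebra_simps)
  finally show "a z * shift_diff c z (jump_op d K b f) w = (LINT y|K. ?g z y)" by simp
 qed
 have 2: "jump_op d K b (jump_op c K a f) w = (\<integral>y. \<integral>z. ?g z y \<partial>K \<partial>K)"
  unfolding jump_op_def[of d]
 proof (intro lint_cong refl)
  fix y
  have "integrable K (\<lambda>z. a z * shift_diff c z f v)" if "v \<in> cadlag" for v
   by (rule shift_diff_integrable[OF f a that])
  then have "shift_diff d y (jump_op c K a f) w = (LINT z|K. a z * shift_diff c z f (add_jump y w) - d * (a z * shift_diff c z f w))"
   using w add_jump_cadlag[of w y] unfolding shift_diff_def[of d] jump_op_def by (simp add: space_path_space)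
  also have "\<dots> = (LINT z|K. a z * shift_diff d y (shift_diff c z f) w)"
   by (intro lint_cong refl) (simp add: shift_diff_def algebra_simps)
  finally show "b y * shift_diff d y (jump_op c K a f) w = (LINT z|K. ?g z y)"
   by (simp add: shift_diff_commute[of d y] mult_ac integral_mult_right_zero[symmetric] del: integral_mult_right_zero)
 qed
 show "jump_op c K a (jump_op d K b f) w = jump_op d K b (jump_op c K a f) w"
  unfolding 1 2 using P.Fubini_integral[OF i] by simp
qed

lemma jump_op_add:
 assumes "f \<in> bmf path_space" "integrable K a" "integrable K b" "w \<in> cadlag"
 shows "jump_op c K (\<lambda>z. a z + b z) f w = jump_op c K a f w + jump_op c K b f w"
 using shift_diff_integrable[OF assms(1,2,4)] shift_diff_integrable[OF assms(1,3,4)]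
 by (simp add: jump_op_def distrib_right)

lemma opexp_jump_op_add:
 assumes f: "f \<in> bmf path_space" and a: "integrable K a" and b: "integrable K b" and w: "w \<in> cadlag"
 shows "opexp (jump_op c K (\<lambda>z. a z + b z)) f w = opexp (jump_op c K a) (opexp (jump_op c K b) f) w"
proof -
 note A = bounded_op_jump_op[OF a, of c] and B = bounded_op_jump_op[OF b, of c]
 have "opexp (jump_op c K (\<lambda>z. a z + b z)) f w = opexp (\<lambda>f w. jump_op c K a f w + jump_op c K b f w) f w"
  using bounded_op_lincomb[OF A B, of 1 1] w
  by (intro opexp_cong[OF bounded_op_jump_op _ _ f]) (auto simp: a b jump_op_add space_path_space)
 also have "\<dots> = opexp (jump_op c K a) (opexp (jump_op c K b) f) w"
  using w by (intro opexp_add[OF A B commuting_jump_op[OF a b] f]) (simp add: space_path_space)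
 finally show ?thesis .
qed

text \<open>\<open>jump_op 1\<close> is the pure shift part minus multiplication by the total
  integral of a, and the two commute. For a \<ge> 0 the right-hand side is the expectation of f
  after adding the points of a Poisson process with intensity a; the first factor is the probability
  of no point.\<close>

lemma opexp_jump_op_eq_shift:
 assumes f: "f \<in> bmf path_space" and a: "integrable K a" and w: "w \<in> cadlag"
 shows "opexp (jump_op 1 K a) f w = exp (- (LINT z|K. a z)) * opexp (jump_op 0 K a) f w"
proof -
 let ?m = "\<integral>z. a z \<partial>K"
 have B: "bounded_op path_space (\<bar>- ?m\<bar> * 1) (\<lambda>(f :: (real => 'a) => real) w. (- ?m) * f w)"
  using bounded_op_lincomb[OF bounded_op_id bounded_op_id, of path_space "- ?m" 0] by simp
 note A = bounded_op_jump_op[OF a]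
 have eq: "jump_op 1 K a g v = (- ?m) * g v + jump_op 0 K a g v" if "g \<in> bmf path_space" "v \<in> space path_space" for g v
 proof -
  have "jump_op 1 K a g v = (LINT z|K. a z * shift_diff 0 z g v - a z * g v)"
   unfolding jump_op_def by (simp add: shift_diff_def algebra_simps)
  also have "\<dots> = jump_op 0 K a g v - ?m * g v"
   using shift_diff_integrable[OF that(1) a, of v 0] that(2) a by (simp add: jump_op_def space_path_space)
  finally show ?thesis by simp
 qed
 have com: "commuting_ops path_space (\<lambda>(f :: (real => 'a) => real) w. (- ?m) * f w) (jump_op 0 K a)"
  unfolding commuting_ops_def using bounded_op_cmult[OF A[of 0], where a = "- ?m"] by simp
 have B2: "bounded_op path_space (\<bar>1\<bar> * (\<bar>- ?m\<bar> * 1) + \<bar>1\<bar> * ((1 + \<bar>0\<bar>) * (LINT z|K. \<bar>a z\<bar>))) (\<lambda>f w. (- ?m) * f w + jump_op 0 K a f w)"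
  using bounded_op_lincomb[OF B A[of 0], of 1 1] by (simp only: mult_1)
 have "opexp (jump_op 1 K a) f w = opexp (\<lambda>f w. (- ?m) * f w + jump_op 0 K a f w) f w"
  by (rule opexp_cong[OF A B2 _ f]) (use eq w in \<open>auto simp: space_path_space\<close>)
 also have "\<dots> = opexp (\<lambda>f w. (- ?m) * f w) (opexp (jump_op 0 K a) f) w"
  by (rule opexp_add[OF B A com f]) (use w in \<open>simp add: space_path_space\<close>)
 finally show ?thesis by (simp only: opexp_const)
qed

lemma product_sigma_finite_jump: "product_sigma_finite (\<lambda>_::nat. K)"
 by (simp add: product_sigma_finite_def sigma_finite_measure_axioms)

lemma measurable_prod_PiM: "a \<in> borel_measurable K ==> (\<lambda>z. \<Prod>i<n. a (z i) :: real) \<in> borel_measurable (PiN n K)"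
 by (intro borel_measurable_prod) (auto intro: measurable_compose[OF measurable_component_singleton[where M = "\<lambda>_. K"]])

lemma measurable_shift_diffs_PiM:
 assumes f: "f \<in> borel_measurable path_space"
 shows "(\<lambda>(z, w). shift_diffs c n z f w) \<in> borel_measurable (PiN n K \<Otimes>\<^sub>M path_space)"
 by (rule measurable_shift_diffs[OF measurable_const_fun_path[OF f]])
  (auto intro: measurable_compose[OF measurable_component_singleton[where M = "\<lambda>_. K"] measurable_jump_id])

lemma integrable_shift_diffs:
 assumes f: "f \<in> bmf path_space" and a: "integrable K a" and w: "w \<in> cadlag"
 shows "integrable (PiN n K) (\<lambda>z. (\<Prod>i<n. a (z i)) * shift_diffs c n z f w)"
proof -
 interpret P: product_sigma_finite "\<lambda>_::nat. K" by (rule product_sigma_finite_jump)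
 obtain C where C0: "0 \<le> C" and C: "\<And>w. w \<in> cadlag ==> \<bar>f w\<bar> \<le> C" using f by (metis bmfE space_path_space)
 have [measurable]: "(\<lambda>z. shift_diffs c n z f w) \<in> borel_measurable (PiN n K)"
  using measurable_compose[OF _ measurable_shift_diffs_PiM[OF bmf_measurable[OF f]], of "\<lambda>z. (z, w)"] w
  by (simp add: space_path_space)
 have [measurable]: "(\<lambda>z. \<Prod>i<n. a (z i)) \<in> borel_measurable (PiN n K)"
  using a by (intro measurable_prod_PiM) auto
 have "integrable (PiN n K) (\<lambda>z. (\<Prod>i<n. a (z i)) * ((1 + \<bar>c\<bar>) ^ n * C))"
  by (intro integrable_mult_left P.product_integrable_prod a) auto
 then show ?thesis
  by (rule integrable_le)
   (use shift_diffs_le[OF C w, where c = c and n = n] C0 in \<open>simp_all add: abs_mult mult_left_mono\<close>)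
qed

text \<open>Iterated differences evaluate the function at finitely many shifted paths, and the bound
  on g, uniform in y and in the path, makes the integral exist at each of them.\<close>

lemma shift_diffs_integral:
 fixes g :: "real \<times> 'a => (real => 'a) => real"
 assumes g: "(\<lambda>(y, w). g y w) \<in> borel_measurable (K \<Otimes>\<^sub>M path_space)" and C: "\<And>y w. w \<in> cadlag ==> \<bar>g y w\<bar> \<le> C"
  and a: "integrable K a" and w: "w \<in> cadlag"
 shows "shift_diffs c n z (\<lambda>w. \<integral>y. a y * g y w \<partial>K) w = (LINT y|K. a y * shift_diffs c n z (g y) w)"
 using g C
proof (induction n arbitrary: g C)
 case (Suc n)
 have int: "integrable K (\<lambda>y. a y * g y v)" if v: "v \<in> cadlag" for v
 proof -
  have [measurable]: "(\<lambda>y. g y v) \<in> borel_measurable K"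
   using measurable_compose[OF _ Suc.prems(1), of "\<lambda>z. (z, v)"] v by (simp add: space_path_space)
  show ?thesis
   by (rule integrable_le[OF integrable_mult_left[OF integrable_abs[OF a], of C]])
    (use a Suc.prems(2)[OF v] in \<open>auto simp: abs_mult intro!: mult_mono order_trans[OF Suc.prems(2)[OF v]]\<close>)
 qed
 have "shift_diffs c (Suc n) z (\<lambda>w. \<integral>y. a y * g y w \<partial>K) w = shift_diffs c n z (\<lambda>w. \<integral>y. a y * shift_diff c (z n) (g y) w \<partial>K) w"
  unfolding shift_diffs.simps
 proof (rule shift_diffs_cong_cadlag[OF _ w])
  fix v :: "real => 'a" assume v: "v \<in> cadlag"
  have "shift_diff c (z n) (\<lambda>w. \<integral>y. a y * g y w \<partial>K) v = (LINT y|K. a y * g y (add_jump (z n) v) - c * (a y * g y v))"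
   using int[OF v] int[OF add_jump_cadlag[OF v]] by (simp add: shift_diff_def)
  then show "shift_diff c (z n) (\<lambda>w. \<integral>y. a y * g y w \<partial>K) v = (LINT y|K. a y * shift_diff c (z n) (g y) v)"
   by (simp add: shift_diff_def algebra_simps)
 qed simp
 also have "\<dots> = (LINT y|K. a y * shift_diffs c n z (shift_diff c (z n) (g y)) w)"
 proof (rule Suc.IH)
  show "(\<lambda>(y, w). shift_diff c (z n) (g y) w) \<in> borel_measurable (K \<Otimes>\<^sub>M path_space)"
   by (rule measurable_shift_diff[OF Suc.prems(1)]) (simp add: space_pair_measure)
  show "v \<in> cadlag ==> \<bar>shift_diff c (z n) (g y) v\<bar> \<le> (1 + \<bar>c\<bar>) * C" for y v
   using shift_diffs_le[of "g y" C v c 1 "\<lambda>_. z n"] Suc.prems(2) by simp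
 qed
 finally show ?case by simp
qed simp

text \<open>Each application of the operator contributes one integration variable; the new one
  becomes coordinate n, which acts innermost, and Fubini joins it to the others.\<close>

lemma funpow_jump_op:
 assumes f: "f \<in> bmf path_space" and a: "integrable K a" and w: "w \<in> cadlag"
 shows "(jump_op c K a ^^ n) f w = (LINT z|PiN n K. (\<Prod>i<n. a (z i)) * shift_diffs c n z f w)"
 using f
proof (induction n arbitrary: f)
 case 0
 then show ?case by (simp add: PiM_empty lebesgue_integral_count_space_finite)
next
 case (Suc n)
 interpret P: product_sigma_finite "\<lambda>_::nat. K" by (rule product_sigma_finite_jump)
 obtain C where C: "\<And>w. w \<in> cadlag ==> \<bar>f w\<bar> \<le> C" using Suc.prems by (metis bmfE space_path_space)
 have "(jump_op c K a ^^ Suc n) f w = (jump_op c K a ^^ n) (jump_op c K a f) w"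
  by (simp only: funpow_Suc_right comp_def)
 also have "\<dots> = (LINT z|PiN n K. (\<Prod>i<n. a (z i)) * shift_diffs c n z (jump_op c K a f) w)"
  by (rule Suc.IH) (rule bounded_op_bmf[OF bounded_op_jump_op[OF a] Suc.prems])
 also have "\<dots> = (LINT z|PiN n K. (LINT y|K. (\<Prod>i<n. a (z i)) * (a y * shift_diffs c n z (shift_diff c y f) w)))"
 proof (intro lint_cong refl)
  fix z
  have "shift_diffs c n z (jump_op c K a f) w = (LINT y|K. a y * shift_diffs c n z (shift_diff c y f) w)"
   unfolding jump_op_def[abs_def]
  proof (rule shift_diffs_integral[OF _ _ a w])
   show "(\<lambda>(y, w). shift_diff c y f w) \<in> borel_measurable (K \<Otimes>\<^sub>M path_space)"
    by (rule measurable_shift_diff[OF measurable_const_fun_path[OF bmf_measurable[OF Suc.prems]] measurable_jump_id])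
   show "v \<in> cadlag ==> \<bar>shift_diff c y f v\<bar> \<le> (1 + \<bar>c\<bar>) * C" for y v
    using shift_diffs_le[of f C v c 1 "\<lambda>_. y"] C by simp
  qed
  then show "(\<Prod>i<n. a (z i)) * shift_diffs c n z (jump_op c K a f) w = (LINT y|K. (\<Prod>i<n. a (z i)) * (a y * shift_diffs c n z (shift_diff c y f) w))"
   by simp
 qed
 also have "\<dots> = (LINT z|Pi\<^sub>M (insert n {..<n}) (\<lambda>_. K). (\<Prod>i<Suc n. a (z i)) * shift_diffs c (Suc n) z f w)"
 proof (subst P.product_integral_insert)
  show "integrable (Pi\<^sub>M (insert n {..<n}) (\<lambda>_. K)) (\<lambda>z. (\<Prod>i<Suc n. a (z i)) * shift_diffs c (Suc n) z f w)"
   using integrable_shift_diffs[OF Suc.prems a w, of "Suc n" c] by (simp only: lessThan_Suc)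
  \<comment> \<open>Coordinate n is read neither by \<open>shift_diffs c n\<close> nor by the
    product over \<open>{..<n}\<close>, so the update is invisible to both.\<close>
  have "shift_diffs c n (z(n := y)) (shift_diff c y f) w = shift_diffs c n z (shift_diff c y f) w" for z y
   by (rule shift_diffs_cong_cadlag) (use w in auto)
  moreover have "(\<Prod>i<n. a ((z(n := y)) i)) = (\<Prod>i<n. a (z i))" for z y
   by (intro prod.cong) auto
  ultimately show "(LINT z|PiN n K. (LINT y|K. (\<Prod>i<n. a (z i)) * (a y * shift_diffs c n z (shift_diff c y f) w))) =
   (\<integral>x. \<integral>y. (\<Prod>i<Suc n. a ((x(n := y)) i)) * shift_diffs c (Suc n) (x(n := y)) f w \<partial>K \<partial>PiN n K)"
   by (simp add: mult.assoc del: fun_upd_apply) simp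
 qed auto
 finally show ?case by (simp only: lessThan_Suc)
qed

text \<open>In complex notation characters are eigenfunctions: on functions of the form
  \<open>Re (\<zeta> * cis S)\<close> the operator multiplies \<zeta> by \<open>kap\<close>, and its
  exponential multiplies \<zeta> by \<open>exp kap\<close>.\<close>

lemma jump_op_trig:
 fixes u :: "real => 'a"
 assumes a: "integrable K a" and F: "finite F" "F \<subseteq> {0..}"
 defines "kap \<equiv> (LINT p|K. a p *\<^sub>R (cis (phase u F p) - 1))"
 shows "opexp (jump_op 1 K a) (trig u F c) w = Re (exp kap * cis ((\<Sum>t\<in>F. u t \<bullet> w t) + c))"
proof -
 let ?S = "\<lambda>w. (\<Sum>t\<in>F. u t \<bullet> w t) + c"
 let ?U = "\<lambda>p. phase u F p"
 define G where "G \<zeta> w = Re (\<zeta> * cis (?S w))" for \<zeta> w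
 have S: "?S (add_jump p w) = ?S w + ?U p" for p w
 proof -
  have "(\<Sum>t\<in>F. u t \<bullet> add_jump p w t) = (\<Sum>t\<in>F. u t \<bullet> w t + (if fst p \<le> t then u t \<bullet> snd p else 0))"
   using F by (intro sum.cong) (auto simp: add_jump_def inner_add_right)
  also have "\<dots> = (\<Sum>t\<in>F. u t \<bullet> w t) + (\<Sum>t\<in>F. if fst p \<le> t then u t \<bullet> snd p else 0)" by (rule sum.distrib)
  also have "(\<Sum>t\<in>F. if fst p \<le> t then u t \<bullet> snd p else 0) = ?U p"
   using F(1) by (auto simp: sum.inter_filter inner_sum_left intro!: sum.cong)
  finally show ?thesis by simp
 qed
 have Um[measurable]: "(\<lambda>p. ?U p) \<in> borel_measurable K"
 proof -
  have eq: "?U p = (\<Sum>t\<in>F. if fst p \<le> t then u t \<bullet> snd p else 0)" for p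
   using F(1) by (auto simp: sum.inter_filter inner_sum_left intro!: sum.cong)
  have "(\<lambda>p. \<Sum>t\<in>F. if fst p \<le> t then u t \<bullet> snd p else 0) \<in> borel_measurable (borel \<Otimes>\<^sub>M borel)"
   by measurable
  from measurable_compose[OF measurable_jump_id this] show ?thesis by (simp only: eq)
 qed
 note [measurable] = borel_measurable_integrable[OF a]
 have cism[measurable]: "cis \<in> borel_measurable borel"
  by (intro borel_measurable_continuous_onI continuous_intros)
 have i: "integrable K (\<lambda>p. a p *\<^sub>R (cis (?U p) - 1))"
 proof (rule integrable_le[OF integrable_mult_left[OF a, of 2]])
  show "AE p in K. norm (a p *\<^sub>R (cis (?U p) - 1)) \<le> norm (a p * 2)"
   using norm_triangle_ineq4[of "cis x" 1 for x] by (auto simp: abs_mult intro!: mult_left_mono)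
 qed measurable
 have step: "jump_op 1 K a (G \<zeta>) w = G (\<zeta> * kap) w" for \<zeta> w
 proof -
  have "jump_op 1 K a (G \<zeta>) w = (LINT p|K. Re ((\<zeta> * cis (?S w)) * (a p *\<^sub>R (cis (?U p) - 1))))"
   unfolding jump_op_def shift_diff_def G_def S
   by (intro lint_cong refl) (simp add: cis_mult[symmetric] algebra_simps)
  also have "\<dots> = Re (LINT p|K. (\<zeta> * cis (?S w)) * (a p *\<^sub>R (cis (?U p) - 1)))"
   by (rule integral_Re) (rule integrable_mult_right[OF i])
  also have "\<dots> = Re ((\<zeta> * cis (?S w)) * kap)" by (simp only: kap_def integral_mult_right_zero)
  finally show ?thesis by (simp add: G_def mult_ac)
 qed
 have pow: "(jump_op 1 K a ^^ n) (G \<zeta>) = G (\<zeta> * kap ^ n)" for n \<zeta>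
  by (induction n) (auto simp: step[abs_def] mult_ac)
 have "trig u F c = G 1" by (simp add: fun_eq_iff G_def trig_def)
 then have "opexp (jump_op 1 K a) (trig u F c) w = (\<Sum>n. Re (kap ^ n /\<^sub>R fact n * cis (?S w)))"
  by (simp add: opexp_def pow G_def divide_inverse mult_ac)
 also have "(\<lambda>n. kap ^ n /\<^sub>R fact n * cis (?S w)) sums (exp kap * cis (?S w))"
  by (intro sums_mult2 exp_converges)
 then have "(\<Sum>n. Re (kap ^ n /\<^sub>R fact n * cis (?S w))) = Re (exp kap * cis (?S w))"
  using sums_Re sums_unique by metis
 finally show ?thesis .
qed

end

section \<open>Cauchy--Schwarz bounds for compound Poisson perturbations\<close>

text \<open>The right-hand side is smallest at t = sqrt (Y / X), with value sqrt (X Y); if X or Y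
  vanishes the infimum is approached as t tends to infinity or to 0. Bounds linear in X and Y can be
  summed and integrated before t is optimised, which is why Cauchy-Schwarz is used in this
  form.\<close>

lemma power2_le_mult_of_weighted_bound:
 fixes x X Y :: real
 assumes le: "\<And>t. 0 < t ==> \<bar>x\<bar> \<le> t / 2 * X + Y / (2 * t)" and X: "0 \<le> X" and Y: "0 \<le> Y"
 shows "x\<^sup>2 \<le> X * Y"
proof -
 consider "X = 0" | "Y = 0" | "0 < X" "0 < Y" using X Y by fastforce
 then show ?thesis
 proof cases
  case 1
  have "\<bar>x\<bar> \<le> 0"
  proof (rule LIMSEQ_le_const)
   show "(\<lambda>n. Y / 2 / real (Suc n)) \<longlonglongrightarrow> 0" using LIMSEQ_Suc[OF lim_const_over_n[of "Y / 2"]] .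
   show "\<exists>N. \<forall>n\<ge>N. \<bar>x\<bar> \<le> Y / 2 / real (Suc n)" using le[of "real (Suc n)" for n] 1 by (auto simp: field_simps)
  qed
  then show ?thesis using X Y by simp
 next
  case 2
  have "\<bar>x\<bar> \<le> 0"
  proof (rule LIMSEQ_le_const)
   show "(\<lambda>n. X / 2 / real (Suc n)) \<longlonglongrightarrow> 0" using LIMSEQ_Suc[OF lim_const_over_n[of "X / 2"]] .
   show "\<exists>N. \<forall>n\<ge>N. \<bar>x\<bar> \<le> X / 2 / real (Suc n)" using le[of "1 / real (Suc n)" for n] 2 by (auto simp: field_simps)
  qed
  then show ?thesis using X Y by simp
 next
  case 3
  define r where "r = sqrt X" define s where "s = sqrt Y"
  have rs: "0 < r" "0 < s" "X = r\<^sup>2" "Y = s\<^sup>2" using 3 by (auto simp: r_def s_def)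
  have "\<bar>x\<bar> \<le> r * s" using le[of "s / r"] rs by (simp add: field_simps power2_eq_square)
  then have "\<bar>x\<bar>\<^sup>2 \<le> (r * s)\<^sup>2" by (rule power_mono) simp
  then show ?thesis using rs by (simp add: power_mult_distrib)
 qed
qed

lemma weighted_AM_GM: "0 < t ==> \<bar>x * y\<bar> \<le> t / 2 * x\<^sup>2 + y\<^sup>2 / (2 * t :: real)"
 using zero_le_power2[of "t * \<bar>x\<bar> - \<bar>y\<bar>"]
 by (simp add: power2_eq_square field_simps abs_mult) (simp add: algebra_simps flip: abs_mult)?

lemma integral_Cauchy_Schwarz:
 fixes f g :: "'x => real"
 assumes [measurable]: "f \<in> borel_measurable M" "g \<in> borel_measurable M"
  and f2: "integrable M (\<lambda>x. (f x)\<^sup>2)" and g2: "integrable M (\<lambda>x. (g x)\<^sup>2)"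
 shows "(LINT x|M. f x * g x)\<^sup>2 \<le> (LINT x|M. (f x)\<^sup>2) * (LINT x|M. (g x)\<^sup>2)"
  and integrable_mult_square: "integrable M (\<lambda>x. f x * g x)"
proof -
 have b: "\<bar>f x * g x\<bar> \<le> t / 2 * (f x)\<^sup>2 + (g x)\<^sup>2 / (2 * t)" if "0 < t" for t x
  using weighted_AM_GM[OF that] .
 have i: "integrable M (\<lambda>x. t / 2 * (f x)\<^sup>2 + (g x)\<^sup>2 / (2 * t))" for t using f2 g2 by simp
 show fg: "integrable M (\<lambda>x. f x * g x)"
  by (rule integrable_le[OF i[of 1]]) (use b[of 1] in auto)
 show "(LINT x|M. f x * g x)\<^sup>2 \<le> (LINT x|M. (f x)\<^sup>2) * (LINT x|M. (g x)\<^sup>2)"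
 proof (rule power2_le_mult_of_weighted_bound)
  fix t :: real assume t: "0 < t"
  have "\<bar>\<integral>x. f x * g x \<partial>M\<bar> \<le> (LINT x|M. \<bar>f x * g x\<bar>)" by (rule integral_abs_bound)
  also have "\<dots> \<le> (LINT x|M. t / 2 * (f x)\<^sup>2 + (g x)\<^sup>2 / (2 * t))"
   using b[OF t] i fg by (intro integral_mono) auto
  finally show "\<bar>\<integral>x. f x * g x \<partial>M\<bar> \<le> t / 2 * (LINT x|M. (f x)\<^sup>2) + (LINT x|M. (g x)\<^sup>2) / (2 * t)"
   using f2 g2 by simp
 qed auto
qed

lemma has_derivative_powser_0:
 fixes c :: "nat => real"
 assumes "\<And>x. summable (\<lambda>n. c n * x ^ n)"
 shows "((\<lambda>x. \<Sum>n. c n * x ^ n) has_real_derivative c 1) (at 0)"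
 using termdiffs_strong_converges_everywhere[OF assms, of 0] by (simp add: powser_zero diffs_def)

text \<open>A pure shift is multiplicative, so it commutes with squaring.\<close>

lemma shift_diffs_0_power2:
 fixes f :: "(real => 'a::monoid_add) => real"
 shows "shift_diffs 0 n z (\<lambda>w. (f w)\<^sup>2) w = (shift_diffs 0 n z f w)\<^sup>2"
proof (induction n arbitrary: f)
 case (Suc n)
 have "shift_diff 0 (z n) (\<lambda>w. (f w)\<^sup>2) = (\<lambda>w. (shift_diff 0 (z n) f w)\<^sup>2)" by (rule ext) (simp add: shift_diff_def)
 then show ?case using Suc by simp
qed simp

lemma exp_series_sums: "(\<lambda>n. x ^ n / fact n) sums exp (x :: real)"
 using exp_converges[of x] by (simp add: scaleR_conv_of_real field_simps)

context jump_measure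
begin

text \<open>Expansion by the number of points: for a \<ge> 0 the n-th term is the contribution of
  the configurations with exactly n added jumps.\<close>

lemma opexp_jump_op_series:
 assumes f: "f \<in> bmf path_space" and a: "integrable K a" and w: "w \<in> cadlag"
 shows "(\<lambda>n. (LINT z|PiN n K. exp (- (LINT z|K. a z)) * (\<Prod>i<n. a (z i)) * shift_diffs 0 n z f w) / fact n)
    sums opexp (jump_op 1 K a) f w"
proof -
 have "(\<lambda>n. (jump_op 0 K a ^^ n) f w / fact n) sums opexp (jump_op 0 K a) f w"
  unfolding opexp_def using summable_opexp[OF bounded_op_jump_op[OF a] f] w
  by (intro summable_sums) (simp add: space_path_space)
 from sums_mult[OF this, of "exp (- (LINT z|K. a z))"] show ?thesis
  unfolding opexp_jump_op_eq_shift[OF f a w] funpow_jump_op[OF f a w]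
  by (simp add: mult.assoc)
qed

text \<open>All three exponentials are integrals over the space of finite configurations, and their
  weights differ from those of intensity K by a likelihood ratio. Cauchy-Schwarz against the weights
  of intensity K leaves f^2 on one side and the squared distance of the two ratios on the other;
  this distance is the second factor, because the inner product of the ratios for a and b is the
  exponential of the integral of (a - 1)(b - 1).\<close>

lemma opexp_cauchy_schwarz:
 assumes fin: "finite_measure K" and [measurable]: "a \<in> borel_measurable K" "b \<in> borel_measurable K"
  and a2: "integrable K (\<lambda>z. (a z)\<^sup>2)" and b2: "integrable K (\<lambda>z. (b z)\<^sup>2)"
  and f: "f \<in> bmf path_space" and w: "w \<in> cadlag"
 shows "(opexp (jump_op 1 K a) f w - opexp (jump_op 1 K b) f w)\<^sup>2 \<le> opexp (jump_op 1 K (\<lambda>_. 1)) (\<lambda>w. (f w)\<^sup>2) w *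
  (exp (LINT z|K. (a z - 1)\<^sup>2) - 2 * exp (LINT z|K. (a z - 1) * (b z - 1)) + exp (LINT z|K. (b z - 1)\<^sup>2))"
  (is "_ \<le> ?X * ?V")
proof -
 interpret finite_measure K by fact
 interpret P: product_sigma_finite "\<lambda>_::nat. K" by (rule product_sigma_finite_jump)
 have a: "integrable K a" and b: "integrable K b" using a2 b2 by (auto intro: square_integrable_imp_integrable)
 have ab: "integrable K (\<lambda>z. a z * b z)" by (rule integrable_mult_square[OF _ _ a2 b2]) auto
 have one: "integrable K (\<lambda>_. 1 :: real)" by simp
 define m where "m = (LINT z|K. (1 :: real))"
 define ia where "ia = (LINT z|K. a z)"
 define ib where "ib = (LINT z|K. b z)"
 \<comment> \<open>The weight of n points for intensity a, without the common factor 1 / n!.\<close>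
 define Ea where "Ea n z = exp (- ia) * (\<Prod>i<n. a (z i))" for n and z :: "nat => real \<times> 'a"
 define Eb where "Eb n z = exp (- ib) * (\<Prod>i<n. b (z i))" for n and z :: "nat => real \<times> 'a"
 define Q where "Q n = Pi\<^sub>M {..<n} (\<lambda>_::nat. K)" for n
 define F where "F n z = shift_diffs 0 n z f w" for n z
 have f2: "(\<lambda>w. (f w)\<^sup>2) \<in> bmf path_space" by (rule bmf_power2[OF f])
 have Sa: "(\<lambda>n. (LINT z|Q n. Ea n z * F n z) / fact n) sums opexp (jump_op 1 K a) f w"
  using opexp_jump_op_series[OF f a w] by (simp add: Ea_def F_def Q_def ia_def)
 have Sb: "(\<lambda>n. (LINT z|Q n. Eb n z * F n z) / fact n) sums opexp (jump_op 1 K b) f w"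
  using opexp_jump_op_series[OF f b w] by (simp add: Eb_def F_def Q_def ib_def)
 have SX: "(\<lambda>n. exp (- m) * (LINT z|Q n. (F n z)\<^sup>2) / fact n) sums ?X"
  using opexp_jump_op_series[OF f2 one w] by (simp add: F_def Q_def m_def shift_diffs_0_power2)
 have iF2: "integrable (Q n) (\<lambda>z. (F n z)\<^sup>2)" for n
  using integrable_shift_diffs[OF f2 one w, of n 0] by (simp add: Q_def F_def shift_diffs_0_power2)
 have iaF: "integrable (Q n) (\<lambda>z. Ea n z * F n z)" for n
  using integrable_shift_diffs[OF f a w, of n 0] by (simp add: Q_def F_def Ea_def mult.assoc)
 have ibF: "integrable (Q n) (\<lambda>z. Eb n z * F n z)" for n
  using integrable_shift_diffs[OF f b w, of n 0] by (simp add: Q_def F_def Eb_def mult.assoc)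
 have prod_int: "integrable (Q n) (\<lambda>z. c * (\<Prod>i<n. h (z i)))" "(LINT z|Q n. c * (\<Prod>i<n. h (z i))) = c * (LINT z|K. h z) ^ n"
  if "integrable K h" for h :: "real \<times> 'a => real" and c n
  unfolding Q_def using P.product_integrable_prod[of "{..<n}" "\<lambda>_. h"] P.product_integral_prod[of "{..<n}" "\<lambda>_. h"] that by auto
 have sq: "(Ea n z - Eb n z)\<^sup>2 = exp (- 2 * ia) * (\<Prod>i<n. (a (z i))\<^sup>2) + (- 2 * exp (- ia - ib)) * (\<Prod>i<n. a (z i) * b (z i))
   + exp (- 2 * ib) * (\<Prod>i<n. (b (z i))\<^sup>2)" for n z
 proof -
  have e: "exp (- 2 * ia) = exp (- ia) * exp (- ia)" "exp (- 2 * ib) = exp (- ib) * exp (- ib)"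
   "exp (- ia - ib) = exp (- ia) * exp (- ib)"
   by (simp_all add: exp_add[symmetric])
  show ?thesis unfolding Ea_def Eb_def e by (simp add: power2_eq_square prod.distrib algebra_simps)
 qed
 define p where "p n = exp (- 2 * ia) * (LINT z|K. (a z)\<^sup>2) ^ n + (- 2 * exp (- ia - ib)) * (LINT z|K. a z * b z) ^ n
   + exp (- 2 * ib) * (LINT z|K. (b z)\<^sup>2) ^ n" for n
 have iE2: "integrable (Q n) (\<lambda>z. (Ea n z - Eb n z)\<^sup>2)" and E2: "(LINT z|Q n. (Ea n z - Eb n z)\<^sup>2) = p n" for n
  unfolding sq p_def using prod_int(1)[OF a2] prod_int(1)[OF ab] prod_int(1)[OF b2]
  by (simp_all only: lint_add integrable_plus prod_int(2)[OF a2] prod_int(2)[OF ab] prod_int(2)[OF b2])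
 have "(\<lambda>n. exp (- 2 * ia) * ((LINT z|K. (a z)\<^sup>2) ^ n / fact n) + (- 2 * exp (- ia - ib)) * ((LINT z|K. a z * b z) ^ n / fact n)
   + exp (- 2 * ib) * ((LINT z|K. (b z)\<^sup>2) ^ n / fact n)) sums
   (exp (- 2 * ia) * exp (LINT z|K. (a z)\<^sup>2) + (- 2 * exp (- ia - ib)) * exp (LINT z|K. a z * b z)
   + exp (- 2 * ib) * exp (LINT z|K. (b z)\<^sup>2))"
  by (intro sums_add sums_mult exp_series_sums)
 \<comment> \<open>The factor \<open>exp m\<close> divides out the reference weight exp (- m). With
   it the exponents combine, the integral of (a - 1)(b - 1) being m - ia - ib plus the integral of a
   b.\<close>
 then have "(\<lambda>n. exp m * (p n / fact n)) sums (exp m * (exp (- 2 * ia) * exp (LINT z|K. (a z)\<^sup>2) + (- 2 * exp (- ia - ib)) * exp (LINT z|K. a z * b z)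
   + exp (- 2 * ib) * exp (LINT z|K. (b z)\<^sup>2)))"
  by (intro sums_mult) (simp add: p_def add_divide_distrib diff_divide_distrib mult.assoc)
 also have "exp m * (exp (- 2 * ia) * exp (LINT z|K. (a z)\<^sup>2) + (- 2 * exp (- ia - ib)) * exp (LINT z|K. a z * b z)
   + exp (- 2 * ib) * exp (LINT z|K. (b z)\<^sup>2)) = ?V"
 proof -
  have 1: "(LINT z|K. (h z - 1) * (k z - 1)) = m - (LINT z|K. h z) - (LINT z|K. k z) + (LINT z|K. h z * k z)"
   if "integrable K h" "integrable K k" "integrable K (\<lambda>z. h z * k z)" for h k :: "real \<times> 'a => real"
  proof -
   have "(\<lambda>z. (h z - 1) * (k z - 1)) = (\<lambda>z. 1 - h z - k z + h z * k z)" by (auto simp: algebra_simps)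
   then show ?thesis using that by (simp add: m_def)
  qed
  have 2: "(LINT z|K. (a z - 1)\<^sup>2) = m - 2 * ia + (LINT z|K. (a z)\<^sup>2)" "(LINT z|K. (b z - 1)\<^sup>2) = m - 2 * ib + (LINT z|K. (b z)\<^sup>2)"
   "(LINT z|K. (a z - 1) * (b z - 1)) = m - ia - ib + (LINT z|K. a z * b z)"
   using 1[OF a a] 1[OF b b] 1[OF a b] a2 b2 ab by (simp_all add: power2_eq_square ia_def ib_def)
  have 3: "exp (m - 2 * x + y) = exp m * (exp (- 2 * x) * exp y)" "exp (m - x - x' + y) = exp m * (exp (- x - x') * exp y)" for x x' y :: real
   unfolding exp_add[symmetric] by (simp_all add: algebra_simps)
  show ?thesis unfolding 2 3 by (simp add: distrib_left right_diff_distrib)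
 qed
 finally have SV: "(\<lambda>n. exp m * (p n / fact n)) sums ?V" .
 have p0: "0 \<le> p n" for n unfolding E2[symmetric] by simp
 have X0: "0 \<le> ?X" by (rule sums_le[OF _ sums_zero SX]) simp
 have V0: "0 \<le> ?V" by (rule sums_le[OF _ sums_zero SV]) (simp add: p0)
 show ?thesis
 proof (rule power2_le_mult_of_weighted_bound[OF _ X0 V0])
  fix t :: real assume t: "0 < t"
  define D where "D n = (LINT z|Q n. Ea n z * F n z) / fact n - (LINT z|Q n. Eb n z * F n z) / fact n" for n
  have SD: "D sums (opexp (jump_op 1 K a) f w - opexp (jump_op 1 K b) f w)"
   unfolding D_def using Sa Sb by (rule sums_diff)
  have R: "(\<lambda>n. t / 2 * (exp (- m) * (LINT z|Q n. (F n z)\<^sup>2) / fact n) + 1 / (2 * t) * (exp m * (p n / fact n))) sums (t / 2 * ?X + 1 / (2 * t) * ?V)"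
   by (intro sums_add sums_mult SX SV)
  have le: "\<bar>D n\<bar> \<le> t / 2 * (exp (- m) * (LINT z|Q n. (F n z)\<^sup>2) / fact n) + 1 / (2 * t) * (exp m * (p n / fact n))" for n
  proof -
   \<comment> \<open>With this choice the reference weight exp (- m) stands in front of the square
     of F and its inverse in front of \<open>p n\<close>, as required by the two series to be
     compared.\<close>
   define t' where "t' = t * exp (- m)"
   have t': "0 < t'" using t by (simp add: t'_def)
   have iD: "integrable (Q n) (\<lambda>z. F n z * (Ea n z - Eb n z))"
    using Bochner_Integration.integrable_diff[OF iaF ibF, of n] by (simp add: algebra_simps)
   have "(LINT z|Q n. Ea n z * F n z) - (LINT z|Q n. Eb n z * F n z) = (LINT z|Q n. F n z * (Ea n z - Eb n z))"
    using Bochner_Integration.integral_diff[OF iaF ibF, of n] by (simp add: algebra_simps)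
   then have "\<bar>D n\<bar> * fact n = \<bar>\<integral>z. F n z * (Ea n z - Eb n z) \<partial>Q n\<bar>"
    unfolding D_def by (simp add: diff_divide_distrib[symmetric] abs_divide)
   also have "\<dots> \<le> (LINT z|Q n. \<bar>F n z * (Ea n z - Eb n z)\<bar>)" by (rule integral_abs_bound)
   also have "\<dots> \<le> (LINT z|Q n. t' / 2 * (F n z)\<^sup>2 + (Ea n z - Eb n z)\<^sup>2 / (2 * t'))"
    using iD iF2 iE2 by (intro integral_mono weighted_AM_GM[OF t'] integrable_abs) auto
   also have "\<dots> = t' / 2 * (LINT z|Q n. (F n z)\<^sup>2) + p n / (2 * t')"
    using iF2 iE2 E2 by simp
   finally have "\<bar>D n\<bar> \<le> (t' / 2 * (LINT z|Q n. (F n z)\<^sup>2) + p n / (2 * t')) / fact n"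
    by (simp add: pos_le_divide_eq)
   also have "\<dots> = t / 2 * (exp (- m) * (LINT z|Q n. (F n z)\<^sup>2) / fact n) + 1 / (2 * t) * (exp m * (p n / fact n))"
   proof -
    have "p n / (2 * t') = 1 / (2 * t) * (exp m * p n)" using t by (simp add: t'_def exp_minus field_simps)
    then show ?thesis by (simp add: t'_def add_divide_distrib)
   qed
   finally show ?thesis .
  qed
  have sD: "summable (\<lambda>n. \<bar>D n\<bar>)"
   by (rule summable_comparison_test'[OF sums_summable[OF R]]) (use le in auto)
  have "\<bar>opexp (jump_op 1 K a) f w - opexp (jump_op 1 K b) f w\<bar> \<le> (\<Sum>n. \<bar>D n\<bar>)"
   using SD summable_rabs[OF sD] by (simp add: sums_iff)
  also have "\<dots> \<le> t / 2 * ?X + 1 / (2 * t) * ?V"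
   by (rule sums_le[OF le summable_sums[OF sD] R])
  finally show "\<bar>opexp (jump_op 1 K a) f w - opexp (jump_op 1 K b) f w\<bar> \<le> t / 2 * ?X + ?V / (2 * t)" by simp
 qed
qed

text \<open>The numerator is exp (2 e s) (exp (e^2 q) - 1) + (exp (e s) - 1)^2; both parts are
  governed by difference quotients of the exponential at 0.\<close>

lemma exp_second_difference_tendsto:
 "((\<lambda>e. (exp (2 * e * s + e\<^sup>2 * q) - 2 * exp (e * s) + 1) / e\<^sup>2) \<longlongrightarrow> q + s\<^sup>2) (at_right (0::real))"
proof -
 have d: "((\<lambda>h. (exp (h * s) - 1) / h) \<longlongrightarrow> s) (at 0)" for s :: real
 proof -
  have "((\<lambda>h. exp (h * s)) has_real_derivative s) (at 0)"
   by (auto intro!: derivative_eq_intros)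
  then show ?thesis by (simp add: DERIV_def)
 qed
 have e2: "filterlim (\<lambda>e::real. e\<^sup>2) (at 0) (at_right 0)"
  unfolding filterlim_at by (auto intro!: tendsto_eq_intros simp: eventually_at_filter)
 have 1: "((\<lambda>e. (exp (e\<^sup>2 * q) - 1) / e\<^sup>2) \<longlongrightarrow> q) (at_right 0)"
  by (rule filterlim_compose[OF d e2])
 have 2: "((\<lambda>e. (exp (e * s) - 1) / e) \<longlongrightarrow> s) (at_right 0)"
  using d[of s] by (rule tendsto_mono[rotated]) (simp add: at_le)
 have 3: "((\<lambda>e. exp (2 * e * s)) \<longlongrightarrow> exp (2 * 0 * s)) (at_right 0)"
  by (intro tendsto_intros)
 have "((\<lambda>e. exp (2 * e * s) * ((exp (e\<^sup>2 * q) - 1) / e\<^sup>2) + ((exp (e * s) - 1) / e)\<^sup>2) \<longlongrightarrow> exp (2 * 0 * s) * q + s\<^sup>2) (at_right 0)"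
  by (intro tendsto_intros 1 2 3)
 moreover have "\<forall>\<^sub>F e in at_right (0::real). exp (2 * e * s) * ((exp (e\<^sup>2 * q) - 1) / e\<^sup>2) + ((exp (e * s) - 1) / e)\<^sup>2
   = (exp (2 * e * s + e\<^sup>2 * q) - 2 * exp (e * s) + 1) / e\<^sup>2"
 proof (rule eventually_at_right_less[THEN eventually_mono])
  fix e :: real assume "0 < e"
  moreover have "exp (2 * e * s) = (exp (e * s))\<^sup>2" by (metis exp_double mult.assoc)
  ultimately show "exp (2 * e * s) * ((exp (e\<^sup>2 * q) - 1) / e\<^sup>2) + ((exp (e * s) - 1) / e)\<^sup>2
   = (exp (2 * e * s + e\<^sup>2 * q) - 2 * exp (e * s) + 1) / e\<^sup>2"
   by (simp add: exp_add power_divide field_simps power2_eq_square)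
 qed
 ultimately show ?thesis by (auto dest: tendsto_cong[THEN iffD1, rotated])
qed

text \<open>The derivative at \<open>0\<close> of the Cauchy--Schwarz bound along the segment from \<open>a\<close> in the direction of
 \<open>G\<close> itself.\<close>

lemma one_jump_square_bound:
 assumes fin: "finite_measure K" and [measurable]: "a \<in> borel_measurable K"
  and a2: "integrable K (\<lambda>z. (a z)\<^sup>2)" and f: "f \<in> bmf path_space" and w: "w \<in> cadlag"
 defines "G \<equiv> \<lambda>z. shift_diff 1 z (opexp (jump_op 1 K a) f) w" and "\<kappa> \<equiv> \<integral>z. (a z - 1)\<^sup>2 \<partial>K"
 shows "(LINT z|K. (G z)\<^sup>2) \<le> exp \<kappa> * (1 + \<kappa>) * opexp (jump_op 1 K (\<lambda>_. 1)) (\<lambda>w. (f w)\<^sup>2) w"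
proof -
 interpret finite_measure K by fact
 have a: "integrable K a" using a2 by (auto intro: square_integrable_imp_integrable)
 define F where "F = opexp (jump_op 1 K a) f"
 have F: "F \<in> bmf path_space" unfolding F_def by (rule bounded_op_bmf[OF bounded_op_opexp(1)[OF bounded_op_jump_op[OF a]] f])
 have G: "integrable K G"
  using shift_diff_integrable[OF F integrable_const w, of 1 1] by (simp add: G_def F_def)
 have [measurable]: "G \<in> borel_measurable K" using G by auto
 obtain C where C: "\<And>w. w \<in> cadlag ==> \<bar>F w\<bar> \<le> C" using F by (metis bmfE space_path_space)
 have "\<bar>G z\<bar> \<le> 2 * C" for z
  using shift_diffs_le[of F C w 1 1 "\<lambda>_. z"] C w by (simp add: G_def F_def)
 then have "\<bar>G z\<bar> \<le> \<bar>2 * C\<bar>" for z using order_trans[OF _ abs_ge_self] by blast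
 then have "(G z)\<^sup>2 \<le> (2 * C)\<^sup>2" for z by (simp only: abs_le_square_iff)
 then have G2: "integrable K (\<lambda>z. (G z)\<^sup>2)" by (intro integrable_const_bound[where B = "(2 * C)\<^sup>2"]) auto
 define X where "X = opexp (jump_op 1 K (\<lambda>_. 1)) (\<lambda>w. (f w)\<^sup>2) w"
 have u2: "integrable K (\<lambda>z. (a z - 1)\<^sup>2)" using a a2 by (simp add: power2_diff)
 define s where "s = (LINT z|K. (a z - 1) * G z)"
 define q where "q = (LINT z|K. (G z)\<^sup>2)"
 have uG: "integrable K (\<lambda>z. (a z - 1) * G z)" by (rule integrable_mult_square[OF _ _ u2 G2]) auto
 \<comment> \<open>By the exponential law \<phi> is an everywhere convergent power series in e. Its
   linear coefficient is \<open>jump_op 1 K G F w\<close>, the integral of G against the very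
   differences that define G, that is q.\<close>
 define \<phi> where "\<phi> e = opexp (jump_op 1 K (\<lambda>z. e * G z + a z)) f w" for e
 have \<phi>: "\<phi> e = (\<Sum>n. ((jump_op 1 K G ^^ n) F w / fact n) * e ^ n)"
  and sm: "summable (\<lambda>n. ((jump_op 1 K G ^^ n) F w / fact n) * e ^ n)" for e
 proof -
  note A = bounded_op_jump_op[OF G, of 1]
  have "\<phi> e = opexp (jump_op 1 K (\<lambda>z. e * G z)) F w"
   unfolding \<phi>_def F_def using opexp_jump_op_add[OF f integrable_mult_right[OF G] a w, of 1 e] by simp
  also have "jump_op 1 K (\<lambda>z. e * G z) = (\<lambda>f w. e * jump_op 1 K G f w)"
   by (simp add: jump_op_def fun_eq_iff mult.assoc)
  finally show "\<phi> e = (\<Sum>n. ((jump_op 1 K G ^^ n) F w / fact n) * e ^ n)"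
   using opexp_scale[OF A F, where t = e and w = w] w by (simp add: space_path_space mult_ac)
  have "bounded_op path_space (\<bar>e\<bar> * ((1 + \<bar>1\<bar>) * (LINT z|K. \<bar>G z\<bar>))) (\<lambda>f w. e * jump_op 1 K G f w)"
   using bounded_op_lincomb[OF A A, of e 0] by simp
  from summable_opexp[OF this F, of w] show "summable (\<lambda>n. ((jump_op 1 K G ^^ n) F w / fact n) * e ^ n)"
   using funpow_scale_op[OF A F, where t = e and w = w] w by (simp add: space_path_space mult_ac)
 qed
 have "(\<phi> has_real_derivative (jump_op 1 K G ^^ 1) F w / fact 1) (at 0)"
  using has_derivative_powser_0[OF sm] unfolding \<phi>[abs_def] .
 also have "(jump_op 1 K G ^^ 1) F w / fact 1 = q"
  by (simp add: jump_op_def q_def power2_eq_square G_def F_def)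
 finally have "((\<lambda>e. (\<phi> e - \<phi> 0) / e) \<longlongrightarrow> q) (at 0)" by (simp add: DERIV_def)
 then have "((\<lambda>e. (\<phi> e - \<phi> 0) / e) \<longlongrightarrow> q) (at_right 0)"
  by (rule tendsto_mono[rotated]) (simp add: at_le)
 then have lim1: "((\<lambda>e. ((\<phi> e - \<phi> 0) / e)\<^sup>2) \<longlongrightarrow> q\<^sup>2) (at_right 0)" by (intro tendsto_intros)
 have lim2: "((\<lambda>e. X * exp \<kappa> * ((exp (2 * e * s + e\<^sup>2 * q) - 2 * exp (e * s) + 1) / e\<^sup>2)) \<longlongrightarrow> X * exp \<kappa> * (q + s\<^sup>2)) (at_right 0)"
  by (intro tendsto_intros exp_second_difference_tendsto)
 have le: "((\<phi> e - \<phi> 0) / e)\<^sup>2 \<le> X * exp \<kappa> * ((exp (2 * e * s + e\<^sup>2 * q) - 2 * exp (e * s) + 1) / e\<^sup>2)" if "0 < e" for e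
 proof -
  have i2: "integrable K (\<lambda>z. (e * G z + a z)\<^sup>2)"
  proof -
   have aG: "integrable K (\<lambda>z. a z * G z)" by (rule integrable_mult_square[OF _ _ a2 G2]) auto
   have "(\<lambda>z. (e * G z + a z)\<^sup>2) = (\<lambda>z. e\<^sup>2 * (G z)\<^sup>2 + 2 * e * (a z * G z) + (a z)\<^sup>2)"
    by (auto simp: power2_eq_square algebra_simps)
   then show ?thesis using aG G2 a2 by simp
  qed
  have 1: "(LINT z|K. (e * G z + a z - 1)\<^sup>2) = \<kappa> + (2 * e * s + e\<^sup>2 * q)"
  proof -
   have "(\<lambda>z. (e * G z + a z - 1)\<^sup>2) = (\<lambda>z. (a z - 1)\<^sup>2 + (2 * e * ((a z - 1) * G z) + e\<^sup>2 * (G z)\<^sup>2))"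
    by (auto simp: power2_eq_square algebra_simps)
   then show ?thesis using u2 uG G2 by (simp add: \<kappa>_def s_def q_def)
  qed
  have 2: "(LINT z|K. (e * G z + a z - 1) * (a z - 1)) = \<kappa> + e * s"
  proof -
   have "(\<lambda>z. (e * G z + a z - 1) * (a z - 1)) = (\<lambda>z. (a z - 1)\<^sup>2 + e * ((a z - 1) * G z))"
    by (auto simp: power2_eq_square algebra_simps)
   then show ?thesis using u2 uG by (simp add: \<kappa>_def s_def)
  qed
  have "(\<phi> e - \<phi> 0)\<^sup>2 \<le> X * (exp (\<kappa> + (2 * e * s + e\<^sup>2 * q)) - 2 * exp (\<kappa> + e * s) + exp \<kappa>)"
   using opexp_cauchy_schwarz[OF fin _ _ i2 a2 f w] unfolding 1 2 by (simp add: \<phi>_def X_def \<kappa>_def)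
  also have "\<dots> = X * exp \<kappa> * (exp (2 * e * s + e\<^sup>2 * q) - 2 * exp (e * s) + 1)"
   by (simp add: exp_add algebra_simps)
  finally show ?thesis using that by (simp add: power_divide divide_right_mono)
 qed
 have "q\<^sup>2 \<le> X * exp \<kappa> * (q + s\<^sup>2)"
  by (rule tendsto_le[OF _ lim2 lim1]) (use le in \<open>auto simp: eventually_at_filter\<close>)
 \<comment> \<open>With Cauchy-Schwarz for s the limit inequality becomes q^2 \<le> X exp \<kappa>
   (1 + \<kappa>) q, and one factor q can be cancelled.\<close>
 moreover have "s\<^sup>2 \<le> \<kappa> * q" unfolding s_def \<kappa>_def q_def
  by (rule integral_Cauchy_Schwarz[OF _ _ u2 G2]) auto
 moreover have X0: "0 \<le> X"
 proof -
  have "(\<lambda>n. (LINT z|PiN n K. exp (- (LINT z|K. 1)) * (\<Prod>i<n. 1) * shift_diffs 0 n z (\<lambda>w. (f w)\<^sup>2) w) / fact n) sums X"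
   unfolding X_def by (rule opexp_jump_op_series[OF bmf_power2[OF f] _ w]) simp
  from sums_le[OF _ sums_zero this] show ?thesis by (simp add: shift_diffs_0_power2)
 qed
 ultimately have qq: "q\<^sup>2 \<le> X * exp \<kappa> * (q + \<kappa> * q)"
  by (smt (verit) exp_ge_zero mult_left_mono mult_nonneg_nonneg)
 have "0 \<le> q" by (simp add: q_def)
 have "0 \<le> \<kappa>" by (simp add: \<kappa>_def)
 have "q \<le> X * exp \<kappa> * (1 + \<kappa>)"
 proof (cases "q = 0")
  case False
  then have "0 < q" using \<open>0 \<le> q\<close> by simp
  moreover have "q * q \<le> (X * exp \<kappa> * (1 + \<kappa>)) * q" using qq by (simp add: power2_eq_square algebra_simps)
  ultimately show ?thesis by simp
 qed (use X0 \<open>0 \<le> \<kappa>\<close> in auto)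
 then show ?thesis by (simp add: q_def X_def mult_ac)
qed

text \<open>The pure shift exponential has nonnegative terms, and the factor relating it to the
  difference form is positive.\<close>

lemma opexp_jump_op_nonneg:
 assumes f: "f \<in> bmf path_space" "\<And>w. w \<in> cadlag ==> 0 \<le> f w" and a: "integrable K a" "AE z in K. 0 \<le> a z" and w: "w \<in> cadlag"
 shows "0 \<le> opexp (jump_op 1 K a) f w"
proof -
 have "0 \<le> (jump_op 0 K a ^^ n) f w" if "w \<in> cadlag" for n w
  using that
 proof (induction n arbitrary: w)
  case (Suc n)
  then show ?case using a(2) unfolding funpow.simps comp_def jump_op_def[of 0 K a "(jump_op 0 K a ^^ n) f"]
   by (intro integral_nonneg_AE) (auto simp: shift_diff_def add_jump_cadlag elim!: eventually_mono)
 qed (use f in auto)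
 then have "0 \<le> opexp (jump_op 0 K a) f w" unfolding opexp_def
  using summable_opexp[OF bounded_op_jump_op[OF a(1)] f(1)] w by (intro suminf_nonneg) (auto simp: space_path_space)
 then show ?thesis by (simp add: opexp_jump_op_eq_shift[OF f(1) a(1) w])
qed

text \<open>Dominated convergence for each power, Tannery's theorem for the series. It supplies the
  continuity along decreasing sets by which a functional built from the exponential becomes a
  measure.\<close>

lemma opexp_jump_op_tendsto_0:
 assumes f: "\<And>i::nat. f i \<in> bmf path_space" and C: "\<And>i w. w \<in> cadlag ==> \<bar>f i w\<bar> \<le> C"
  and lim: "\<And>w. w \<in> cadlag ==> (\<lambda>i. f i w) \<longlonglongrightarrow> 0" and a: "integrable K a" and w: "w \<in> cadlag"
 shows "(\<lambda>i. opexp (jump_op c K a) (f i) w) \<longlonglongrightarrow> 0"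
proof -
 note A = bounded_op_jump_op[OF a, of c]
 let ?d = "(1 + \<bar>c\<bar>) * (LINT z|K. \<bar>a z\<bar>)"
 note [measurable] = borel_measurable_integrable[OF a]
 have bm: "(jump_op c K a ^^ n) (f i) \<in> bmf path_space" for n i
  by (rule bounded_op_bmf[OF bounded_op_funpow[OF A] f])
 have le: "\<bar>(jump_op c K a ^^ n) (f i) w\<bar> \<le> ?d ^ n * C" if "w \<in> cadlag" for n i w
  using that by (intro bounded_op_le[OF bounded_op_funpow[OF A] f]) (auto simp: space_path_space C)
 have n: "(\<lambda>i. (jump_op c K a ^^ n) (f i) w) \<longlonglongrightarrow> 0" if "w \<in> cadlag" for n w
  using that
 proof (induction n arbitrary: w)
  case (Suc n)
  let ?g = "\<lambda>i. (jump_op c K a ^^ n) (f i)"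
  have "(\<lambda>i. \<integral>z. a z * shift_diff c z (?g i) w \<partial>K) \<longlonglongrightarrow> (LINT z|K. 0)"
  proof (rule integral_dominated_convergence)
   show "integrable K (\<lambda>z. \<bar>a z\<bar> * ((1 + \<bar>c\<bar>) * (?d ^ n * C)))" using a by (intro integrable_mult_left integrable_abs)
   show "AE z in K. (\<lambda>i. a z * shift_diff c z (?g i) w) \<longlonglongrightarrow> 0"
   proof (rule AE_I2)
    fix z
    have "(\<lambda>i. a z * (?g i (add_jump z w) - c * ?g i w)) \<longlonglongrightarrow> a z * (0 - c * 0)"
     by (intro tendsto_mult tendsto_diff tendsto_const Suc.IH[OF Suc.prems] Suc.IH[OF add_jump_cadlag[OF Suc.prems]])
    then show "(\<lambda>i. a z * shift_diff c z (?g i) w) \<longlonglongrightarrow> 0" by (simp add: shift_diff_def)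
   qed
   show "AE z in K. norm (a z * shift_diff c z (?g i) w) \<le> \<bar>a z\<bar> * ((1 + \<bar>c\<bar>) * (?d ^ n * C))" for i
   proof (rule AE_I2)
    fix z
    have "\<bar>shift_diffs c 1 (\<lambda>_. z) (?g i) w\<bar> \<le> (1 + \<bar>c\<bar>) ^ 1 * (?d ^ n * C)"
     by (rule shift_diffs_le[OF le Suc.prems])
    then show "norm (a z * shift_diff c z (?g i) w) \<le> \<bar>a z\<bar> * ((1 + \<bar>c\<bar>) * (?d ^ n * C))"
     by (simp add: abs_mult mult_left_mono)
   qed
   show "(\<lambda>z. a z * shift_diff c z (?g i) w) \<in> borel_measurable K" for i
    using shift_diff_integrable[OF bm a Suc.prems] by blast
  qed simp
  moreover have "(jump_op c K a ^^ Suc n) (f i) w = (LINT z|K. a z * shift_diff c z (?g i) w)" for i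
   by (simp add: jump_op_def[of c K a "?g i"])
  ultimately show ?case by simp
 qed (use lim in simp)
 have "((\<lambda>i. \<Sum>n. (jump_op c K a ^^ n) (f i) w / fact n) \<longlongrightarrow> (\<Sum>n::nat. 0)) sequentially"
 proof (rule tannerys_theorem[THEN conjunct2, THEN conjunct2])
  show "((\<lambda>i. (jump_op c K a ^^ n) (f i) w / fact n) \<longlongrightarrow> 0) sequentially" for n
   using tendsto_divide[OF n[OF w] tendsto_const, of "fact n" n] by simp
  show "\<forall>\<^sub>F (n, i) in at_top \<times>\<^sub>F sequentially. norm ((jump_op c K a ^^ n) (f i) w / fact n) \<le> ?d ^ n / fact n * C"
   using le[OF w] by (intro always_eventually) (auto simp: divide_simps)
  show "summable (\<lambda>n. ?d ^ n / fact n * C)" by (rule summable_exp_series)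
 qed simp
 then show ?thesis by (simp add: opexp_def)
qed

text \<open>For a fixed jump the difference operator is itself bounded and commutes with
  \<open>jump_op\<close>, hence with its exponential.\<close>

lemma opexp_shift_diff_commute:
 assumes f: "f \<in> bmf path_space" and a: "integrable K a" and w: "w \<in> cadlag"
 shows "opexp (jump_op c K a) (shift_diff d z f) w = shift_diff d z (opexp (jump_op c K a) f) w"
proof -
 have S: "bounded_op path_space (1 + \<bar>d\<bar>) (shift_diff d z :: ((real => 'a) => real) => _)"
  unfolding bounded_op_def
 proof (intro conjI ballI allI impI)
  show "f \<in> bmf path_space ==> shift_diff d z f \<in> bmf path_space" for f :: "(real => 'a) => real" by (rule shift_diff_bmf)
  show "\<bar>shift_diff d z f w\<bar> \<le> (1 + \<bar>d\<bar>) * C" if "\<forall>w\<in>space path_space. \<bar>f w\<bar> \<le> C" "w \<in> space path_space" for f :: "(real => 'a) => real" and C w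
   using shift_diffs_le[of f C w d 1 "\<lambda>_. z"] that by (simp add: space_path_space)
 qed (auto simp: shift_diff_def algebra_simps)
 have "commuting_ops path_space (shift_diff d z) (jump_op c K a)"
  unfolding commuting_ops_def
 proof (intro ballI)
  fix f :: "(real => 'a) => real" and w :: "real => 'a" assume f: "f \<in> bmf path_space" and w: "w \<in> space path_space"
  have "integrable K (\<lambda>y. a y * shift_diff c y f v)" if "v \<in> cadlag" for v
   by (rule shift_diff_integrable[OF f a that])
  then have "shift_diff d z (jump_op c K a f) w = (LINT y|K. a y * shift_diff c y f (add_jump z w) - d * (a y * shift_diff c y f w))"
   using w add_jump_cadlag[of w z] unfolding shift_diff_def[of d] jump_op_def by (simp add: space_path_space)
  also have "\<dots> = (LINT y|K. a y * shift_diff d z (shift_diff c y f) w)"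
   by (intro lint_cong refl) (simp add: shift_diff_def algebra_simps)
  finally show "shift_diff d z (jump_op c K a f) w = jump_op c K a (shift_diff d z f) w"
   by (simp add: jump_op_def shift_diff_commute[of d z])
 qed
 from commuting_ops_opexp[OF S bounded_op_jump_op[OF a] this] show ?thesis
  using f w by (simp add: commuting_ops_def space_path_space)
qed

lemma jump_op_density:
 assumes k: "k \<in> borel_measurable K" "AE z in K. 0 \<le> k z" and a: "a \<in> borel_measurable K" and f: "f \<in> bmf path_space" and w: "w \<in> cadlag"
 shows "jump_op c (density K (\<lambda>z. ennreal (k z))) a f w = jump_op c K (\<lambda>z. k z * a z) f w"
proof -
 have "(\<lambda>z. case (z, w) of (z, w) => shift_diff c z f w) \<in> borel_measurable K"
  by (rule measurable_compose[OF _ measurable_shift_diff[OF measurable_const_fun_path[OF bmf_measurable[OF f]] measurable_jump_id]])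
   (use w in \<open>auto simp: space_path_space\<close>)
 then have "(\<lambda>z. a z * shift_diff c z f w) \<in> borel_measurable K" using a by simp
 from integral_density[OF this k] show ?thesis by (simp add: jump_op_def mult.assoc)
qed

lemma jump_measure_density:
 assumes k: "integrable K k" shows "jump_measure (density K (\<lambda>z. ennreal (k z)))" "finite_measure (density K (\<lambda>z. ennreal (k z)))"
proof -
 have "(\<integral>\<^sup>+z. ennreal (k z) \<partial>K) \<le> (\<integral>\<^sup>+z. ennreal (norm (k z)) \<partial>K)"
  by (intro nn_integral_mono ennreal_leI) auto
 also have "\<dots> < \<infinity>" using k by (simp add: integrable_iff_bounded)
 finally show fin: "finite_measure (density K (\<lambda>z. ennreal (k z)))"
  using k by (intro finite_measureI) (auto simp: emeasure_density cong: nn_integral_cong)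
 then show "jump_measure (density K (\<lambda>z. ennreal (k z)))"
  unfolding jump_measure_def jump_measure_axioms_def using measurable_jump_id
  by (auto simp: finite_measure_def)
qed

end

section \<open>Intensities on a finite time horizon\<close>

lemma levy_measure_sets: "levy_measure \<nu> ==> sets \<nu> = sets borel"
 by (simp add: levy_measure_def)

lemma levy_measure_space: "levy_measure \<nu> ==> space \<nu> = UNIV"
 using sets_eq_imp_space_eq[of \<nu> borel] by (simp add: levy_measure_def)

text \<open>Markov's inequality: outside the ball of radius e the integrand min (|x|^2, 1) is at
  least min (e^2, 1).\<close>

lemma levy_measure_emeasure_norm_gt:
 fixes \<nu> :: "'a::euclidean_space measure"
 assumes L: "levy_measure \<nu>" and e: "0 < e" shows "emeasure \<nu> {x. e < norm x} < \<infinity>"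
proof -
 have sets[measurable_cong, simp]: "sets \<nu> = sets borel" using L by (rule levy_measure_sets)
 define c where "c = min (e\<^sup>2) 1"
 have c: "0 < c" using e by (simp add: c_def)
 have "ennreal c * indicator {x. e < norm x} x \<le> ennreal (min ((norm x)\<^sup>2) 1)" for x :: 'a
  using e power_mono[of e "norm x" 2] by (auto simp: indicator_def c_def intro!: ennreal_leI min.coboundedI1)
 then have "(\<integral>\<^sup>+x. ennreal c * indicator {x. e < norm x} x \<partial>\<nu>) \<le> (\<integral>\<^sup>+x. ennreal (min ((norm x)\<^sup>2) 1) \<partial>\<nu>)"
  by (intro nn_integral_mono) auto
 also have "\<dots> < \<infinity>" using L by (simp add: levy_measure_def)
 finally have "ennreal c * emeasure \<nu> {x. e < norm x} < \<infinity>"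
  by (subst (asm) nn_integral_cmult_indicator) auto
 then show ?thesis using c by (auto simp: ennreal_mult_less_top)
qed

lemma levy_measure_AE_nonzero:
 fixes \<nu> :: "'a::euclidean_space measure"
 assumes L: "levy_measure \<nu>" shows "AE x in \<nu>. x \<noteq> 0"
 using L by (intro AE_I[of _ _ "{0}"]) (auto simp: levy_measure_def)

text \<open>The sets |x| > 1 / (n + 1) have finite measure and exhaust everything but the origin,
  which is a null set.\<close>

lemma levy_measure_sigma_finite:
 fixes \<nu> :: "'a::euclidean_space measure"
 assumes L: "levy_measure \<nu>" shows "sigma_finite_measure \<nu>"
proof
 let ?B = "\<lambda>n::nat. {x::'a. 1 / real (Suc n) < norm x}"
 have "x = 0 \<or> (\<exists>n. 1 / real (Suc n) < norm x)" for x :: 'a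
  using reals_Archimedean[of "norm x"] by (auto simp: inverse_eq_divide)
 then have "\<Union> (insert {0} (range ?B)) = UNIV" by auto
 then have U: "\<Union> (insert {0} (range ?B)) = space \<nu>" by (simp only: levy_measure_space[OF L])
 have m: "{x::'a. c < norm x} \<in> sets \<nu>" for c
  unfolding levy_measure_sets[OF L] by (intro borel_open open_Collect_less continuous_intros)
 have "a \<in> sets \<nu> \<and> emeasure \<nu> a \<noteq> \<infinity>" if "a \<in> insert {0} (range ?B)" for a
  using that
 proof
  assume "a = {0}" then show ?thesis using L by (simp add: levy_measure_def)
 next
  assume "a \<in> range ?B"
  then obtain n where "a = ?B n" by blast
  then show ?thesis using m levy_measure_emeasure_norm_gt[OF L, of "1 / real (Suc n)"] by (simp add: less_top)
 qed
 then show "\<exists>A. countable A \<and> A \<subseteq> sets \<nu> \<and> \<Union> A = space \<nu> \<and> (\<forall>a\<in>A. emeasure \<nu> a \<noteq> \<infinity>)"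
  using U by (intro exI[of _ "insert {0} (range ?B)"] conjI) (simp, blast, assumption, blast)
qed

lemma half_line_lebesgue_eq: "sets half_line_lebesgue = sets (restrict_space borel {0..})" "space half_line_lebesgue = {0..}"
 by (auto simp: half_line_lebesgue_def sets_restrict_space space_restrict_space)

lemma sigma_finite_half_line: "sigma_finite_measure half_line_lebesgue"
 unfolding half_line_lebesgue_def by (rule sigma_finite_measure_restrict_space) (auto intro: lborel.sigma_finite_measure_axioms)

lemma measurable_half_line_id: "(\<lambda>t. t) \<in> measurable half_line_lebesgue borel"
 unfolding half_line_lebesgue_def by (rule measurable_restrict_space1) simp

text \<open>Lebesgue measure on [0, T], written as a density so that the \<sigma>-field stays that
  of the half-line and integrals over all times can be compared directly.\<close>

definition horizon :: "real => real measure" where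
 "horizon T = density half_line_lebesgue (\<lambda>t. ennreal (indicator {..T} t))"

lemma emeasure_horizon: assumes "0 \<le> T" shows "emeasure (horizon T) (space (horizon T)) = ennreal T"
proof -
 note [measurable] = measurable_half_line_id
 have "emeasure (horizon T) (space (horizon T)) = (\<integral>\<^sup>+t. ennreal (indicator {..T} t) \<partial>half_line_lebesgue)"
  by (auto simp: horizon_def emeasure_density intro!: nn_integral_cong)
 also have "\<dots> = (\<integral>\<^sup>+t. ennreal (indicator {..T} t) * indicator {0..} t \<partial>lborel)"
  unfolding half_line_lebesgue_def by (rule nn_integral_restrict_space) simp
 also have "\<dots> = (\<integral>\<^sup>+t. indicator {0..T} t \<partial>lborel)" by (intro nn_integral_cong) (auto simp: indicator_def)
 finally show ?thesis using assms by simp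
qed

lemma finite_measure_horizon: "0 \<le> T ==> finite_measure (horizon T)"
 using emeasure_horizon by (intro finite_measureI) simp

definition intensity_upto :: "real => 'a::euclidean_space measure => (real \<times> 'a) measure" where
 "intensity_upto T \<nu> = density (jump_intensity \<nu>) (\<lambda>p. ennreal (indicator {..T} (fst p)))"

lemma intensity_upto_eq_pair:
 assumes T: "0 \<le> T" and L: "sigma_finite_measure \<nu>"
 shows "intensity_upto T \<nu> = horizon T \<Otimes>\<^sub>M \<nu>"
proof -
 note [measurable] = measurable_half_line_id
 have "horizon T \<Otimes>\<^sub>M density \<nu> (\<lambda>_. 1) = density (half_line_lebesgue \<Otimes>\<^sub>M \<nu>) (\<lambda>(x,y). ennreal (indicator {..T} x) * 1)"
  unfolding horizon_def using L finite_measure_horizon[OF T]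
  by (intro pair_measure_density) (auto simp: density_1 horizon_def finite_measure_def)
 then show ?thesis by (simp add: intensity_upto_def jump_intensity_def density_1 case_prod_beta')
qed

lemma jump_measure_jump_intensity:
 fixes \<nu> :: "'a::euclidean_space measure"
 assumes L: "levy_measure \<nu>" shows "jump_measure (jump_intensity \<nu>)"
proof -
 interpret pair_sigma_finite half_line_lebesgue \<nu>
  using sigma_finite_half_line levy_measure_sigma_finite[OF L] by (simp add: pair_sigma_finite_def)
 have "(\<lambda>z. (fst z, snd z)) \<in> measurable (half_line_lebesgue \<Otimes>\<^sub>M \<nu>) (borel \<Otimes>\<^sub>M borel)"
  using measurable_compose[OF measurable_fst measurable_half_line_id, of \<nu>]
   measurable_compose[OF measurable_snd measurable_ident_sets[OF levy_measure_sets[OF L]], of half_line_lebesgue]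
  by (intro measurable_Pair) auto
 then show ?thesis unfolding jump_measure_def jump_measure_axioms_def jump_intensity_def
  using sigma_finite_measure_axioms by simp
qed

context
 fixes \<nu> :: "'a::euclidean_space measure" and T :: real
 assumes L: "levy_measure \<nu>" and T: "0 \<le> T"
begin

lemma intensity_pair: "intensity_upto T \<nu> = horizon T \<Otimes>\<^sub>M \<nu>"
 by (rule intensity_upto_eq_pair[OF T levy_measure_sigma_finite[OF L]])

lemma pair_horizon: "pair_sigma_finite (horizon T) \<nu>"
 using finite_measure_horizon[OF T] levy_measure_sigma_finite[OF L] by (simp add: pair_sigma_finite_def finite_measure_def)

lemma jump_measure_intensity_upto: "jump_measure (intensity_upto T \<nu>)"
proof -
 interpret J: jump_measure "jump_intensity \<nu>" by (rule jump_measure_jump_intensity[OF L])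
 interpret pair_sigma_finite "horizon T" \<nu> by (rule pair_horizon)
 have "sets (intensity_upto T \<nu>) = sets (jump_intensity \<nu>)" by (simp add: intensity_upto_def)
 then show ?thesis unfolding jump_measure_def jump_measure_axioms_def
  using J.measurable_jump_id sigma_finite_measure_axioms intensity_pair by (auto cong: measurable_cong_sets)
qed

text \<open>The time coordinate has total mass T, so it contributes this factor to the integral of a
  function of the jump size alone.\<close>

lemma integral_intensity_snd:
 fixes h :: "'a => 'b::{banach, second_countable_topology}"
 assumes h: "integrable \<nu> h"
 shows "integrable (intensity_upto T \<nu>) (\<lambda>p. h (snd p))" "(LINT p|intensity_upto T \<nu>. h (snd p)) = T *\<^sub>R (LINT x|\<nu>. h x)"
proof -
 interpret H: finite_measure "horizon T" by (rule finite_measure_horizon[OF T])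
 interpret P: pair_sigma_finite "horizon T" \<nu> by (rule pair_horizon)
 have m: "measure (horizon T) (space (horizon T)) = T" using emeasure_horizon[OF T] T by (simp add: measure_def)
 have [measurable]: "h \<in> borel_measurable \<nu>" using h by auto
 show i: "integrable (intensity_upto T \<nu>) (\<lambda>p. h (snd p))" unfolding intensity_pair
  by (rule P.Fubini_integrable) (use h in auto)
 show "(LINT p|intensity_upto T \<nu>. h (snd p)) = T *\<^sub>R (LINT x|\<nu>. h x)"
  using P.integral_fst'[OF i[unfolded intensity_pair]] m unfolding intensity_pair by simp
qed

lemma AE_intensity_snd:
 assumes "AE x in \<nu>. P x" shows "AE p in intensity_upto T \<nu>. P (snd p)"
proof -
 interpret P: pair_sigma_finite "horizon T" \<nu> by (rule pair_horizon)
 obtain N where N: "{x \<in> space \<nu>. \<not> P x} \<subseteq> N" "N \<in> sets \<nu>" "emeasure \<nu> N = 0" using assms by (rule AE_E)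
 have "emeasure (horizon T \<Otimes>\<^sub>M \<nu>) (space (horizon T) \<times> N) = 0"
  using N by (simp add: P.M2.emeasure_pair_measure_Times)
 moreover have "{p \<in> space (horizon T \<Otimes>\<^sub>M \<nu>). \<not> P (snd p)} \<subseteq> space (horizon T) \<times> N"
  using N(1) by (auto simp: space_pair_measure)
 ultimately show ?thesis unfolding intensity_pair using N(2) by (intro AE_I) auto
qed

lemma measurable_intensity_snd:
 assumes h: "h \<in> borel_measurable borel" shows "(\<lambda>p. h (snd p)) \<in> borel_measurable (intensity_upto T \<nu>)"
proof -
 have "h \<in> borel_measurable \<nu>" using h levy_measure_sets[OF L] by (simp cong: measurable_cong_sets)
 then show ?thesis unfolding intensity_pair by (rule measurable_compose[OF measurable_snd])
qed

end

section \<open>A family of laws indexed by densities\<close>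

context jump_measure
begin

text \<open>Changing c adds a multiple of the identity, which commutes with the operator and
  exponentiates to a scalar. With \<open>c = -1\<close> this expresses the exponential of the
  majorising operator through that of the difference operator.\<close>

lemma opexp_jump_op_change:
 assumes f: "f \<in> bmf path_space" and a: "integrable K a" and w: "w \<in> cadlag"
 shows "opexp (jump_op c K a) f w = exp ((1 - c) * (LINT z|K. a z)) * opexp (jump_op 1 K a) f w"
proof -
 let ?m = "(1 - c) * (LINT z|K. a z)"
 have B: "bounded_op path_space (\<bar>?m\<bar> * 1) (\<lambda>(f :: (real => 'a) => real) w. ?m * f w)"
  using bounded_op_lincomb[OF bounded_op_id bounded_op_id, of path_space ?m 0] by simp
 note A = bounded_op_jump_op[OF a]
 have eq: "jump_op c K a g v = ?m * g v + jump_op 1 K a g v" if "g \<in> bmf path_space" "v \<in> space path_space" for g v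
 proof -
  have "jump_op c K a g v = (LINT z|K. a z * shift_diff 1 z g v + a z * ((1 - c) * g v))"
   unfolding jump_op_def by (simp add: shift_diff_def algebra_simps)
  also have "\<dots> = jump_op 1 K a g v + (LINT z|K. a z * ((1 - c) * g v))"
   using shift_diff_integrable[OF that(1) a, of v 1] that(2) a
   unfolding jump_op_def by (subst lint_add) (auto simp: space_path_space)
  finally show ?thesis by simp
 qed
 have com: "commuting_ops path_space (\<lambda>(f :: (real => 'a) => real) w. ?m * f w) (jump_op 1 K a)"
  unfolding commuting_ops_def using bounded_op_cmult[OF A[of 1], where a = ?m] by simp
 have B2: "bounded_op path_space (\<bar>1\<bar> * (\<bar>?m\<bar> * 1) + \<bar>1\<bar> * ((1 + \<bar>1\<bar>) * (LINT z|K. \<bar>a z\<bar>))) (\<lambda>f w. ?m * f w + jump_op 1 K a f w)"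
  using bounded_op_lincomb[OF B A[of 1], of 1 1] by (simp only: mult_1)
 have "opexp (jump_op c K a) f w = opexp (\<lambda>f w. ?m * f w + jump_op 1 K a f w) f w"
  by (rule opexp_cong[OF A B2 _ f]) (use eq w in \<open>auto simp: space_path_space\<close>)
 also have "\<dots> = opexp (\<lambda>f w. ?m * f w) (opexp (jump_op 1 K a) f) w"
  by (rule opexp_add[OF B A com f]) (use w in \<open>simp add: space_path_space\<close>)
 finally show ?thesis by (simp only: opexp_const)
qed

lemma measurable_phase:
 fixes u :: "real => 'a"
 assumes "finite F" shows "(\<lambda>p. phase u F p) \<in> borel_measurable K"
proof -
 have eq: "phase u F p = (\<Sum>t\<in>F. if fst p \<le> t then u t \<bullet> snd p else 0)" for p :: "real \<times> 'a"
  using assms by (auto simp: sum.inter_filter inner_sum_left intro!: sum.cong)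
 have "(\<lambda>p. \<Sum>t\<in>F. if fst p \<le> t then u t \<bullet> snd p else 0) \<in> borel_measurable (borel \<Otimes>\<^sub>M borel)"
  by measurable
 from measurable_compose[OF measurable_jump_id this] show ?thesis by (simp only: eq)
qed

end

section \<open>Cutting off small jumps\<close>

lemma cmod_cis_minus_1_le: "cmod (cis y - 1) \<le> \<bar>y\<bar>" "cmod (cis y - 1) \<le> 2"
 using iexp_approx1[of y 0] norm_triangle_ineq4[of "cis y" 1] by (simp_all add: cis_conv_exp)

lemma measurable_cis[measurable]: "cis \<in> borel_measurable borel"
 by (intro borel_measurable_continuous_onI continuous_intros)

text \<open>A sequence of thresholds is used so that the complement of 0 is exhausted by a countable
  increasing union.\<close>

definition cutoff :: "nat => 'a::euclidean_space set" where
 "cutoff m = {x. 1 / real (Suc m) < norm x}"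

lemma cutoff_borel[measurable]: "cutoff m \<in> sets borel"
 unfolding cutoff_def by (intro borel_open open_Collect_less continuous_intros)

lemma eventually_mem_cutoff: assumes "x \<noteq> 0" shows "\<forall>\<^sub>F m in sequentially. x \<in> cutoff m"
proof -
 have "(\<lambda>m. 1 / real (Suc m)) \<longlonglongrightarrow> 0" using LIMSEQ_Suc[OF lim_const_over_n[of "1::real"]] .
 from order_tendstoD(2)[OF this, of "norm x"] assms show ?thesis by (simp add: cutoff_def)
qed

lemma integral_cutoff_tendsto:
 fixes h :: "'b => 'c::{banach, second_countable_topology}" and y :: "'b => 'a::euclidean_space"
 assumes h: "integrable M h" and y: "y \<in> borel_measurable M" and nz: "AE p in M. y p \<noteq> 0"
 shows "(\<lambda>m. \<integral>p. indicator (cutoff m) (y p) *\<^sub>R h p \<partial>M) \<longlonglongrightarrow> (LINT p|M. h p)"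
proof (rule integral_dominated_convergence)
 note [measurable] = y
 have [measurable]: "h \<in> borel_measurable M" using h by auto
 show "(\<lambda>p. indicator (cutoff m) (y p) *\<^sub>R h p) \<in> borel_measurable M" for m by measurable
 show "integrable M (\<lambda>p. norm (h p))" using h by simp
 show "AE p in M. (\<lambda>m. indicator (cutoff m) (y p) *\<^sub>R h p) \<longlonglongrightarrow> h p"
  using nz
 proof eventually_elim
  case (elim p)
  show ?case by (rule tendsto_eventually) (use eventually_mem_cutoff[OF elim] in eventually_elim, simp)
 qed
 show "AE p in M. norm (indicator (cutoff m) (y p) *\<^sub>R h p) \<le> norm (h p)" for m
  by (auto simp: indicator_def)
qed (use h in auto)

text \<open>\<open>v\<close> is the density relative to the reference measure minus 1. The
  integrability condition makes the exponent with \<open>cis - 1\<close> converge without a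
  compensator.\<close>

definition admissible :: "'a::euclidean_space measure => ('a => real) => bool" where
 "admissible \<nu> v \<longleftrightarrow> v \<in> borel_measurable borel \<and> (AE x in \<nu>. - 1 \<le> v x) \<and> integrable \<nu> (\<lambda>x. min (norm x) 1 * v x)"

text \<open>All that the perturbation argument uses of Levy processes: for each admissible v there
  is a law whose trigonometric moments are a fixed complex factor times an exponential linear in v.
  The factor \<open>C\<close> is the characteristic function at v = 0; it carries the Gaussian part,
  the drift and the unperturbed jumps and is the same for all v.\<close>

locale perturbed_family =
 fixes \<nu> :: "'a::euclidean_space measure" and T :: real
  and Q :: "('a => real) => (real => 'a) measure" and C :: "(real => 'a) => real set => complex"
 assumes levy: "levy_measure \<nu>" and T: "0 \<le> T"
  and Q_prob: "admissible \<nu> v ==> prob_space (Q v)"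
  and Q_sets: "admissible \<nu> v ==> sets (Q v) = sets path_space"
  and Q_trig: "admissible \<nu> v ==> finite F ==> F \<subseteq> {0..} ==> (LINT w|Q v. trig u F c w) =
   Re (C u F * exp (LINT p|intensity_upto T \<nu>. v (snd p) *\<^sub>R (cis (phase u F p) - 1)) * cis c)"
begin

sublocale jump_measure "intensity_upto T \<nu>"
 by (rule jump_measure_intensity_upto[OF levy T])

abbreviation E :: "('a => real) => ((real => 'a) => real) => (real => 'a) => real" where
 "E h \<equiv> opexp (jump_op 1 (intensity_upto T \<nu>) (\<lambda>p. h (snd p)))"

lemma sets_nu[measurable_cong]: "sets \<nu> = sets borel" by (rule levy_measure_sets[OF levy])

lemma borel_nu: "h \<in> borel_measurable borel ==> h \<in> borel_measurable \<nu>"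
 using measurable_cong_sets[OF sets_nu refl] by blast

lemma finite_Q: "admissible \<nu> v ==> finite_measure (Q v)"
 using Q_prob prob_space.finite_measure by blast

lemma space_Q: "admissible \<nu> v ==> space (Q v) = cadlag"
 using sets_eq_imp_space_eq[OF Q_sets] by (simp add: space_path_space)

lemma bmf_integrable_Q: "admissible \<nu> v ==> f \<in> bmf path_space ==> integrable (Q v) f"
 by (rule bmf_integrable[OF finite_Q Q_sets])

lemma E_bmf: "integrable \<nu> h ==> f \<in> bmf path_space ==> E h f \<in> bmf path_space"
 by (rule bounded_op_bmf[OF bounded_op_opexp(1)[OF bounded_op_jump_op[OF integral_intensity_snd(1)[OF levy T]]]])

text \<open>|cis y - 1| is at most |y| and at most 2, and the phase is at most S |x|; together this
  gives the bound (2 + S) min (|x|, 1).\<close>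

lemma integrable_char_exponent:
 fixes u :: "real => 'a"
 assumes v: "v \<in> borel_measurable borel" "integrable \<nu> (\<lambda>x. min (norm x) 1 * v x)" and F: "finite F"
 shows "integrable (intensity_upto T \<nu>) (\<lambda>p. v (snd p) *\<^sub>R (cis (phase u F p) - 1))"
proof -
 define S where "S = (\<Sum>t\<in>F. norm (u t))"
 have S: "0 \<le> S" by (simp add: S_def sum_nonneg)
 have y: "\<bar>(\<Sum>t | t \<in> F \<and> r \<le> t. u t) \<bullet> x\<bar> \<le> S * norm x" for r and x :: 'a
 proof -
  have "\<bar>(\<Sum>t | t \<in> F \<and> r \<le> t. u t) \<bullet> x\<bar> \<le> norm (\<Sum>t | t \<in> F \<and> r \<le> t. u t) * norm x" by (rule Cauchy_Schwarz_ineq2)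
  also have "norm (\<Sum>t | t \<in> F \<and> r \<le> t. u t) \<le> (\<Sum>t | t \<in> F \<and> r \<le> t. norm (u t))" by (rule norm_sum)
  also have "\<dots> \<le> S" unfolding S_def using F by (intro sum_mono2) auto
  finally show ?thesis by (simp add: mult_right_mono)
 qed
 have le: "cmod (cis ((\<Sum>t | t \<in> F \<and> r \<le> t. u t) \<bullet> x) - 1) \<le> (2 + S) * min (norm x) 1" for r and x :: 'a
 proof (cases "norm x \<le> 1")
  case True
  have "S * norm x \<le> (2 + S) * norm x" by (simp add: mult_right_mono)
  then show ?thesis using True order_trans[OF cmod_cis_minus_1_le(1) y, of r x] by simp
 next
  case False
  then show ?thesis using cmod_cis_minus_1_le(2)[of "(\<Sum>t | t \<in> F \<and> r \<le> t. u t) \<bullet> x"] S by simp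
 qed
 note [measurable] = measurable_phase[OF F, of u] measurable_intensity_snd[OF levy T v(1)]
 show ?thesis
 proof (rule integrable_le)
  show "integrable (intensity_upto T \<nu>) (\<lambda>p. (2 + S) * (min (norm (snd p)) 1 * v (snd p)))"
   by (intro integrable_mult_right integral_intensity_snd(1)[OF levy T] v)
  show "AE p in intensity_upto T \<nu>. norm (v (snd p) *\<^sub>R (cis (phase u F p) - 1)) \<le> norm ((2 + S) * (min (norm (snd p)) 1 * v (snd p)))"
  proof (rule AE_I2)
   fix p :: "real \<times> 'a"
   have "norm (v (snd p) *\<^sub>R (cis (phase u F p) - 1)) \<le> \<bar>v (snd p)\<bar> * ((2 + S) * min (norm (snd p)) 1)"
    using le[of "fst p" "snd p"] by (simp add: mult_left_mono)
   also have "\<dots> = norm ((2 + S) * (min (norm (snd p)) 1 * v (snd p)))" using S by (simp add: abs_mult mult_ac)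
   finally show "norm (v (snd p) *\<^sub>R (cis (phase u F p) - 1)) \<le> norm ((2 + S) * (min (norm (snd p)) 1 * v (snd p)))" .
  qed
 qed measurable
qed

text \<open>For k \<ge> 0 the functional on the right is linear, positive, normalised and continuous
  along decreasing sets, hence integration against a probability measure. Its trigonometric moments
  are the ones prescribed for v + k, so it is that law.\<close>

lemma integral_add_jumps_nonneg:
 assumes v: "admissible \<nu> v" and vk: "admissible \<nu> (\<lambda>x. v x + k x)" and k: "integrable \<nu> k" "k \<in> borel_measurable borel" "AE x in \<nu>. 0 \<le> k x"
  and f: "f \<in> bmf path_space"
 shows "(LINT w|Q (\<lambda>x. v x + k x). f w) = (LINT w|Q v. E k f w)"
proof -
 interpret Qv: prob_space "Q v" by (rule Q_prob[OF v])
 note ks = integral_intensity_snd(1)[OF levy T k(1)]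
 note O = bounded_op_opexp(1)[OF bounded_op_jump_op[OF ks, of 1]]
 have i: "integrable (Q v) (E k g)" if "g \<in> bmf path_space" for g
  by (rule bmf_integrable_Q[OF v E_bmf[OF k(1) that]])
 obtain R where R: "prob_space R" "sets R = sets path_space" "\<And>f. f \<in> bmf path_space ==> integral\<^sup>L R f = (LINT w|Q v. E k f w)"
 proof (rule functional_measureE[of path_space "\<lambda>f. \<integral>w. E k f w \<partial>Q v"])
  show "(LINT w|Q v. E k (\<lambda>w. f w + g w) w) = (LINT w|Q v. E k f w) + (LINT w|Q v. E k g w)"
   if "f \<in> bmf path_space" "g \<in> bmf path_space" for f g
   unfolding lint_add[OF i[OF that(1)] i[OF that(2)], symmetric]
   by (intro lint_cong refl bounded_op_add[OF O that]) (simp add: space_Q[OF v] space_path_space)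
  show "(LINT w|Q v. E k (\<lambda>w. a * f w) w) = a * (LINT w|Q v. E k f w)" if "f \<in> bmf path_space" for f a
   unfolding integral_mult_right_zero[symmetric]
   by (intro lint_cong refl bounded_op_cmult[OF O that]) (simp add: space_Q[OF v] space_path_space)
  show "0 \<le> (LINT w|Q v. E k f w)" if "f \<in> bmf path_space" "\<And>w. w \<in> space path_space ==> 0 \<le> f w" for f
   by (intro Bochner_Integration.integral_nonneg opexp_jump_op_nonneg[OF that(1) _ ks AE_intensity_snd[OF levy T k(3)]])
    (use that in \<open>auto simp: space_path_space space_Q[OF v]\<close>)
  \<comment> \<open>Constants are annihilated by the difference operator, so only the term n = 0 of
    the series remains.\<close>
  have one: "E k (\<lambda>_. 1) w = 1" if "w \<in> cadlag" for w
  proof -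
   have z: "jump_op 1 (intensity_upto T \<nu>) (\<lambda>p. k (snd p)) (\<lambda>_. c) = (\<lambda>_. 0)" for c
    by (rule ext) (simp add: jump_op_def shift_diff_def)
   have "(jump_op 1 (intensity_upto T \<nu>) (\<lambda>p. k (snd p)) ^^ n) (\<lambda>_. 0) = (\<lambda>_. 0)" for n
    by (induction n) (simp_all add: z)
   then have "(jump_op 1 (intensity_upto T \<nu>) (\<lambda>p. k (snd p)) ^^ n) (\<lambda>_. 1) w / fact n = (if n = 0 then 1 else 0)" for n
    by (cases n) (simp_all add: funpow_Suc_right z del: funpow.simps(2))
   then show ?thesis using sums_If_finite[of "\<lambda>n. n = 0" "\<lambda>_. 1 :: real"] by (simp add: opexp_def sums_iff)
  qed
  show "(LINT w|Q v. E k (\<lambda>_. 1) w) = 1"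
   using one Qv.prob_space by (subst lint_cong[OF refl, of _ _ "\<lambda>_. 1"]) (auto simp: space_Q[OF v])
  show "(\<lambda>i. \<integral>w. E k (indicator (A i)) w \<partial>Q v) \<longlonglongrightarrow> 0"
   if A: "range A \<subseteq> sets path_space" "decseq A" "(\<Inter>i. A i) = {}" for A :: "nat => _"
  proof -
   have Ai: "indicator (A i) \<in> bmf path_space" for i using A by (intro bmf_indicator) auto
   have lim: "(\<lambda>i. indicator (A i) w :: real) \<longlonglongrightarrow> 0" for w
   proof -
    obtain n where n: "w \<notin> A n" using A by blast
    have "\<forall>i\<ge>n. w \<notin> A i" using n A(2) by (auto simp: decseq_def)
    then show ?thesis by (intro tendsto_eventually) (auto simp: eventually_sequentially indicator_def)
   qed
   have "(\<lambda>i. \<integral>w. E k (indicator (A i)) w \<partial>Q v) \<longlonglongrightarrow> (LINT w|Q v. 0)"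
   proof (rule integral_dominated_convergence)
    show "AE w in Q v. (\<lambda>i. E k (indicator (A i)) w) \<longlonglongrightarrow> 0"
     using lim by (intro AE_I2 opexp_jump_op_tendsto_0[OF Ai, where C = 1] ks) (auto simp: indicator_def space_Q[OF v])
    show "AE w in Q v. norm (E k (indicator (A i)) w) \<le> exp ((1 + \<bar>1\<bar>) * (LINT z|intensity_upto T \<nu>. \<bar>k (snd z)\<bar>)) * 1" for i
    proof (rule AE_I2)
     fix w assume "w \<in> space (Q v)"
     then have "w \<in> space path_space" by (simp add: space_Q[OF v] space_path_space)
     from bounded_op_le[OF O Ai[of i], of 1, OF _ this]
     show "norm (E k (indicator (A i)) w) \<le> exp ((1 + \<bar>1\<bar>) * (LINT z|intensity_upto T \<nu>. \<bar>k (snd z)\<bar>)) * 1"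
      by (simp add: indicator_def)
    qed
   qed (use i[OF Ai] in auto)
   then show ?thesis by simp
  qed
 qed blast
 have "R = Q (\<lambda>x. v x + k x)"
 proof (rule path_measure_eqI[OF R(1) Q_prob[OF vk] R(2) Q_sets[OF vk]])
  fix u :: "real => 'a" and F :: "real set" and c :: real assume F: "finite F" "F \<subseteq> {0..}"
  define ch where "ch p = cis (phase u F p) - 1" for p :: "real \<times> 'a"
  define z where "z = (LINT p|intensity_upto T \<nu>. k (snd p) *\<^sub>R ch p)"
  define y where "y = (LINT p|intensity_upto T \<nu>. v (snd p) *\<^sub>R ch p)"
  have vi: "integrable (intensity_upto T \<nu>) (\<lambda>p. v (snd p) *\<^sub>R ch p)"
   unfolding ch_def using v by (intro integrable_char_exponent F) (auto simp: admissible_def)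
  have vki: "integrable (intensity_upto T \<nu>) (\<lambda>p. (v (snd p) + k (snd p)) *\<^sub>R ch p)"
   unfolding ch_def using vk by (intro integrable_char_exponent[where v = "\<lambda>x. v x + k x"] F) (auto simp: admissible_def)
  have ki: "integrable (intensity_upto T \<nu>) (\<lambda>p. k (snd p) *\<^sub>R ch p)"
   using Bochner_Integration.integrable_diff[OF vki vi] by (simp add: scaleR_add_left)
  have yz: "(LINT p|intensity_upto T \<nu>. (v (snd p) + k (snd p)) *\<^sub>R ch p) = y + z"
   using vi ki by (simp add: y_def z_def scaleR_add_left)
  define r where "r = cmod (exp z)"
  \<comment> \<open>In polar form the complex factor exp z acts on \<open>trig\<close> as
    multiplication by its modulus and a shift of the phase, so the result stays among the functions
    whose integrals are known.\<close>
  obtain \<phi> where \<phi>: "exp z = of_real r * cis \<phi>" using rcis_cmod_Arg[of "exp z"] unfolding r_def rcis_def by metis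
  have "E k (trig u F c) w = r * trig u F (c + \<phi>) w" for w
   unfolding jump_op_trig[OF ks F] using \<phi>
   by (simp add: trig_def z_def[symmetric] ch_def[symmetric] cis_mult mult.assoc add_ac)
  then have "integral\<^sup>L R (trig u F c) = r * (LINT w|Q v. trig u F (c + \<phi>) w)"
   by (simp add: R(3)[OF trig_bmf])
  also have "\<dots> = Re (C u F * (exp y * exp z) * cis c)"
   unfolding Q_trig[OF v F] \<phi> by (simp only: y_def[symmetric] ch_def[symmetric])
    (simp add: cis_mult[symmetric] algebra_simps)
  also have "\<dots> = integral\<^sup>L (Q (\<lambda>x. v x + k x)) (trig u F c)"
   using Q_trig[OF vk F, of u c] unfolding ch_def[symmetric] yz by (simp add: exp_add)
  finally show "integral\<^sup>L R (trig u F c) = integral\<^sup>L (Q (\<lambda>x. v x + k x)) (trig u F c)" .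
 qed
 then show ?thesis using R(3)[OF f] by simp
qed

lemma E_0: assumes "f \<in> bmf path_space" "w \<in> cadlag" shows "E (\<lambda>_. 0) f w = f w"
proof -
 have "E (\<lambda>_. 0) f w = opexp (\<lambda>f w. 0 * f w) f w" by (simp add: jump_op_def[abs_def])
 then show ?thesis using opexp_const[of 0 f w] by simp
qed

lemma E_add:
 assumes "f \<in> bmf path_space" "integrable \<nu> h" "integrable \<nu> k" "w \<in> cadlag"
 shows "E (\<lambda>x. h x + k x) f w = E h (E k f) w"
 using opexp_jump_op_add[OF assms(1) integral_intensity_snd(1)[OF levy T assms(2)] integral_intensity_snd(1)[OF levy T assms(3)] assms(4), of 1]
 by simp

text \<open>For signed h = p - n the functional on the right is not visibly positive. Writing f as
  \<open>E n\<close> applied to \<open>E (- n) f\<close> moves the negative part to the other side: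
  the laws for v + h and for v are both linked to the larger law for v + p by adding nonnegative
  densities.\<close>

lemma integral_add_jumps:
 assumes v: "admissible \<nu> v" and vh: "admissible \<nu> (\<lambda>x. v x + h x)" and h: "integrable \<nu> h" "h \<in> borel_measurable borel"
  and f: "f \<in> bmf path_space"
 shows "(LINT w|Q (\<lambda>x. v x + h x). f w) = (LINT w|Q v. E h f w)"
proof -
 note [measurable] = h(2)
 define p where "p x = max (h x) 0" for x
 define n where "n x = max (- h x) 0" for x
 have hn: "h x + n x = p x" and hp: "h x = p x + - n x" for x by (auto simp: p_def n_def)
 have p: "integrable \<nu> p" "p \<in> borel_measurable borel" and n: "integrable \<nu> n" "n \<in> borel_measurable borel"
  unfolding p_def[abs_def] n_def[abs_def] using h by auto
 have m: "integrable \<nu> (\<lambda>x. min (norm x) 1 * k x)" if "integrable \<nu> k" "k \<in> borel_measurable borel" for k :: "'a => real"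
 proof -
  note [measurable] = that(2)
  have "(\<lambda>x. min (norm x) 1 * k x) \<in> borel_measurable borel" by measurable
  from borel_nu[OF this] show ?thesis by (rule integrable_le[OF that(1)])
    (auto simp: abs_mult intro!: mult_left_le_one_le)
 qed
 have vp: "admissible \<nu> (\<lambda>x. v x + p x)"
 proof -
  have "AE x in \<nu>. - 1 \<le> v x + p x" using v by (auto simp: admissible_def p_def elim!: eventually_mono)
  then show ?thesis using v m[OF p] p(2) by (auto simp: admissible_def distrib_left)
 qed
 have nn: "integrable \<nu> (\<lambda>x. - n x)" using n by simp
 have gb: "E (\<lambda>x. - n x) f \<in> bmf path_space" by (rule E_bmf[OF nn f])
 have bk: "E n (E (\<lambda>x. - n x) f) w = f w" if "w \<in> cadlag" for w
  using E_add[OF f n(1) nn that] E_0[OF f that] by simp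
 have vpn: "(\<lambda>x. v x + h x + n x) = (\<lambda>x. v x + p x)" by (auto simp: hn add.assoc)
 have "(LINT w|Q (\<lambda>x. v x + h x). f w) = (LINT w|Q (\<lambda>x. v x + h x). E n (E (\<lambda>x. - n x) f) w)"
  by (intro lint_cong refl) (simp add: bk space_Q[OF vh])
 also have "\<dots> = (LINT w|Q (\<lambda>x. v x + h x + n x). E (\<lambda>x. - n x) f w)"
  by (rule integral_add_jumps_nonneg[OF vh _ n _ gb, symmetric]) (use vp vpn in \<open>auto simp: n_def\<close>)
 also have "\<dots> = (LINT w|Q (\<lambda>x. v x + p x). E (\<lambda>x. - n x) f w)" by (simp only: vpn)
 also have "\<dots> = (LINT w|Q v. E p (E (\<lambda>x. - n x) f) w)"
  by (rule integral_add_jumps_nonneg[OF v vp p _ gb]) (simp add: p_def)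
 also have "\<dots> = (LINT w|Q v. E h f w)"
 proof (intro lint_cong refl)
  fix w assume "w \<in> space (Q v)"
  then show "E p (E (\<lambda>x. - n x) f) w = E h f w"
   using E_add[OF f p(1) nn, of w] by (simp only: hp[symmetric] space_Q[OF v])
 qed
 finally show ?thesis .
qed

end

section \<open>Square-integrable changes of intensity\<close>

text \<open>The intensity with density r (1 + u); the final - 1 translates it to the index of the
  family. A reference density r other than 1 occurs when only a part of the reference intensity is
  present.\<close>

abbreviation tilt :: "('a => real) => ('a => real) => 'a => real" where
 "tilt r u \<equiv> \<lambda>x. r x * (1 + u x) - 1"

declare measurable_path_eval[measurable del]

lemma cutoff_mono: "m \<le> k ==> cutoff m \<subseteq> cutoff k"
 unfolding cutoff_def by (auto intro: le_less_trans[rotated] simp: frac_le)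

context perturbed_family
begin

text \<open>The squared distance, in L^2 of the Poisson law with density r, of the likelihood ratios
  for the tilts by u and v; each exponential is one inner product.\<close>

definition cs_factor :: "('a => real) => ('a => real) => ('a => real) => real" where
 "cs_factor r u v = exp (T * (LINT x|\<nu>. r x * (u x * u x))) - 2 * exp (T * (LINT x|\<nu>. r x * (u x * v x))) + exp (T * (LINT x|\<nu>. r x * (v x * v x)))"

lemma admissibleI:
 "v \<in> borel_measurable borel ==> AE x in \<nu>. - 1 \<le> v x ==> integrable \<nu> (\<lambda>x. min (norm x) 1 * v x) ==> admissible \<nu> v"
 by (simp add: admissible_def)

lemma
 assumes "admissible \<nu> v"
 shows admissible_measurable: "v \<in> borel_measurable borel"
  and admissible_ge: "AE x in \<nu>. - 1 \<le> v x"
  and admissible_integrable: "integrable \<nu> (\<lambda>x. min (norm x) 1 * v x)"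
 using assms by (auto simp: admissible_def)

lemma integrable_min_mult:
 assumes "integrable \<nu> k" "k \<in> borel_measurable borel" shows "integrable \<nu> (\<lambda>x. min (norm x) 1 * k x)"
proof -
 note [measurable] = assms(2)
 have "(\<lambda>x. min (norm x) 1 * k x) \<in> borel_measurable borel" by measurable
 from borel_nu[OF this] show ?thesis
  by (rule integrable_le[OF assms(1)]) (auto simp: abs_mult intro!: mult_left_le_one_le)
qed

lemma integrable_indicator_cutoff: "integrable \<nu> (indicator (cutoff m) :: 'a => real)"
 using levy_measure_emeasure_norm_gt[OF levy, of "1 / real (Suc m)"] sets_nu cutoff_borel[of m]
 by (intro integrable_real_indicator) (auto simp: cutoff_def)

text \<open>On the cutoff region (m + 1) min (|x|, 1) is at least 1, so the weighted condition there
  controls h itself.\<close>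

lemma integrable_cutoff:
 assumes h: "h \<in> borel_measurable borel" "integrable \<nu> (\<lambda>x. min (norm x) 1 * h x)"
 shows "integrable \<nu> (\<lambda>x. indicator (cutoff m) x * h x)"
proof -
 note [measurable] = h(1)
 have "(\<lambda>x. indicator (cutoff m) x * h x) \<in> borel_measurable borel" by measurable
 note m = borel_nu[OF this]
 show ?thesis
 proof (rule integrable_le[OF integrable_mult_right[OF h(2), of "real (Suc m)"] m])
  show "AE x in \<nu>. norm (indicator (cutoff m) x * h x) \<le> norm (real (Suc m) * (min (norm x) 1 * h x))"
  proof (rule AE_I2)
   fix x :: 'a
   have "1 \<le> real (Suc m) * min (norm x) 1" if "x \<in> cutoff m"
    using that by (auto simp: cutoff_def min_def field_simps)
   then have "1 * \<bar>h x\<bar> \<le> real (Suc m) * min (norm x) 1 * \<bar>h x\<bar>" if "x \<in> cutoff m"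
    using that by (intro mult_right_mono) auto
   then show "norm (indicator (cutoff m) x * h x) \<le> norm (real (Suc m) * (min (norm x) 1 * h x))"
    by (auto simp: indicator_def abs_mult mult.assoc)
  qed
 qed
qed

lemma integrable_weighted_mult:
 fixes r u v :: "'a => real"
 assumes [measurable]: "r \<in> borel_measurable borel" "u \<in> borel_measurable borel" "v \<in> borel_measurable borel"
  and r: "\<And>x. 0 \<le> r x" and u: "integrable \<nu> (\<lambda>x. r x * (u x * u x))" and v: "integrable \<nu> (\<lambda>x. r x * (v x * v x))"
 shows "integrable \<nu> (\<lambda>x. r x * (u x * v x))"
proof -
 have "(\<lambda>x. r x * (u x * v x)) \<in> borel_measurable borel" by measurable
 note m = borel_nu[OF this]
 have "integrable \<nu> (\<lambda>x. r x * (u x * u x) + r x * (v x * v x))" using u v by simp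
 then show ?thesis
 proof (rule integrable_le[OF _ m], intro AE_I2)
  fix x
  have "\<bar>u x * v x\<bar> \<le> u x * u x + v x * v x"
   using weighted_AM_GM[of 1 "u x" "v x"] zero_le_power2[of "u x"] zero_le_power2[of "v x"] by (simp add: power2_eq_square)
  then have "r x * \<bar>u x * v x\<bar> \<le> r x * (u x * u x + v x * v x)" using r by (rule mult_left_mono)
  then show "norm (r x * (u x * v x)) \<le> norm (r x * (u x * u x) + r x * (v x * v x))"
   using r[of x] by (simp add: abs_mult distrib_left)
 qed
qed

text \<open>The factor k moves from the integrand into the measure. A density of finite activity
  thereby becomes the finite base intensity over which the Cauchy-Schwarz bound was shown.\<close>

lemma E_eq_density:
 assumes k: "k \<in> borel_measurable borel" "integrable \<nu> k" "AE x in \<nu>. 0 \<le> k x" and a: "a \<in> borel_measurable borel"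
  and ka: "integrable \<nu> (\<lambda>x. k x * a x)" and f: "f \<in> bmf path_space" and w: "w \<in> cadlag"
 shows "E (\<lambda>x. k x * a x) f w = opexp (jump_op 1 (density (intensity_upto T \<nu>) (\<lambda>p. ennreal (k (snd p)))) (\<lambda>p. a (snd p))) f w"
proof -
 note ki = integral_intensity_snd(1)[OF levy T k(2)]
 interpret K: jump_measure "density (intensity_upto T \<nu>) (\<lambda>p. ennreal (k (snd p)))" by (rule jump_measure_density[OF ki])
 note [measurable] = measurable_intensity_snd[OF levy T k(1)] measurable_intensity_snd[OF levy T a]
 note k0 = AE_intensity_snd[OF levy T k(3)]
 have ai: "integrable (density (intensity_upto T \<nu>) (\<lambda>p. ennreal (k (snd p)))) (\<lambda>p. a (snd p))"
  using integral_intensity_snd(1)[OF levy T ka] k0 by (subst integrable_density) auto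
 show ?thesis
  using w k0 by (intro opexp_cong[OF bounded_op_jump_op[OF integral_intensity_snd(1)[OF levy T ka]] K.bounded_op_jump_op[OF ai] _ f])
   (auto simp: space_path_space jump_op_density)
qed

lemma integral_density_snd:
 assumes k: "k \<in> borel_measurable borel" "AE x in \<nu>. 0 \<le> k x" and a: "a \<in> borel_measurable borel"
  and ka: "integrable \<nu> (\<lambda>x. k x * a x)"
 shows "integrable (density (intensity_upto T \<nu>) (\<lambda>p. ennreal (k (snd p)))) (\<lambda>p. a (snd p))"
  and "(LINT p|density (intensity_upto T \<nu>) (\<lambda>p. ennreal (k (snd p))). a (snd p)) = T * (LINT x|\<nu>. k x * a x)"
proof -
 note [measurable] = measurable_intensity_snd[OF levy T k(1)] measurable_intensity_snd[OF levy T a]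
 note k0 = AE_intensity_snd[OF levy T k(2)]
 show "integrable (density (intensity_upto T \<nu>) (\<lambda>p. ennreal (k (snd p)))) (\<lambda>p. a (snd p))"
  using integral_intensity_snd(1)[OF levy T ka] k0 by (subst integrable_density) auto
 show "(LINT p|density (intensity_upto T \<nu>) (\<lambda>p. ennreal (k (snd p))). a (snd p)) = T * (LINT x|\<nu>. k x * a x)"
  using integral_intensity_snd(2)[OF levy T ka] k0 by (subst integral_density) auto
qed

text \<open>All three laws arise from one law, in which the jumps of the cutoff region are absent,
  by adding jumps of finite activity: with density k for the reference and k (1 + u) for the tilts.
  The pointwise inequality for added configurations is then integrated over that law.\<close>

lemma cs_bound_cutoff:
 assumes r[measurable]: "r \<in> borel_measurable borel" and r0: "\<And>x. 0 \<le> r x" and ar: "admissible \<nu> (\<lambda>x. r x - 1)"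
  and u[measurable]: "u1 \<in> borel_measurable borel" "u2 \<in> borel_measurable borel"
  and a1: "admissible \<nu> (tilt r u1)" and a2: "admissible \<nu> (tilt r u2)"
  and i1: "integrable \<nu> (\<lambda>x. r x * (u1 x * u1 x))" and i2: "integrable \<nu> (\<lambda>x. r x * (u2 x * u2 x))"
  and z1: "\<And>x. x \<notin> cutoff m ==> u1 x = 0" and z2: "\<And>x. x \<notin> cutoff m ==> u2 x = 0"
  and f: "f \<in> bmf path_space"
 shows "((LINT w|Q (tilt r u1). f w) - (LINT w|Q (tilt r u2). f w))\<^sup>2
  \<le> (LINT w|Q (\<lambda>x. r x - 1). (f w)\<^sup>2) * cs_factor r u1 u2"
proof -
 let ?B = "cutoff m :: 'a set"
 define k where "k x = indicator ?B x * r x" for x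
 \<comment> \<open>On the cutoff region p equals - 1, which means intensity zero; elsewhere it
   equals r - 1.\<close>
 define p where "p x = r x - 1 - k x" for x
 define h where "h u x = k x * (1 + u x)" for u x
 have [measurable]: "k \<in> borel_measurable borel" "p \<in> borel_measurable borel" unfolding k_def[abs_def] p_def[abs_def] by measurable
 have hm[measurable]: "h u \<in> borel_measurable borel" if "u \<in> borel_measurable borel" for u
  using that unfolding h_def[abs_def] by measurable
 have k0: "0 \<le> k x" for x using r0 by (simp add: k_def)
 have ki: "integrable \<nu> k"
  using integrable_cutoff[OF admissible_measurable[OF ar] admissible_integrable[OF ar], of m] integrable_indicator_cutoff[of m]
  unfolding k_def[abs_def] by (simp add: right_diff_distrib) (metis (no_types, lifting) integrable_plus Bochner_Integration.integrable_cong diff_add_cancel)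
 have hi: "integrable \<nu> (h u)" if "admissible \<nu> (tilt r u)" for u
 proof -
  have "integrable \<nu> (\<lambda>x. indicator ?B x * (r x * (1 + u x) - 1) + indicator ?B x)"
   using integrable_cutoff[OF admissible_measurable[OF that] admissible_integrable[OF that], of m] integrable_indicator_cutoff[of m]
   by (rule integrable_plus)
  moreover have "(\<lambda>x. indicator ?B x * (r x * (1 + u x) - 1) + indicator ?B x) = h u"
   by (auto simp: h_def k_def algebra_simps)
  ultimately show ?thesis by simp
 qed
 have ap: "admissible \<nu> p"
 proof (rule admissibleI)
  show "AE x in \<nu>. - 1 \<le> p x" using r0 by (auto simp: p_def k_def indicator_def)
  have "integrable \<nu> (\<lambda>x. min (norm x) 1 * (r x - 1) - min (norm x) 1 * k x)"
   by (intro Bochner_Integration.integrable_diff admissible_integrable[OF ar] integrable_min_mult ki) measurable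
  then show "integrable \<nu> (\<lambda>x. min (norm x) 1 * p x)" by (simp add: p_def right_diff_distrib)
 qed measurable
 have ph: "(tilt r u) = (\<lambda>x. p x + h u x)" if "\<And>x. x \<notin> ?B ==> u x = 0" for u
 proof
  fix x show "r x * (1 + u x) - 1 = p x + h u x"
   using that[of x] by (cases "x \<in> ?B") (auto simp: p_def h_def k_def)
 qed
 have ph1: "(tilt r u1) = (\<lambda>x. p x + h u1 x)" by (rule ph) (rule z1)
 have ph2: "(tilt r u2) = (\<lambda>x. p x + h u2 x)" by (rule ph) (rule z2)
 have pk: "(\<lambda>x. r x - 1) = (\<lambda>x. p x + k x)" by (simp add: p_def)
 have Q1: "(LINT w|Q (tilt r u1). f w) = (LINT w|Q p. E (h u1) f w)"
  using a1 unfolding ph1 by (intro integral_add_jumps ap hi[OF a1] f hm u) auto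
 have Q2: "(LINT w|Q (tilt r u2). f w) = (LINT w|Q p. E (h u2) f w)"
  using a2 unfolding ph2 by (intro integral_add_jumps ap hi[OF a2] f hm u) auto
 have Qr: "(LINT w|Q (\<lambda>x. r x - 1). g w) = (LINT w|Q p. E k g w)" if "g \<in> bmf path_space" for g
  using ar unfolding pk by (intro integral_add_jumps ap ki that) auto
 define D where "D w = E (h u1) f w - E (h u2) f w" for w
 have Db: "D \<in> bmf path_space" unfolding D_def[abs_def] by (intro bmf_diff E_bmf hi a1 a2 f)
 define K where "K = density (intensity_upto T \<nu>) (\<lambda>p. ennreal (k (snd p)))"
 note kis = integral_intensity_snd(1)[OF levy T ki]
 interpret K: jump_measure K unfolding K_def by (rule jump_measure_density[OF kis])
 have finK: "finite_measure K" unfolding K_def by (rule jump_measure_density[OF kis])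
 have kAE: "AE x in \<nu>. 0 \<le> k x" using k0 by simp
 have kuu: "k x * (a x * b x) = r x * (a x * b x)" if "\<And>x. x \<notin> ?B ==> a x = 0" for a b :: "'a => real" and x
  using that[of x] by (cases "x \<in> ?B") (auto simp: k_def)
 have i12: "integrable \<nu> (\<lambda>x. r x * (u1 x * u2 x))" by (rule integrable_weighted_mult[OF r u r0 i1 i2])
 have Ksq: "integrable K (\<lambda>p. (1 + u (snd p))\<^sup>2)"
  if "\<And>x. x \<notin> ?B ==> u x = 0" "integrable \<nu> (\<lambda>x. r x * (u x * u x))" "admissible \<nu> (tilt r u)" "u \<in> borel_measurable borel" for u
 proof -
  note [measurable] = that(4)
  have "integrable \<nu> (\<lambda>x. 2 * h u x - k x + k x * (u x * u x))"
  proof -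
   have e: "k x * (u x * u x) = r x * (u x * u x)" for x by (rule kuu) (rule that(1))
   show ?thesis unfolding e using hi[OF that(3)] ki that(2)
    by (intro integrable_plus Bochner_Integration.integrable_diff integrable_mult_right)
  qed
  moreover have "(\<lambda>x. 2 * h u x - k x + k x * (u x * u x)) = (\<lambda>x. k x * (1 + u x)\<^sup>2)"
   by (auto simp: h_def power2_eq_square algebra_simps)
  ultimately have "integrable \<nu> (\<lambda>x. k x * (1 + u x)\<^sup>2)" by simp
  then show ?thesis unfolding K_def by (intro integral_density_snd(1)[where a = "\<lambda>x. (1 + u x)\<^sup>2"] kAE) measurable
 qed
 have Kint: "(LINT p|K. a (snd p) * b (snd p)) = T * (LINT x|\<nu>. r x * (a x * b x))"
  if "\<And>x. x \<notin> ?B ==> a x = 0" "integrable \<nu> (\<lambda>x. r x * (a x * b x))" "a \<in> borel_measurable borel" "b \<in> borel_measurable borel" for a b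
 proof -
  note [measurable] = that(3,4)
  have e: "k x * (a x * b x) = r x * (a x * b x)" for x by (rule kuu) (rule that(1))
  have "integrable \<nu> (\<lambda>x. k x * (a x * b x))" using that(2) unfolding e .
  from integral_density_snd(2)[OF _ kAE _ this] show ?thesis unfolding K_def e by simp
 qed
 have EK: "E (h u) f w = opexp (jump_op 1 K (\<lambda>p. 1 + u (snd p))) f w"
  if "w \<in> cadlag" "admissible \<nu> (tilt r u)" "u \<in> borel_measurable borel" for u w
 proof -
  note [measurable] = that(3)
  show ?thesis unfolding h_def[abs_def] K_def
   by (rule E_eq_density[OF _ ki kAE _ _ f that(1)]) (use hi[OF that(2)] in \<open>auto simp: h_def[abs_def]\<close>)
 qed
 have Ek1: "E k g w = opexp (jump_op 1 K (\<lambda>_. 1)) g w" if "g \<in> bmf path_space" "w \<in> cadlag" for g w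
  using E_eq_density[OF _ ki kAE, of "\<lambda>_. 1" g w] that ki by (simp add: K_def)
 have mK: "(\<lambda>p. 1 + u (snd p)) \<in> borel_measurable K" if "u \<in> borel_measurable borel" for u :: "'a => real"
  using measurable_intensity_snd[OF levy T that] by (simp add: K_def)
 have pt: "(D w)\<^sup>2 \<le> E k (\<lambda>w. (f w)\<^sup>2) w * cs_factor r u1 u2" if w: "w \<in> cadlag" for w
 proof -
  have "(D w)\<^sup>2 \<le> opexp (jump_op 1 K (\<lambda>_. 1)) (\<lambda>w. (f w)\<^sup>2) w *
   (exp (LINT z|K. (1 + u1 (snd z) - 1)\<^sup>2) - 2 * exp (LINT z|K. (1 + u1 (snd z) - 1) * (1 + u2 (snd z) - 1)) + exp (LINT z|K. (1 + u2 (snd z) - 1)\<^sup>2))"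
   unfolding D_def EK[OF w a1 u(1)] EK[OF w a2 u(2)]
   by (rule K.opexp_cauchy_schwarz[OF finK mK[OF u(1)] mK[OF u(2)] Ksq[OF z1 i1 a1 u(1)] Ksq[OF z2 i2 a2 u(2)] f w])
  also have "\<dots> = E k (\<lambda>w. (f w)\<^sup>2) w * cs_factor r u1 u2"
   unfolding Ek1[OF bmf_power2[OF f] w] cs_factor_def
   using Kint[OF z1 i1 u(1) u(1)] Kint[OF z1 i12 u(1) u(2)] Kint[OF z2 i2 u(2) u(2)]
   by (simp add: power2_eq_square)
  finally show ?thesis .
 qed
 interpret Qp: prob_space "Q p" by (rule Q_prob[OF ap])
 note bi = bmf_integrable_Q[OF ap]
 \<comment> \<open>Jensen's inequality, as Cauchy-Schwarz against the constant 1 under a probability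
   measure.\<close>
 have "(LINT w|Q p. D w * 1)\<^sup>2 \<le> (LINT w|Q p. (D w)\<^sup>2) * (LINT w|Q p. 1\<^sup>2)"
  using bi[OF Db] bi[OF bmf_power2[OF Db]] by (intro integral_Cauchy_Schwarz) auto
 also have "\<dots> = (LINT w|Q p. (D w)\<^sup>2)" using Qp.prob_space by simp
 also have "\<dots> \<le> (LINT w|Q p. E k (\<lambda>w. (f w)\<^sup>2) w * cs_factor r u1 u2)"
  by (intro integral_mono bi bmf_power2 Db bmf_mult[OF E_bmf[OF ki bmf_power2[OF f]] bmf_const]) (simp add: pt space_Q[OF ap])
 also have "\<dots> = (LINT w|Q (\<lambda>x. r x - 1). (f w)\<^sup>2) * cs_factor r u1 u2"
  unfolding Qr[OF bmf_power2[OF f]] by simp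
 finally have *: "(LINT w|Q p. D w)\<^sup>2 \<le> (LINT w|Q (\<lambda>x. r x - 1). (f w)\<^sup>2) * cs_factor r u1 u2" by simp
 show ?thesis unfolding Q1 Q2
  using * bi[OF E_bmf[OF hi[OF a1] f]] bi[OF E_bmf[OF hi[OF a2] f]] by (simp add: D_def[abs_def])
qed


text \<open>Restricting the relative density to a cutoff region makes the jump activity of the perturbation finite;
 the resulting laws converge setwise, and the limit is identified by its trigonometric moments.\<close>

definition restrict_to :: "nat => ('a => real) => 'a => real" where
 "restrict_to m u x = indicator (cutoff m) x * u x"

context
 fixes r :: "'a => real"
 assumes r[measurable]: "r \<in> borel_measurable borel" and r0: "\<And>x. 0 \<le> r x" and ar: "admissible \<nu> (\<lambda>x. r x - 1)"
begin

lemma restrict_to_measurable: "u \<in> borel_measurable borel ==> restrict_to m u \<in> borel_measurable borel"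
 unfolding restrict_to_def[abs_def] by measurable

lemma restrict_to_admissible:
 assumes u[measurable]: "u \<in> borel_measurable borel" and a: "admissible \<nu> (tilt r u)"
 shows "admissible \<nu> (tilt r (restrict_to m u))"
proof (rule admissibleI)
 note [measurable] = restrict_to_measurable[OF u]
 show "(tilt r (restrict_to m u)) \<in> borel_measurable borel" by measurable
 show "AE x in \<nu>. - 1 \<le> r x * (1 + restrict_to m u x) - 1"
  using admissible_ge[OF a] by eventually_elim (use r0 in \<open>auto simp: restrict_to_def indicator_def\<close>)
 have "integrable \<nu> (\<lambda>x. indicator (cutoff m) x * ((r x * (1 + u x) - 1) - (r x - 1)))"
 proof (rule integrable_cutoff)
  show "integrable \<nu> (\<lambda>x. min (norm x) 1 * ((r x * (1 + u x) - 1) - (r x - 1)))"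
   using Bochner_Integration.integrable_diff[OF admissible_integrable[OF a] admissible_integrable[OF ar]]
   by (simp add: right_diff_distrib)
 qed measurable
 then have "integrable \<nu> (\<lambda>x. indicator (cutoff m) x * (r x * u x))" by (simp add: algebra_simps)
 then have "integrable \<nu> (\<lambda>x. min (norm x) 1 * (indicator (cutoff m) x * (r x * u x)))"
  by (rule integrable_min_mult) measurable
 then have "integrable \<nu> (\<lambda>x. min (norm x) 1 * (r x - 1) + min (norm x) 1 * (indicator (cutoff m) x * (r x * u x)))"
  by (rule integrable_plus[OF admissible_integrable[OF ar]])
 then show "integrable \<nu> (\<lambda>x. min (norm x) 1 * (r x * (1 + restrict_to m u x) - 1))"
  by (simp add: restrict_to_def algebra_simps)
qed

lemma restrict_to_mult_integrable:
 assumes [measurable]: "u \<in> borel_measurable borel" "v \<in> borel_measurable borel" and i: "integrable \<nu> (\<lambda>x. r x * (u x * v x))"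
 shows "integrable \<nu> (\<lambda>x. r x * (restrict_to m u x * restrict_to k v x))"
proof -
 have "(\<lambda>x. r x * (restrict_to m u x * restrict_to k v x)) \<in> borel_measurable borel"
  unfolding restrict_to_def[abs_def] by measurable
 from borel_nu[OF this] show ?thesis
  by (rule integrable_le[OF i]) (auto simp: restrict_to_def indicator_def)
qed

lemma restrict_to_tendsto:
 assumes [measurable]: "u \<in> borel_measurable borel" "v \<in> borel_measurable borel" and i: "integrable \<nu> (\<lambda>x. r x * (u x * v x))"
 shows "(\<lambda>m. \<integral>x. r x * (restrict_to m u x * restrict_to m v x) \<partial>\<nu>) \<longlonglongrightarrow> (LINT x|\<nu>. r x * (u x * v x))"
proof -
 have e: "r x * (restrict_to m u x * restrict_to m v x) = indicator (cutoff m) x *\<^sub>R (r x * (u x * v x))" for m x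
  by (simp add: restrict_to_def indicator_def)
 have "(\<lambda>x. x) \<in> borel_measurable \<nu>" by (rule measurable_ident_sets[OF sets_nu])
 then show ?thesis unfolding e
  by (rule integral_cutoff_tendsto[OF i _ levy_measure_AE_nonzero[OF levy]])
qed

text \<open>Two different cutoffs are compared inside the larger of the two regions, outside of
  which both functions vanish.\<close>

lemma cs_bound_restrict:
 assumes u1: "u1 \<in> borel_measurable borel" "admissible \<nu> (tilt r u1)" "integrable \<nu> (\<lambda>x. r x * (u1 x * u1 x))"
  and u2: "u2 \<in> borel_measurable borel" "admissible \<nu> (tilt r u2)" "integrable \<nu> (\<lambda>x. r x * (u2 x * u2 x))"
  and f: "f \<in> bmf path_space"
 shows "((LINT w|Q (tilt r (restrict_to m u1)). f w) - (LINT w|Q (tilt r (restrict_to k u2)). f w))\<^sup>2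
  \<le> (LINT w|Q (\<lambda>x. r x - 1). (f w)\<^sup>2) * cs_factor r (restrict_to m u1) (restrict_to k u2)"
proof (rule cs_bound_cutoff[OF r r0 ar])
 have mk: "cutoff m \<subseteq> (cutoff (max m k) :: 'a set)" "cutoff k \<subseteq> (cutoff (max m k) :: 'a set)" by (auto intro!: cutoff_mono)
 show "x \<notin> cutoff (max m k) ==> restrict_to m u1 x = 0" "x \<notin> cutoff (max m k) ==> restrict_to k u2 x = 0" for x
  using mk by (auto simp: restrict_to_def indicator_def)
qed (auto intro!: restrict_to_measurable restrict_to_admissible restrict_to_mult_integrable u1 u2 f)

text \<open>The Cauchy-Schwarz bound between two cutoffs makes the integrals of each bounded
  function a Cauchy sequence. The comparison with u = 0 controls them by the reference law uniformly
  in the cutoff, which gives the limit functional its continuity along decreasing sets.\<close>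

lemma restrict_laws_tendsto:
 assumes u[measurable]: "u \<in> borel_measurable borel" and a: "admissible \<nu> (tilt r u)"
  and i: "integrable \<nu> (\<lambda>x. r x * (u x * u x))" and f: "f \<in> bmf path_space"
 shows "(\<lambda>m. \<integral>w. f w \<partial>Q (tilt r (restrict_to m u))) \<longlonglongrightarrow> (LINT w|Q (tilt r u). f w)"
proof -
 define v where "v m x = r x * (1 + restrict_to m u x) - 1" for m x
 have av: "admissible \<nu> (v m)" for m unfolding v_def[abs_def] by (rule restrict_to_admissible[OF u a])
 define s where "s m = T * (LINT x|\<nu>. r x * (restrict_to m u x * restrict_to m u x))" for m
 define S where "S = T * (LINT x|\<nu>. r x * (u x * u x))"
 interpret Qr: prob_space "Q (\<lambda>x. r x - 1)" by (rule Q_prob[OF ar])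
 have sS: "s \<longlonglongrightarrow> S" unfolding s_def[abs_def] S_def by (intro tendsto_mult tendsto_const restrict_to_tendsto u i)
 have s_le: "s m \<le> S" for m unfolding s_def S_def
  using T r0 by (intro mult_left_mono integral_mono restrict_to_mult_integrable u i) (auto simp: restrict_to_def indicator_def)
 have diff: "((LINT w|Q (v m). g w) - (LINT w|Q (v k). g w))\<^sup>2 \<le> (LINT w|Q (\<lambda>x. r x - 1). (g w)\<^sup>2) * (exp (s k) - exp (s m))"
  if "m \<le> k" and g: "g \<in> bmf path_space" for m k g
 proof -
  \<comment> \<open>For nested cutoffs the cross term coincides with the smaller square, so the
    three exponentials collapse to exp (s k) - exp (s m).\<close>
  have e: "restrict_to m u x * restrict_to k u x = restrict_to m u x * restrict_to m u x" for x
   using cutoff_mono[OF that(1), where 'a = 'a] by (auto simp: restrict_to_def indicator_def)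
  have "cs_factor r (restrict_to m u) (restrict_to k u) = exp (s k) - exp (s m)"
   unfolding cs_factor_def e by (simp add: s_def)
  then show ?thesis using cs_bound_restrict[OF u a i u a i g, of m k] by (simp add: v_def[abs_def])
 qed
 have base: "((LINT w|Q (v m). g w) - (LINT w|Q (\<lambda>x. r x - 1). g w))\<^sup>2 \<le> (LINT w|Q (\<lambda>x. r x - 1). (g w)\<^sup>2) * exp S"
  if g: "g \<in> bmf path_space" for m g
 proof -
  have "((LINT w|Q (tilt r (restrict_to m u)). g w) - (LINT w|Q (\<lambda>x. r x * (1 + restrict_to m (\<lambda>_. 0) x) - 1). g w))\<^sup>2
   \<le> (LINT w|Q (\<lambda>x. r x - 1). (g w)\<^sup>2) * cs_factor r (restrict_to m u) (restrict_to m (\<lambda>_. 0))"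
   using ar by (intro cs_bound_restrict u a i g) auto
  also have "cs_factor r (restrict_to m u) (restrict_to m (\<lambda>_. 0)) = exp (s m) - 1"
   by (simp add: cs_factor_def s_def restrict_to_def)
  finally have "((LINT w|Q (v m). g w) - (LINT w|Q (\<lambda>x. r x - 1). g w))\<^sup>2 \<le> (LINT w|Q (\<lambda>x. r x - 1). (g w)\<^sup>2) * (exp (s m) - 1)"
   by (simp add: v_def[abs_def] restrict_to_def)
  also have "\<dots> \<le> (LINT w|Q (\<lambda>x. r x - 1). (g w)\<^sup>2) * exp S"
  proof (rule mult_left_mono)
   have "exp (s m) \<le> exp S" using s_le by simp
   then show "exp (s m) - 1 \<le> exp S" by linarith
  qed simp
  finally show ?thesis .
 qed
 have Cau: "Cauchy (\<lambda>m. \<integral>w. g w \<partial>Q (v m))" if g: "g \<in> bmf path_space" for g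
 proof (rule metric_CauchyI)
  fix e :: real assume e: "0 < e"
  define q where "q = (LINT w|Q (\<lambda>x. r x - 1). (g w)\<^sup>2) + 1"
  have q: "0 < q" unfolding q_def by (intro add_nonneg_pos) auto
  have "Cauchy (\<lambda>m. exp (s m))" by (rule LIMSEQ_imp_Cauchy[OF tendsto_exp[OF sS]])
  from metric_CauchyD[OF this, of "e\<^sup>2 / q"] e q obtain M where
   M: "\<And>m n. m \<ge> M ==> n \<ge> M ==> dist (exp (s m)) (exp (s n)) < e\<^sup>2 / q" by auto
  have *: "dist (LINT w|Q (v m). g w) (LINT w|Q (v k). g w) < e" if "m \<ge> M" "m \<le> k" for m k
  proof -
   have "((LINT w|Q (v m). g w) - (LINT w|Q (v k). g w))\<^sup>2 \<le> (q - 1) * \<bar>exp (s k) - exp (s m)\<bar>"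
    using diff[OF that(2) g] by (rule order_trans) (auto simp: q_def intro!: mult_left_mono)
   also have "\<dots> \<le> q * \<bar>exp (s k) - exp (s m)\<bar>" by (intro mult_right_mono) auto
   also have "\<dots> < q * (e\<^sup>2 / q)" using M[of k m] that q by (intro mult_strict_left_mono) (auto simp: dist_real_def)
   finally have "\<bar>(LINT w|Q (v m). g w) - (LINT w|Q (v k). g w)\<bar>\<^sup>2 < e\<^sup>2" using q by simp
   from power_less_imp_less_base[OF this] e show ?thesis by (simp add: dist_real_def)
  qed
  show "\<exists>M. \<forall>m\<ge>M. \<forall>n\<ge>M. dist (LINT w|Q (v m). g w) (LINT w|Q (v n). g w) < e"
   using * by (intro exI[of _ M]) (metis dist_commute nat_le_linear)
 qed
 define \<Phi> :: "((real => 'a) => real) => real" where "\<Phi> g = lim (\<lambda>m. \<integral>w. g w \<partial>Q (v m))" for g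
 have lim: "(\<lambda>m. \<integral>w. g w \<partial>Q (v m)) \<longlonglongrightarrow> \<Phi> g" if "g \<in> bmf path_space" for g
  unfolding \<Phi>_def using Cau[OF that] Cauchy_convergent_iff convergent_LIMSEQ_iff by blast
 obtain R where R: "prob_space R" "sets R = sets path_space" "\<And>g. g \<in> bmf path_space ==> integral\<^sup>L R g = \<Phi> g"
 proof (rule functional_measureE[of path_space \<Phi>])
  show "\<Phi> (\<lambda>w. g w + h w) = \<Phi> g + \<Phi> h" if "g \<in> bmf path_space" "h \<in> bmf path_space" for g h
  proof (rule LIMSEQ_unique[OF lim[OF bmf_add[OF that]]])
   show "(\<lambda>m. \<integral>w. g w + h w \<partial>Q (v m)) \<longlonglongrightarrow> \<Phi> g + \<Phi> h"
    using tendsto_add[OF lim[OF that(1)] lim[OF that(2)]] bmf_integrable_Q[OF av that(1)] bmf_integrable_Q[OF av that(2)] by simp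
  qed
  show "\<Phi> (\<lambda>w. b * g w) = b * \<Phi> g" if "g \<in> bmf path_space" for g b
   using LIMSEQ_unique[OF lim[OF bmf_cmult[OF that]]] tendsto_mult[OF tendsto_const lim[OF that]] by simp
  show "0 \<le> \<Phi> g" if "g \<in> bmf path_space" "\<And>w. w \<in> space path_space ==> 0 \<le> g w" for g
   using that by (intro LIMSEQ_le_const[OF lim[OF that(1)]] exI[of _ 0] allI impI Bochner_Integration.integral_nonneg)
    (auto simp: space_Q[OF av] space_path_space)
  show "\<Phi> (\<lambda>_. 1) = 1"
  proof (rule LIMSEQ_unique[OF lim[OF bmf_const]])
   have "(LINT w|Q (v m). 1) = (1::real)" for m
    using prob_space.prob_space[OF Q_prob[OF av]] by simp
   then show "(\<lambda>m. \<integral>w. 1 \<partial>Q (v m)) \<longlonglongrightarrow> (1::real)" by simp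
  qed
  show "(\<lambda>i. \<Phi> (indicator (A i))) \<longlonglongrightarrow> 0"
   if A: "range A \<subseteq> sets path_space" "decseq A" "(\<Inter>i. A i) = {}" for A :: "nat => (real => 'a) set"
  proof -
   have Ab: "indicator (A i) \<in> bmf path_space" for i using A by (intro bmf_indicator) auto
   define \<mu> where "\<mu> i = measure (Q (\<lambda>x. r x - 1)) (A i)" for i
   have \<mu>: "\<mu> \<longlonglongrightarrow> 0" unfolding \<mu>_def
    using Qr.finite_Lim_measure_decseq[of A] A Q_sets[OF ar] by simp
   have \<mu>i: "(LINT w|Q (\<lambda>x. r x - 1). indicator (A i) w) = \<mu> i" "(LINT w|Q (\<lambda>x. r x - 1). (indicator (A i) w)\<^sup>2) = \<mu> i" for i
   proof -
    have "(\<lambda>w. (indicator (A i) w)\<^sup>2) = (indicator (A i) :: _ => real)" by (auto simp: indicator_def)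
    then show "(LINT w|Q (\<lambda>x. r x - 1). indicator (A i) w) = \<mu> i" "(LINT w|Q (\<lambda>x. r x - 1). (indicator (A i) w)\<^sup>2) = \<mu> i"
     using A Q_sets[OF ar] by (auto simp: \<mu>_def)
   qed
   define d where "d i = \<Phi> (indicator (A i)) - \<mu> i" for i
   \<comment> \<open>An indicator is its own square, so the uniform bound compares the limit
     functional with the reference measure of the set, which tends to 0.\<close>
   have le: "(d i)\<^sup>2 \<le> \<mu> i * exp S" for i
   proof (rule LIMSEQ_le_const2)
    show "(\<lambda>m. ((LINT w|Q (v m). indicator (A i) w) - \<mu> i)\<^sup>2) \<longlonglongrightarrow> (d i)\<^sup>2"
     unfolding d_def by (intro tendsto_intros lim Ab)
    show "\<exists>N. \<forall>m\<ge>N. ((LINT w|Q (v m). indicator (A i) w) - \<mu> i)\<^sup>2 \<le> \<mu> i * exp S"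
     using base[OF Ab[of i]] unfolding \<mu>i by blast
   qed
   have "(\<lambda>i. \<mu> i * exp S) \<longlonglongrightarrow> 0 * exp S" by (intro tendsto_mult \<mu> tendsto_const)
   then have z: "(\<lambda>i. \<mu> i * exp S) \<longlonglongrightarrow> 0" by simp
   have "(\<lambda>i. (d i)\<^sup>2) \<longlonglongrightarrow> 0"
    by (rule tendsto_sandwich[OF always_eventually always_eventually tendsto_const z]) (simp_all add: le)
   from tendsto_real_sqrt[OF this] have "(\<lambda>i. \<bar>d i\<bar>) \<longlonglongrightarrow> 0" by (simp only: real_sqrt_abs real_sqrt_zero)
   from tendsto_add[OF tendsto_rabs_zero_cancel[OF this] \<mu>] show ?thesis by (simp add: d_def)
  qed
 qed blast
 have "R = Q (tilt r u)"
 proof (rule path_measure_eqI[OF R(1) Q_prob[OF a] R(2) Q_sets[OF a]])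
  fix y :: "real => 'a" and F :: "real set" and c :: real assume F: "finite F" "F \<subseteq> {0..}"
  define ch where "ch p = cis (phase y F p) - 1" for p :: "real \<times> 'a"
  let ?L = "intensity_upto T \<nu>"
  have i1: "integrable ?L (\<lambda>p. (r (snd p) - 1) *\<^sub>R ch p)" unfolding ch_def
   by (rule integrable_char_exponent[OF admissible_measurable[OF ar] admissible_integrable[OF ar] F(1)])
  have i2: "integrable ?L (\<lambda>p. (r (snd p) * (1 + u (snd p)) - 1) *\<^sub>R ch p)" unfolding ch_def
   by (rule integrable_char_exponent[OF admissible_measurable[OF a] admissible_integrable[OF a] F(1)])
  have "integrable ?L (\<lambda>p. (r (snd p) * (1 + u (snd p)) - 1) *\<^sub>R ch p - (r (snd p) - 1) *\<^sub>R ch p)" by (rule Bochner_Integration.integrable_diff[OF i2 i1])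
  then have i3: "integrable ?L (\<lambda>p. (r (snd p) * u (snd p)) *\<^sub>R ch p)" by (simp add: scaleR_diff_left[symmetric] algebra_simps)
  have sndm: "snd \<in> borel_measurable ?L"
   using measurable_compose[OF measurable_jump_id, of snd borel] by simp
  have i4: "integrable ?L (\<lambda>p. indicator (cutoff m) (snd p) *\<^sub>R ((r (snd p) * u (snd p)) *\<^sub>R ch p))" for m
  proof -
   have [measurable]: "snd \<in> borel_measurable ?L" by (rule sndm)
   have "(\<lambda>p. (r (snd p) * u (snd p)) *\<^sub>R ch p) \<in> borel_measurable ?L" using i3 by auto
   note [measurable] = this
   show ?thesis by (rule integrable_le[OF i3]) (measurable, auto simp: indicator_def)
  qed
  have lim3: "(\<lambda>m. \<integral>p. indicator (cutoff m) (snd p) *\<^sub>R ((r (snd p) * u (snd p)) *\<^sub>R ch p) \<partial>?L) \<longlonglongrightarrow> (LINT p|?L. (r (snd p) * u (snd p)) *\<^sub>R ch p)"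
   by (rule integral_cutoff_tendsto[OF i3 sndm AE_intensity_snd[OF levy T levy_measure_AE_nonzero[OF levy]]])
  have e1: "(LINT p|?L. v m (snd p) *\<^sub>R ch p) = (LINT p|?L. (r (snd p) - 1) *\<^sub>R ch p) + (LINT p|?L. indicator (cutoff m) (snd p) *\<^sub>R ((r (snd p) * u (snd p)) *\<^sub>R ch p))" for m
   unfolding lint_add[OF i1 i4, symmetric]
   by (intro lint_cong refl) (simp add: v_def restrict_to_def scaleR_add_left[symmetric] algebra_simps del: scaleR_add_left)
  have e2: "(LINT p|?L. (r (snd p) * (1 + u (snd p)) - 1) *\<^sub>R ch p) = (LINT p|?L. (r (snd p) - 1) *\<^sub>R ch p) + (LINT p|?L. (r (snd p) * u (snd p)) *\<^sub>R ch p)"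
   unfolding lint_add[OF i1 i3, symmetric]
   by (intro lint_cong refl) (simp add: scaleR_add_left[symmetric] algebra_simps del: scaleR_add_left)
  have "(\<lambda>m. \<integral>w. trig y F c w \<partial>Q (v m)) \<longlonglongrightarrow> (LINT w|Q (tilt r u). trig y F c w)"
   unfolding Q_trig[OF av F] Q_trig[OF a F] ch_def[symmetric] e1 e2
   by (intro tendsto_Re tendsto_mult tendsto_const tendsto_exp tendsto_add lim3)
  from LIMSEQ_unique[OF this lim[OF trig_bmf]] R(3)[OF trig_bmf]
  show "integral\<^sup>L R (trig y F c) = integral\<^sup>L (Q (tilt r u)) (trig y F c)" by simp
 qed
 then show ?thesis using lim[OF f] R(3)[OF f] by (simp add: v_def[abs_def])
qed

text \<open>Both sides pass to the limit in the cutoff: the laws by the convergence just shown, the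
  inner products by dominated convergence.\<close>

theorem cs_bound:
 assumes u1: "u1 \<in> borel_measurable borel" "admissible \<nu> (tilt r u1)" "integrable \<nu> (\<lambda>x. r x * (u1 x * u1 x))"
  and u2: "u2 \<in> borel_measurable borel" "admissible \<nu> (tilt r u2)" "integrable \<nu> (\<lambda>x. r x * (u2 x * u2 x))"
  and f: "f \<in> bmf path_space"
 shows "((LINT w|Q (tilt r u1). f w) - (LINT w|Q (tilt r u2). f w))\<^sup>2
  \<le> (LINT w|Q (\<lambda>x. r x - 1). (f w)\<^sup>2) * cs_factor r u1 u2"
proof (rule LIMSEQ_le)
 show "(\<lambda>m. ((LINT w|Q (tilt r (restrict_to m u1)). f w) - (LINT w|Q (tilt r (restrict_to m u2)). f w))\<^sup>2)
  \<longlonglongrightarrow> ((LINT w|Q (tilt r u1). f w) - (LINT w|Q (tilt r u2). f w))\<^sup>2"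
  by (intro tendsto_power tendsto_diff restrict_laws_tendsto u1 u2 f)
 show "(\<lambda>m. (LINT w|Q (\<lambda>x. r x - 1). (f w)\<^sup>2) * cs_factor r (restrict_to m u1) (restrict_to m u2))
  \<longlonglongrightarrow> (LINT w|Q (\<lambda>x. r x - 1). (f w)\<^sup>2) * cs_factor r u1 u2"
  unfolding cs_factor_def
  by (intro tendsto_intros restrict_to_tendsto u1 u2 integrable_weighted_mult[OF r _ _ r0])
 show "\<exists>N. \<forall>m\<ge>N. ((LINT w|Q (tilt r (restrict_to m u1)). f w) - (LINT w|Q (tilt r (restrict_to m u2)). f w))\<^sup>2
  \<le> (LINT w|Q (\<lambda>x. r x - 1). (f w)\<^sup>2) * cs_factor r (restrict_to m u1) (restrict_to m u2)"
  using cs_bound_restrict[OF u1 u2 f] by blast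
qed

text \<open>Comparison with u = 0, where the factor reduces to an exponential minus 1, and Jensen's
  inequality for the reference law; the 2 comes from a^2 \<le> 2 (a - b)^2 + 2 b^2.\<close>

lemma square_bound:
 assumes u: "u \<in> borel_measurable borel" "admissible \<nu> (tilt r u)" "integrable \<nu> (\<lambda>x. r x * (u x * u x))"
  and f: "f \<in> bmf path_space"
 shows "(LINT w|Q (tilt r u). f w)\<^sup>2 \<le> 2 * exp (T * (LINT x|\<nu>. r x * (u x * u x))) * (LINT w|Q (\<lambda>x. r x - 1). (f w)\<^sup>2)"
proof -
 interpret Qr: prob_space "Q (\<lambda>x. r x - 1)" by (rule Q_prob[OF ar])
 define a where "a = (LINT w|Q (tilt r u). f w)"
 define b where "b = (LINT w|Q (\<lambda>x. r x - 1). f w)"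
 define q where "q = (LINT w|Q (\<lambda>x. r x - 1). (f w)\<^sup>2)"
 have 1: "(a - b)\<^sup>2 \<le> q * (exp (T * (LINT x|\<nu>. r x * (u x * u x))) - 1)"
  using cs_bound[OF u, of "\<lambda>_. 0" f] ar f by (simp add: a_def b_def q_def cs_factor_def)
 have "(LINT w|Q (\<lambda>x. r x - 1). f w * 1)\<^sup>2 \<le> (LINT w|Q (\<lambda>x. r x - 1). (f w)\<^sup>2) * (LINT w|Q (\<lambda>x. r x - 1). 1\<^sup>2)"
  using bmf_integrable_Q[OF ar f] bmf_integrable_Q[OF ar bmf_power2[OF f]] by (intro integral_Cauchy_Schwarz) auto
 then have 2: "b\<^sup>2 \<le> q" using Qr.prob_space by (simp add: b_def q_def)
 have "a\<^sup>2 \<le> 2 * (a - b)\<^sup>2 + 2 * b\<^sup>2"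
  using zero_le_power2[of "a - 2 * b"] by (simp add: power2_eq_square algebra_simps)
 also have "\<dots> \<le> 2 * (q * (exp (T * (LINT x|\<nu>. r x * (u x * u x))) - 1)) + 2 * q" using 1 2 by simp
 finally show ?thesis by (simp add: a_def q_def algebra_simps)
qed

end

end

section \<open>Square integrability of expected differences\<close>

lemma AE_PiM_finite:
 assumes M: "sigma_finite_measure M" and P: "AE x in M. P x"
 shows "AE z in PiN n M. \<forall>i<n. P (z i)"
proof -
 interpret P: product_sigma_finite "\<lambda>_::nat. M" using M by (simp add: product_sigma_finite_def)
 obtain N where N: "{x \<in> space M. \<not> P x} \<subseteq> N" "N \<in> sets M" "emeasure M N = 0" using P by (rule AE_E)
 have "AE z in PiN n M. P (z i)" if i: "i < n" for i
 proof (rule AE_I)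
  let ?A = "Pi\<^sub>E {..<n} (\<lambda>j. if j = i then N else space M)"
  show "{z \<in> space (PiN n M). \<not> P (z i)} \<subseteq> ?A"
   using N(1) i by (auto simp: space_PiM PiE_def Pi_def)
  have "emeasure (PiN n M) ?A = (\<Prod>j<n. emeasure M (if j = i then N else space M))"
   using N by (intro P.emeasure_PiM) auto
  also have "\<dots> = 0" using i N by (intro prod_zero) auto
  finally show "emeasure (PiN n M) ?A = 0" .
  show "?A \<in> sets (PiN n M)" using N by (intro sets_PiM_I_finite) auto
 qed
 then have "AE z in PiN n M. \<forall>i\<in>{..<n}. P (z i)" by (subst AE_finite_all) auto
 then show ?thesis by (auto elim!: eventually_mono)
qed

text \<open>Serves twice: for the pieces into which the intensity is divided, and for the
  restriction of the jump times to the horizon.\<close>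

lemma nn_integral_PiM_density:
 assumes M: "sigma_finite_measure M" and D: "sigma_finite_measure (density M k)" and k[measurable]: "k \<in> borel_measurable M"
  and F: "F \<in> borel_measurable (PiN n M)"
 shows "(\<integral>\<^sup>+z. F z \<partial>PiN n (density M k)) = (\<integral>\<^sup>+z. F z * (\<Prod>i<n. k (z i)) \<partial>PiN n M)"
 using F
proof (induction n arbitrary: F)
 case (Suc n)
 interpret P: product_sigma_finite "\<lambda>_::nat. M" using M by (simp add: product_sigma_finite_def)
 interpret D: product_sigma_finite "\<lambda>_::nat. density M k" using D by (simp add: product_sigma_finite_def)
 have sets: "sets (Pi\<^sub>M I (\<lambda>_. density M k)) = sets (Pi\<^sub>M I (\<lambda>_. M))" for I :: "nat set" by (intro sets_PiM_cong) auto
 have F: "F \<in> borel_measurable (Pi\<^sub>M (insert n {..<n}) (\<lambda>_. M))" using Suc.prems by (simp add: lessThan_Suc)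
 have kp: "(\<lambda>z. \<Prod>i<m. k (z i)) \<in> borel_measurable (Pi\<^sub>M {..<m} (\<lambda>_. M))" for m :: nat
  by (intro borel_measurable_prod_ennreal) (auto intro: measurable_compose[OF measurable_component_singleton[where M = "\<lambda>_. M"]])
 have upd: "(\<lambda>(x, y). x(n := y)) \<in> measurable (PiN n M \<Otimes>\<^sub>M M) (Pi\<^sub>M (insert n {..<n}) (\<lambda>_. M))"
  by (rule measurable_add_dim)
 have Fu: "(\<lambda>(x, y). F (x(n := y))) \<in> borel_measurable (PiN n M \<Otimes>\<^sub>M M)"
  using measurable_compose[OF upd F] by (simp add: case_prod_beta')
 have Fku: "(\<lambda>(x, y). k y * F (x(n := y))) \<in> borel_measurable (PiN n M \<Otimes>\<^sub>M M)"
  using Fu measurable_compose[OF measurable_snd k] by (simp add: case_prod_beta')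
 have Fx: "(\<lambda>y. F (x(n := y))) \<in> borel_measurable M" if "x \<in> space (PiN n M)" for x
  using measurable_compose[OF measurable_Pair1'[OF that] Fu] by simp
 have sp: "space (PiN n (density M k)) = space (PiN n M)" by (simp add: space_PiM)
 have "(\<integral>\<^sup>+z. F z \<partial>Pi\<^sub>M {..<Suc n} (\<lambda>_. density M k)) = (\<integral>\<^sup>+x. \<integral>\<^sup>+y. F (x(n := y)) \<partial>density M k \<partial>PiN n (density M k))"
  unfolding lessThan_Suc using F measurable_cong_sets[OF sets refl] by (intro D.product_nn_integral_insert) auto
 also have "\<dots> = (\<integral>\<^sup>+x. \<integral>\<^sup>+y. k y * F (x(n := y)) \<partial>M \<partial>PiN n (density M k))"
  using Fx by (intro nn_integral_cong nn_integral_density) (auto simp: sp)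
 also have "\<dots> = (\<integral>\<^sup>+x. (\<integral>\<^sup>+y. k y * F (x(n := y)) \<partial>M) * (\<Prod>i<n. k (x i)) \<partial>PiN n M)"
  using sigma_finite_measure.borel_measurable_nn_integral[OF M Fku] by (intro Suc.IH) (simp del: fun_upd_apply)
 also have "\<dots> = (\<integral>\<^sup>+x. (\<integral>\<^sup>+y. F (x(n := y)) * (\<Prod>i<Suc n. k ((x(n := y)) i)) \<partial>M) \<partial>PiN n M)"
 proof (intro nn_integral_cong)
  fix x assume x: "x \<in> space (PiN n M)"
  have "(\<Prod>i<n. k ((x(n := y)) i)) = (\<Prod>i<n. k (x i))" for y by (intro prod.cong) auto
  then have "F (x(n := y)) * (\<Prod>i<Suc n. k ((x(n := y)) i)) = k y * F (x(n := y)) * (\<Prod>i<n. k (x i))" for y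
   by (simp add: mult_ac)
  then show "(\<integral>\<^sup>+y. k y * F (x(n := y)) \<partial>M) * (\<Prod>i<n. k (x i)) = (\<integral>\<^sup>+y. F (x(n := y)) * (\<Prod>i<Suc n. k ((x(n := y)) i)) \<partial>M)"
   using Fx[OF x] by (simp add: nn_integral_multc)
 qed
 also have "\<dots> = (\<integral>\<^sup>+z. F z * (\<Prod>i<Suc n. k (z i)) \<partial>Pi\<^sub>M (insert n {..<n}) (\<lambda>_. M))"
  using F kp[of "Suc n"] by (intro P.product_nn_integral_insert[symmetric]) (auto simp: lessThan_Suc)
 finally show ?case by (simp only: lessThan_Suc)
qed (simp add: PiM_empty)

text \<open>Each difference is dominated by the corresponding sum, and the operators with
  \<open>c = -1\<close> are monotone, so the domination can be iterated.\<close>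

lemma shift_diffs_abs_le:
 "\<bar>shift_diffs 1 n z f w\<bar> \<le> shift_diffs (- 1) n z (\<lambda>w. \<bar>f w\<bar>) w"
proof -
 have mono: "shift_diffs (- 1) n z f w \<le> shift_diffs (- 1) n z g w" if "\<And>w. f w \<le> g w" for f g n w
  using that
 proof (induction n arbitrary: f g)
  case (Suc n)
  show ?case unfolding shift_diffs.simps by (rule Suc.IH) (use Suc.prems in \<open>auto simp: shift_diff_def add_mono\<close>)
 qed simp
 show ?thesis
 proof (induction n arbitrary: f)
  case (Suc n)
  have "\<bar>shift_diffs 1 (Suc n) z f w\<bar> \<le> shift_diffs (- 1) n z (\<lambda>w. \<bar>shift_diff 1 (z n) f w\<bar>) w" using Suc.IH by simp
  also have "\<dots> \<le> shift_diffs (- 1) (Suc n) z (\<lambda>w. \<bar>f w\<bar>) w" unfolding shift_diffs.simps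
   by (rule mono) (auto simp: shift_diff_def)
  finally show ?case .
 qed simp
qed

lemma shift_diffs_minus_mono:
 assumes "\<And>w. f w \<le> g w" shows "shift_diffs (- 1) n z f w \<le> shift_diffs (- 1) n z g w"
 using assms
proof (induction n arbitrary: f g)
 case (Suc n)
 show ?case unfolding shift_diffs.simps by (rule Suc.IH) (use Suc.prems in \<open>auto simp: shift_diff_def add_mono\<close>)
qed simp

lemma shift_diffs_minus_nonneg:
 assumes "\<And>w. 0 \<le> f w" shows "0 \<le> shift_diffs (- 1) n z f w"
 using assms
proof (induction n arbitrary: f)
 case (Suc n)
 show ?case unfolding shift_diffs.simps by (rule Suc.IH) (use Suc.prems in \<open>auto simp: shift_diff_def\<close>)
qed simp

lemma shift_diffs_tendsto:
 assumes "\<And>w. (\<lambda>i. f i w) \<longlonglongrightarrow> g w" shows "(\<lambda>i. shift_diffs c n z (f i) w) \<longlonglongrightarrow> shift_diffs c n z g w"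
 using assms
proof (induction n arbitrary: f g)
 case (Suc n)
 show ?case unfolding shift_diffs.simps
  by (rule Suc.IH) (use Suc.prems in \<open>auto simp: shift_diff_def intro!: tendsto_intros\<close>)
qed simp

context perturbed_family
begin

lemma opexp_shift_diffs_commute:
 assumes f: "f \<in> bmf path_space" and h: "integrable \<nu> h" and w: "w \<in> cadlag"
 shows "E h (shift_diffs c n z f) w = shift_diffs c n z (E h f) w"
 using f
proof (induction n arbitrary: f)
 case (Suc n)
 have "E h (shift_diffs c n z (shift_diff c (z n) f)) w = shift_diffs c n z (E h (shift_diff c (z n) f)) w"
  by (rule Suc.IH) (rule shift_diff_bmf[OF Suc.prems])
 also have "\<dots> = shift_diffs c n z (shift_diff c (z n) (E h f)) w"
  by (rule shift_diffs_cong_cadlag[OF _ w])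
   (auto intro: opexp_shift_diff_commute[OF Suc.prems integral_intensity_snd(1)[OF levy T h]])
 finally show ?case by simp
qed simp

lemma measurable_integral_shift_diffs:
 assumes v: "admissible \<nu> v" and f: "f \<in> borel_measurable path_space"
 shows "(\<lambda>z. \<integral>w. shift_diffs c n z f w \<partial>Q v) \<in> borel_measurable (PiN n (intensity_upto T \<nu>))"
proof -
 interpret Qv: prob_space "Q v" by (rule Q_prob[OF v])
 have "(\<lambda>(z, w). shift_diffs c n z f w) \<in> borel_measurable (PiN n (intensity_upto T \<nu>) \<Otimes>\<^sub>M Q v)"
  using measurable_shift_diffs_PiM[OF f, of c n] measurable_cong_sets[OF sets_pair_measure_cong[OF refl Q_sets[OF v]] refl] by blast
 then show ?thesis by (rule Qv.borel_measurable_lebesgue_integral)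
qed

context
 fixes u :: "'a => real"
 assumes u[measurable]: "u \<in> borel_measurable borel" and au: "admissible \<nu> u" and u2: "integrable \<nu> (\<lambda>x. u x * u x)"
begin

context
 fixes m N :: nat
 assumes N: "0 < N"
begin

text \<open>One of N equal shares of the reference intensity above the threshold; each share will
  serve one difference operator.\<close>

definition piece :: "'a => real" where "piece x = indicator (cutoff m) x / real N"
text \<open>The intensity that keeps all jumps below the threshold and j of the N shares above it;
  for j = N it is the full reference intensity.\<close>

definition partial_density :: "nat => 'a => real" where "partial_density j x = 1 - indicator (cutoff m) x + real j * piece x"

lemma piece_facts: "piece \<in> borel_measurable borel" "integrable \<nu> piece" "\<And>x. 0 \<le> piece x" "\<And>x. piece x \<le> 1"
proof -
 show "piece \<in> borel_measurable borel" "integrable \<nu> piece"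
  using integrable_indicator_cutoff[of m] unfolding piece_def[abs_def] by simp_all
 show "0 \<le> piece x" "piece x \<le> 1" for x using N by (auto simp: piece_def indicator_def)
qed

lemma partial_density_facts:
 "partial_density j \<in> borel_measurable borel" "0 \<le> partial_density j x" "partial_density j x \<le> 1 + real j"
 "admissible \<nu> (\<lambda>x. partial_density j x - 1)" "admissible \<nu> (\<lambda>x. partial_density j x * (1 + u x) - 1)"
proof -
 note [measurable] = piece_facts(1)
 show m[measurable]: "partial_density j \<in> borel_measurable borel" unfolding partial_density_def[abs_def] by measurable
 show p0: "0 \<le> partial_density j x" for x using piece_facts(3)[of x] by (auto simp: partial_density_def indicator_def)
 show p1: "partial_density j x \<le> 1 + real j" for x
  using piece_facts(4)[of x] mult_left_mono[OF piece_facts(4)[of x], of "real j"] by (auto simp: partial_density_def indicator_def)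
 have i1: "integrable \<nu> (\<lambda>x. partial_density j x - 1)"
  unfolding partial_density_def using piece_facts(2) integrable_indicator_cutoff[of m] by simp
 have i2: "integrable \<nu> (\<lambda>x. min (norm x) 1 * (partial_density j x - 1))" by (rule integrable_min_mult[OF i1]) measurable
 then show "admissible \<nu> (\<lambda>x. partial_density j x - 1)" using p0 by (intro admissibleI) auto
 have i3: "integrable \<nu> (\<lambda>x. min (norm x) 1 * (partial_density j x * u x))"
 proof -
  have "(\<lambda>x. min (norm x) 1 * (partial_density j x * u x)) \<in> borel_measurable borel" by measurable
  from borel_nu[OF this] show ?thesis
  proof (rule integrable_le[OF integrable_mult_right[OF admissible_integrable[OF au], of "1 + real j"]], intro AE_I2)
   fix x
   have "\<bar>partial_density j x\<bar> * (min (norm x) 1 * \<bar>u x\<bar>) \<le> (1 + real j) * (min (norm x) 1 * \<bar>u x\<bar>)"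
    using p0[of x] p1[of x] by (intro mult_right_mono) auto
   then show "norm (min (norm x) 1 * (partial_density j x * u x)) \<le> norm ((1 + real j) * (min (norm x) 1 * u x))"
    by (simp add: abs_mult mult_ac)
  qed
 qed
 show "admissible \<nu> (\<lambda>x. partial_density j x * (1 + u x) - 1)"
 proof (rule admissibleI)
  show "AE x in \<nu>. - 1 \<le> partial_density j x * (1 + u x) - 1"
   using admissible_ge[OF au] by eventually_elim (use p0 in \<open>auto intro!: mult_nonneg_nonneg\<close>)
  show "integrable \<nu> (\<lambda>x. min (norm x) 1 * (partial_density j x * (1 + u x) - 1))"
   using integrable_plus[OF i2 i3] by (simp add: algebra_simps)
 qed measurable
qed

text \<open>Each induction step uses up one piece. Taking it out of the law replaces f by G =
  \<open>E h f\<close>, with h the tilted piece; the last difference of G is controlled by the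
  one-jump bound over that piece, the remaining j differences by the induction hypothesis. Each
  piece thus contributes exp \<kappa> (1 + \<kappa>), and in the reference law the piece reappears
  through \<open>E piece\<close>.\<close>

lemma piecewise_square_bound:
 assumes f: "f \<in> bmf path_space"
 defines "\<kappa> \<equiv> T * (LINT x|\<nu>. piece x * (u x * u x))"
 shows "(\<integral>\<^sup>+z. ennreal ((LINT w|Q (\<lambda>x. partial_density j x * (1 + u x) - 1). shift_diffs 1 j z f w)\<^sup>2)
   \<partial>Pi\<^sub>M {..<j} (\<lambda>_. density (intensity_upto T \<nu>) (\<lambda>p. ennreal (piece (snd p)))))
  \<le> ennreal (2 * exp (T * (LINT x|\<nu>. partial_density 0 x * (u x * u x))) * (exp \<kappa> * (1 + \<kappa>)) ^ j * (LINT w|Q (\<lambda>x. partial_density j x - 1). (f w)\<^sup>2))"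
 using f
proof (induction j arbitrary: f)
 case 0
 have "integrable \<nu> (\<lambda>x. partial_density 0 x * (u x * u x))"
 proof -
  note [measurable] = partial_density_facts(1)
  have "(\<lambda>x. partial_density 0 x * (u x * u x)) \<in> borel_measurable borel" by measurable
  from borel_nu[OF this] show ?thesis
   by (rule integrable_le[OF u2]) (auto simp: partial_density_def indicator_def)
 qed
 from square_bound[OF partial_density_facts(1,2,4) u partial_density_facts(5) this 0]
 show ?case by (simp add: PiM_empty ennreal_leI)
next
 case (Suc j)
 let ?L = "intensity_upto T \<nu>"
 define K where "K = density ?L (\<lambda>p. ennreal (piece (snd p)))"
 note [measurable] = piece_facts(1) partial_density_facts(1)
 have kAE: "AE x in \<nu>. 0 \<le> piece x" using piece_facts(3) by simp
 interpret K: jump_measure K unfolding K_def by (rule jump_measure_density[OF integral_intensity_snd(1)[OF levy T piece_facts(2)]])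
 have finK: "finite_measure K" unfolding K_def by (rule jump_measure_density[OF integral_intensity_snd(1)[OF levy T piece_facts(2)]])
 interpret fK: finite_measure K by (rule finK)
 interpret PK: product_sigma_finite "\<lambda>_::nat. K" by (rule K.product_sigma_finite_jump)
 define h where "h x = piece x * (1 + u x)" for x
 have hm[measurable]: "h \<in> borel_measurable borel" unfolding h_def[abs_def] by measurable
 have pu: "integrable \<nu> (\<lambda>x. piece x * u x)"
 proof -
  have "integrable \<nu> (\<lambda>x. indicator (cutoff m) x * u x)" by (rule integrable_cutoff[OF u admissible_integrable[OF au]])
  then have "integrable \<nu> (\<lambda>x. indicator (cutoff m) x * u x / real N)" by simp
  then show ?thesis by (simp add: piece_def)
 qed
 have hi: "integrable \<nu> h" unfolding h_def[abs_def] using integrable_plus[OF piece_facts(2) pu] by (simp add: distrib_left)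
 have puu: "integrable \<nu> (\<lambda>x. piece x * (u x * u x))"
 proof -
  have "(\<lambda>x. piece x * (u x * u x)) \<in> borel_measurable borel" by measurable
  from borel_nu[OF this] show ?thesis
   by (rule integrable_le[OF u2])
    (use piece_facts(3,4) in \<open>auto simp: abs_mult intro!: mult_left_le_one_le\<close>)
 qed
 have pi2: "integrable \<nu> (\<lambda>x. piece x * (1 + u x)\<^sup>2)"
 proof -
  have "(\<lambda>x. piece x * (1 + u x)\<^sup>2) = (\<lambda>x. piece x + 2 * (piece x * u x) + piece x * (u x * u x))"
   by (auto simp: power2_eq_square algebra_simps)
  then show ?thesis using pu puu piece_facts(2) by simp
 qed
 let ?Qw = "\<lambda>j. Q (\<lambda>x. partial_density j x * (1 + u x) - 1)"
 \<comment> \<open>The tilted and the reference density both gain a piece when j grows by one, the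
   tilted one with the factor 1 + u.\<close>
 have dS: "(\<lambda>x. partial_density (Suc j) x * (1 + u x) - 1) = (\<lambda>x. (partial_density j x * (1 + u x) - 1) + h x)"
  and dr: "(\<lambda>x. partial_density (Suc j) x - 1) = (\<lambda>x. (partial_density j x - 1) + piece x)"
  by (auto simp: partial_density_def h_def algebra_simps)
 have peel: "(LINT w|?Qw (Suc j). F w) = (LINT w|?Qw j. E h F w)" if "F \<in> bmf path_space" for F
  unfolding dS using partial_density_facts(5)[of "Suc j"] unfolding dS
  by (rule integral_add_jumps[OF partial_density_facts(5) _ hi hm that])
 have peelr: "(LINT w|Q (\<lambda>x. partial_density (Suc j) x - 1). F w) = (LINT w|Q (\<lambda>x. partial_density j x - 1). E piece F w)" if "F \<in> bmf path_space" for F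
  unfolding dr using partial_density_facts(4)[of "Suc j"] unfolding dr
  by (rule integral_add_jumps[OF partial_density_facts(4) _ piece_facts(2,1) that])
 define G where "G = E h f"
 have G: "G \<in> bmf path_space" unfolding G_def by (rule E_bmf[OF hi Suc.prems])
 note Gy = shift_diff_bmf[OF G]
 have step: "(LINT w|?Qw (Suc j). shift_diffs 1 (Suc j) z f w) = (LINT w|?Qw j. shift_diffs 1 j z (shift_diff 1 (z j) G) w)" for z
 proof -
  have "(LINT w|?Qw (Suc j). shift_diffs 1 (Suc j) z f w) = (LINT w|?Qw j. E h (shift_diffs 1 (Suc j) z f) w)"
   by (rule peel) (rule shift_diffs_bmf[OF Suc.prems])
  also have "\<dots> = (LINT w|?Qw j. shift_diffs 1 (Suc j) z G w)"
   unfolding G_def by (intro lint_cong refl opexp_shift_diffs_commute[OF Suc.prems hi])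
    (simp add: space_Q[OF partial_density_facts(5)])
  finally show ?thesis by simp
 qed
 have GK: "G w = opexp (jump_op 1 K (\<lambda>p. 1 + u (snd p))) f w" if "w \<in> cadlag" for w
  unfolding G_def h_def[abs_def] K_def
  by (rule E_eq_density[OF piece_facts(1,2) kAE _ _ Suc.prems that]) (use hi in \<open>auto simp: h_def[abs_def]\<close>)
 have Ep: "E piece F w = opexp (jump_op 1 K (\<lambda>_. 1)) F w" if "F \<in> bmf path_space" "w \<in> cadlag" for F w
  using E_eq_density[OF piece_facts(1,2) kAE, of "\<lambda>_. 1" F w] that piece_facts(2) by (simp add: K_def)
 have \<kappa>K: "(LINT z|K. (1 + u (snd z) - 1)\<^sup>2) = \<kappa>"
  unfolding K_def \<kappa>_def using integral_density_snd(2)[OF piece_facts(1) kAE _ puu] by (simp add: power2_eq_square)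
 have \<kappa>0: "0 \<le> \<kappa>" unfolding \<kappa>K[symmetric] by simp
 \<comment> \<open>The base intensity is now the piece itself. Relative to it the tilt has density 1
   + u, so the constant of the one-jump bound is T times the integral of
   \<open>piece x * (u x * u x)\<close>.\<close>
 have one: "(LINT y|K. (shift_diff 1 y G w)\<^sup>2) \<le> exp \<kappa> * (1 + \<kappa>) * E piece (\<lambda>w. (f w)\<^sup>2) w" if w: "w \<in> cadlag" for w
 proof -
  have "(LINT y|K. (shift_diff 1 y (opexp (jump_op 1 K (\<lambda>p. 1 + u (snd p))) f) w)\<^sup>2)
   \<le> exp (LINT z|K. (1 + u (snd z) - 1)\<^sup>2) * (1 + (LINT z|K. (1 + u (snd z) - 1)\<^sup>2)) * opexp (jump_op 1 K (\<lambda>_. 1)) (\<lambda>w. (f w)\<^sup>2) w"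
  proof (rule K.one_jump_square_bound[OF finK _ _ Suc.prems w])
   show "(\<lambda>p. 1 + u (snd p)) \<in> borel_measurable K"
    using measurable_intensity_snd[OF levy T u] by (simp add: K_def)
   show "integrable K (\<lambda>p. (1 + u (snd p))\<^sup>2)" unfolding K_def
    by (rule integral_density_snd(1)[OF piece_facts(1) kAE _ pi2]) measurable
  qed
  then show ?thesis unfolding \<kappa>K Ep[OF bmf_power2[OF Suc.prems] w]
   using GK w by (simp add: shift_diff_def add_jump_cadlag)
 qed
 have sK: "sets (Pi\<^sub>M I (\<lambda>_. K)) = sets (Pi\<^sub>M I (\<lambda>_. ?L))" for I :: "nat set" by (intro sets_PiM_cong) (auto simp: K_def)
 have meas: "(\<lambda>z. ennreal ((LINT w|?Qw (Suc j). shift_diffs 1 (Suc j) z f w)\<^sup>2)) \<in> borel_measurable (Pi\<^sub>M (insert j {..<j}) (\<lambda>_. K))"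
  unfolding measurable_cong_sets[OF sK refl]
  using measurable_integral_shift_diffs[OF partial_density_facts(5) bmf_measurable[OF Suc.prems], where c = 1 and n = "Suc j"]
  by (simp only: lessThan_Suc) simp
 let ?A = "2 * exp (T * (LINT x|\<nu>. partial_density 0 x * (u x * u x))) * (exp \<kappa> * (1 + \<kappa>)) ^ j"
 have A0: "0 \<le> ?A" using \<kappa>0 by simp
 let ?R = "Q (\<lambda>x. partial_density j x - 1)"
 interpret R: prob_space ?R by (rule Q_prob[OF partial_density_facts(4)])
 have sR: "space ?R = cadlag" by (rule space_Q[OF partial_density_facts(4)])
 have Gm: "(\<lambda>(y, w). (shift_diff 1 y G w)\<^sup>2) \<in> borel_measurable (K \<Otimes>\<^sub>M ?R)"
 proof -
  have "(\<lambda>(y, w). shift_diff 1 y G w) \<in> borel_measurable (K \<Otimes>\<^sub>M path_space)"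
   by (rule measurable_shift_diff[OF measurable_const_fun_path[OF bmf_measurable[OF G]] K.measurable_jump_id])
  then have "(\<lambda>(y, w). shift_diff 1 y G w) \<in> borel_measurable (K \<Otimes>\<^sub>M ?R)"
   using measurable_cong_sets[OF sets_pair_measure_cong[OF refl Q_sets[OF partial_density_facts(4)]] refl] by blast
  then show ?thesis by (simp add: case_prod_beta')
 qed
 interpret KR: pair_sigma_finite K ?R ..
 have "(\<integral>\<^sup>+z. ennreal ((LINT w|?Qw (Suc j). shift_diffs 1 (Suc j) z f w)\<^sup>2) \<partial>Pi\<^sub>M {..<Suc j} (\<lambda>_. K))
  = (\<integral>\<^sup>+y. \<integral>\<^sup>+z. ennreal ((LINT w|?Qw (Suc j). shift_diffs 1 (Suc j) (z(j := y)) f w)\<^sup>2) \<partial>Pi\<^sub>M {..<j} (\<lambda>_. K) \<partial>K)"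
  unfolding lessThan_Suc by (rule PK.product_nn_integral_insert_rev) (use meas in auto)
 also have "\<dots> = (\<integral>\<^sup>+y. \<integral>\<^sup>+z. ennreal ((LINT w|?Qw j. shift_diffs 1 j z (shift_diff 1 y G) w)\<^sup>2) \<partial>Pi\<^sub>M {..<j} (\<lambda>_. K) \<partial>K)"
 proof (intro nn_integral_cong arg_cong[where f = ennreal] arg_cong[where f = "\<lambda>x. x\<^sup>2"])
  fix y z
  have "(LINT w|?Qw (Suc j). shift_diffs 1 (Suc j) (z(j := y)) f w) = (LINT w|?Qw j. shift_diffs 1 j (z(j := y)) (shift_diff 1 y G) w)"
   unfolding step by simp
  also have "\<dots> = (LINT w|?Qw j. shift_diffs 1 j z (shift_diff 1 y G) w)"
   by (intro lint_cong refl shift_diffs_cong_cadlag) (auto simp: space_Q[OF partial_density_facts(5)])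
  finally show "(LINT w|?Qw (Suc j). shift_diffs 1 (Suc j) (z(j := y)) f w) = (LINT w|?Qw j. shift_diffs 1 j z (shift_diff 1 y G) w)" .
 qed
 \<comment> \<open>For a fixed last jump y the induction hypothesis is applied to
   \<open>shift_diff 1 y G\<close> in place of f; the integration over y is still to come.\<close>
 also have "\<dots> \<le> (\<integral>\<^sup>+y. ennreal (?A * (LINT w|?R. (shift_diff 1 y G w)\<^sup>2)) \<partial>K)"
  using Suc.IH[OF Gy] unfolding K_def[symmetric] by (intro nn_integral_mono)
 also have "\<dots> = (\<integral>\<^sup>+y. ennreal ?A * (\<integral>\<^sup>+w. ennreal ((shift_diff 1 y G w)\<^sup>2) \<partial>?R) \<partial>K)"
  using A0 bmf_integrable_Q[OF partial_density_facts(4) bmf_power2[OF Gy]]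
  by (intro nn_integral_cong) (simp add: ennreal_mult nn_integral_eq_integral)
 also have "\<dots> = ennreal ?A * (\<integral>\<^sup>+y. \<integral>\<^sup>+w. ennreal ((shift_diff 1 y G w)\<^sup>2) \<partial>?R \<partial>K)"
  using Gm by (intro nn_integral_cmult R.borel_measurable_nn_integral) (simp add: case_prod_beta')
 finally have left: "(\<integral>\<^sup>+z. ennreal ((LINT w|?Qw (Suc j). shift_diffs 1 (Suc j) z f w)\<^sup>2) \<partial>Pi\<^sub>M {..<Suc j} (\<lambda>_. K))
  \<le> ennreal ?A * (\<integral>\<^sup>+y. \<integral>\<^sup>+w. ennreal ((shift_diff 1 y G w)\<^sup>2) \<partial>?R \<partial>K)" .
 have "(\<integral>\<^sup>+y. \<integral>\<^sup>+w. ennreal ((shift_diff 1 y G w)\<^sup>2) \<partial>?R \<partial>K) = (\<integral>\<^sup>+w. \<integral>\<^sup>+y. ennreal ((shift_diff 1 y G w)\<^sup>2) \<partial>K \<partial>?R)"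
  using Gm by (intro KR.Fubini'[symmetric]) (simp add: case_prod_beta')
 \<comment> \<open>After the interchange of the integrals the one-jump bound applies path by
   path.\<close>
 also have "\<dots> \<le> (\<integral>\<^sup>+w. ennreal (exp \<kappa> * (1 + \<kappa>) * E piece (\<lambda>w. (f w)\<^sup>2) w) \<partial>?R)"
 proof (intro nn_integral_mono)
  fix w assume "w \<in> space ?R"
  then have w: "w \<in> cadlag" by (simp add: sR)
  obtain C where C: "\<And>w. w \<in> cadlag ==> \<bar>G w\<bar> \<le> C" using G by (metis bmfE space_path_space)
  have "\<bar>shift_diff 1 y G w\<bar> \<le> \<bar>2 * C\<bar>" for y
   using shift_diffs_le[of G C w 1 1 "\<lambda>_. y"] C w by simp
  then have "(shift_diff 1 y G w)\<^sup>2 \<le> (2 * C)\<^sup>2" for y by (simp only: abs_le_square_iff)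
  moreover have "(\<lambda>y. shift_diff 1 y G w) \<in> borel_measurable K"
   using K.shift_diff_integrable[OF G fK.integrable_const w, of 1 1] by auto
  ultimately have "integrable K (\<lambda>y. (shift_diff 1 y G w)\<^sup>2)"
   by (intro fK.integrable_const_bound[where B = "(2 * C)\<^sup>2"]) auto
  then show "(\<integral>\<^sup>+y. ennreal ((shift_diff 1 y G w)\<^sup>2) \<partial>K) \<le> ennreal (exp \<kappa> * (1 + \<kappa>) * E piece (\<lambda>w. (f w)\<^sup>2) w)"
   using one[OF w] by (simp add: nn_integral_eq_integral ennreal_leI)
 qed
 also have "\<dots> = ennreal (exp \<kappa> * (1 + \<kappa>) * (LINT w|Q (\<lambda>x. partial_density (Suc j) x - 1). (f w)\<^sup>2))"
 proof -
  have Eb: "E piece (\<lambda>w. (f w)\<^sup>2) \<in> bmf path_space" by (rule E_bmf[OF piece_facts(2) bmf_power2[OF Suc.prems]])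
  have E0: "0 \<le> E piece (\<lambda>w. (f w)\<^sup>2) w" if "w \<in> cadlag" for w
   using opexp_jump_op_nonneg[OF bmf_power2[OF Suc.prems] _ integral_intensity_snd(1)[OF levy T piece_facts(2)] AE_intensity_snd[OF levy T kAE] that] by simp
  show ?thesis unfolding peelr[OF bmf_power2[OF Suc.prems]]
   using E0 \<kappa>0 bmf_integrable_Q[OF partial_density_facts(4) Eb] sR
   by (subst nn_integral_eq_integral) (auto intro!: mult_nonneg_nonneg integrable_mult_right)
 qed
 finally have right: "(\<integral>\<^sup>+y. \<integral>\<^sup>+w. ennreal ((shift_diff 1 y G w)\<^sup>2) \<partial>?R \<partial>K)
  \<le> ennreal (exp \<kappa> * (1 + \<kappa>) * (LINT w|Q (\<lambda>x. partial_density (Suc j) x - 1). (f w)\<^sup>2))" .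
 have "ennreal ?A * ennreal (exp \<kappa> * (1 + \<kappa>) * (LINT w|Q (\<lambda>x. partial_density (Suc j) x - 1). (f w)\<^sup>2))
  = ennreal (2 * exp (T * (LINT x|\<nu>. partial_density 0 x * (u x * u x))) * (exp \<kappa> * (1 + \<kappa>)) ^ Suc j * (LINT w|Q (\<lambda>x. partial_density (Suc j) x - 1). (f w)\<^sup>2))"
  unfolding ennreal_mult'[OF A0, symmetric] by (simp add: mult_ac)
 then show ?case using order_trans[OF left mult_left_mono[OF right]] unfolding K_def by simp
qed

end

end

end

section \<open>The perturbation series\<close>

text \<open>Fatou's lemma for a sequence whose integrals have a common bound.\<close>

lemma nn_integral_le_of_tendsto:
 assumes F: "\<And>n::nat. F n \<in> borel_measurable M" and lim: "AE x in M. (\<lambda>n. F n x) \<longlonglongrightarrow> G x"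
  and le: "\<And>n. (\<integral>\<^sup>+x. F n x \<partial>M) \<le> c"
 shows "(\<integral>\<^sup>+x. G x \<partial>M) \<le> (c :: ennreal)"
proof -
 have "AE x in M. G x = liminf (\<lambda>n. F n x)" using lim by eventually_elim (rule lim_imp_Liminf[symmetric], simp_all)
 then have "(\<integral>\<^sup>+x. G x \<partial>M) = (\<integral>\<^sup>+x. liminf (\<lambda>n. F n x) \<partial>M)" by (rule nn_integral_cong_AE)
 also have "\<dots> \<le> liminf (\<lambda>n. \<integral>\<^sup>+x. F n x \<partial>M)" by (rule nn_integral_liminf[OF F])
 also have "\<dots> \<le> liminf (\<lambda>n. c)" by (rule Liminf_mono) (simp add: le)
 finally show ?thesis by (simp add: Liminf_const)
qed

definition trunc :: "nat => real => real" where "trunc R y = max (- real R) (min (real R) y)"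

lemma trunc_le: "\<bar>trunc R y\<bar> \<le> real R" "\<bar>trunc R y\<bar> \<le> \<bar>y\<bar>"
 by (auto simp: trunc_def)

lemma trunc_tendsto: "(\<lambda>R. trunc R y) \<longlonglongrightarrow> y"
proof (rule tendsto_eventually)
 obtain N :: nat where N: "\<bar>y\<bar> \<le> real N" using real_arch_simple by blast
 have "trunc R y = y" if "N \<le> R" for R
 proof -
  have "\<bar>y\<bar> \<le> real R" using N that by linarith
  then show ?thesis by (auto simp: trunc_def)
 qed
 then show "\<forall>\<^sub>F R in sequentially. trunc R y = y" by (auto simp: eventually_sequentially)
qed

lemma trunc_bmf:
 assumes "f \<in> borel_measurable M" shows "(\<lambda>w. trunc R (f w)) \<in> bmf M"
 using assms trunc_le(1) by (intro bmfI[of _ _ "real R"]) (auto simp: trunc_def)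

lemma power_n_le_fact: "real n ^ n \<le> fact n * exp (real n)"
proof -
 have "real n ^ n / fact n \<le> exp (real n)"
  using sums_le[OF _ sums_single[of n "\<lambda>k. real n ^ k / fact k"] exp_series_sums[of "real n"]] by simp
 then show ?thesis by (simp add: pos_divide_le_eq mult.commute)
qed

text \<open>From n^n \<le> n! e^n the term is at most y^n / sqrt (n!) with y = x sqrt e. The ratio
  test starts where sqrt (n + 1) is at least 2 y.\<close>

lemma summable_sqrt_power:
 fixes x :: real
 assumes x: "0 \<le> x" shows "summable (\<lambda>n. x ^ n / fact n * sqrt (real n ^ n))"
proof -
 define y where "y = x * sqrt (exp 1)"
 have y: "0 \<le> y" using x by (simp add: y_def)
 have "summable (\<lambda>n. y ^ n / sqrt (fact n))"
 proof (rule summable_ratio_test)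
  fix n assume n: "nat \<lceil>4 * y\<^sup>2\<rceil> \<le> n"
  have "4 * y\<^sup>2 \<le> real (Suc n)" using n by linarith
  then have "sqrt (4 * y\<^sup>2) \<le> sqrt (real (Suc n))" by (rule real_sqrt_le_mono)
  then have "2 * y \<le> sqrt (real (Suc n))" using y by (simp add: real_sqrt_mult)
  then have "y / sqrt (real (Suc n)) \<le> 1 / 2" by (simp add: field_simps)
  then have "y ^ n / sqrt (fact n) * (y / sqrt (real (Suc n))) \<le> y ^ n / sqrt (fact n) * (1 / 2)"
   using y by (intro mult_left_mono) auto
  then show "norm (y ^ Suc n / sqrt (fact (Suc n))) \<le> 1 / 2 * norm (y ^ n / sqrt (fact n))"
   using y by (simp add: real_sqrt_mult mult_ac)
 qed simp
 then show ?thesis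
 proof (rule summable_comparison_test')
  fix n :: nat
  have "sqrt (real n ^ n) \<le> sqrt (fact n) * sqrt (exp 1) ^ n"
  proof -
   have "sqrt (real n ^ n) \<le> sqrt (fact n * exp (real n))" using power_n_le_fact by (rule real_sqrt_le_mono)
   also have "exp (real n) = exp 1 ^ n" by (simp add: exp_of_nat_mult[symmetric])
   finally show ?thesis by (simp add: real_sqrt_mult real_sqrt_power)
  qed
  then have "x ^ n / fact n * sqrt (real n ^ n) \<le> x ^ n / fact n * (sqrt (fact n) * sqrt (exp 1) ^ n)"
   using x by (intro mult_left_mono) auto
  also have "\<dots> = y ^ n / sqrt (fact n)"
  proof -
   have "(fact n :: real) = sqrt (fact n) * sqrt (fact n)" by simp
   then have "sqrt (fact n) / fact n = 1 / (sqrt (fact n) :: real)" by (metis div_by_1 divide_divide_eq_left' nonzero_divide_mult_cancel_left divide_self_if fact_nonzero mult_zero_left)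
   then show ?thesis by (simp add: y_def power_mult_distrib field_simps)
  qed
  finally show "norm (x ^ n / fact n * sqrt (real n ^ n)) \<le> y ^ n / sqrt (fact n)"
   using x by (simp add: abs_mult)
 qed
qed

section \<open>Square-integrable functionals\<close>

context perturbed_family
begin

lemma admissible_0: "admissible \<nu> (\<lambda>_. 0)"
 by (rule admissibleI) auto

lemma cs_bound_1:
 assumes "u \<in> borel_measurable borel" "admissible \<nu> u" "integrable \<nu> (\<lambda>x. u x * u x)"
  and "v \<in> borel_measurable borel" "admissible \<nu> v" "integrable \<nu> (\<lambda>x. v x * v x)" and f: "f \<in> bmf path_space"
 shows "((LINT w|Q u. f w) - (LINT w|Q v. f w))\<^sup>2 \<le> (LINT w|Q (\<lambda>_. 0). (f w)\<^sup>2) * cs_factor (\<lambda>_. 1) u v"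
 using cs_bound[of "\<lambda>_. 1" u v f] admissible_0 assms by simp

lemma square_bound_1:
 assumes "u \<in> borel_measurable borel" "admissible \<nu> u" "integrable \<nu> (\<lambda>x. u x * u x)" and f: "f \<in> bmf path_space"
 shows "(LINT w|Q u. f w)\<^sup>2 \<le> 2 * exp (T * (LINT x|\<nu>. u x * u x)) * (LINT w|Q (\<lambda>_. 0). (f w)\<^sup>2)"
 using square_bound[of "\<lambda>_. 1" u f] admissible_0 assms by simp

lemma measurable_Q: "admissible \<nu> v ==> f \<in> borel_measurable path_space ==> f \<in> borel_measurable (Q v)"
 using measurable_cong_sets[OF Q_sets refl] by blast

lemma trunc_square_le:
 fixes f :: "(real => 'a) => real"
 assumes f: "f \<in> borel_measurable path_space" and f2: "integrable (Q (\<lambda>_. 0)) (\<lambda>w. (f w)\<^sup>2)"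
 shows "(LINT w|Q (\<lambda>_. 0). (trunc R (f w))\<^sup>2) \<le> (LINT w|Q (\<lambda>_. 0). (f w)\<^sup>2)"
 using trunc_le(2)[of R "f w" for w]
 by (intro integral_mono bmf_integrable_Q[OF admissible_0] bmf_power2 trunc_bmf f f2) (simp add: abs_le_square_iff)

text \<open>The second moment under the reference law controls the first moment under every
  square-integrable tilt: the square bound is applied to the truncations of |f|, and Fatou removes
  the truncation.\<close>

lemma integrable_L2:
 fixes f :: "(real => 'a) => real"
 assumes f: "f \<in> borel_measurable path_space" and f2: "integrable (Q (\<lambda>_. 0)) (\<lambda>w. (f w)\<^sup>2)"
  and v: "v \<in> borel_measurable borel" "admissible \<nu> v" "integrable \<nu> (\<lambda>x. v x * v x)"
 shows "integrable (Q v) f"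
proof -
 note [measurable] = measurable_Q[OF v(2) f]
 define c where "c = sqrt (2 * exp (T * (LINT x|\<nu>. v x * v x)) * (LINT w|Q (\<lambda>_. 0). (f w)\<^sup>2))"
 have b: "(\<lambda>w. \<bar>trunc R (f w)\<bar>) \<in> bmf path_space" for R by (intro bmf_abs trunc_bmf f)
 have le: "(LINT w|Q v. \<bar>trunc R (f w)\<bar>) \<le> c" for R
 proof -
  have "(LINT w|Q v. \<bar>trunc R (f w)\<bar>)\<^sup>2 \<le> 2 * exp (T * (LINT x|\<nu>. v x * v x)) * (LINT w|Q (\<lambda>_. 0). (trunc R (f w))\<^sup>2)"
   using square_bound_1[OF v b] by simp
  also have "\<dots> \<le> 2 * exp (T * (LINT x|\<nu>. v x * v x)) * (LINT w|Q (\<lambda>_. 0). (f w)\<^sup>2)"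
   by (intro mult_left_mono trunc_square_le f f2) simp
  finally show ?thesis unfolding c_def by (rule real_le_rsqrt)
 qed
 have "(\<integral>\<^sup>+w. ennreal \<bar>f w\<bar> \<partial>Q v) \<le> ennreal c"
 proof (rule nn_integral_le_of_tendsto)
  show "(\<lambda>w. ennreal \<bar>trunc n (f w)\<bar>) \<in> borel_measurable (Q v)" for n unfolding trunc_def by measurable
  show "AE w in Q v. (\<lambda>n. ennreal \<bar>trunc n (f w)\<bar>) \<longlonglongrightarrow> ennreal \<bar>f w\<bar>"
   by (intro AE_I2 tendsto_ennrealI tendsto_rabs trunc_tendsto)
  show "(\<integral>\<^sup>+w. ennreal \<bar>trunc n (f w)\<bar> \<partial>Q v) \<le> ennreal c" for n
   using le[of n] bmf_integrable_Q[OF v(2) b] by (simp add: nn_integral_eq_integral ennreal_leI)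
 qed
 then show ?thesis by (intro integrableI_bounded) (auto simp: le_less_trans)
qed

lemma integral_trunc_tendsto:
 fixes f :: "(real => 'a) => real"
 assumes f: "f \<in> borel_measurable path_space" and v: "admissible \<nu> v" and i: "integrable (Q v) f"
 shows "(\<lambda>R. \<integral>w. trunc R (f w) \<partial>Q v) \<longlonglongrightarrow> (LINT w|Q v. f w)"
proof (rule integral_dominated_convergence)
 note [measurable] = measurable_Q[OF v f]
 show "(\<lambda>w. trunc n (f w)) \<in> borel_measurable (Q v)" for n unfolding trunc_def by measurable
 show "integrable (Q v) (\<lambda>w. \<bar>f w\<bar>)" using i by simp
qed (use i trunc_tendsto trunc_le(2) in auto)

context
 fixes u :: "'a => real"
 assumes u[measurable]: "u \<in> borel_measurable borel" and au: "admissible \<nu> u" and u2: "integrable \<nu> (\<lambda>x. u x * u x)"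
begin

abbreviation (input) "Lam n \<equiv> PiN n (intensity_upto T \<nu>)"

text \<open>n^n is the price of dividing the intensity into n pieces, 2 is the constant of
  \<open>square_bound\<close>, and the exponential bounds what the small jumps and the n pieces
  contribute together.\<close>

definition diff_const :: "nat => real" where
 "diff_const n = 2 * real n ^ n * exp (2 * T * (LINT x|\<nu>. u x * u x))"

lemma diff_const_nonneg: "0 \<le> diff_const n" by (simp add: diff_const_def)

lemma AE_Lam_nonzero: "AE z in Lam n. \<forall>i<n. snd (z i) \<noteq> 0"
 by (rule AE_PiM_finite[OF sigma_finite_measure_axioms AE_intensity_snd[OF levy T levy_measure_AE_nonzero[OF levy]]])

lemma Lam_component_measurable:
 assumes "h \<in> borel_measurable borel" "i < n" shows "(\<lambda>z. h (snd (z i))) \<in> borel_measurable (Lam n)"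
 using assms(2) by (intro measurable_compose[OF measurable_component_singleton[where M = "\<lambda>_. intensity_upto T \<nu>"] measurable_intensity_snd[OF levy T assms(1)]]) auto

lemma Lam_prod_measurable:
 fixes h :: "'a => real"
 assumes "h \<in> borel_measurable borel" shows "(\<lambda>z. \<Prod>i<n. h (snd (z i))) \<in> borel_measurable (Lam n)"
 by (intro borel_measurable_prod Lam_component_measurable assms) auto

lemma cutoff_prod_eventually:
 assumes "\<forall>i<n::nat. snd (z i) \<noteq> 0"
 shows "\<forall>\<^sub>F m in sequentially. \<forall>i<n. snd (z i) \<in> (cutoff m :: 'a set)"
proof -
 have "\<forall>i\<in>{..<n}. \<forall>\<^sub>F m in sequentially. snd (z i) \<in> (cutoff m :: 'a set)"
  using assms eventually_mem_cutoff by auto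
 then have "\<forall>\<^sub>F m in sequentially. \<forall>i\<in>{..<n}. snd (z i) \<in> (cutoff m :: 'a set)"
  by (intro eventually_ball_finite) auto
 then show ?thesis by (auto elim!: eventually_mono)
qed

text \<open>The number of pieces is chosen equal to the number of differences, so that with all
  pieces present the tilted law is that of u and the reference law that of 0.\<close>

lemma diff_square_bound_cutoff:
 assumes n: "0 < n" and f: "f \<in> bmf path_space"
 shows "(\<integral>\<^sup>+z. ennreal ((LINT w|Q u. shift_diffs 1 n z f w)\<^sup>2) * (\<Prod>i<n. ennreal (indicator (cutoff m) (snd (z i)))) \<partial>Lam n)
  \<le> ennreal (diff_const n * (LINT w|Q (\<lambda>_. 0). (f w)\<^sup>2))"
proof -
 let ?p = "piece m n"
 note pf = piece_facts[OF u au u2 n, of m] and pd = partial_density_facts[OF u au u2 n, of m]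
 note piece_def = piece_def[OF u au u2 n] and partial_density_def = partial_density_def[OF u au u2 n]
 define F where "F z = ennreal ((LINT w|Q u. shift_diffs 1 n z f w)\<^sup>2)" for z
 have Fm: "F \<in> borel_measurable (Lam n)"
  unfolding F_def[abs_def] using measurable_integral_shift_diffs[OF au bmf_measurable[OF f], of 1 n] by simp
 have one: "partial_density m n n x = 1" for x using n by (simp add: partial_density_def piece_def)
 have dm: "sigma_finite_measure (density (intensity_upto T \<nu>) (\<lambda>p. ennreal (?p (snd p))))"
  using jump_measure_density(1)[OF integral_intensity_snd(1)[OF levy T pf(2)]] by (simp add: jump_measure_def)
 note pm = measurable_intensity_snd[OF levy T pf(1)]
 have "(\<integral>\<^sup>+z. F z * (\<Prod>i<n. ennreal (?p (snd (z i)))) \<partial>Lam n) = (\<integral>\<^sup>+z. F z \<partial>PiN n (density (intensity_upto T \<nu>) (\<lambda>p. ennreal (?p (snd p)))))"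
  using pm by (intro nn_integral_PiM_density[OF sigma_finite_measure_axioms dm _ Fm, symmetric]) simp
 also have "\<dots> \<le> ennreal (2 * exp (T * (LINT x|\<nu>. partial_density m n 0 x * (u x * u x))) *
   (exp (T * (LINT x|\<nu>. ?p x * (u x * u x))) * (1 + T * (LINT x|\<nu>. ?p x * (u x * u x)))) ^ n * (LINT w|Q (\<lambda>_. 0). (f w)\<^sup>2))"
  using piecewise_square_bound[OF u au u2 n f, of n m] by (simp add: one F_def)
 also have "\<dots> \<le> ennreal (2 * exp (2 * T * (LINT x|\<nu>. u x * u x)) * (LINT w|Q (\<lambda>_. 0). (f w)\<^sup>2))"
 proof (intro ennreal_leI mult_right_mono)
  define k where "k = T * (LINT x|\<nu>. ?p x * (u x * u x))"
  define k0 where "k0 = T * (LINT x|\<nu>. partial_density m n 0 x * (u x * u x))"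
  define U where "U = T * (LINT x|\<nu>. u x * u x)"
  have bi: "integrable \<nu> (\<lambda>x. h x * (u x * u x))" if "h \<in> borel_measurable borel" "\<And>x. 0 \<le> h x" "\<And>x. h x \<le> 1" for h :: "'a => real"
  proof -
   note [measurable] = that(1)
   have "(\<lambda>x. h x * (u x * u x)) \<in> borel_measurable borel" by measurable
   from borel_nu[OF this] show ?thesis
    by (rule integrable_le[OF u2]) (use that in \<open>auto simp: abs_mult intro!: mult_left_le_one_le\<close>)
  qed
  have i1: "integrable \<nu> (\<lambda>x. ?p x * (u x * u x))" by (intro bi pf)
  have i0: "integrable \<nu> (\<lambda>x. partial_density m n 0 x * (u x * u x))" using pd(2,3)[of 0] by (intro bi pd(1)) auto
  have nonneg: "0 \<le> k" "0 \<le> k0" unfolding k_def k0_def using T pf(3) pd(2) by (auto intro!: mult_nonneg_nonneg Bochner_Integration.integral_nonneg)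
  \<comment> \<open>The small jumps and the n pieces together make up the whole integral of
    u^2.\<close>
  have "k0 + real n * k = U"
  proof -
   have "(\<lambda>x. u x * u x) = (\<lambda>x. partial_density m n 0 x * (u x * u x) + real n * (?p x * (u x * u x)))"
    using n by (auto simp: partial_density_def piece_def algebra_simps)
   from arg_cong[OF this, of "integral\<^sup>L \<nu>"]
   have "(LINT x|\<nu>. u x * u x) = (LINT x|\<nu>. partial_density m n 0 x * (u x * u x) + real n * (?p x * (u x * u x)))" .
   also have "\<dots> = (LINT x|\<nu>. partial_density m n 0 x * (u x * u x)) + real n * (LINT x|\<nu>. ?p x * (u x * u x))"
    unfolding lint_add[OF i0 integrable_mult_right[OF i1]] integral_mult_right_zero ..
   finally show ?thesis by (simp add: k_def k0_def U_def algebra_simps)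
  qed
  \<comment> \<open>By 1 + k \<le> exp k each piece costs at most exp (2 k), so the total is at most
    exp (2 U), whatever the cutoff.\<close>
  have "exp k0 * (exp k * (1 + k)) ^ n \<le> exp k0 * (exp k * exp k) ^ n"
   using nonneg exp_ge_add_one_self[of k] by (intro mult_left_mono power_mono) auto
  also have "(exp k * exp k) ^ n = exp (real n * (k + k))" by (simp only: exp_add[symmetric] exp_of_nat_mult[symmetric])
  also have "exp k0 * exp (real n * (k + k)) = exp (k0 + 2 * (real n * k))" by (simp add: exp_add[symmetric] algebra_simps)
  also have "\<dots> \<le> exp (2 * U)" using nonneg \<open>k0 + real n * k = U\<close> by simp
  finally show "2 * exp k0 * (exp k * (1 + k)) ^ n \<le> 2 * exp (2 * T * (LINT x|\<nu>. u x * u x))" by (simp add: U_def mult.assoc)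
 qed simp
 finally have *: "(\<integral>\<^sup>+z. F z * (\<Prod>i<n. ennreal (?p (snd (z i)))) \<partial>Lam n) \<le> ennreal (2 * exp (2 * T * (LINT x|\<nu>. u x * u x)) * (LINT w|Q (\<lambda>_. 0). (f w)\<^sup>2))" .
 \<comment> \<open>The indicator of the cutoff region is n times the piece, in each of the n
   coordinates; this is where n^n arises.\<close>
 have pr: "(\<Prod>i<n. ennreal (indicator (cutoff m) (snd (z i)))) = ennreal (real n ^ n) * (\<Prod>i<n. ennreal (?p (snd (z i))))" for z
 proof -
  have "ennreal (indicator (cutoff m) x) = ennreal (real n) * ennreal (?p x)" for x
   using n pf(3)[of x] by (simp add: ennreal_mult'[symmetric] piece_def)
  then show ?thesis by (simp add: prod.distrib ennreal_power)
 qed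
 have "(\<integral>\<^sup>+z. F z * (\<Prod>i<n. ennreal (indicator (cutoff m) (snd (z i)))) \<partial>Lam n) = ennreal (real n ^ n) * (\<integral>\<^sup>+z. F z * (\<Prod>i<n. ennreal (?p (snd (z i)))) \<partial>Lam n)"
  unfolding pr using Fm pf(1)
  by (subst nn_integral_cmult[symmetric])
   (auto intro!: nn_integral_cong borel_measurable_times_ennreal borel_measurable_prod_ennreal measurable_compose[OF Lam_component_measurable measurable_ennreal] simp: mult_ac)
 also have "\<dots> \<le> ennreal (real n ^ n) * ennreal (2 * exp (2 * T * (LINT x|\<nu>. u x * u x)) * (LINT w|Q (\<lambda>_. 0). (f w)\<^sup>2))"
  by (intro mult_left_mono *) simp
 also have "\<dots> = ennreal (diff_const n * (LINT w|Q (\<lambda>_. 0). (f w)\<^sup>2))"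
  by (subst ennreal_mult'[symmetric]) (auto simp: diff_const_def mult_ac)
 finally show ?thesis by (simp add: F_def)
qed

text \<open>Almost every jump is nonzero, hence above all small thresholds, and the bound does not
  depend on the cutoff; Fatou removes it.\<close>

lemma diff_square_bound:
 assumes n: "0 < n" and f: "f \<in> bmf path_space"
 shows "(\<integral>\<^sup>+z. ennreal ((LINT w|Q u. shift_diffs 1 n z f w)\<^sup>2) \<partial>Lam n) \<le> ennreal (diff_const n * (LINT w|Q (\<lambda>_. 0). (f w)\<^sup>2))"
proof (rule nn_integral_le_of_tendsto[OF _ _ diff_square_bound_cutoff[OF n f]])
 show "(\<lambda>z. ennreal ((LINT w|Q u. shift_diffs 1 n z f w)\<^sup>2) * (\<Prod>i<n. ennreal (indicator (cutoff m) (snd (z i))))) \<in> borel_measurable (Lam n)" for m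
  using measurable_integral_shift_diffs[OF au bmf_measurable[OF f], of 1 n]
  by (intro borel_measurable_times_ennreal borel_measurable_prod_ennreal measurable_compose[OF Lam_component_measurable measurable_ennreal]) auto
 show "AE z in Lam n. (\<lambda>m. ennreal ((LINT w|Q u. shift_diffs 1 n z f w)\<^sup>2) * (\<Prod>i<n. ennreal (indicator (cutoff m) (snd (z i))))) \<longlonglongrightarrow> ennreal ((LINT w|Q u. shift_diffs 1 n z f w)\<^sup>2)"
  using AE_Lam_nonzero
 proof eventually_elim
  case (elim z)
  show ?case by (rule tendsto_eventually) (use cutoff_prod_eventually[OF elim] in eventually_elim, simp)
 qed
qed

context
 fixes f :: "(real => 'a) => real"
 assumes f: "f \<in> borel_measurable path_space" and f2: "integrable (Q (\<lambda>_. 0)) (\<lambda>w. (f w)\<^sup>2)"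
begin

lemma measurable_shift_diffs_Q:
 assumes "h \<in> borel_measurable path_space"
 shows "(\<lambda>(z, w). shift_diffs c n z h w) \<in> borel_measurable (Lam n \<Otimes>\<^sub>M Q u)"
 using measurable_shift_diffs_PiM[OF assms, of c n] measurable_cong_sets[OF sets_pair_measure_cong[OF refl Q_sets[OF au]] refl] by blast

text \<open>For unbounded f the existence of the expected differences has to be shown. Integrated
  over jumps above a threshold, the majorant with \<open>c = -1\<close> is one term of an
  exponential series with nonnegative terms. That exponential is a constant times
  \<open>E k\<close>, and integrating it under the law of u gives the integral of |f| under the law
  of u + k, which is finite because u + k is again square integrable. Truncations of |f| intervene
  since the operators act on bounded functions.\<close>

lemma AE_integrable_shift_diffs: "AE z in Lam n. integrable (Q u) (shift_diffs (- 1) n z (\<lambda>w. \<bar>f w\<bar>))"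
proof -
 interpret Qu: prob_space "Q u" by (rule Q_prob[OF au])
 interpret P: product_sigma_finite "\<lambda>_::nat. intensity_upto T \<nu>" by (rule product_sigma_finite_jump)
 interpret L: sigma_finite_measure "Lam n" by (rule P.sigma_finite) simp
 interpret PQ: pair_sigma_finite "Lam n" "Q u" ..
 have fa: "(\<lambda>w. \<bar>f w\<bar>) \<in> borel_measurable path_space" using f by simp
 have cut: "AE z in Lam n. (\<forall>i<n. snd (z i) \<in> cutoff m) \<longrightarrow> integrable (Q u) (shift_diffs (- 1) n z (\<lambda>w. \<bar>f w\<bar>))" for m
 proof -
  define k where "k = (indicator (cutoff m) :: 'a => real)"
  have km[measurable]: "k \<in> borel_measurable borel" by (simp add: k_def)
  have ki: "integrable \<nu> k" unfolding k_def by (rule integrable_indicator_cutoff)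
  have k0: "0 \<le> k x" for x by (simp add: k_def)
  note ks = integral_intensity_snd(1)[OF levy T ki]
  let ?A = "jump_op (- 1) (intensity_upto T \<nu>) (\<lambda>p. k (snd p))"
  have auk: "admissible \<nu> (\<lambda>x. u x + k x)"
  proof (rule admissibleI)
   show "AE x in \<nu>. - 1 \<le> u x + k x" using admissible_ge[OF au] by eventually_elim (simp add: k_def indicator_def)
   show "integrable \<nu> (\<lambda>x. min (norm x) 1 * (u x + k x))"
    using integrable_plus[OF admissible_integrable[OF au] integrable_min_mult[OF ki km]] by (simp add: distrib_left)
  qed measurable
  have uk2: "integrable \<nu> (\<lambda>x. (u x + k x) * (u x + k x))"
  proof -
   have "integrable \<nu> (\<lambda>x. k x * u x)" unfolding k_def by (rule integrable_cutoff[OF u admissible_integrable[OF au]])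
   moreover have "(\<lambda>x. (u x + k x) * (u x + k x)) = (\<lambda>x. u x * u x + 2 * (k x * u x) + k x)"
    by (auto simp: k_def indicator_def algebra_simps)
   ultimately show ?thesis using u2 ki by simp
  qed
  have fi: "integrable (Q (\<lambda>x. u x + k x)) f" by (rule integrable_L2[OF f f2 _ auk uk2]) measurable
  define c where "c = fact n * (exp (2 * (LINT p|intensity_upto T \<nu>. k (snd p))) * (LINT w|Q (\<lambda>x. u x + k x). \<bar>f w\<bar>))"
  define G where "G R w = \<bar>trunc R (f w)\<bar>" for R w
  have Gb: "G R \<in> bmf path_space" for R unfolding G_def[abs_def] by (intro bmf_abs trunc_bmf f)
  have Gm: "(\<lambda>(z, w). shift_diffs (- 1) n z (G R) w) \<in> borel_measurable (Lam n \<Otimes>\<^sub>M Q u)" for R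
   by (rule measurable_shift_diffs_Q[OF bmf_measurable[OF Gb]])
  have pm: "(\<lambda>z. \<Prod>i<n. k (snd (z i))) \<in> borel_measurable (Lam n)" by (rule Lam_prod_measurable[OF km])
  have pow0: "0 \<le> (?A ^^ j) (G R) w" if "w \<in> cadlag" for j R w
   unfolding funpow_jump_op[OF Gb ks that]
   by (intro Bochner_Integration.integral_nonneg mult_nonneg_nonneg prod_nonneg shift_diffs_minus_nonneg) (auto simp: k0 G_def)
  \<comment> \<open>All terms of the series are nonnegative, so the n-th power is at most n! times
    the sum.\<close>
  have term_le: "(?A ^^ n) (G R) w \<le> fact n * opexp ?A (G R) w" if w: "w \<in> cadlag" for R w
  proof -
   have sm: "summable (\<lambda>j. (?A ^^ j) (G R) w / fact j)"
    using summable_opexp[OF bounded_op_jump_op[OF ks] Gb] w by (simp add: space_path_space)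
   have "(\<Sum>j\<in>{n}. (?A ^^ j) (G R) w / fact j) \<le> opexp ?A (G R) w"
    unfolding opexp_def by (rule sum_le_suminf[OF sm]) (use pow0 w in auto)
   then show ?thesis by (simp add: field_simps)
  qed
  have bound: "(\<integral>\<^sup>+w. ennreal ((?A ^^ n) (G R) w) \<partial>Q u) \<le> ennreal c" for R
  proof -
   have Ab: "(?A ^^ n) (G R) \<in> bmf path_space" by (rule bounded_op_bmf[OF bounded_op_funpow[OF bounded_op_jump_op[OF ks]] Gb])
   have "(LINT w|Q u. (?A ^^ n) (G R) w) \<le> (LINT w|Q u. fact n * (exp (2 * (LINT p|intensity_upto T \<nu>. k (snd p))) * E k (G R) w))"
   proof (rule integral_mono[OF bmf_integrable_Q[OF au Ab] bmf_integrable_Q[OF au bmf_cmult[OF bmf_cmult[OF E_bmf[OF ki Gb]]]]])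
    fix w assume "w \<in> space (Q u)"
    then have w: "w \<in> cadlag" by (simp add: space_Q[OF au])
    show "(?A ^^ n) (G R) w \<le> fact n * (exp (2 * (LINT p|intensity_upto T \<nu>. k (snd p))) * E k (G R) w)"
     using term_le[OF w, of R] opexp_jump_op_change[OF Gb ks w, of "- 1" R] by simp
   qed
   also have "\<dots> = fact n * (exp (2 * (LINT p|intensity_upto T \<nu>. k (snd p))) * (LINT w|Q (\<lambda>x. u x + k x). G R w))"
    using integral_add_jumps[OF au auk ki km Gb] by simp
   also have "\<dots> \<le> c" unfolding c_def
    by (intro mult_left_mono integral_mono bmf_integrable_Q[OF auk Gb] integrable_abs fi) (auto simp: G_def trunc_le(2))
   finally show ?thesis
    using bmf_integrable_Q[OF au Ab] pow0 by (subst nn_integral_eq_integral) (auto simp: space_Q[OF au] ennreal_leI)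
  qed
  have m: "(\<lambda>(z, w). ennreal (\<Prod>i<n. k (snd (z i))) * ennreal (shift_diffs (- 1) n z h w)) \<in> borel_measurable (Lam n \<Otimes>\<^sub>M Q u)"
   if "(\<lambda>(z, w). shift_diffs (- 1) n z h w) \<in> borel_measurable (Lam n \<Otimes>\<^sub>M Q u)" for h
   using that measurable_compose[OF measurable_fst pm, of "Q u"] by (simp add: case_prod_beta')
  have le: "(\<integral>\<^sup>+z. \<integral>\<^sup>+w. ennreal (\<Prod>i<n. k (snd (z i))) * ennreal (shift_diffs (- 1) n z (G R) w) \<partial>Q u \<partial>Lam n) \<le> ennreal c" for R
  proof -
   have "(\<integral>\<^sup>+z. \<integral>\<^sup>+w. ennreal (\<Prod>i<n. k (snd (z i))) * ennreal (shift_diffs (- 1) n z (G R) w) \<partial>Q u \<partial>Lam n)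
    = (\<integral>\<^sup>+w. \<integral>\<^sup>+z. ennreal (\<Prod>i<n. k (snd (z i))) * ennreal (shift_diffs (- 1) n z (G R) w) \<partial>Lam n \<partial>Q u)"
    by (rule PQ.Fubini'[OF m[OF Gm], symmetric])
   also have "\<dots> = (\<integral>\<^sup>+w. ennreal ((?A ^^ n) (G R) w) \<partial>Q u)"
   proof (rule nn_integral_cong)
    fix w assume "w \<in> space (Q u)"
    then have w: "w \<in> cadlag" by (simp add: space_Q[OF au])
    have "(\<integral>\<^sup>+z. ennreal ((\<Prod>i<n. k (snd (z i))) * shift_diffs (- 1) n z (G R) w) \<partial>Lam n) = ennreal ((?A ^^ n) (G R) w)"
     unfolding funpow_jump_op[OF Gb ks w]
     by (intro nn_integral_eq_integral integrable_shift_diffs[OF Gb ks w] AE_I2 mult_nonneg_nonneg prod_nonneg shift_diffs_minus_nonneg)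
      (auto simp: k0 G_def)
    then show "(\<integral>\<^sup>+z. ennreal (\<Prod>i<n. k (snd (z i))) * ennreal (shift_diffs (- 1) n z (G R) w) \<partial>Lam n) = ennreal ((?A ^^ n) (G R) w)"
     by (simp add: ennreal_mult' prod_nonneg k0)
   qed
   also have "\<dots> \<le> ennreal c" by (rule bound)
   finally show ?thesis .
  qed
  have lim: "(\<integral>\<^sup>+p. (case p of (z, w) => ennreal (\<Prod>i<n. k (snd (z i))) * ennreal (shift_diffs (- 1) n z (G R) w)) \<partial>(Lam n \<Otimes>\<^sub>M Q u)) \<le> ennreal c" for R
   using le[of R] Qu.nn_integral_fst[OF m[OF Gm], of R] by simp
  have fm: "(\<lambda>(z, w). shift_diffs (- 1) n z (\<lambda>w. \<bar>f w\<bar>) w) \<in> borel_measurable (Lam n \<Otimes>\<^sub>M Q u)"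
   by (rule measurable_shift_diffs_Q[OF fa])
  have "(\<integral>\<^sup>+p. (case p of (z, w) => ennreal (\<Prod>i<n. k (snd (z i))) * ennreal (shift_diffs (- 1) n z (\<lambda>w. \<bar>f w\<bar>) w)) \<partial>(Lam n \<Otimes>\<^sub>M Q u)) \<le> ennreal c"
  proof (rule nn_integral_le_of_tendsto[OF _ _ lim])
   show "(\<lambda>p. case p of (z, w) => ennreal (\<Prod>i<n. k (snd (z i))) * ennreal (shift_diffs (- 1) n z (G R) w)) \<in> borel_measurable (Lam n \<Otimes>\<^sub>M Q u)" for R
    by (rule m[OF Gm])
   show "AE p in Lam n \<Otimes>\<^sub>M Q u. (\<lambda>R. case p of (z, w) => ennreal (\<Prod>i<n. k (snd (z i))) * ennreal (shift_diffs (- 1) n z (G R) w))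
    \<longlonglongrightarrow> (case p of (z, w) => ennreal (\<Prod>i<n. k (snd (z i))) * ennreal (shift_diffs (- 1) n z (\<lambda>w. \<bar>f w\<bar>) w))"
   proof (rule AE_I2)
    fix p :: "(nat => real \<times> 'a) \<times> (real => 'a)"
    obtain z w where p: "p = (z, w)" by force
    have "(\<lambda>R. (\<Prod>i<n. k (snd (z i))) * shift_diffs (- 1) n z (G R) w) \<longlonglongrightarrow> (\<Prod>i<n. k (snd (z i))) * shift_diffs (- 1) n z (\<lambda>w. \<bar>f w\<bar>) w"
     unfolding G_def by (intro tendsto_intros shift_diffs_tendsto trunc_tendsto)
    from tendsto_ennrealI[OF this]
    show "(\<lambda>R. case p of (z, w) => ennreal (\<Prod>i<n. k (snd (z i))) * ennreal (shift_diffs (- 1) n z (G R) w))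
    \<longlonglongrightarrow> (case p of (z, w) => ennreal (\<Prod>i<n. k (snd (z i))) * ennreal (shift_diffs (- 1) n z (\<lambda>w. \<bar>f w\<bar>) w))"
     by (simp add: p ennreal_mult' prod_nonneg k0)
   qed
  qed
  then have fin: "(\<integral>\<^sup>+z. \<integral>\<^sup>+w. ennreal (\<Prod>i<n. k (snd (z i))) * ennreal (shift_diffs (- 1) n z (\<lambda>w. \<bar>f w\<bar>) w) \<partial>Q u \<partial>Lam n) \<noteq> \<infinity>"
   using Qu.nn_integral_fst[OF m[OF fm]] by (auto simp: top_unique)
  have "AE z in Lam n. (\<integral>\<^sup>+w. ennreal (\<Prod>i<n. k (snd (z i))) * ennreal (shift_diffs (- 1) n z (\<lambda>w. \<bar>f w\<bar>) w) \<partial>Q u) \<noteq> \<infinity>"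
   by (rule nn_integral_PInf_AE[OF Qu.borel_measurable_nn_integral[OF m[OF fm]] fin])
  with AE_space show ?thesis
  proof eventually_elim
   case (elim z)
   show ?case
   proof
    assume "\<forall>i<n. snd (z i) \<in> cutoff m"
    then have "(\<Prod>i<n. k (snd (z i))) = 1" by (simp add: k_def)
    then have "(\<integral>\<^sup>+w. ennreal (shift_diffs (- 1) n z (\<lambda>w. \<bar>f w\<bar>) w) \<partial>Q u) < \<infinity>" using elim by (simp add: less_top)
    moreover have "shift_diffs (- 1) n z (\<lambda>w. \<bar>f w\<bar>) \<in> borel_measurable (Q u)"
     using measurable_compose[OF measurable_Pair1'[OF elim(1)] fm] by simp
    ultimately show "integrable (Q u) (shift_diffs (- 1) n z (\<lambda>w. \<bar>f w\<bar>))"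
     using shift_diffs_minus_nonneg[of "\<lambda>w. \<bar>f w\<bar>" n z] by (intro integrableI_bounded) auto
   qed
  qed
 qed
 \<comment> \<open>Only countably many cutoffs occur, so one null set serves them all, and almost
   every z lies in the cutoff region for large m.\<close>
 then have "AE z in Lam n. \<forall>m. (\<forall>i<n. snd (z i) \<in> cutoff m) \<longrightarrow> integrable (Q u) (shift_diffs (- 1) n z (\<lambda>w. \<bar>f w\<bar>))"
  using cut unfolding AE_all_countable by blast
 with AE_Lam_nonzero show ?thesis
 proof eventually_elim
  case (elim z)
  show ?case using eventually_happens'[OF sequentially_bot cutoff_prod_eventually[OF elim(1)]] elim(2) by blast
 qed
qed

lemma AE_integrable_jump_diffs: "AE z in Lam n. integrable (Q u) (shift_diffs 1 n z f)"
 using AE_integrable_shift_diffs[of n] AE_space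
proof eventually_elim
 case (elim z)
 have "shift_diffs 1 n z f \<in> borel_measurable (Q u)"
  using measurable_compose[OF measurable_Pair1'[OF elim(2)] measurable_shift_diffs_Q[OF f, of 1 n]] by simp
 then show ?case
  by (rule integrable_le[OF elim(1)])
   (auto intro: order_trans[OF shift_diffs_abs_le abs_ge_self])
qed

end

end

end

context perturbed_family
begin

context
 fixes u :: "'a => real"
 assumes u[measurable]: "u \<in> borel_measurable borel" and au: "admissible \<nu> u" and u2: "integrable \<nu> (\<lambda>x. u x * u x)"
begin

definition expected_diff :: "((real => 'a) => real) => nat => (nat => real \<times> 'a) => real" where
 "expected_diff f n z = (LINT w|Q u. shift_diffs 1 n z f w)"

definition coefficient :: "((real => 'a) => real) => ('a => real) => nat => real" where
 "coefficient f g n = (LINT z|Lam n. expected_diff f n z * (\<Prod>i<n. g (snd (z i))))"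

lemma expected_diff_measurable: "f \<in> borel_measurable path_space ==> expected_diff f n \<in> borel_measurable (Lam n)"
 unfolding expected_diff_def[abs_def] by (rule measurable_integral_shift_diffs[OF au])

lemma L2_diff:
 fixes f h :: "(real => 'a) => real"
 assumes "f \<in> borel_measurable path_space" "integrable (Q (\<lambda>_. 0)) (\<lambda>w. (f w)\<^sup>2)"
  and "h \<in> borel_measurable path_space" "integrable (Q (\<lambda>_. 0)) (\<lambda>w. (h w)\<^sup>2)"
 shows "integrable (Q (\<lambda>_. 0)) (\<lambda>w. (f w - h w)\<^sup>2)"
proof -
 note [measurable] = measurable_Q[OF admissible_0 assms(1)] measurable_Q[OF admissible_0 assms(3)]
 have "integrable (Q (\<lambda>_. 0)) (\<lambda>w. 2 * (f w)\<^sup>2 + 2 * (h w)\<^sup>2)" using assms by simp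
 then show ?thesis
 proof (rule integrable_le)
  show "AE w in Q (\<lambda>_. 0). norm ((f w - h w)\<^sup>2) \<le> norm (2 * (f w)\<^sup>2 + 2 * (h w)\<^sup>2)"
  proof (rule AE_I2)
   fix w
   have "(f w - h w)\<^sup>2 \<le> 2 * (f w)\<^sup>2 + 2 * (h w)\<^sup>2"
    using zero_le_power2[of "f w + h w"] by (simp add: power2_eq_square algebra_simps)
   then show "norm ((f w - h w)\<^sup>2) \<le> norm (2 * (f w)\<^sup>2 + 2 * (h w)\<^sup>2)" by simp
  qed
 qed measurable
qed

lemma trunc_L2:
 assumes "f \<in> borel_measurable path_space"
 shows "integrable (Q (\<lambda>_. 0)) (\<lambda>w. (trunc R (f w))\<^sup>2)"
 by (intro bmf_integrable_Q[OF admissible_0] bmf_power2 trunc_bmf assms)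

text \<open>The bound for the truncations passes to f by Fatou. The expected differences converge at
  almost every z by dominated convergence, with the majorant just shown to be integrable.\<close>

lemma expected_diff_square:
 assumes f: "f \<in> borel_measurable path_space" and f2: "integrable (Q (\<lambda>_. 0)) (\<lambda>w. (f w)\<^sup>2)" and n: "0 < n"
 shows "integrable (Lam n) (\<lambda>z. (expected_diff f n z)\<^sup>2)"
  and "(LINT z|Lam n. (expected_diff f n z)\<^sup>2) \<le> diff_const u n * (LINT w|Q (\<lambda>_. 0). (f w)\<^sup>2)"
proof -
 let ?c = "diff_const u n * (LINT w|Q (\<lambda>_. 0). (f w)\<^sup>2)"
 have c0: "0 \<le> ?c" using diff_const_nonneg[OF u au u2] by simp
 have nn: "(\<integral>\<^sup>+z. ennreal ((expected_diff f n z)\<^sup>2) \<partial>Lam n) \<le> ennreal ?c"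
 proof (rule nn_integral_le_of_tendsto)
  fix R
  have tb: "(\<lambda>w. trunc R (f w)) \<in> bmf path_space" by (rule trunc_bmf[OF f])
  show "(\<lambda>z. ennreal ((expected_diff (\<lambda>w. trunc R (f w)) n z)\<^sup>2)) \<in> borel_measurable (Lam n)"
   using expected_diff_measurable[OF bmf_measurable[OF tb]] by simp
  have "(\<integral>\<^sup>+z. ennreal ((expected_diff (\<lambda>w. trunc R (f w)) n z)\<^sup>2) \<partial>Lam n) \<le> ennreal (diff_const u n * (LINT w|Q (\<lambda>_. 0). (trunc R (f w))\<^sup>2))"
   unfolding expected_diff_def by (rule diff_square_bound[OF u au u2 n tb])
  also have "\<dots> \<le> ennreal ?c"
   by (intro ennreal_leI mult_left_mono trunc_square_le f f2 diff_const_nonneg[OF u au u2])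
  finally show "(\<integral>\<^sup>+z. ennreal ((expected_diff (\<lambda>w. trunc R (f w)) n z)\<^sup>2) \<partial>Lam n) \<le> ennreal ?c" .
 next
  show "AE z in Lam n. (\<lambda>R. ennreal ((expected_diff (\<lambda>w. trunc R (f w)) n z)\<^sup>2)) \<longlonglongrightarrow> ennreal ((expected_diff f n z)\<^sup>2)"
   using AE_integrable_shift_diffs[OF u au u2 f f2, of n] AE_space
  proof eventually_elim
   case (elim z)
   have "(\<lambda>R. expected_diff (\<lambda>w. trunc R (f w)) n z) \<longlonglongrightarrow> expected_diff f n z"
    unfolding expected_diff_def
   proof (rule integral_dominated_convergence[OF _ _ elim(1)])
    have m: "shift_diffs 1 n z h \<in> borel_measurable (Q u)" if "h \<in> borel_measurable path_space" for h
     using measurable_compose[OF measurable_Pair1'[OF elim(2)] measurable_shift_diffs_Q[OF u au u2 f f2 that]] by simp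
    show "shift_diffs 1 n z f \<in> borel_measurable (Q u)" by (rule m[OF f])
    show "shift_diffs 1 n z (\<lambda>w. trunc R (f w)) \<in> borel_measurable (Q u)" for R by (rule m[OF bmf_measurable[OF trunc_bmf[OF f]]])
    show "AE w in Q u. (\<lambda>R. shift_diffs 1 n z (\<lambda>w. trunc R (f w)) w) \<longlonglongrightarrow> shift_diffs 1 n z f w"
     by (intro AE_I2 shift_diffs_tendsto trunc_tendsto)
    show "AE w in Q u. norm (shift_diffs 1 n z (\<lambda>w. trunc R (f w)) w) \<le> shift_diffs (- 1) n z (\<lambda>w. \<bar>f w\<bar>) w" for R
     unfolding real_norm_def by (intro AE_I2 order_trans[OF shift_diffs_abs_le] shift_diffs_minus_mono trunc_le)
   qed
   then show ?case by (intro tendsto_ennrealI tendsto_power)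
  qed
 qed
 have m: "(\<lambda>z. (expected_diff f n z)\<^sup>2) \<in> borel_measurable (Lam n)" using expected_diff_measurable[OF f] by simp
 show i: "integrable (Lam n) (\<lambda>z. (expected_diff f n z)\<^sup>2)"
  using nn by (intro integrableI_bounded m) (auto simp: le_less_trans)
 show "(LINT z|Lam n. (expected_diff f n z)\<^sup>2) \<le> ?c"
  using nn i c0 by (subst (asm) nn_integral_eq_integral) auto
qed

lemma prod_square:
 assumes g[measurable]: "g \<in> borel_measurable borel" and g2: "integrable \<nu> (\<lambda>x. (g x)\<^sup>2)"
 shows "integrable (Lam n) (\<lambda>z. (\<Prod>i<n. g (snd (z i)))\<^sup>2)" "(LINT z|Lam n. (\<Prod>i<n. g (snd (z i)))\<^sup>2) = (T * (LINT x|\<nu>. (g x)\<^sup>2)) ^ n"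
proof -
 interpret P: product_sigma_finite "\<lambda>_::nat. intensity_upto T \<nu>" by (rule product_sigma_finite_jump)
 note i = integral_intensity_snd[OF levy T g2]
 have e: "(\<Prod>i<n. g (snd (z i)))\<^sup>2 = (\<Prod>i<n. (g (snd (z i)))\<^sup>2)" for z by (simp add: prod_power_distrib)
 show "integrable (Lam n) (\<lambda>z. (\<Prod>i<n. g (snd (z i)))\<^sup>2)" unfolding e by (rule P.product_integrable_prod) (auto simp: i)
 show "(LINT z|Lam n. (\<Prod>i<n. g (snd (z i)))\<^sup>2) = (T * (LINT x|\<nu>. (g x)\<^sup>2)) ^ n" unfolding e
  by (subst P.product_integral_prod) (auto simp: i)
qed

text \<open>Cauchy-Schwarz on the n-fold product, where the squared norm of the tensor power is the
  n-th power of the squared norm of g.\<close>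

lemma coefficient_bound:
 assumes f: "f \<in> borel_measurable path_space" and f2: "integrable (Q (\<lambda>_. 0)) (\<lambda>w. (f w)\<^sup>2)" and n: "0 < n"
  and g: "g \<in> borel_measurable borel" and g2: "integrable \<nu> (\<lambda>x. (g x)\<^sup>2)"
 shows "integrable (Lam n) (\<lambda>z. expected_diff f n z * (\<Prod>i<n. g (snd (z i))))"
  and "(LINT z|Lam n. \<bar>expected_diff f n z * (\<Prod>i<n. g (snd (z i)))\<bar>) \<le> sqrt (diff_const u n * (LINT w|Q (\<lambda>_. 0). (f w)\<^sup>2)) * sqrt (T * (LINT x|\<nu>. (g x)\<^sup>2)) ^ n"
proof -
 note Fm = expected_diff_measurable[OF f, of n] and Gm = Lam_prod_measurable[OF u au u2 g, of n]
 note F2 = expected_diff_square[OF f f2 n] and G2 = prod_square[OF g g2, of n]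
 show "integrable (Lam n) (\<lambda>z. expected_diff f n z * (\<Prod>i<n. g (snd (z i))))"
  by (rule integrable_mult_square[OF Fm Gm F2(1) G2(1)])
 have "(LINT z|Lam n. \<bar>expected_diff f n z\<bar> * \<bar>\<Prod>i<n. g (snd (z i))\<bar>)\<^sup>2 \<le> (LINT z|Lam n. \<bar>expected_diff f n z\<bar>\<^sup>2) * (LINT z|Lam n. \<bar>\<Prod>i<n. g (snd (z i))\<bar>\<^sup>2)"
  using F2(1) G2(1) by (intro integral_Cauchy_Schwarz borel_measurable_abs Fm Gm) (simp_all only: power2_abs)
 also have "\<dots> \<le> (diff_const u n * (LINT w|Q (\<lambda>_. 0). (f w)\<^sup>2)) * (T * (LINT x|\<nu>. (g x)\<^sup>2)) ^ n"
  unfolding power2_abs G2(2) using F2(2) T by (intro mult_right_mono zero_le_power mult_nonneg_nonneg) auto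
 finally have "(LINT z|Lam n. \<bar>expected_diff f n z\<bar> * \<bar>\<Prod>i<n. g (snd (z i))\<bar>) \<le> sqrt ((diff_const u n * (LINT w|Q (\<lambda>_. 0). (f w)\<^sup>2)) * (T * (LINT x|\<nu>. (g x)\<^sup>2)) ^ n)"
  by (rule real_le_rsqrt)
 then show "(LINT z|Lam n. \<bar>expected_diff f n z * (\<Prod>i<n. g (snd (z i)))\<bar>) \<le> sqrt (diff_const u n * (LINT w|Q (\<lambda>_. 0). (f w)\<^sup>2)) * sqrt (T * (LINT x|\<nu>. (g x)\<^sup>2)) ^ n"
  by (simp add: abs_mult real_sqrt_mult real_sqrt_power)
qed

definition term_bound :: "real => real => real => nat => real" where
 "term_bound q s t n = \<bar>t\<bar> ^ n / fact n * (sqrt (diff_const u n * q) * sqrt s ^ n)"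

lemma summable_term_bound: assumes "0 \<le> s" shows "summable (term_bound q s t)"
proof -
 have "summable (\<lambda>n. sqrt (2 * exp (2 * T * (LINT x|\<nu>. u x * u x)) * q) * ((\<bar>t\<bar> * sqrt s) ^ n / fact n * sqrt (real n ^ n)))"
  using assms by (intro summable_mult summable_sqrt_power) auto
 moreover have "sqrt (2 * exp (2 * T * (LINT x|\<nu>. u x * u x)) * q) * ((\<bar>t\<bar> * sqrt s) ^ n / fact n * sqrt (real n ^ n)) = term_bound q s t n" for n
  by (simp add: term_bound_def diff_const_def[OF u au u2] real_sqrt_mult power_mult_distrib)
 ultimately show ?thesis by simp
qed

lemma term_le:
 assumes f: "f \<in> borel_measurable path_space" and f2: "integrable (Q (\<lambda>_. 0)) (\<lambda>w. (f w)\<^sup>2)" and n: "0 < n"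
  and g: "g \<in> borel_measurable borel" and g2: "integrable \<nu> (\<lambda>x. (g x)\<^sup>2)"
 shows "\<bar>t ^ n / fact n * coefficient f g n\<bar> \<le> term_bound (LINT w|Q (\<lambda>_. 0). (f w)\<^sup>2) (T * (LINT x|\<nu>. (g x)\<^sup>2)) t n"
proof -
 have "\<bar>coefficient f g n\<bar> \<le> sqrt (diff_const u n * (LINT w|Q (\<lambda>_. 0). (f w)\<^sup>2)) * sqrt (T * (LINT x|\<nu>. (g x)\<^sup>2)) ^ n"
  unfolding coefficient_def by (rule order_trans[OF integral_abs_bound coefficient_bound(2)[OF assms]])
 then have "\<bar>t\<bar> ^ n / fact n * \<bar>coefficient f g n\<bar> \<le> \<bar>t\<bar> ^ n / fact n * (sqrt (diff_const u n * (LINT w|Q (\<lambda>_. 0). (f w)\<^sup>2)) * sqrt (T * (LINT x|\<nu>. (g x)\<^sup>2)) ^ n)"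
  by (intro mult_left_mono) auto
 then show ?thesis by (simp add: term_bound_def abs_mult power_abs)
qed

lemma coefficient_0: "coefficient f g 0 = (LINT w|Q u. f w)"
 by (simp add: coefficient_def expected_diff_def PiM_empty lebesgue_integral_count_space_finite)

text \<open>For integrable h the operator is bounded and the law of u + t h comes from that of u by
  its exponential. The claim is the exponential series integrated term by term, with Fubini turning
  the powers into integrals of expected differences.\<close>

lemma series_finite_activity:
 assumes f: "f \<in> bmf path_space" and h: "integrable \<nu> h" "h \<in> borel_measurable borel" and ah: "admissible \<nu> (\<lambda>x. u x + t * h x)"
 shows "(\<lambda>n. t ^ n / fact n * coefficient f h n) sums (LINT w|Q (\<lambda>x. u x + t * h x). f w)"
proof -
 interpret Qu: prob_space "Q u" by (rule Q_prob[OF au])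
 interpret P: product_sigma_finite "\<lambda>_::nat. intensity_upto T \<nu>" by (rule product_sigma_finite_jump)
 note hs = integral_intensity_snd(1)[OF levy T h(1)]
 let ?A = "jump_op 1 (intensity_upto T \<nu>) (\<lambda>p. h (snd p))"
 note A = bounded_op_jump_op[OF hs, of 1]
 have tA: "jump_op 1 (intensity_upto T \<nu>) (\<lambda>p. t * h (snd p)) = (\<lambda>f w. t * ?A f w)"
  by (simp add: jump_op_def fun_eq_iff mult.assoc)
 \<comment> \<open>Integration under the law of u, with values in the constant functions, is a
   bounded operator; termwise integration is then an instance of \<open>opexp_sums\<close>.\<close>
 have B: "bounded_op path_space 1 (\<lambda>F (w :: real => 'a). \<integral>v. F v \<partial>Q u)"
  unfolding bounded_op_def
 proof (intro conjI ballI allI impI)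
  fix F G :: "(real => 'a) => real" and a b and w :: "real => 'a" assume F: "F \<in> bmf path_space" and G: "G \<in> bmf path_space"
  show "(LINT v|Q u. a * F v + b * G v) = a * (LINT v|Q u. F v) + b * (LINT v|Q u. G v)"
   using bmf_integrable_Q[OF au F] bmf_integrable_Q[OF au G] by simp
 next
  fix F :: "(real => 'a) => real" and C and w :: "real => 'a" assume F: "F \<in> bmf path_space" and C: "\<forall>w\<in>space path_space. \<bar>F w\<bar> \<le> C"
  have "\<bar>\<integral>v. F v \<partial>Q u\<bar> \<le> (LINT v|Q u. \<bar>F v\<bar>)" by (rule integral_abs_bound)
  also have "\<dots> \<le> (LINT v|Q u. C)"
   using C bmf_integrable_Q[OF au F] by (intro integral_mono) (auto simp: space_Q[OF au] space_path_space)
  finally show "\<bar>\<integral>v. F v \<partial>Q u\<bar> \<le> 1 * C" using Qu.prob_space by simp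
 qed auto
 have "bounded_op path_space (\<bar>t\<bar> * ((1 + \<bar>1\<bar>) * (LINT z|intensity_upto T \<nu>. \<bar>h (snd z)\<bar>))) (\<lambda>f w. t * ?A f w)"
  using bounded_op_lincomb[OF A A, of t 0] by simp
 note tAb = this
 \<comment> \<open>A path at which the constant function is evaluated; the zero path serves.\<close>
 define w0 :: "real => 'a" where "w0 = (\<lambda>t\<in>{0..}. 0)"
 have w0: "w0 \<in> space path_space"
 proof -
  have "(w0 \<longlongrightarrow> 0) (at_right t)" if "0 \<le> t" for t
   by (rule tendsto_eventually) (use that in \<open>auto simp: w0_def eventually_at_right_field intro!: exI[of _ "t + 1"]\<close>)
  moreover have "(w0 \<longlongrightarrow> 0) (at_left t)" if "0 < t" for t
   by (rule tendsto_eventually) (use that in \<open>auto simp: w0_def eventually_at_left_field intro!: exI[of _ 0]\<close>)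
  ultimately show ?thesis by (auto simp: space_path_space cadlag_def w0_def[THEN fun_cong] intro!: exI) (auto simp: w0_def)
 qed
 have S: "(\<lambda>n. (LINT v|Q u. ((\<lambda>f w. t * ?A f w) ^^ n) f v) / fact n) sums (LINT v|Q u. opexp (\<lambda>f w. t * ?A f w) f v)"
  by (rule opexp_sums[OF B tAb f w0])
 have "(LINT w|Q (\<lambda>x. u x + t * h x). f w) = (LINT w|Q u. E (\<lambda>x. t * h x) f w)"
  using h by (intro integral_add_jumps[OF au ah _ _ f]) auto
 also have "\<dots> = (LINT v|Q u. opexp (\<lambda>f w. t * ?A f w) f v)" by (simp only: tA)
 finally have L: "(LINT w|Q (\<lambda>x. u x + t * h x). f w) = (LINT v|Q u. opexp (\<lambda>f w. t * ?A f w) f v)" .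
 have "(LINT v|Q u. ((\<lambda>f w. t * ?A f w) ^^ n) f v) = t ^ n * coefficient f h n" for n
 proof -
  interpret Ln: sigma_finite_measure "Lam n" by (rule P.sigma_finite) simp
  interpret PQ: pair_sigma_finite "Lam n" "Q u" ..
  let ?F = "\<lambda>z w. (\<Prod>i<n. h (snd (z i))) * shift_diffs 1 n z f w"
  obtain C where C: "\<And>w. w \<in> cadlag ==> \<bar>f w\<bar> \<le> C" "0 \<le> C" using f by (metis bmfE space_path_space)
  have pm: "(\<lambda>z. \<Prod>i<n. h (snd (z i))) \<in> borel_measurable (Lam n)" by (rule Lam_prod_measurable[OF u au u2 h(2)])
  have pi: "integrable (Lam n) (\<lambda>z. \<Prod>i<n. h (snd (z i)))" by (rule P.product_integrable_prod) (auto intro: hs)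
  have sm: "(\<lambda>(z, w). shift_diffs 1 n z f w) \<in> borel_measurable (Lam n \<Otimes>\<^sub>M Q u)"
   using measurable_shift_diffs_PiM[OF bmf_measurable[OF f], of 1 n] measurable_cong_sets[OF sets_pair_measure_cong[OF refl Q_sets[OF au]] refl] by blast
  have Fm: "(\<lambda>(z, w). ?F z w) \<in> borel_measurable (Lam n \<Otimes>\<^sub>M Q u)"
   using sm measurable_compose[OF measurable_fst pm, of "Q u"] by (simp add: case_prod_beta')
  have gi: "integrable (Lam n \<Otimes>\<^sub>M Q u) (\<lambda>(z, w). (\<Prod>i<n. h (snd (z i))) * (2 ^ n * C))"
  proof (rule PQ.Fubini_integrable)
   show "(\<lambda>(z, w). (\<Prod>i<n. h (snd (z i))) * (2 ^ n * C)) \<in> borel_measurable (Lam n \<Otimes>\<^sub>M Q u)"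
    using measurable_compose[OF measurable_fst pm, of "Q u"] by (simp add: case_prod_beta')
  qed (use pi in \<open>auto simp: abs_mult intro!: integrable_mult_left\<close>)
  have Fi: "integrable (Lam n \<Otimes>\<^sub>M Q u) (\<lambda>(z, w). ?F z w)"
  proof (rule integrable_le[OF gi Fm], rule AE_I2)
   fix p assume "p \<in> space (Lam n \<Otimes>\<^sub>M Q u)"
   then obtain z w where p: "p = (z, w)" and w: "w \<in> cadlag" by (auto simp: space_pair_measure space_Q[OF au])
   have "\<bar>shift_diffs 1 n z f w\<bar> \<le> 2 ^ n * C" using shift_diffs_le[OF C(1) w, where c = 1 and n = n and z = z] by simp
   then show "norm (case p of (z, w) => ?F z w) \<le> norm (case p of (z, w) => (\<Prod>i<n. h (snd (z i))) * (2 ^ n * C))"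
    using C(2) by (simp add: p abs_mult mult_left_mono)
  qed
  have "(LINT v|Q u. ((\<lambda>f w. t * ?A f w) ^^ n) f v) = (LINT v|Q u. t ^ n * (LINT z|Lam n. ?F z v))"
   using funpow_scale_op[OF A f, where t = t and n = n] funpow_jump_op[OF f hs]
   by (intro lint_cong refl) (simp add: space_Q[OF au] space_path_space)
  also have "\<dots> = t ^ n * (LINT v|Q u. (LINT z|Lam n. ?F z v))" by simp
  also have "(LINT v|Q u. (LINT z|Lam n. ?F z v)) = (LINT z|Lam n. (LINT v|Q u. ?F z v))"
   by (rule PQ.Fubini_integral[OF Fi])
  also have "\<dots> = coefficient f h n"
   unfolding coefficient_def expected_diff_def by (simp add: mult.commute)
  finally show ?thesis .
 qed
 then show ?thesis using S unfolding L by simp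
qed

section \<open>Removal of the cutoff on g and of the truncation of f\<close>

context
 fixes g :: "'a => real" and t :: real
 assumes g[measurable]: "g \<in> borel_measurable borel" and g2: "integrable \<nu> (\<lambda>x. (g x)\<^sup>2)"
  and gm: "integrable \<nu> (\<lambda>x. min (norm x) 1 * g x)" and ag: "admissible \<nu> (\<lambda>x. u x + t * g x)"
begin

lemma ug: "integrable \<nu> (\<lambda>x. u x * g x)"
 using integrable_mult_square[OF borel_nu[OF u] borel_nu[OF g] _ g2] u2 by (simp add: power2_eq_square)

lemma perturbed_square: "integrable \<nu> (\<lambda>x. (u x + t * g x) * (u x + t * g x))"
proof -
 have "(\<lambda>x. (u x + t * g x) * (u x + t * g x)) = (\<lambda>x. u x * u x + (2 * t) * (u x * g x) + t\<^sup>2 * (g x)\<^sup>2)"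
  by (auto simp: power2_eq_square algebra_simps)
 then show ?thesis using u2 ug g2 by simp
qed

text \<open>The factor in the last claim tends to 0 because the three inner products have a common
  limit, the squared norm of u + t g, so that the exponentials cancel as 1 - 2 + 1.\<close>

lemma cut_facts:
 defines "gc \<equiv> \<lambda>m. restrict_to m g"
 shows "gc m \<in> borel_measurable borel" "integrable \<nu> (gc m)" "integrable \<nu> (\<lambda>x. (gc m x)\<^sup>2)"
  "admissible \<nu> (\<lambda>x. u x + t * gc m x)" "integrable \<nu> (\<lambda>x. (u x + t * gc m x) * (u x + t * gc m x))"
  "(\<lambda>m. cs_factor (\<lambda>_. 1) (\<lambda>x. u x + t * gc m x) (\<lambda>x. u x + t * g x)) \<longlonglongrightarrow> 0"
proof -
 show m[measurable]: "gc m \<in> borel_measurable borel" for m unfolding gc_def restrict_to_def[abs_def] by measurable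
 show i: "integrable \<nu> (gc m)" for m using integrable_cutoff[OF g gm, of m] by (simp add: gc_def restrict_to_def[abs_def])
 have sq: "(\<lambda>x. (gc m x)\<^sup>2) \<in> borel_measurable borel" for m by measurable
 show i2: "integrable \<nu> (\<lambda>x. (gc m x)\<^sup>2)" for m
  by (rule integrable_le[OF g2 borel_nu[OF sq]]) (auto simp: gc_def restrict_to_def indicator_def)
 show "admissible \<nu> (\<lambda>x. u x + t * gc m x)" for m
 proof (rule admissibleI)
  show "AE x in \<nu>. - 1 \<le> u x + t * gc m x"
   using admissible_ge[OF au] admissible_ge[OF ag] by eventually_elim (auto simp: gc_def restrict_to_def indicator_def)
  have "integrable \<nu> (\<lambda>x. min (norm x) 1 * u x + t * (min (norm x) 1 * gc m x))"
   by (intro integrable_plus integrable_mult_right admissible_integrable[OF au] integrable_min_mult i m)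
  then show "integrable \<nu> (\<lambda>x. min (norm x) 1 * (u x + t * gc m x))" by (simp add: algebra_simps)
 qed measurable
 have uc: "integrable \<nu> (\<lambda>x. u x * gc m x)" for m
  using integrable_mult_square[OF borel_nu[OF u] borel_nu[OF m] _ i2] u2 by (simp add: power2_eq_square)
 have sqe: "(\<lambda>x. (u x + t * gc m x) * (u x + t * gc m x)) = (\<lambda>x. u x * u x + (2 * t) * (u x * gc m x) + t\<^sup>2 * (gc m x)\<^sup>2)" for m
  by (auto simp: power2_eq_square algebra_simps)
 then show "integrable \<nu> (\<lambda>x. (u x + t * gc m x) * (u x + t * gc m x))" for m using u2 uc i2 by simp
 \<comment> \<open>Each product is written as a fixed part plus a part multiplied by the cutoff
   indicator, so that every limit is an instance of dominated convergence.\<close>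
 define H1 where "H1 x = (2 * t) * (u x * g x) + t\<^sup>2 * (g x)\<^sup>2" for x
 define H2 where "H2 x = t * (u x * g x) + t\<^sup>2 * (g x)\<^sup>2" for x
 define H3 where "H3 x = u x * u x + t * (u x * g x)" for x
 have Hi: "integrable \<nu> H1" "integrable \<nu> H2" "integrable \<nu> H3" unfolding H1_def[abs_def] H2_def[abs_def] H3_def[abs_def] using ug g2 u2 by auto
 have idm: "(\<lambda>x. x) \<in> borel_measurable \<nu>" by (rule measurable_ident_sets[OF sets_nu])
 have ci: "integrable \<nu> (\<lambda>x. indicator (cutoff m) x *\<^sub>R H x)" if "integrable \<nu> H" for H :: "'a => real" and m
 proof -
  have "cutoff m \<in> sets \<nu>" using sets_nu by simp
  then show ?thesis using that by (rule integrable_mult_indicator)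
 qed
 have L: "(\<lambda>m. \<integral>x. indicator (cutoff m) x *\<^sub>R H x \<partial>\<nu>) \<longlonglongrightarrow> (LINT x|\<nu>. H x)" if "integrable \<nu> H" for H :: "'a => real"
  by (rule integral_cutoff_tendsto[OF that idm levy_measure_AE_nonzero[OF levy]])
 let ?A = "\<integral>x. (u x + t * g x) * (u x + t * g x) \<partial>\<nu>"
 have A1: "?A = (LINT x|\<nu>. u x * u x) + (LINT x|\<nu>. H1 x)"
  unfolding lint_add[OF u2 Hi(1), symmetric]
  by (intro lint_cong refl) (simp add: H1_def power2_eq_square algebra_simps)
 have A2: "?A = (LINT x|\<nu>. H3 x) + (LINT x|\<nu>. H2 x)"
  unfolding lint_add[OF Hi(3) Hi(2), symmetric]
  by (intro lint_cong refl) (simp add: H2_def H3_def power2_eq_square algebra_simps)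
 have e1: "(LINT x|\<nu>. (u x + t * gc m x) * (u x + t * gc m x)) = (LINT x|\<nu>. u x * u x) + (LINT x|\<nu>. indicator (cutoff m) x *\<^sub>R H1 x)" for m
  unfolding lint_add[OF u2 ci[OF Hi(1)], symmetric]
  by (intro lint_cong refl) (auto simp: H1_def gc_def restrict_to_def power2_eq_square algebra_simps indicator_def)
 have e2: "(LINT x|\<nu>. (u x + t * gc m x) * (u x + t * g x)) = (LINT x|\<nu>. H3 x) + (LINT x|\<nu>. indicator (cutoff m) x *\<^sub>R H2 x)" for m
  unfolding lint_add[OF Hi(3) ci[OF Hi(2)], symmetric]
  by (intro lint_cong refl) (auto simp: H2_def H3_def gc_def restrict_to_def power2_eq_square algebra_simps indicator_def)
 have "(\<lambda>m. cs_factor (\<lambda>_. 1) (\<lambda>x. u x + t * gc m x) (\<lambda>x. u x + t * g x)) \<longlonglongrightarrow>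
  exp (T * ((LINT x|\<nu>. u x * u x) + (LINT x|\<nu>. H1 x))) - 2 * exp (T * ((LINT x|\<nu>. H3 x) + (LINT x|\<nu>. H2 x))) + exp (T * ?A)"
  unfolding cs_factor_def mult_1 e1 e2 by (intro tendsto_intros L Hi)
 then show "(\<lambda>m. cs_factor (\<lambda>_. 1) (\<lambda>x. u x + t * gc m x) (\<lambda>x. u x + t * g x)) \<longlonglongrightarrow> 0"
  unfolding A1[symmetric] A2[symmetric] by simp
qed

text \<open>Both sides are limits along the cutoffs of g: the integrals by the Cauchy-Schwarz bound,
  the series by Tannery's theorem with the majorant for g itself, since cutting off only lowers the
  norm.\<close>

lemma series_bounded:
 assumes f: "f \<in> bmf path_space"
 shows "(LINT w|Q (\<lambda>x. u x + t * g x). f w) = (\<Sum>n. t ^ n / fact n * coefficient f g n)"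
proof -
 let ?gc = "\<lambda>m. restrict_to m g"
 let ?q = "\<integral>w. (f w)\<^sup>2 \<partial>Q (\<lambda>_. 0)"
 have f2: "integrable (Q (\<lambda>_. 0)) (\<lambda>w. (f w)\<^sup>2)" by (rule bmf_integrable_Q[OF admissible_0 bmf_power2[OF f]])
 note fm = bmf_measurable[OF f]
 have X: "(\<lambda>m. \<integral>w. f w \<partial>Q (\<lambda>x. u x + t * ?gc m x)) \<longlonglongrightarrow> (LINT w|Q (\<lambda>x. u x + t * g x). f w)"
 proof -
  define d where "d m = (LINT w|Q (\<lambda>x. u x + t * ?gc m x). f w) - (LINT w|Q (\<lambda>x. u x + t * g x). f w)" for m
  have le: "(d m)\<^sup>2 \<le> ?q * cs_factor (\<lambda>_. 1) (\<lambda>x. u x + t * ?gc m x) (\<lambda>x. u x + t * g x)" for m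
   unfolding d_def using cut_facts(1)[of m] by (intro cs_bound_1 cut_facts ag perturbed_square f) auto
  have "(\<lambda>m. ?q * cs_factor (\<lambda>_. 1) (\<lambda>x. u x + t * ?gc m x) (\<lambda>x. u x + t * g x)) \<longlonglongrightarrow> ?q * 0"
   by (intro tendsto_mult tendsto_const cut_facts)
  then have z: "(\<lambda>m. ?q * cs_factor (\<lambda>_. 1) (\<lambda>x. u x + t * ?gc m x) (\<lambda>x. u x + t * g x)) \<longlonglongrightarrow> 0" by simp
  have "(\<lambda>m. (d m)\<^sup>2) \<longlonglongrightarrow> 0"
   by (rule tendsto_sandwich[OF always_eventually always_eventually tendsto_const z]) (simp_all add: le)
  from tendsto_real_sqrt[OF this] have "(\<lambda>m. \<bar>d m\<bar>) \<longlonglongrightarrow> 0" by (simp only: real_sqrt_abs real_sqrt_zero)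
  from tendsto_rabs_zero_cancel[OF this] show ?thesis unfolding d_def by (rule LIM_zero_cancel)
 qed
 have c: "(\<lambda>m. coefficient f (?gc m) n) \<longlonglongrightarrow> coefficient f g n" for n
 proof (cases "n = 0")
  case False
  have dom: "integrable (Lam n) (\<lambda>z. \<bar>expected_diff f n z * (\<Prod>i<n. g (snd (z i)))\<bar>)"
   using coefficient_bound(1)[OF fm f2 _ g g2] False by simp
  show ?thesis unfolding coefficient_def
  proof (rule integral_dominated_convergence[OF _ _ dom])
   show "(\<lambda>z. expected_diff f n z * (\<Prod>i<n. g (snd (z i)))) \<in> borel_measurable (Lam n)"
    by (intro borel_measurable_times expected_diff_measurable[OF fm] Lam_prod_measurable[OF u au u2 g])
   show "(\<lambda>z. expected_diff f n z * (\<Prod>i<n. ?gc m (snd (z i)))) \<in> borel_measurable (Lam n)" for m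
    by (intro borel_measurable_times expected_diff_measurable[OF fm] Lam_prod_measurable[OF u au u2 cut_facts(1)])
   show "AE z in Lam n. (\<lambda>m. expected_diff f n z * (\<Prod>i<n. ?gc m (snd (z i)))) \<longlonglongrightarrow> expected_diff f n z * (\<Prod>i<n. g (snd (z i)))"
    using AE_Lam_nonzero[OF u au u2]
   proof eventually_elim
    case (elim z)
    show ?case
     by (rule tendsto_eventually) (use cutoff_prod_eventually[OF u au u2 elim] in eventually_elim, simp add: restrict_to_def)
   qed
   show "AE z in Lam n. norm (expected_diff f n z * (\<Prod>i<n. ?gc m (snd (z i)))) \<le> \<bar>expected_diff f n z * (\<Prod>i<n. g (snd (z i)))\<bar>" for m
    by (intro AE_I2) (auto simp: abs_mult abs_prod restrict_to_def indicator_def intro!: mult_left_mono prod_mono)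
  qed
 qed (simp add: coefficient_0)
 have "(\<lambda>m. \<Sum>n. t ^ n / fact n * coefficient f (?gc m) n) \<longlonglongrightarrow> (\<Sum>n. t ^ n / fact n * coefficient f g n)"
 proof (rule tannerys_theorem[THEN conjunct2, THEN conjunct2])
  show "(\<lambda>m. t ^ n / fact n * coefficient f (?gc m) n) \<longlonglongrightarrow> t ^ n / fact n * coefficient f g n" for n
   by (intro tendsto_mult tendsto_const c)
  show "summable (term_bound ?q (T * (LINT x|\<nu>. (g x)\<^sup>2)) t)" using T by (intro summable_term_bound) auto
  have "\<bar>t ^ n / fact n * coefficient f (?gc m) n\<bar> \<le> term_bound ?q (T * (LINT x|\<nu>. (g x)\<^sup>2)) t n" if n: "0 < n" for n m
  proof (rule order_trans[OF term_le[OF fm f2 n cut_facts(1,3)]])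
   have "(LINT x|\<nu>. (?gc m x)\<^sup>2) \<le> (LINT x|\<nu>. (g x)\<^sup>2)"
    by (intro integral_mono cut_facts g2) (auto simp: restrict_to_def indicator_def)
   then show "term_bound ?q (T * (LINT x|\<nu>. (?gc m x)\<^sup>2)) t n \<le> term_bound ?q (T * (LINT x|\<nu>. (g x)\<^sup>2)) t n"
    unfolding term_bound_def using T
    by (intro mult_left_mono power_mono real_sqrt_le_mono mult_nonneg_nonneg) (auto intro!: diff_const_nonneg[OF u au u2] mult_nonneg_nonneg)
  qed
  \<comment> \<open>The majorant is available for n > 0; domination for all large n is what
    Tannery's theorem requires.\<close>
  then show "\<forall>\<^sub>F (n, m) in at_top \<times>\<^sub>F sequentially. norm (t ^ n / fact n * coefficient f (?gc m) n) \<le> term_bound ?q (T * (LINT x|\<nu>. (g x)\<^sup>2)) t n"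
   unfolding eventually_prod_filter
   by (intro exI[of _ "\<lambda>n. 0 < n"] exI[of _ "\<lambda>_. True"]) (auto intro: eventually_gt_at_top)
 qed simp
 moreover have "(\<Sum>n. t ^ n / fact n * coefficient f (?gc m) n) = (LINT w|Q (\<lambda>x. u x + t * ?gc m x). f w)" for m
  using series_finite_activity[OF f cut_facts(2,1,4)] by (simp add: sums_iff)
 ultimately show ?thesis using LIMSEQ_unique[OF X] by simp
qed

text \<open>The truncation error of f tends to 0 in L^2 of the reference law. Each coefficient with
  n > 0 is linear in f and bounded by that norm, hence converges, and the majorants of the
  truncations are below the one for f.\<close>

theorem perturbation_series:
 assumes f: "f \<in> borel_measurable path_space" and f2: "integrable (Q (\<lambda>_. 0)) (\<lambda>w. (f w)\<^sup>2)"
 shows "(LINT w|Q (\<lambda>x. u x + t * g x). f w) = (\<Sum>n. t ^ n / fact n * coefficient f g n)"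
proof -
 let ?G = "T * (LINT x|\<nu>. (g x)\<^sup>2)"
 let ?q = "\<integral>w. (f w)\<^sup>2 \<partial>Q (\<lambda>_. 0)"
 let ?f = "\<lambda>R w. trunc R (f w)"
 have um: "(\<lambda>x. u x + t * g x) \<in> borel_measurable borel" by measurable
 have X: "(\<lambda>R. \<integral>w. ?f R w \<partial>Q (\<lambda>x. u x + t * g x)) \<longlonglongrightarrow> (LINT w|Q (\<lambda>x. u x + t * g x). f w)"
  by (rule integral_trunc_tendsto[OF f ag integrable_L2[OF f f2 um ag perturbed_square]])
 note tm = bmf_measurable[OF trunc_bmf[OF f]] and t2 = trunc_L2[OF f]
 have c: "(\<lambda>R. coefficient (?f R) g n) \<longlonglongrightarrow> coefficient f g n" for n
 proof (cases "n = 0")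
  case True
  then show ?thesis using integral_trunc_tendsto[OF f au integrable_L2[OF f f2 u au u2]] by (simp add: coefficient_0)
 next
  case False
  then have n: "0 < n" by simp
  define e where "e R = (LINT w|Q (\<lambda>_. 0). (?f R w - f w)\<^sup>2)" for R
  have fd: "(\<lambda>w. ?f R w - f w) \<in> borel_measurable path_space" for R using tm f by simp
  have fd2: "integrable (Q (\<lambda>_. 0)) (\<lambda>w. (?f R w - f w)\<^sup>2)" for R by (rule L2_diff[OF tm t2 f f2])
  have e0: "e \<longlonglongrightarrow> 0"
  proof -
   note [measurable] = measurable_Q[OF admissible_0 f]
   have "e \<longlonglongrightarrow> (LINT w|Q (\<lambda>_. 0). 0)" unfolding e_def[abs_def]
   proof (rule integral_dominated_convergence)
    show "integrable (Q (\<lambda>_. 0)) (\<lambda>w. 4 * (f w)\<^sup>2)" using f2 by simp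
    show "(\<lambda>w. (?f R w - f w)\<^sup>2) \<in> borel_measurable (Q (\<lambda>_. 0))" for R using fd2 by blast
    show "AE w in Q (\<lambda>_. 0). (\<lambda>R. (?f R w - f w)\<^sup>2) \<longlonglongrightarrow> 0"
    proof (rule AE_I2)
     fix w
     have "(\<lambda>R. (?f R w - f w)\<^sup>2) \<longlonglongrightarrow> (f w - f w)\<^sup>2" by (intro tendsto_intros trunc_tendsto)
     then show "(\<lambda>R. (?f R w - f w)\<^sup>2) \<longlonglongrightarrow> 0" by simp
    qed
    show "AE w in Q (\<lambda>_. 0). norm ((?f R w - f w)\<^sup>2) \<le> 4 * (f w)\<^sup>2" for R
    proof (rule AE_I2)
     fix w
     have "\<bar>?f R w - f w\<bar> \<le> \<bar>2 * f w\<bar>" using trunc_le(2)[of R "f w"] by linarith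
     then show "norm ((?f R w - f w)\<^sup>2) \<le> 4 * (f w)\<^sup>2" unfolding abs_le_square_iff by (simp add: power_mult_distrib)
    qed
   qed simp
   then show ?thesis by simp
  qed
  have lin: "coefficient (?f R) g n - coefficient f g n = coefficient (\<lambda>w. ?f R w - f w) g n" for R
  proof -
   \<comment> \<open>Linearity of the expected difference uses that both integrals exist, which is
     known for almost every z.\<close>
   have ae: "AE z in Lam n. expected_diff (\<lambda>w. ?f R w - f w) n z = expected_diff (?f R) n z - expected_diff f n z"
    using AE_integrable_jump_diffs[OF u au u2 f f2, of n] AE_integrable_jump_diffs[OF u au u2 tm t2, of n R]
   proof eventually_elim
    case (elim z)
    have "shift_diffs 1 n z (\<lambda>w. ?f R w - f w) w = shift_diffs 1 n z (?f R) w - shift_diffs 1 n z f w" for w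
     using shift_diffs_linear[of 1 n z 1 "?f R" "- 1" f w] by simp
    then show ?case using elim by (simp add: expected_diff_def)
   qed
   have "coefficient (\<lambda>w. ?f R w - f w) g n = (LINT z|Lam n. expected_diff (?f R) n z * (\<Prod>i<n. g (snd (z i))) - expected_diff f n z * (\<Prod>i<n. g (snd (z i))))"
    unfolding coefficient_def
   proof (rule integral_cong_AE)
    show "AE z in Lam n. expected_diff (\<lambda>w. ?f R w - f w) n z * (\<Prod>i<n. g (snd (z i))) = expected_diff (?f R) n z * (\<Prod>i<n. g (snd (z i))) - expected_diff f n z * (\<Prod>i<n. g (snd (z i)))"
     using ae by eventually_elim (simp add: left_diff_distrib)
   qed (intro borel_measurable_times borel_measurable_diff expected_diff_measurable fd tm f Lam_prod_measurable[OF u au u2 g])+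
   then show ?thesis unfolding coefficient_def
    using coefficient_bound(1)[OF f f2 n g g2] coefficient_bound(1)[OF tm t2 n g g2] by simp
  qed
  have le: "\<bar>coefficient (?f R) g n - coefficient f g n\<bar> \<le> sqrt (diff_const u n * e R) * sqrt ?G ^ n" for R
   unfolding lin e_def by (subst coefficient_def) (rule order_trans[OF integral_abs_bound coefficient_bound(2)[OF fd fd2 n g g2]])
  have "(\<lambda>R. sqrt (diff_const u n * e R) * sqrt ?G ^ n) \<longlonglongrightarrow> sqrt (diff_const u n * 0) * sqrt ?G ^ n"
   by (intro tendsto_intros e0)
  then have z: "(\<lambda>R. sqrt (diff_const u n * e R) * sqrt ?G ^ n) \<longlonglongrightarrow> 0" by simp
  have "(\<lambda>R. coefficient (?f R) g n - coefficient f g n) \<longlonglongrightarrow> 0"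
   by (rule Lim_null_comparison[OF always_eventually z]) (simp add: le)
  then show ?thesis by (rule LIM_zero_cancel)
 qed
 have "(\<lambda>R. \<Sum>n. t ^ n / fact n * coefficient (?f R) g n) \<longlonglongrightarrow> (\<Sum>n. t ^ n / fact n * coefficient f g n)"
 proof (rule tannerys_theorem[THEN conjunct2, THEN conjunct2])
  show "(\<lambda>R. t ^ n / fact n * coefficient (?f R) g n) \<longlonglongrightarrow> t ^ n / fact n * coefficient f g n" for n
   by (intro tendsto_mult tendsto_const c)
  show "summable (term_bound ?q ?G t)" using T by (intro summable_term_bound) auto
  have "\<bar>t ^ n / fact n * coefficient (?f R) g n\<bar> \<le> term_bound ?q ?G t n" if n: "0 < n" for n R
  proof (rule order_trans[OF term_le[OF tm t2 n g g2]])
   show "term_bound (LINT w|Q (\<lambda>_. 0). (?f R w)\<^sup>2) ?G t n \<le> term_bound ?q ?G t n"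
    unfolding term_bound_def using T
    by (intro mult_left_mono mult_right_mono real_sqrt_le_mono trunc_square_le f f2 diff_const_nonneg[OF u au u2]) auto
  qed
  then show "\<forall>\<^sub>F (n, R) in at_top \<times>\<^sub>F sequentially. norm (t ^ n / fact n * coefficient (?f R) g n) \<le> term_bound ?q ?G t n"
   unfolding eventually_prod_filter
   by (intro exI[of _ "\<lambda>n. 0 < n"] exI[of _ "\<lambda>_. True"]) (auto intro: eventually_gt_at_top)
 qed simp
 then show ?thesis using LIMSEQ_unique[OF X] series_bounded[OF trunc_bmf[OF f]] by simp
qed

end

end

end

section \<open>Poisson and Wiener processes\<close>

text \<open>\<open>N\<close> is left arbitrary: besides the probability space it will be the
  \<sigma>-field generated by the counts, to which the independence of the Gaussian part refers. The
  proof is the standard induction over nonnegative measurable functions.\<close>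

lemma measurable_nn_integral_random_measure:
 fixes \<Phi> :: "'w => 'y measure" and h :: "'y => ennreal"
 assumes s: "\<And>w. w \<in> space N ==> sets (\<Phi> w) = sets L"
  and m: "\<And>B. B \<in> sets L ==> (\<lambda>w. emeasure (\<Phi> w) B) \<in> borel_measurable N"
  and h: "h \<in> borel_measurable L"
 shows "(\<lambda>w. \<integral>\<^sup>+p. h p \<partial>\<Phi> w) \<in> borel_measurable N"
proof -
 have step: "F \<in> borel_measurable N" if "\<And>w. w \<in> space N ==> F w = G w" "G \<in> borel_measurable N" for F G :: "'w => ennreal"
  using measurable_cong[of N F G borel] that by blast
 from h show ?thesis
 proof (induction rule: borel_measurable_induct)
 case (cong f g)
 have eq: "(\<integral>\<^sup>+p. f p \<partial>\<Phi> w) = (\<integral>\<^sup>+p. g p \<partial>\<Phi> w)" if "w \<in> space N" for w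
  using cong(3) sets_eq_imp_space_eq[OF s[OF that]] by (intro nn_integral_cong) auto
 show ?case by (rule step[OF eq]) (assumption | rule cong)+
next
 case (set A)
 have eq: "(\<integral>\<^sup>+p. indicator A p \<partial>\<Phi> w) = emeasure (\<Phi> w) A" if "w \<in> space N" for w
  using set s[OF that] by simp
 show ?case by (rule step[OF eq]) (assumption | rule m[OF set])+
next
 case (mult u c)
 have eq: "(\<integral>\<^sup>+p. c * u p \<partial>\<Phi> w) = c * (\<integral>\<^sup>+p. u p \<partial>\<Phi> w)" if "w \<in> space N" for w
  using mult(2) measurable_cong_sets[OF s[OF that] refl] by (intro nn_integral_cmult) blast
 show ?case by (rule step[OF eq]) (assumption, use mult.IH in measurable)
next
 case (add u v)
 have eq: "(\<integral>\<^sup>+p. v p + u p \<partial>\<Phi> w) = (\<integral>\<^sup>+p. v p \<partial>\<Phi> w) + (\<integral>\<^sup>+p. u p \<partial>\<Phi> w)" if "w \<in> space N" for w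
  using add measurable_cong_sets[OF s[OF that] refl] by (intro nn_integral_add) blast+
 show ?case by (rule step[OF eq]) (assumption, use add.IH in measurable)
next
 case (seq U)
 have eq: "(\<integral>\<^sup>+p. (SUP i. U i) p \<partial>\<Phi> w) = (SUP i. \<integral>\<^sup>+p. U i p \<partial>\<Phi> w)" if "w \<in> space N" for w
 proof -
  have "(\<integral>\<^sup>+p. (SUP i. U i p) \<partial>\<Phi> w) = (SUP i. \<integral>\<^sup>+p. U i p \<partial>\<Phi> w)"
   using seq measurable_cong_sets[OF s[OF that] refl] by (intro nn_integral_monotone_convergence_SUP) blast+
  then show ?thesis unfolding SUP_apply .
 qed
 show ?case by (rule step[OF eq]) (assumption | rule borel_measurable_SUP[OF countableI_type seq.IH])+
qed
qed

lemma measurable_integral_random_measure_real: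
 fixes \<Phi> :: "'w => 'y measure" and h :: "'y => real"
 assumes s: "\<And>w. w \<in> space N ==> sets (\<Phi> w) = sets L"
  and m: "\<And>B. B \<in> sets L ==> (\<lambda>w. emeasure (\<Phi> w) B) \<in> borel_measurable N"
  and h: "h \<in> borel_measurable L"
 shows "(\<lambda>w. \<integral>p. h p \<partial>\<Phi> w) \<in> borel_measurable N"
proof -
 have aux: "(\<lambda>w. \<integral>\<^sup>+p. k p \<partial>\<Phi> w) \<in> borel_measurable N" if "k \<in> borel_measurable L" for k
  using s m that by (rule measurable_nn_integral_random_measure)
 have [measurable]: "(\<lambda>w. \<integral>\<^sup>+p. ennreal (norm (h p)) \<partial>\<Phi> w) \<in> borel_measurable N"
  by (intro aux measurable_compose[OF measurable_compose[OF h borel_measurable_norm] measurable_ennreal])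
 have [measurable]: "(\<lambda>w. \<integral>\<^sup>+p. ennreal (h p) \<partial>\<Phi> w) \<in> borel_measurable N"
  using h by (intro aux measurable_compose[OF _ measurable_ennreal])
 have [measurable]: "(\<lambda>w. \<integral>\<^sup>+p. ennreal (- h p) \<partial>\<Phi> w) \<in> borel_measurable N"
  using h by (intro aux measurable_compose[OF _ measurable_ennreal] borel_measurable_uminus)
 \<comment> \<open>Where h is not integrable the integral is 0 by convention; the case distinction
   on the integral of the norm makes the formula valid for every w.\<close>
 have "(LINT p|\<Phi> w. h p) = (if (\<integral>\<^sup>+p. ennreal (norm (h p)) \<partial>\<Phi> w) < \<infinity> then enn2real (\<integral>\<^sup>+p. ennreal (h p) \<partial>\<Phi> w) - enn2real (\<integral>\<^sup>+p. ennreal (- h p) \<partial>\<Phi> w) else 0)"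
  if "w \<in> space N" for w
 proof -
  have "h \<in> borel_measurable (\<Phi> w)" using h measurable_cong_sets[OF s[OF that] refl] by blast
  then show ?thesis by (auto simp: integrable_iff_bounded real_lebesgue_integral_def not_integrable_integral_eq)
 qed
 then show ?thesis by (subst measurable_cong) (assumption, measurable)
qed

text \<open>Componentwise, with one precaution: a vector function may fail to be integrable although
  one of its components is integrable, and then the vector integral is 0 while the component
  integral need not be. The case distinction is therefore on the norm.\<close>

lemma measurable_integral_random_measure:
 fixes \<Phi> :: "'w => 'y measure" and h :: "'y => 'a::euclidean_space"
 assumes s: "\<And>w. w \<in> space N ==> sets (\<Phi> w) = sets L"
  and m: "\<And>B. B \<in> sets L ==> (\<lambda>w. emeasure (\<Phi> w) B) \<in> borel_measurable N"
  and h: "h \<in> borel_measurable L"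
 shows "(\<lambda>w. \<integral>p. h p \<partial>\<Phi> w) \<in> borel_measurable N"
 unfolding borel_measurable_euclidean_space[where f = "\<lambda>w. \<integral>p. h p \<partial>\<Phi> w"]
proof
 fix i :: 'a assume "i \<in> Basis"
 have aux: "(\<lambda>w. \<integral>\<^sup>+p. k p \<partial>\<Phi> w) \<in> borel_measurable N" if "k \<in> borel_measurable L" for k
  using s m that by (rule measurable_nn_integral_random_measure)
 have [measurable]: "(\<lambda>w. \<integral>\<^sup>+p. ennreal (norm (h p)) \<partial>\<Phi> w) \<in> borel_measurable N"
  by (intro aux measurable_compose[OF measurable_compose[OF h borel_measurable_norm] measurable_ennreal])
 have [measurable]: "(\<lambda>w. \<integral>p. h p \<bullet> i \<partial>\<Phi> w) \<in> borel_measurable N"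
  using s m borel_measurable_inner[OF h borel_measurable_const] by (rule measurable_integral_random_measure_real)
 have "(LINT p|\<Phi> w. h p) \<bullet> i = (if (\<integral>\<^sup>+p. ennreal (norm (h p)) \<partial>\<Phi> w) < \<infinity> then (LINT p|\<Phi> w. h p \<bullet> i) else 0)"
  if "w \<in> space N" for w
 proof -
  have "h \<in> borel_measurable (\<Phi> w)" using h measurable_cong_sets[OF s[OF that] refl] by blast
  then show ?thesis by (auto simp: integrable_iff_bounded not_integrable_integral_eq)
 qed
 then show "(\<lambda>w. (LINT p|\<Phi> w. h p) \<bullet> i) \<in> borel_measurable N"
  by (subst measurable_cong) (assumption, measurable)
qed

text \<open>Independence is a property of the two generated \<sigma>-fields, so it passes to complex
  functions measurable with respect to them, and expectations of bounded ones factorise.\<close>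

lemma independent_elements_integral:
 fixes \<phi> \<psi> :: "'w => complex"
 assumes M: "prob_space M" and I: "independent_elements M A U B V"
  and \<phi>: "\<phi> \<in> borel_measurable (vimage_algebra (space M) U A)" and \<psi>: "\<psi> \<in> borel_measurable (vimage_algebra (space M) V B)"
  and b: "\<And>w. norm (\<phi> w) \<le> 1" "\<And>w. norm (\<psi> w) \<le> 1"
 shows "(LINT w|M. \<phi> w * \<psi> w) = (LINT w|M. \<phi> w) * (LINT w|M. \<psi> w)"
  and "\<phi> \<in> borel_measurable M" "\<psi> \<in> borel_measurable M"
proof -
 interpret prob_space M by fact
 have U: "U \<in> measurable M A" and V: "V \<in> measurable M B"
  and ind: "indep_set (sets (vimage_algebra (space M) U A)) (sets (vimage_algebra (space M) V B))"
  using I by (auto simp: independent_elements_def)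
 have sub: "sets (vimage_algebra (space M) U A) \<subseteq> sets M" "sets (vimage_algebra (space M) V B) \<subseteq> sets M"
  using ind by (auto simp: indep_set_def indep_sets_def UNIV_bool)
 have gen: "sigma_sets (space M) {f -` C \<inter> space M | C. C \<in> sets borel} \<subseteq> sets N"
  if "f \<in> borel_measurable N" "space N = space M" for f :: "'w => complex" and N
  using sets.sigma_sets_subset[of "{f -` C \<inter> space M | C. C \<in> sets borel}" N] measurable_sets[OF that(1)] that(2) by auto
 have mM: "f \<in> borel_measurable M" if "f \<in> borel_measurable N" "space N = space M" "sets N \<subseteq> sets M" for f :: "'w => complex" and N
  using that by (auto simp: measurable_def)
 show \<phi>M: "\<phi> \<in> borel_measurable M" by (rule mM[OF \<phi> _ sub(1)]) simp
 show \<psi>M: "\<psi> \<in> borel_measurable M" by (rule mM[OF \<psi> _ sub(2)]) simp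
 have "indep_var borel \<phi> borel \<psi>"
  unfolding indep_var_eq
 proof (intro conjI \<phi>M \<psi>M indep_setI)
  have g1: "sigma_sets (space M) {\<phi> -` C \<inter> space M | C. C \<in> sets borel} \<subseteq> sets (vimage_algebra (space M) U A)" by (rule gen[OF \<phi>]) simp
  have g2: "sigma_sets (space M) {\<psi> -` C \<inter> space M | C. C \<in> sets borel} \<subseteq> sets (vimage_algebra (space M) V B)" by (rule gen[OF \<psi>]) simp
  show "sigma_sets (space M) {\<phi> -` C \<inter> space M | C. C \<in> sets borel} \<subseteq> events" "sigma_sets (space M) {\<psi> -` C \<inter> space M | C. C \<in> sets borel} \<subseteq> events"
   using g1 g2 sub by auto
  fix a c assume "a \<in> sigma_sets (space M) {\<phi> -` C \<inter> space M | C. C \<in> sets borel}" "c \<in> sigma_sets (space M) {\<psi> -` C \<inter> space M | C. C \<in> sets borel}"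
  then show "prob (a \<inter> c) = prob a * prob c" using g1 g2 indep_setD[OF ind] by blast
 qed
 then show "(LINT w|M. \<phi> w * \<psi> w) = (LINT w|M. \<phi> w) * (LINT w|M. \<psi> w)"
  by (rule indep_var_lebesgue_integral) (use b \<phi>M \<psi>M in \<open>auto intro!: integrable_const_bound[where B = 1]\<close>)
qed

text \<open>For m \<ge> 0 this is the characteristic function of the Poisson distribution with mean
  m.\<close>

lemma exp_of_real_cis_sums: "(\<lambda>k. (m ^ k / fact k * exp (- m)) *\<^sub>R cis (c * real k)) sums exp (of_real m * (cis c - 1))"
proof -
 have "(\<lambda>k. exp (- of_real m) * ((of_real m * cis c) ^ k /\<^sub>R fact k)) sums (exp (- of_real m) * exp (of_real m * cis c))"
  by (intro sums_mult exp_converges)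
 moreover have "exp (- of_real m) * ((of_real m * cis c) ^ k /\<^sub>R fact k) = (m ^ k / fact k * exp (- m)) *\<^sub>R cis (c * real k)" for k
 proof -
  have e: "exp (- of_real m) = (of_real (exp (- m)) :: complex)" using exp_of_real[of "- m", where 'a = complex] by simp
  have d: "(of_real m * cis c) ^ k = of_real (m ^ k) * cis (c * real k)" unfolding power_mult_distrib Complex.DeMoivre by (simp only: of_real_power mult.commute[of c])
  show ?thesis unfolding e d by (simp add: scaleR_conv_of_real divide_inverse mult_ac)
 qed
 ultimately show ?thesis by (simp add: exp_add[symmetric] algebra_simps)
qed

section \<open>Characteristic functionals of Poisson processes\<close>

context
 fixes M :: "'w measure" and L :: "'y measure" and \<Phi> :: "'w => 'y measure"
 assumes M: "prob_space M" and P: "poisson_process M L \<Phi>"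
begin

interpretation prob_space M by (rule M)

lemma poisson_sets: "w \<in> space M ==> sets (\<Phi> w) = sets L"
 and poisson_values: "w \<in> space M ==> B \<in> sets L ==> emeasure (\<Phi> w) B \<in> insert \<infinity> (range of_nat)"
 and poisson_measurable: "B \<in> sets L ==> (\<lambda>w. emeasure (\<Phi> w) B) \<in> borel_measurable M"
 and poisson_prob: "B \<in> sets L ==> emeasure L B < \<infinity> ==> measure M {w\<in>space M. emeasure (\<Phi> w) B = of_nat k} = measure L B ^ k / fact k * exp (- measure L B)"
 and poisson_indep: "range A \<subseteq> sets L ==> disjoint_family A ==> indep_vars (\<lambda>_. borel) (\<lambda>i w. emeasure (\<Phi> w) (A i)) (UNIV :: nat set)"
 using P by (auto simp: poisson_process_def)

lemma poisson_char_set: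
 assumes B: "B \<in> sets L" "emeasure L B < \<infinity>"
 shows "AE w in M. emeasure (\<Phi> w) B < \<infinity>"
  and "(LINT w|M. cis (c * enn2real (emeasure (\<Phi> w) B))) = exp (of_real (measure L B) * (cis c - 1))"
proof -
 note [measurable] = poisson_measurable[OF B(1)]
 define A where "A k = {w\<in>space M. emeasure (\<Phi> w) B = of_nat k}" for k
 have A[measurable]: "A k \<in> sets M" for k unfolding A_def by measurable
 have disj: "disjoint_family A" by (auto simp: disjoint_family_on_def A_def)
 have pA: "measure M (A k) = measure L B ^ k / fact k * exp (- measure L B)" for k
  unfolding A_def by (rule poisson_prob[OF B])
 have rA: "range A \<subseteq> sets M" using A by blast
 have "(\<lambda>k. measure M (A k)) sums measure M (\<Union>k. A k)"
  by (rule finite_measure_UNION[OF rA disj])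
 moreover have "(\<lambda>k. measure M (A k)) sums (exp (measure L B) * exp (- measure L B))"
  unfolding pA by (intro sums_mult2 exp_series_sums)
 \<comment> \<open>The Poisson weights sum to 1, which excludes the value \<infinity> almost surely,
   so \<open>enn2real\<close> loses nothing.\<close>
 ultimately have "prob (\<Union>k. A k) = 1" using sums_unique2 by (fastforce simp: exp_minus)
 then have ae: "AE w in M. w \<in> (\<Union>k. A k)" by (subst (asm) prob_eq_1) auto
 then show "AE w in M. emeasure (\<Phi> w) B < \<infinity>" by eventually_elim (auto simp: A_def of_nat_less_top)
 let ?f = "\<lambda>w. cis (c * enn2real (emeasure (\<Phi> w) B))"
 have fm: "?f \<in> borel_measurable M" by measurable
 have fi: "integrable M ?f" by (rule integrable_const_bound[where B = 1]) (use fm in auto)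
 have "(LINT w|M. ?f w) = (LINT w:(\<Union>k. A k)|M. ?f w)"
  unfolding set_lebesgue_integral_def
 proof (rule integral_cong_AE)
  show "AE w in M. ?f w = indicator (\<Union>k. A k) w *\<^sub>R ?f w" using ae by eventually_elim simp
  show "(\<lambda>w. indicator (\<Union>k. A k) w *\<^sub>R ?f w) \<in> borel_measurable M" using fm by (intro borel_measurable_scaleR borel_measurable_indicator) auto
 qed (rule fm)
 also have "\<dots> = (\<Sum>k. LINT w:A k|M. ?f w)"
 proof (rule lebesgue_integral_countable_add)
  show "set_integrable M (\<Union>k. A k) ?f" unfolding set_integrable_def by (rule integrable_mult_indicator[OF _ fi]) auto
 qed (use disj A in \<open>auto simp: disjoint_family_on_def\<close>)
 also have "(\<lambda>k. LINT w:A k|M. ?f w) = (\<lambda>k. (measure L B ^ k / fact k * exp (- measure L B)) *\<^sub>R cis (c * real k))"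
 proof
  fix k
  have "(LINT w:A k|M. ?f w) = (LINT w|M. indicator (A k) w *\<^sub>R cis (c * real k))"
   unfolding set_lebesgue_integral_def
   by (intro lint_cong refl) (auto simp: indicator_def A_def)
  also have "\<dots> = measure M (A k) *\<^sub>R cis (c * real k)" using A by (simp add: less_top[symmetric])
  finally show "(LINT w:A k|M. ?f w) = (measure L B ^ k / fact k * exp (- measure L B)) *\<^sub>R cis (c * real k)" by (simp add: pA)
 qed
 also have "(\<Sum>k. (measure L B ^ k / fact k * exp (- measure L B)) *\<^sub>R cis (c * real k)) = exp (of_real (measure L B) * (cis c - 1))"
  using exp_of_real_cis_sums[of "measure L B" c] by (simp add: sums_iff)
 finally show "(LINT w|M. ?f w) = exp (of_real (measure L B) * (cis c - 1))" .
qed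

lemma poisson_char_disjoint:
 fixes n :: nat
 assumes A: "range A \<subseteq> sets L" "disjoint_family A" "\<And>i. i < n ==> emeasure L (A i) < \<infinity>"
 shows "(LINT w|M. cis (\<Sum>i<n. c i * enn2real (emeasure (\<Phi> w) (A i)))) = exp (\<Sum>i<n. of_real (measure L (A i)) * (cis (c i) - 1))"
proof -
 have iv: "indep_vars (\<lambda>_. borel) (\<lambda>i w. cis (c i * enn2real (emeasure (\<Phi> w) (A i)))) {..<n}"
  by (rule indep_vars_compose2[OF indep_vars_subset[OF poisson_indep[OF A(1,2)]]]) auto
 have "cis (\<Sum>i<k. x i) = (\<Prod>i<k. cis (x i))" for x and k :: nat
  by (induction k) (auto simp: cis_mult[symmetric])
 then have "(LINT w|M. cis (\<Sum>i<n. c i * enn2real (emeasure (\<Phi> w) (A i)))) = (LINT w|M. (\<Prod>i<n. cis (c i * enn2real (emeasure (\<Phi> w) (A i)))))"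
  by simp
 also have "\<dots> = (\<Prod>i<n. \<integral>w. cis (c i * enn2real (emeasure (\<Phi> w) (A i))) \<partial>M)"
 proof (rule indep_vars_lebesgue_integral[OF _ iv])
  fix i assume "i \<in> {..<n}"
  have [measurable]: "(\<lambda>w. emeasure (\<Phi> w) (A i)) \<in> borel_measurable M" using A by (intro poisson_measurable) auto
  show "integrable M (\<lambda>w. cis (c i * enn2real (emeasure (\<Phi> w) (A i))))"
   by (rule integrable_const_bound[where B = 1]) auto
 qed simp
 also have "\<dots> = (\<Prod>i<n. exp (of_real (measure L (A i)) * (cis (c i) - 1)))"
  using A by (intro prod.cong refl poisson_char_set) auto
 finally show ?thesis by (simp add: exp_sum)
qed

text \<open>The counts of the sets |h| > k inside D decrease to 0 and, being finite, are integers,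
  so they vanish from some k on. Hence h is essentially bounded for \<Phi> w, which has finite mass
  on D.\<close>

lemma poisson_AE_integrable:
 fixes h :: "'y => 'b::{banach, second_countable_topology}"
 assumes D: "D \<in> sets L" "emeasure L D < \<infinity>" and h: "h \<in> borel_measurable L" and z: "\<And>p. p \<notin> D ==> h p = 0"
 shows "AE w in M. integrable (\<Phi> w) h"
 using poisson_char_set(1)[OF D] AE_space
proof eventually_elim
 case (elim w)
 note s = poisson_sets[OF elim(2)]
 have sp: "space (\<Phi> w) = space L" by (rule sets_eq_imp_space_eq[OF s])
 define A where "A k = {p \<in> space L. real k < norm (h p)} \<inter> D" for k :: nat
 note [measurable] = h D(1)
 have A: "A k \<in> sets L" for k unfolding A_def by measurable
 have "(\<lambda>k. emeasure (\<Phi> w) (A k)) \<longlonglongrightarrow> emeasure (\<Phi> w) (\<Inter>k. A k)"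
 proof (rule Lim_emeasure_decseq)
  show "range A \<subseteq> sets (\<Phi> w)" using A s by auto
  show "decseq A" by (auto simp: decseq_def A_def)
  have "emeasure (\<Phi> w) (A k) \<le> emeasure (\<Phi> w) D" for k using D s by (intro emeasure_mono) (auto simp: A_def)
  then show "emeasure (\<Phi> w) (A k) \<noteq> \<infinity>" for k using elim(1) by (metis infinity_ennreal_def less_top not_le top.not_eq_extremum)
 qed
 moreover have "(\<Inter>k. A k) = {}"
 proof -
  have "\<exists>k. p \<notin> A k" for p
  proof -
   obtain k where "norm (h p) \<le> real k" using real_arch_simple by blast
   then have "p \<notin> A k" by (simp add: A_def)
   then show ?thesis ..
  qed
  then show ?thesis by blast
 qed
 ultimately have "(\<lambda>k. emeasure (\<Phi> w) (A k)) \<longlonglongrightarrow> 0" by simp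
 from order_tendstoD(2)[OF this, of 1] obtain k where k: "emeasure (\<Phi> w) (A k) < 1"
  by (auto simp: eventually_sequentially)
 have "emeasure (\<Phi> w) (A k) = 0"
 proof -
  have "emeasure (\<Phi> w) (A k) \<in> insert \<infinity> (range of_nat)" by (rule poisson_values[OF elim(2) A])
  then consider "emeasure (\<Phi> w) (A k) = \<infinity>" | j where "emeasure (\<Phi> w) (A k) = of_nat j" by auto
  then show ?thesis
  proof cases
   case 2
   then have "(of_nat j :: ennreal) < of_nat 1" using k by simp
   then show ?thesis using 2 by (simp only: of_nat_less_iff) simp
  qed (use k in auto)
 qed
 then have ae: "AE p in \<Phi> w. p \<notin> A k" using A s by (intro AE_not_in) (auto intro!: null_setsI)
 show "integrable (\<Phi> w) h"
 proof (rule integrable_le)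
  show "integrable (\<Phi> w) (\<lambda>p. real k * indicator D p)"
   using D s elim(1) by (intro integrable_mult_right integrable_real_indicator) auto
  show "h \<in> borel_measurable (\<Phi> w)" using h measurable_cong_sets[OF s refl] by blast
  show "AE p in \<Phi> w. norm (h p) \<le> norm (real k * indicator D p)"
   using ae AE_space by eventually_elim (use z sp in \<open>auto simp: A_def indicator_def not_less\<close>)
 qed
qed

text \<open>The counts of the level sets of the nonzero values are independent Poisson variables.
  The value 0 is left out, because its level set may have infinite measure.\<close>

lemma poisson_char_simple:
 fixes s :: "'y => real"
 assumes D: "D \<in> sets L" "emeasure L D < \<infinity>" and s: "simple_function L s" and z: "\<And>p. p \<in> space L ==> p \<notin> D ==> s p = 0"
 shows "(LINT w|M. cis (LINT p|\<Phi> w. s p)) = exp (LINT p|L. cis (s p) - 1)"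
proof -
 define V where "V = s ` space L - {0}"
 have fV: "finite V" using s by (simp add: V_def simple_function_def)
 obtain e where e: "bij_betw e {0..<card V} V" using ex_bij_betw_nat_finite[OF fV] by blast
 define n where "n = card V"
 have e: "bij_betw e {..<n} V" using e by (simp add: n_def atLeast0LessThan)
 \<comment> \<open>The finitely many level sets are continued by empty sets, because independence is
   postulated for infinite sequences.\<close>
 define A where "A i = (if i < n then s -` {e i} \<inter> space L else {})" for i
 have A: "A i \<in> sets L" for i using s simple_functionD(2)[OF s, of "{e i}"] by (simp add: A_def)
 have disj: "disjoint_family A"
  using bij_betw_imp_inj_on[OF e] by (auto simp: disjoint_family_on_def A_def inj_on_def)
 have AD: "A i \<subseteq> D" if "i < n" for i
 proof
  fix p assume "p \<in> A i"
  then have "s p = e i" "p \<in> space L" using that by (auto simp: A_def)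
  moreover have "e i \<noteq> 0" using e that by (auto simp: bij_betw_def V_def)
  ultimately show "p \<in> D" using z by force
 qed
 have Afin: "emeasure L (A i) < \<infinity>" if "i < n" for i using emeasure_mono[OF AD[OF that] D(1)] D(2) by (auto simp: le_less_trans)
 have dec: "f (s p) = (\<Sum>i<n. indicator (A i) p *\<^sub>R f (e i))" if "p \<in> space L" "f 0 = 0" for p and f :: "real => 'c::real_vector"
 proof (cases "s p = 0")
  case True
  have "(\<Sum>i<n. indicator (A i) p *\<^sub>R f (e i)) = 0"
   using True e that by (intro sum.neutral) (auto simp: A_def bij_betw_def V_def indicator_def)
  then show ?thesis using True that by simp
 next
  case False
  then have "s p \<in> V" using that by (simp add: V_def)
  then obtain j where j: "j < n" "e j = s p" using e by (auto simp: bij_betw_def)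
  have "(\<Sum>i<n. indicator (A i) p *\<^sub>R f (e i)) = (\<Sum>i<n. if i = j then f (e i) else 0)"
  proof (intro sum.cong refl)
   fix i assume i: "i \<in> {..<n}"
   have "e i = s p \<longleftrightarrow> i = j" using i j bij_betw_imp_inj_on[OF e] by (auto simp: inj_on_def)
   then show "indicator (A i) p *\<^sub>R f (e i) = (if i = j then f (e i) else 0)" using i that by (auto simp: A_def indicator_def)
  qed
  then show ?thesis using j by simp
 qed
 have 1: "AE w in M. (LINT p|\<Phi> w. s p) = (\<Sum>i<n. e i * enn2real (emeasure (\<Phi> w) (A i)))"
  using poisson_char_set(1)[OF D] AE_space
 proof eventually_elim
  case (elim w)
  note ss = poisson_sets[OF elim(2)]
  have fin: "emeasure (\<Phi> w) (A i) < \<infinity>" if "i < n" for i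
   using emeasure_mono[OF AD[OF that], of "\<Phi> w"] D(1) ss elim(1) by (auto simp: le_less_trans)
  have "(LINT p|\<Phi> w. s p) = (LINT p|\<Phi> w. (\<Sum>i<n. indicator (A i) p *\<^sub>R e i))"
   using dec[of _ "\<lambda>x. x"] sets_eq_imp_space_eq[OF ss] by (intro lint_cong) auto
  also have "\<dots> = (\<Sum>i<n. \<integral>p. indicator (A i) p *\<^sub>R e i \<partial>\<Phi> w)"
   using A ss fin by (intro Bochner_Integration.integral_sum integrable_scaleR_left integrable_real_indicator) auto
  also have "\<dots> = (\<Sum>i<n. e i * enn2real (emeasure (\<Phi> w) (A i)))"
   using A ss fin by (intro sum.cong refl) (auto simp: measure_def mult.commute)
  finally show ?case .
 qed
 have 2: "(LINT p|L. cis (s p) - 1) = (\<Sum>i<n. of_real (measure L (A i)) * (cis (e i) - 1))"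
 proof -
  have "(LINT p|L. cis (s p) - 1) = (LINT p|L. (\<Sum>i<n. indicator (A i) p *\<^sub>R (cis (e i) - 1)))"
   using dec[of _ "\<lambda>x. cis x - 1"] by (intro lint_cong) auto
  also have "\<dots> = (\<Sum>i<n. \<integral>p. indicator (A i) p *\<^sub>R (cis (e i) - 1) \<partial>L)"
   using A Afin by (intro Bochner_Integration.integral_sum integrable_scaleR_left integrable_real_indicator) auto
  also have "\<dots> = (\<Sum>i<n. of_real (measure L (A i)) * (cis (e i) - 1))"
   using A Afin by (intro sum.cong refl) (auto simp: scaleR_conv_of_real)
  finally show ?thesis .
 qed
 have sm: "s \<in> borel_measurable L" by (rule borel_measurable_simple_function[OF s])
 have [measurable]: "(\<lambda>w. \<integral>p. s p \<partial>\<Phi> w) \<in> borel_measurable M"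
  by (rule measurable_integral_random_measure_real[OF poisson_sets poisson_measurable sm])
 have [measurable]: "(\<lambda>w. emeasure (\<Phi> w) (A i)) \<in> borel_measurable M" for i by (rule poisson_measurable[OF A])
 have "(LINT w|M. cis (LINT p|\<Phi> w. s p)) = (LINT w|M. cis (\<Sum>i<n. e i * enn2real (emeasure (\<Phi> w) (A i))))"
 proof (rule integral_cong_AE)
  show "AE w in M. cis (LINT p|\<Phi> w. s p) = cis (\<Sum>i<n. e i * enn2real (emeasure (\<Phi> w) (A i)))" using 1 by eventually_elim simp
 qed measurable
 then show ?thesis unfolding 2 using poisson_char_disjoint[of A n e] A disj Afin by auto
qed

text \<open>Approximation by simple functions below 2 |h|. The random integrals converge for almost
  every w, since |h| is integrable with respect to almost every \<Phi> w; in the exponent the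
  integrands are at most 2 on D and 0 outside.\<close>

theorem poisson_char:
 fixes h :: "'y => real"
 assumes D: "D \<in> sets L" "emeasure L D < \<infinity>" and h: "h \<in> borel_measurable L" and z: "\<And>p. p \<notin> D ==> h p = 0"
 shows "(LINT w|M. cis (LINT p|\<Phi> w. h p)) = exp (LINT p|L. cis (h p) - 1)"
proof -
 from borel_measurable_implies_sequence_metric[OF h, of 0] obtain F where
  F0: "\<forall>i. simple_function L (F i)" "\<forall>p\<in>space L. (\<lambda>i. F i p) \<longlonglongrightarrow> h p" "\<forall>i. \<forall>p\<in>space L. dist (F i p) 0 \<le> 2 * dist (h p) 0"
  by blast
 have F: "\<And>i. simple_function L (F i)" "\<And>p. p \<in> space L ==> (\<lambda>i. F i p) \<longlonglongrightarrow> h p" "\<And>i p. p \<in> space L ==> \<bar>F i p\<bar> \<le> 2 * \<bar>h p\<bar>"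
  using F0 by auto
 have ai: "AE w in M. integrable (\<Phi> w) h" using D h z by (rule poisson_AE_integrable)
 note Fm = borel_measurable_simple_function[OF F(1)]
 note hm = measurable_integral_random_measure_real[OF poisson_sets poisson_measurable h]
 note Fim = measurable_integral_random_measure_real[OF poisson_sets poisson_measurable Fm]
 have Fz: "F i p = 0" if "p \<in> space L" "p \<notin> D" for i p using F(3)[OF that(1), of i] z[OF that(2)] by simp
 have l1: "(\<lambda>i. \<integral>w. cis (LINT p|\<Phi> w. F i p) \<partial>M) \<longlonglongrightarrow> (LINT w|M. cis (LINT p|\<Phi> w. h p))"
 proof (rule integral_dominated_convergence)
  show "(\<lambda>w. cis (LINT p|\<Phi> w. h p)) \<in> borel_measurable M" "(\<lambda>w. cis (LINT p|\<Phi> w. F i p)) \<in> borel_measurable M" for i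
   by (rule measurable_compose[OF hm measurable_cis] measurable_compose[OF Fim measurable_cis]; assumption?)+
  show "integrable M (\<lambda>_. 1)" by simp
  show "AE w in M. (\<lambda>i. cis (LINT p|\<Phi> w. F i p)) \<longlonglongrightarrow> cis (LINT p|\<Phi> w. h p)"
   using ai AE_space
  proof eventually_elim
   case (elim w)
   note ss = poisson_sets[OF elim(2)]
   have tr: "f \<in> borel_measurable (\<Phi> w)" if "f \<in> borel_measurable L" for f :: "'y => real"
    using that measurable_cong_sets[OF ss refl] by blast
   have "(\<lambda>i. \<integral>p. F i p \<partial>\<Phi> w) \<longlonglongrightarrow> (LINT p|\<Phi> w. h p)"
   proof (rule integral_dominated_convergence)
    show "integrable (\<Phi> w) (\<lambda>p. 2 * \<bar>h p\<bar>)" using elim(1) by simp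
    show "h \<in> borel_measurable (\<Phi> w)" "F i \<in> borel_measurable (\<Phi> w)" for i by (rule tr[OF h] tr[OF Fm])+
    show "AE p in \<Phi> w. (\<lambda>i. F i p) \<longlonglongrightarrow> h p"
     by (rule AE_I2) (simp add: F(2) sets_eq_imp_space_eq[OF ss])
    show "AE p in \<Phi> w. norm (F i p) \<le> 2 * \<bar>h p\<bar>" for i
     by (rule AE_I2) (simp add: F(3) sets_eq_imp_space_eq[OF ss])
   qed
   then show ?case by (intro tendsto_cis)
  qed
 qed auto
 have l2: "(\<lambda>i. \<integral>p. cis (F i p) - 1 \<partial>L) \<longlonglongrightarrow> (LINT p|L. cis (h p) - 1)"
 proof (rule integral_dominated_convergence)
  note [measurable] = h Fm
  show "(\<lambda>p. cis (h p) - 1) \<in> borel_measurable L" "(\<lambda>p. cis (F i p) - 1) \<in> borel_measurable L" for i by measurable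
  show "integrable L (\<lambda>p. 2 * indicator D p :: real)" using D by (intro integrable_mult_right integrable_real_indicator) auto
  show "AE p in L. (\<lambda>i. cis (F i p) - 1) \<longlonglongrightarrow> cis (h p) - 1"
   by (intro AE_I2 tendsto_diff tendsto_cis F(2) tendsto_const)
  show "AE p in L. norm (cis (F i p) - 1) \<le> 2 * indicator D p" for i
   using cmod_cis_minus_1_le(2) Fz by (intro AE_I2) (auto simp: indicator_def)
 qed
 have "(\<lambda>i. exp (LINT p|L. cis (F i p) - 1)) \<longlonglongrightarrow> exp (LINT p|L. cis (h p) - 1)" by (intro tendsto_exp l2)
 moreover have "exp (LINT p|L. cis (F i p) - 1) = (LINT w|M. cis (LINT p|\<Phi> w. F i p))" for i
  by (rule poisson_char_simple[OF D F(1) Fz, symmetric]) auto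
 ultimately show ?thesis using LIMSEQ_unique[OF l1] by simp
qed

end

text \<open>Only the agreement of the two laws matters, since the Gaussian factor is common to all
  triplets considered. Induction on the largest time b, with a the preceding one: u_b x_b = u_b (x_b
  - x_a) + u_b x_a, and the increment is independent of the past and has a prescribed characteristic
  function.\<close>

lemma wiener_char_unique:
 fixes S :: "real^'d^'d"
 assumes M: "prob_space M" "prob_space M'" and W: "wiener_process M S W" "wiener_process M' S W'"
  and F: "finite F" "F \<subseteq> {0..}"
 shows "(LINT w|M. cis (\<Sum>t\<in>F. u t \<bullet> W t w)) = (LINT w|M'. cis (\<Sum>t\<in>F. u t \<bullet> W' t w))"
 using F
proof (induction F arbitrary: u rule: finite_linorder_max_induct)
 case empty
 then show ?case using prob_space.prob_space[OF M(1)] prob_space.prob_space[OF M(2)] by simp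
next
 case (insert b A)
 have b: "0 \<le> b" and A: "A \<subseteq> {0..}" and bA: "b \<notin> A" using insert by auto
 have normal: "(LINT w|N. cis (v \<bullet> (V b w - V a w))) = of_real (exp (- (v \<bullet> (((b - a) *\<^sub>R S) *v v)) / 2))"
  if "wiener_process N S V" "0 \<le> a" "a \<le> b" for N :: "'x measure" and V a v
  using that b unfolding wiener_process_def centred_normal_def by blast
 show ?case
 proof (cases "A = {}")
  \<comment> \<open>A single time is compared with time 0, where the process vanishes almost
    surely.\<close>
  case True
  have "(LINT w|N. cis (\<Sum>t\<in>insert b A. u t \<bullet> V t w)) = of_real (exp (- (u b \<bullet> (((b - 0) *\<^sub>R S) *v u b)) / 2))"
   if "prob_space N" "wiener_process N S V" for N :: "'x measure" and V
  proof -
   have [measurable]: "V 0 \<in> borel_measurable N" "V b \<in> borel_measurable N" using that b by (auto simp: wiener_process_def)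
   have "(LINT w|N. cis (\<Sum>t\<in>insert b A. u t \<bullet> V t w)) = (LINT w|N. cis (u b \<bullet> (V b w - V 0 w)))"
   proof (rule integral_cong_AE)
    have "AE w in N. V 0 w = 0" using that by (simp add: wiener_process_def)
    then show "AE w in N. cis (\<Sum>t\<in>insert b A. u t \<bullet> V t w) = cis (u b \<bullet> (V b w - V 0 w))"
     by eventually_elim (simp add: True)
    show "(\<lambda>w. cis (\<Sum>t\<in>insert b A. u t \<bullet> V t w)) \<in> borel_measurable N" unfolding True by simp
   qed measurable
   then show ?thesis using normal[OF that(2) order.refl b, of "u b"] by simp
  qed
  from this[OF M(1) W(1)] this[OF M(2) W(2)] show ?thesis by simp
 next
  case False
  define a where "a = Max A"
  have aA: "a \<in> A" "\<And>t. t \<in> A ==> t \<le> a" using False insert(1) by (auto simp: a_def)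
  have a: "0 \<le> a" "a \<le> b" using aA A insert(2) by auto
  \<comment> \<open>The coefficient of the removed time b is passed on to a.\<close>
  define v where "v = u(a := u a + u b)"
  have split: "(\<Sum>t\<in>insert b A. u t \<bullet> x t) = u b \<bullet> (x b - x a) + (\<Sum>t\<in>A. v t \<bullet> x t)" for x :: "real => real^'d"
  proof -
   have "(\<Sum>t\<in>A. v t \<bullet> x t) = v a \<bullet> x a + (\<Sum>t\<in>A - {a}. v t \<bullet> x t)" by (rule sum.remove[OF insert(1) aA(1)])
   also have "(\<Sum>t\<in>A - {a}. v t \<bullet> x t) = (\<Sum>t\<in>A - {a}. u t \<bullet> x t)" by (intro sum.cong) (auto simp: v_def)
   also have "v a \<bullet> x a + (\<Sum>t\<in>A - {a}. u t \<bullet> x t) = u b \<bullet> x a + (\<Sum>t\<in>A. u t \<bullet> x t)"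
    using sum.remove[OF insert(1) aA(1), of "\<lambda>t. u t \<bullet> x t"] by (simp add: v_def inner_add_left)
   finally show ?thesis using insert(1) bA by (simp add: inner_diff_right)
  qed
  have prod: "(LINT w|N. cis (\<Sum>t\<in>insert b A. u t \<bullet> V t w)) = of_real (exp (- (u b \<bullet> (((b - a) *\<^sub>R S) *v u b)) / 2)) * (LINT w|N. cis (\<Sum>t\<in>A. v t \<bullet> V t w))"
   if "prob_space N" "wiener_process N S V" for N :: "'x measure" and V
  proof -
   let ?U = "\<lambda>w. V b w - V a w" and ?V = "\<lambda>w. \<lambda>r\<in>{0..a}. V r w" and ?P = "Pi\<^sub>M {0..a} (\<lambda>_. borel) :: (real => real^'d) measure"
   have ind: "independent_elements N borel ?U ?P ?V" using that a by (auto simp: wiener_process_def)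
   have Um: "?U \<in> measurable (vimage_algebra (space N) ?U borel) borel" by (rule measurable_vimage_algebra1) auto
   have Vm: "?V \<in> measurable (vimage_algebra (space N) ?V ?P) ?P"
    by (rule measurable_vimage_algebra1) (auto simp: space_PiM)
   have 1: "(\<lambda>w. cis (u b \<bullet> ?U w)) \<in> borel_measurable (vimage_algebra (space N) ?U borel)" using Um by measurable
   have cm: "(\<lambda>w. ?V w t) \<in> borel_measurable (vimage_algebra (space N) ?V ?P)" if "t \<in> {0..a}" for t
    by (rule measurable_compose[OF Vm measurable_component_singleton[OF that]])
   have "(\<lambda>w. \<Sum>t\<in>A. v t \<bullet> ?V w t) \<in> borel_measurable (vimage_algebra (space N) ?V ?P)"
    using A aA by (intro borel_measurable_sum borel_measurable_inner borel_measurable_const cm) auto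
   then have "(\<lambda>w. cis (\<Sum>t\<in>A. v t \<bullet> ?V w t)) \<in> borel_measurable (vimage_algebra (space N) ?V ?P)" by measurable
   moreover have "(\<Sum>t\<in>A. v t \<bullet> ?V w t) = (\<Sum>t\<in>A. v t \<bullet> V t w)" for w using A aA by (intro sum.cong) auto
   ultimately have 2: "(\<lambda>w. cis (\<Sum>t\<in>A. v t \<bullet> V t w)) \<in> borel_measurable (vimage_algebra (space N) ?V ?P)" by simp
   have "(LINT w|N. cis (\<Sum>t\<in>insert b A. u t \<bullet> V t w)) = (LINT w|N. cis (u b \<bullet> ?U w) * cis (\<Sum>t\<in>A. v t \<bullet> V t w))"
    by (simp only: split[of "\<lambda>t. V t w" for w] cis_mult)
   also have "\<dots> = (LINT w|N. cis (u b \<bullet> ?U w)) * (LINT w|N. cis (\<Sum>t\<in>A. v t \<bullet> V t w))"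
    by (rule independent_elements_integral(1)[OF that(1) ind 1 2]) auto
   finally show ?thesis using normal[OF that(2) a] by simp
  qed
  show ?thesis unfolding prod[OF M(1) W(1)] prod[OF M(2) W(2)] using insert.IH[of v] A by simp
 qed
qed

section \<open>The Levy-Khintchine formula\<close>

lemma phase_outside: assumes "F \<subseteq> {..T}" "T < fst p" shows "phase u F p = 0"
proof -
 have "{t. t \<in> F \<and> fst p \<le> t} = {}" using assms by fastforce
 then show ?thesis by (simp only: sum.empty inner_zero_left)
qed

text \<open>The Levy-Khintchine integrand in space-time: a jump enters through its phase, which
  takes account of the evaluation times that follow it, and jumps of norm at most 1 are
  compensated.\<close>

definition compensated :: "(real => 'a::real_inner) => real set => real \<times> 'a => complex" where
 "compensated u F p = cis (phase u F p) - 1 - \<i> * of_real (indicator {x. norm x \<le> 1} (snd p) * phase u F p)"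

lemma cmod_cis_diff_le: "cmod (cis a - cis b) \<le> \<bar>a - b\<bar>" "cmod (cis a - cis b) \<le> 2"
proof -
 have "cis a - cis b = cis b * (cis (a - b) - 1)" by (simp add: algebra_simps cis_mult)
 then have "cmod (cis a - cis b) = cmod (cis (a - b) - 1)" by (simp add: norm_mult)
 then show "cmod (cis a - cis b) \<le> \<bar>a - b\<bar>" "cmod (cis a - cis b) \<le> 2" using cmod_cis_minus_1_le[of "a - b"] by simp_all
qed

text \<open>Taylor expansion to second order for jumps of norm at most 1, the trivial bound 2 for
  larger ones.\<close>

lemma cmod_compensated_le:
 assumes F: "finite F" shows "cmod (compensated u F p) \<le> (2 + (\<Sum>t\<in>F. norm (u t))\<^sup>2) * min ((norm (snd p))\<^sup>2) 1"
proof (cases "norm (snd p) \<le> 1")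
 case True
 let ?S = "\<Sum>t\<in>F. norm (u t)" and ?y = "phase u F p"
 have "cmod (cis ?y - 1 - \<i> * of_real ?y) \<le> ?y\<^sup>2 / 2"
  using iexp_approx1[of ?y 1] by (simp add: cis_conv_exp numeral_2_eq_2[symmetric] diff_diff_eq)
 also have "\<dots> \<le> (?S * norm (snd p))\<^sup>2 / 2"
  using power_mono[OF phase_le[OF F, of u p], of 2] by simp
 also have "\<dots> \<le> (2 + ?S\<^sup>2) * (norm (snd p))\<^sup>2" by (simp add: power_mult_distrib algebra_simps)
 finally show ?thesis using True by (simp add: compensated_def power_le_one)
next
 case False
 then have "1 \<le> (norm (snd p))\<^sup>2" by (simp add: one_le_power)
 then show ?thesis using False cmod_cis_minus_1_le(2)[of "phase u F p"] by (simp add: compensated_def add_increasing2)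
qed

lemma (in jump_measure) measurable_compensated:
 assumes F: "finite F" shows "compensated u F \<in> borel_measurable K"
proof -
 note [measurable] = measurable_phase[OF F, of u]
 have [measurable]: "(\<lambda>p. norm (snd p)) \<in> borel_measurable K"
  by (rule measurable_compose[OF measurable_jump_id]) measurable
 have "(\<lambda>p. cis (phase u F p) - 1 - \<i> * of_real ((if norm (snd p) \<le> 1 then 1 else 0) * phase u F p)) \<in> borel_measurable K"
  by measurable
 then show ?thesis unfolding compensated_def[abs_def] by (simp add: indicator_def)
qed

lemma compensated_integrable:
 fixes \<mu> :: "'a::euclidean_space measure"
 assumes L: "levy_measure \<mu>" and T: "0 \<le> T" and F: "finite F"
 shows "integrable (intensity_upto T \<mu>) (compensated u F)"
proof (rule integrable_le)
 interpret J: jump_measure "intensity_upto T \<mu>" by (rule jump_measure_intensity_upto[OF L T])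
 let ?c = "2 + (\<Sum>t\<in>F. norm (u t))\<^sup>2"
 have "(\<lambda>x::'a. min ((norm x)\<^sup>2) 1) \<in> borel_measurable borel" by measurable
 then have "(\<lambda>x. min ((norm x)\<^sup>2) 1) \<in> borel_measurable \<mu>" using measurable_cong_sets[OF levy_measure_sets[OF L] refl] by blast
 then have "integrable \<mu> (\<lambda>x. min ((norm x)\<^sup>2) 1)"
  using L by (intro integrableI_bounded) (auto simp: levy_measure_def)
 from integral_intensity_snd(1)[OF L T this]
 show "integrable (intensity_upto T \<mu>) (\<lambda>p. ?c * min ((norm (snd p))\<^sup>2) 1)" by (rule integrable_mult_right)
 show "compensated u F \<in> borel_measurable (intensity_upto T \<mu>)" by (rule J.measurable_compensated[OF F])
 show "AE p in intensity_upto T \<mu>. norm (compensated u F p) \<le> norm (?c * min ((norm (snd p))\<^sup>2) 1)"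
  using order_trans[OF cmod_compensated_le[OF F, of u] abs_ge_self] by (intro AE_I2) simp
qed

text \<open>Where all approximations are within d, the characters differ by at most d C; on the
  exceptional events they differ by at most 2, and these events have small probability.
  \<open>K\<close> is the part of the exponent that is not approximated.\<close>

lemma char_tendsto:
 fixes Z :: "'t => 'i => 'w => 'a::euclidean_space"
 assumes M: "prob_space M" and F: "finite F" and K: "K \<in> borel_measurable M"
  and Z: "\<And>t i. t \<in> F ==> Z t i \<in> borel_measurable M"
  and c: "\<And>t. t \<in> F ==> converges_in_probability M (Z t) (J t) fl"
 shows "((\<lambda>i. \<integral>w. cis (K w + (\<Sum>t\<in>F. u t \<bullet> Z t i w)) \<partial>M) \<longlongrightarrow> (LINT w|M. cis (K w + (\<Sum>t\<in>F. u t \<bullet> J t w)))) fl"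
proof (rule tendstoI)
 interpret prob_space M by fact
 fix e :: real assume e: "0 < e"
 define C where "C = (\<Sum>t\<in>F. norm (u t))"
 have C: "0 \<le> C" by (simp add: C_def sum_nonneg)
 \<comment> \<open>d and r share e between the two contributions: d C < e / 2 and 2 r card F < e /
   2. The added ones keep the denominators positive.\<close>
 define d where "d = e / (2 * (C + 1))"
 have d: "0 < d" using e C by (simp add: d_def)
 have dC: "d * C < e / 2" using e C by (simp add: d_def field_simps)
 define r where "r = e / (4 * (real (card F) + 1))"
 have r: "0 < r" using e by (simp add: r_def)
 have rF: "2 * (real (card F) * r) < e / 2" using e by (simp add: r_def field_simps)
 have Jm: "J t \<in> borel_measurable M" if "t \<in> F" for t using c[OF that] by (simp add: converges_in_probability_def)
 define B where "B i t = {w\<in>space M. d < norm (Z t i w - J t w)}" for i t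
 have "\<forall>t\<in>F. \<forall>\<^sub>F i in fl. measure M (B i t) < r"
  using c d r by (auto simp: converges_in_probability_def B_def intro!: order_tendstoD(2))
 then have "\<forall>\<^sub>F i in fl. \<forall>t\<in>F. measure M (B i t) < r" by (rule eventually_ball_finite[OF F])
 then show "\<forall>\<^sub>F i in fl. dist (LINT w|M. cis (K w + (\<Sum>t\<in>F. u t \<bullet> Z t i w))) (LINT w|M. cis (K w + (\<Sum>t\<in>F. u t \<bullet> J t w))) < e"
 proof eventually_elim
  case (elim i)
  have Bm: "B i t \<in> sets M" if "t \<in> F" for t
  proof -
   note [measurable] = Z[OF that] Jm[OF that]
   show ?thesis unfolding B_def by measurable
  qed
  define X where "X w = cis (K w + (\<Sum>t\<in>F. u t \<bullet> Z t i w)) - cis (K w + (\<Sum>t\<in>F. u t \<bullet> J t w))" for w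
  have sm: "(\<lambda>w. \<Sum>t\<in>F. u t \<bullet> Z t i w) \<in> borel_measurable M" "(\<lambda>w. \<Sum>t\<in>F. u t \<bullet> J t w) \<in> borel_measurable M"
   using Z Jm by (auto intro!: borel_measurable_sum borel_measurable_inner)
  have cm: "(\<lambda>w. cis (K w + (\<Sum>t\<in>F. u t \<bullet> Z t i w))) \<in> borel_measurable M" "(\<lambda>w. cis (K w + (\<Sum>t\<in>F. u t \<bullet> J t w))) \<in> borel_measurable M"
   by (rule measurable_compose[OF borel_measurable_add[OF K sm(1)] measurable_cis] measurable_compose[OF borel_measurable_add[OF K sm(2)] measurable_cis])+
  have ci: "integrable M (\<lambda>w. cis (K w + (\<Sum>t\<in>F. u t \<bullet> Z t i w)))" "integrable M (\<lambda>w. cis (K w + (\<Sum>t\<in>F. u t \<bullet> J t w)))"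
   by (rule integrable_const_bound[where B = 1]; use cm in simp)+
  have Xi: "integrable M X" unfolding X_def by (intro Bochner_Integration.integrable_diff ci)
  have le: "norm (X w) \<le> d * C + (\<Sum>t\<in>F. 2 * indicator (B i t) w)" if "w \<in> space M" for w
  proof (cases "\<exists>t\<in>F. w \<in> B i t")
   case True
   then obtain t where t: "t \<in> F" "w \<in> B i t" by blast
   have "2 * indicator (B i t) w \<le> (\<Sum>t\<in>F. 2 * indicator (B i t) w :: real)"
    by (rule member_le_sum[OF t(1)]) (use F in auto)
   moreover have "0 \<le> d * C" using d C by simp
   ultimately show ?thesis
    using t(2) cmod_cis_diff_le(2)[of "K w + (\<Sum>t\<in>F. u t \<bullet> Z t i w)" "K w + (\<Sum>t\<in>F. u t \<bullet> J t w)"] unfolding X_def by simp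
  next
   case False
   then have n: "norm (Z t i w - J t w) \<le> d" if "t \<in> F" for t using that \<open>w \<in> space M\<close> by (auto simp: B_def not_less)
   have "norm (X w) \<le> \<bar>(\<Sum>t\<in>F. u t \<bullet> Z t i w) - (\<Sum>t\<in>F. u t \<bullet> J t w)\<bar>"
    unfolding X_def by (rule order_trans[OF cmod_cis_diff_le(1)]) simp
   also have "\<dots> = \<bar>\<Sum>t\<in>F. u t \<bullet> (Z t i w - J t w)\<bar>" by (simp add: sum_subtractf inner_diff_right)
   also have "\<dots> \<le> (\<Sum>t\<in>F. \<bar>u t \<bullet> (Z t i w - J t w)\<bar>)" by (rule sum_abs)
   also have "\<dots> \<le> (\<Sum>t\<in>F. norm (u t) * d)"
    by (intro sum_mono order_trans[OF Cauchy_Schwarz_ineq2] mult_left_mono n) auto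
   also have "\<dots> = d * C" by (simp add: C_def sum_distrib_left mult.commute)
   finally show ?thesis using False by (simp add: sum_nonneg add_increasing2)
  qed
  have bi: "integrable M (\<lambda>w. d * C + (\<Sum>t\<in>F. 2 * indicator (B i t) w))"
   using Bm by (intro integrable_plus Bochner_Integration.integrable_sum integrable_mult_right integrable_real_indicator) (auto simp: less_top[symmetric])
  have "dist (LINT w|M. cis (K w + (\<Sum>t\<in>F. u t \<bullet> Z t i w))) (LINT w|M. cis (K w + (\<Sum>t\<in>F. u t \<bullet> J t w))) = norm (LINT w|M. X w)"
   unfolding X_def dist_norm by (subst Bochner_Integration.integral_diff[OF ci]) simp
  also have "\<dots> \<le> (LINT w|M. norm (X w))" by (rule integral_norm_bound)
  also have "\<dots> \<le> (LINT w|M. d * C + (\<Sum>t\<in>F. 2 * indicator (B i t) w))"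
   by (rule integral_mono_AE[OF _ bi]) (use Xi le in auto)
  also have "\<dots> = d * C + (\<Sum>t\<in>F. 2 * measure M (B i t))"
  proof -
   have ii: "integrable M (\<lambda>w. 2 * indicator (B i t) w :: real)" if "t \<in> F" for t
    using Bm[OF that] by (intro integrable_mult_right integrable_real_indicator) (auto simp: less_top[symmetric])
   show ?thesis
    using Bm by (subst lint_add)
     (auto intro!: Bochner_Integration.integrable_sum ii sum.cong simp: Bochner_Integration.integral_sum[OF ii] prob_space)
  qed
  also have "(\<Sum>t\<in>F. 2 * measure M (B i t)) \<le> (\<Sum>t\<in>F. 2 * r)" using elim by (intro sum_mono) (auto intro: less_imp_le)
  also have "d * C + (\<Sum>t\<in>F. 2 * r) < e" using dC rF by (simp add: mult.left_commute)
  finally show ?case by simp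
 qed
qed

lemma jump_box:
 fixes \<mu> :: "'a::euclidean_space measure"
 assumes L: "levy_measure \<mu>" and t: "0 \<le> t" and B: "B \<in> sets borel"
 shows "{0..t} \<times> B \<in> sets (jump_intensity \<mu>)" "emeasure (jump_intensity \<mu>) ({0..t} \<times> B) = ennreal t * emeasure \<mu> B"
proof -
 interpret s: sigma_finite_measure \<mu> by (rule levy_measure_sigma_finite[OF L])
 have a: "{0..t} \<in> sets half_line_lebesgue"
  unfolding half_line_lebesgue_def sets_restrict_space using t by (intro image_eqI[of _ _ "{0..t}"]) auto
 have e: "emeasure half_line_lebesgue {0..t} = ennreal t"
  unfolding half_line_lebesgue_def using t by (subst emeasure_restrict_space) auto
 have b: "B \<in> sets \<mu>" using B levy_measure_sets[OF L] by simp
 show "{0..t} \<times> B \<in> sets (jump_intensity \<mu>)" unfolding jump_intensity_def using a b by (rule pair_measureI)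
 show "emeasure (jump_intensity \<mu>) ({0..t} \<times> B) = ennreal t * emeasure \<mu> B"
  unfolding jump_intensity_def using a b by (simp add: s.emeasure_pair_measure_Times e)
qed

lemma sum_inner_integral:
 assumes "\<And>t. t \<in> F ==> integrable N (k t)"
 shows "(\<Sum>t\<in>F. u t \<bullet> (LINT p|N. k t p)) = (LINT p|N. (\<Sum>t\<in>F. u t \<bullet> k t p))"
proof -
 have "(\<Sum>t\<in>F. u t \<bullet> (LINT p|N. k t p)) = (\<Sum>t\<in>F. \<integral>p. u t \<bullet> k t p \<partial>N)"
  using assms by (intro sum.cong refl integral_inner_right[symmetric]) auto
 also have "\<dots> = (LINT p|N. (\<Sum>t\<in>F. u t \<bullet> k t p))"
  using assms by (intro Bochner_Integration.integral_sum[symmetric] integrable_inner_right) auto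
 finally show ?thesis .
qed

text \<open>The compensated integrals are approximated by those over jumps of norm above
  \<open>ep n\<close>, where the intensity on the horizon is finite. There the jump contributions at
  all times of F merge into one Poisson integral, whose characteristic functional is known, and
  independence separates the Gaussian factor. The subtracted means supply the linear term of
  \<open>compensated\<close>, which makes the exponents converge as the threshold tends to
  0.\<close>

lemma levy_ito_char_aux:
 fixes \<mu> :: "(real^'d) measure"
 assumes M: "prob_space M" and W: "wiener_process M S W" and P: "poisson_process M (jump_intensity \<mu>) \<Phi>"
  and I: "independent_elements M
     (Pi\<^sub>M {0..} (\<lambda>_. borel)) (\<lambda>w. \<lambda>t\<in>{0..}. W t w)
     (Pi\<^sub>M (sets (jump_intensity \<mu>)) (\<lambda>_. borel))
      (\<lambda>w. \<lambda>B\<in>sets (jump_intensity \<mu>). emeasure (\<Phi> w) B)"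
  and J: "\<And>t. 0 \<le> t ==> converges_in_probability M
     (\<lambda>\<epsilon> w. (LINT p:{0..t} \<times> {x. \<epsilon> < norm x \<and> norm x \<le> 1}|\<Phi> w. snd p)
         - (LINT p:{0..t} \<times> {x. \<epsilon> < norm x \<and> norm x \<le> 1}|jump_intensity \<mu>. snd p))
     (J t) (at_right 0)"
  and Y: "\<And>t w. 0 \<le> t ==> w \<in> space M ==>
     Y t w = t *\<^sub>R b + W t w + J t w + (LINT p:{0..t} \<times> {x. 1 < norm x}|\<Phi> w. snd p)"
  and L: "levy_measure \<mu>" and F: "finite F" "F \<subseteq> {0..T}" and T: "0 \<le> T"
 shows "(LINT w|M. cis (\<Sum>t\<in>F. u t \<bullet> Y t w)) =
  (LINT w|M. cis (\<Sum>t\<in>F. u t \<bullet> W t w)) * cis (\<Sum>t\<in>F. t * (u t \<bullet> b)) * exp (LINT p|intensity_upto T \<mu>. compensated u F p)"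
proof -
 interpret prob_space M by fact
 let ?L = "jump_intensity \<mu>"
 interpret K: jump_measure ?L by (rule jump_measure_jump_intensity[OF L])
 \<comment> \<open>The thresholds are those of \<open>cutoff\<close>, so that the convergence along
   cutoffs applies to the exponent.\<close>
 define ep where "ep n = 1 / real (Suc n)" for n
 have ep: "0 < ep n" "ep n \<le> 1" for n by (auto simp: ep_def)
 let ?B = "\<lambda>n. {x::real^'d. ep n < norm x \<and> norm x \<le> 1}" and ?B1 = "{x::real^'d. 1 < norm x}"
 define D where "D n = {0..T} \<times> {x::real^'d. ep n < norm x}" for n
 have t0: "0 \<le> t" "t \<le> T" if "t \<in> F" for t using F(2) that by auto
 have Bs: "?B n \<in> sets borel" "?B1 \<in> sets borel" "{x::real^'d. ep n < norm x} \<in> sets borel" for n by measurable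
 have D: "D n \<in> sets ?L" "emeasure ?L (D n) < \<infinity>" for n
  using jump_box[OF L T Bs(3)] levy_measure_emeasure_norm_gt[OF L ep(1)] by (auto simp: D_def ennreal_mult_less_top)
 have sm: "snd \<in> borel_measurable ?L" by (rule measurable_compose[OF K.measurable_jump_id]) measurable
 define k1 where "k1 n t p = indicator ({0..t} \<times> ?B n) p *\<^sub>R snd p" for n t and p :: "real \<times> (real^'d)"
 define k2 where "k2 t p = indicator ({0..t} \<times> ?B1) p *\<^sub>R snd p" for t and p :: "real \<times> (real^'d)"
 have k1m: "k1 n t \<in> borel_measurable ?L" and k2m: "k2 t \<in> borel_measurable ?L" if "t \<in> F" for n t
  unfolding k1_def k2_def using jump_box(1)[OF L t0(1)[OF that]] Bs sm by (auto intro!: borel_measurable_scaleR borel_measurable_indicator)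
 have kz: "k1 n t p = 0" "k2 t p = 0" if "t \<in> F" "p \<notin> D n" for n t p
  using that t0[OF that(1)] ep(2)[of n] by (auto simp: k1_def k2_def D_def indicator_def)
 \<comment> \<open>The contribution of one jump above the threshold to the sum over F. The condition
   \<open>0 \<le> fst p\<close> matches the boxes over \<open>{0..t}\<close>, so that the identity
   with the sum over F holds at every point p.\<close>
 define h where "h n p = (if ep n < norm (snd p) \<and> 0 \<le> fst p then phase u F p else 0)" for n and p :: "real \<times> (real^'d)"
 have hm: "h n \<in> borel_measurable ?L" for n
 proof -
  note [measurable] = K.measurable_phase[OF F(1), of u] sm
  have [measurable]: "fst \<in> borel_measurable ?L" by (rule measurable_compose[OF K.measurable_jump_id]) measurable
  show ?thesis unfolding h_def by measurable
 qed
 have FT: "F \<subseteq> {..T}" using F(2) by auto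
 have hz: "h n p = 0" if "p \<notin> D n" for n p
 proof (cases "fst p \<le> T")
  case True
  then show ?thesis using that by (cases p) (auto simp: h_def D_def)
 next
  case False
  then show ?thesis using phase_outside[OF FT, of p u] by (simp add: h_def)
 qed
 have sum_k: "(\<Sum>t\<in>F. u t \<bullet> (k1 n t p + k2 t p)) = h n p" for n p
 proof -
  have "u t \<bullet> (k1 n t p + k2 t p) = (if ep n < norm (snd p) \<and> 0 \<le> fst p then (if fst p \<le> t then u t \<bullet> snd p else 0) else 0)" for t
   using ep(2)[of n] by (cases p) (auto simp: k1_def k2_def indicator_def)
  then show ?thesis unfolding h_def phase_eq_sum[OF F(1)] by auto
 qed
 \<comment> \<open>The part coming from jumps of norm at most 1, whose mean is subtracted.\<close>
 define hs where "hs n p = indicator {x. norm x \<le> 1} (snd p) * h n p" for n and p :: "real \<times> (real^'d)"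
 have sum_k1: "(\<Sum>t\<in>F. u t \<bullet> k1 n t p) = hs n p" for n p
 proof -
  have "u t \<bullet> k1 n t p = indicator {x. norm x \<le> 1} (snd p) * (if ep n < norm (snd p) \<and> 0 \<le> fst p then (if fst p \<le> t then u t \<bullet> snd p else 0) else 0)" for t
   by (cases p) (auto simp: k1_def indicator_def)
  then show ?thesis unfolding hs_def h_def phase_eq_sum[OF F(1)] by (auto simp: sum_distrib_left)
 qed
 have integ: "integrable ?L k" if "k \<in> borel_measurable ?L" "\<And>p. norm (k p) \<le> c" "\<And>p. p \<notin> D n ==> k p = 0"
  for k :: "real \<times> (real^'d) => 'e::{banach, second_countable_topology}" and c n
 proof (rule integrable_le[OF _ that(1)])
  show "integrable ?L (\<lambda>p. c * indicator (D n) p :: real)"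
   using D[of n] by (intro integrable_mult_right integrable_real_indicator) auto
  show "AE p in ?L. norm (k p) \<le> norm (c * indicator (D n) p)"
   using that(2,3) order_trans[OF that(2) abs_ge_self] by (intro AE_I2) (auto simp: indicator_def)
 qed
 have k1i: "integrable ?L (k1 n t)" if "t \<in> F" for n t
 proof -
  have "norm (k1 n t p) \<le> 1" for p by (auto simp: k1_def indicator_def)
  from integ[OF k1m[OF that] this kz(1)[OF that]] show ?thesis by simp
 qed
 have hsi: "integrable ?L (hs n)" for n
  unfolding sum_k1[symmetric, abs_def] using k1i by (intro Bochner_Integration.integrable_sum integrable_inner_right) auto
 define Z where "Z t e w = (LINT p:{0..t} \<times> {x. e < norm x \<and> norm x \<le> 1}|\<Phi> w. snd p)
         - (LINT p:{0..t} \<times> {x. e < norm x \<and> norm x \<le> 1}|?L. snd p)" for t e w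
 have Zn: "Z t (ep n) w = (LINT p|\<Phi> w. k1 n t p) - (LINT p|?L. k1 n t p)" for t n w
  by (simp add: Z_def k1_def set_lebesgue_integral_def)
 define X where "X w = (\<Sum>t\<in>F. u t \<bullet> (t *\<^sub>R b + W t w + (LINT p|\<Phi> w. k2 t p)))" for w
 note meas = measurable_integral_random_measure[OF poisson_sets[OF M P] poisson_measurable[OF M P]]
 have k2M: "(\<lambda>w. \<integral>p. k2 t p \<partial>\<Phi> w) \<in> borel_measurable M" if "t \<in> F" for t
  using k2m[OF that] by (intro meas)
 have k1M: "(\<lambda>w. \<integral>p. k1 n t p \<partial>\<Phi> w) \<in> borel_measurable M" if "t \<in> F" for n t
  using k1m[OF that] by (intro meas)
 have Xm: "X \<in> borel_measurable M"
  unfolding X_def using W k2M t0 by (intro borel_measurable_sum borel_measurable_inner borel_measurable_add) (auto simp: wiener_process_def)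
 have lim: "(\<lambda>n. \<integral>w. cis (X w + (\<Sum>t\<in>F. u t \<bullet> Z t (ep n) w)) \<partial>M) \<longlonglongrightarrow> (LINT w|M. cis (X w + (\<Sum>t\<in>F. u t \<bullet> J t w)))"
 proof (rule char_tendsto[OF M F(1) Xm])
  fix t assume t: "t \<in> F"
  show "Z t (ep n) \<in> borel_measurable M" for n
   unfolding Zn[abs_def] using k1M[OF t] by (intro borel_measurable_diff) auto
  have "(\<lambda>n. ep n) \<longlonglongrightarrow> 0" unfolding ep_def using LIMSEQ_Suc[OF lim_const_over_n[of "1::real"]] .
  then have fl: "filterlim ep (at_right 0) sequentially"
   by (rule tendsto_imp_filterlim_at_right) (simp add: ep)
  have "converges_in_probability M (Z t) (J t) (at_right 0)"
   using J[OF t0(1)[OF t]] by (simp add: Z_def[abs_def])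
  then show "converges_in_probability M (\<lambda>n. Z t (ep n)) (J t) sequentially"
   unfolding converges_in_probability_def using filterlim_compose[OF _ fl] by fast
 qed
 have lhs: "(LINT w|M. cis (X w + (\<Sum>t\<in>F. u t \<bullet> J t w))) = (LINT w|M. cis (\<Sum>t\<in>F. u t \<bullet> Y t w))"
 proof (rule lint_cong[OF refl])
  fix w assume o: "w \<in> space M"
  have "X w + (\<Sum>t\<in>F. u t \<bullet> J t w) = (\<Sum>t\<in>F. u t \<bullet> (t *\<^sub>R b + W t w + (LINT p|\<Phi> w. k2 t p)) + u t \<bullet> J t w)"
   by (simp add: X_def sum.distrib)
  also have "\<dots> = (\<Sum>t\<in>F. u t \<bullet> Y t w)"
   using t0 o by (intro sum.cong refl) (simp add: Y k2_def[symmetric] set_lebesgue_integral_def inner_add_right)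
  finally show "cis (X w + (\<Sum>t\<in>F. u t \<bullet> J t w)) = cis (\<Sum>t\<in>F. u t \<bullet> Y t w)" by simp
 qed
 let ?G = "\<integral>w. cis (\<Sum>t\<in>F. u t \<bullet> W t w) \<partial>M" and ?d = "\<Sum>t\<in>F. t * (u t \<bullet> b)"
 \<comment> \<open>The \<Phi>-integrals may be added only where they exist, hence for almost every
   w.\<close>
 have ae: "AE w in M. X w + (\<Sum>t\<in>F. u t \<bullet> Z t (ep n) w) = (\<Sum>t\<in>F. u t \<bullet> W t w) + (LINT p|\<Phi> w. h n p) + (?d - (LINT p|?L. hs n p))" for n
 proof -
  have "AE w in M. integrable (\<Phi> w) (k1 n t) \<and> integrable (\<Phi> w) (k2 t)" if "t \<in> F" for t
  proof -
   have "AE w in M. integrable (\<Phi> w) (k1 n t)" by (rule poisson_AE_integrable[OF M P D k1m[OF that] kz(1)[OF that]])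
   moreover have "AE w in M. integrable (\<Phi> w) (k2 t)" by (rule poisson_AE_integrable[OF M P D k2m[OF that] kz(2)[OF that]])
   ultimately show ?thesis by eventually_elim simp
  qed
  then have "AE w in M. \<forall>t\<in>F. integrable (\<Phi> w) (k1 n t) \<and> integrable (\<Phi> w) (k2 t)"
   by (intro eventually_ball_finite F) auto
  then show ?thesis
  proof eventually_elim
   case (elim w)
   have "X w + (\<Sum>t\<in>F. u t \<bullet> Z t (ep n) w) = (\<Sum>t\<in>F. t * (u t \<bullet> b) + u t \<bullet> W t w + u t \<bullet> (LINT p|\<Phi> w. k1 n t p + k2 t p) - u t \<bullet> (LINT p|?L. k1 n t p))"
    unfolding X_def sum.distrib[symmetric] Zn using elim
    by (intro sum.cong refl) (simp add: inner_add_right inner_diff_right)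
   also have "\<dots> = ?d + (\<Sum>t\<in>F. u t \<bullet> W t w) + (\<Sum>t\<in>F. u t \<bullet> (LINT p|\<Phi> w. k1 n t p + k2 t p)) - (\<Sum>t\<in>F. u t \<bullet> (LINT p|?L. k1 n t p))"
    by (simp add: sum.distrib sum_subtractf)
   also have "(\<Sum>t\<in>F. u t \<bullet> (LINT p|\<Phi> w. k1 n t p + k2 t p)) = (LINT p|\<Phi> w. h n p)"
    unfolding sum_k[symmetric] by (rule sum_inner_integral) (use elim in auto)
   also have "(\<Sum>t\<in>F. u t \<bullet> (LINT p|?L. k1 n t p)) = (LINT p|?L. hs n p)"
    unfolding sum_k1[symmetric] by (rule sum_inner_integral) (rule k1i)
   finally show ?case by simp
  qed
 qed
 let ?A = "Pi\<^sub>M {0..} (\<lambda>_. borel) :: (real => real^'d) measure" and ?U = "\<lambda>w. \<lambda>t\<in>{0..}. W t w"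
 let ?C = "Pi\<^sub>M (sets ?L) (\<lambda>_. borel) :: ((real \<times> (real^'d)) set => ennreal) measure" and ?V = "\<lambda>w. \<lambda>B\<in>sets ?L. emeasure (\<Phi> w) B"
 have Um: "?U \<in> measurable (vimage_algebra (space M) ?U ?A) ?A" by (rule measurable_vimage_algebra1) (auto simp: space_PiM)
 have Vm: "?V \<in> measurable (vimage_algebra (space M) ?V ?C) ?C" by (rule measurable_vimage_algebra1) (auto simp: space_PiM)
 have phi: "(\<lambda>w. cis (\<Sum>t\<in>F. u t \<bullet> W t w)) \<in> borel_measurable (vimage_algebra (space M) ?U ?A)"
 proof -
  have cm: "(\<lambda>w. ?U w t) \<in> borel_measurable (vimage_algebra (space M) ?U ?A)" if "t \<in> F" for t
   by (rule measurable_compose[OF Um measurable_component_singleton]) (use t0[OF that] in simp)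
  have "(\<lambda>w. \<Sum>t\<in>F. u t \<bullet> ?U w t) \<in> borel_measurable (vimage_algebra (space M) ?U ?A)"
   by (intro borel_measurable_sum borel_measurable_inner borel_measurable_const cm) auto
  from measurable_compose[OF this measurable_cis] show ?thesis using t0 by simp
 qed
 have psi: "(\<lambda>w. cis (LINT p|\<Phi> w. h n p)) \<in> borel_measurable (vimage_algebra (space M) ?V ?C)" for n
 proof -
  have cm: "(\<lambda>w. emeasure (\<Phi> w) B) \<in> borel_measurable (vimage_algebra (space M) ?V ?C)" if "B \<in> sets ?L" for B
   using measurable_compose[OF Vm measurable_component_singleton[OF that]] that by simp
  have "(\<lambda>w. \<integral>p. h n p \<partial>\<Phi> w) \<in> borel_measurable (vimage_algebra (space M) ?V ?C)"
   by (rule measurable_integral_random_measure_real[OF _ cm hm]) (simp_all add: poisson_sets[OF M P])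
  from measurable_compose[OF this measurable_cis] show ?thesis .
 qed
 have val: "(LINT w|M. cis (X w + (\<Sum>t\<in>F. u t \<bullet> Z t (ep n) w))) = ?G * cis ?d * exp (LINT p|intensity_upto T \<mu>. indicator (cutoff n) (snd p) *\<^sub>R compensated u F p)" for n
 proof -
  note ind = independent_elements_integral[OF M I phi psi[of n]]
  let ?e = "?d - (LINT p|?L. hs n p)"
  have Zm: "(\<lambda>w. \<Sum>t\<in>F. u t \<bullet> Z t (ep n) w) \<in> borel_measurable M"
   unfolding Zn using k1M by (intro borel_measurable_sum borel_measurable_inner borel_measurable_diff) auto
  have "(LINT w|M. cis (X w + (\<Sum>t\<in>F. u t \<bullet> Z t (ep n) w))) = (LINT w|M. cis (\<Sum>t\<in>F. u t \<bullet> W t w) * cis (LINT p|\<Phi> w. h n p) * cis ?e)"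
  proof (rule integral_cong_AE)
   show "(\<lambda>w. cis (X w + (\<Sum>t\<in>F. u t \<bullet> Z t (ep n) w))) \<in> borel_measurable M"
    by (rule measurable_compose[OF borel_measurable_add[OF Xm Zm] measurable_cis])
   show "(\<lambda>w. cis (\<Sum>t\<in>F. u t \<bullet> W t w) * cis (LINT p|\<Phi> w. h n p) * cis ?e) \<in> borel_measurable M"
    by (intro borel_measurable_times borel_measurable_const ind(2,3)) auto
   show "AE w in M. cis (X w + (\<Sum>t\<in>F. u t \<bullet> Z t (ep n) w)) = cis (\<Sum>t\<in>F. u t \<bullet> W t w) * cis (LINT p|\<Phi> w. h n p) * cis ?e"
    using ae[of n] by eventually_elim (simp only: cis_mult)
  qed
  also have "\<dots> = (LINT w|M. cis (\<Sum>t\<in>F. u t \<bullet> W t w) * cis (LINT p|\<Phi> w. h n p)) * cis ?e"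
   by (rule integral_mult_left_zero)
  also have "(LINT w|M. cis (\<Sum>t\<in>F. u t \<bullet> W t w) * cis (LINT p|\<Phi> w. h n p)) = ?G * (LINT w|M. cis (LINT p|\<Phi> w. h n p))"
   by (rule ind(1)) auto
  also have "(LINT w|M. cis (LINT p|\<Phi> w. h n p)) = exp (LINT p|?L. cis (h n p) - 1)"
   by (rule poisson_char[OF M P D hm hz])
  also have "?G * exp (LINT p|?L. cis (h n p) - 1) * cis ?e = ?G * cis ?d * exp ((LINT p|?L. cis (h n p) - 1) - \<i> * of_real (LINT p|?L. hs n p))"
   by (simp add: cis_conv_exp exp_diff right_diff_distrib)
  also have "(LINT p|?L. cis (h n p) - 1) - \<i> * of_real (LINT p|?L. hs n p) = (LINT p|?L. cis (h n p) - 1 - \<i> * of_real (hs n p))"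
  proof -
   have "integrable ?L (\<lambda>p. cis (h n p) - 1)"
   proof -
    have "(\<lambda>p. cis (h n p) - 1) \<in> borel_measurable ?L"
     by (intro borel_measurable_diff borel_measurable_const measurable_compose[OF hm measurable_cis])
    moreover have "cis (h n p) - 1 = 0" if "p \<notin> D n" for p using hz[OF that] by simp
    ultimately show ?thesis by (rule integ[OF _ cmod_cis_minus_1_le(2)])
   qed
   then show ?thesis using hsi[of n] by (subst Bochner_Integration.integral_diff) auto
  qed
  \<comment> \<open>Jumps after T have phase zero, so the integrand vanishes there and the horizon
    can be inserted.\<close>
  also have "\<dots> = (LINT p|?L. indicator {..T} (fst p) *\<^sub>R (indicator (cutoff n) (snd p) *\<^sub>R compensated u F p))"
  proof (rule lint_cong[OF refl])
   fix p assume "p \<in> space ?L"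
   then have "0 \<le> fst p" by (auto simp: jump_intensity_def space_pair_measure half_line_lebesgue_eq)
   moreover have "phase u F p = 0" if "\<not> fst p \<le> T" using phase_outside[OF FT, of p u] that by simp
   ultimately show "cis (h n p) - 1 - \<i> * of_real (hs n p) = indicator {..T} (fst p) *\<^sub>R (indicator (cutoff n) (snd p) *\<^sub>R compensated u F p)"
    by (auto simp: h_def hs_def compensated_def indicator_def cutoff_def ep_def)
  qed
  also have "\<dots> = (LINT p|intensity_upto T \<mu>. indicator (cutoff n) (snd p) *\<^sub>R compensated u F p)"
   unfolding intensity_upto_def
  proof (rule integral_density[symmetric])
   have [measurable]: "snd \<in> borel_measurable ?L" "fst \<in> borel_measurable ?L"
    by (rule sm, rule measurable_compose[OF K.measurable_jump_id]) measurable
   note [measurable] = K.measurable_compensated[OF F(1), of u]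
   show "(\<lambda>p. indicator (cutoff n) (snd p) *\<^sub>R compensated u F p) \<in> borel_measurable ?L" by measurable
   show "(\<lambda>p. indicator {..T} (fst p)) \<in> borel_measurable ?L" by measurable
  qed auto
  finally show ?thesis .
 qed
 have "(\<lambda>n. ?G * cis ?d * exp (LINT p|intensity_upto T \<mu>. indicator (cutoff n) (snd p) *\<^sub>R compensated u F p)) \<longlonglongrightarrow> ?G * cis ?d * exp (LINT p|intensity_upto T \<mu>. compensated u F p)"
 proof (intro tendsto_mult tendsto_const tendsto_exp integral_cutoff_tendsto)
  show "integrable (intensity_upto T \<mu>) (compensated u F)" by (rule compensated_integrable[OF L T F(1)])
  show "snd \<in> borel_measurable (intensity_upto T \<mu>)"
   using measurable_intensity_snd[OF L T measurable_ident] by (simp add: eta_contract_eq)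
  show "AE p in intensity_upto T \<mu>. snd p \<noteq> 0" by (rule AE_intensity_snd[OF L T levy_measure_AE_nonzero[OF L]])
 qed
 with lim show ?thesis unfolding val lhs by (rule LIMSEQ_unique)
qed

lemma measurable_path_space_PiM: "X \<in> measurable P path_space ==> X \<in> measurable P (Pi\<^sub>M {0..} (\<lambda>_. borel))"
 unfolding path_space_def by (simp add: measurable_restrict_space2_iff)

text \<open>Every triplet comes with its own representation. Expressing the Gaussian factor through
  one fixed Wiener process \<open>W0\<close> makes the formulas for different triplets
  comparable.\<close>

lemma levy_process_char:
 fixes \<mu> :: "(real^'d) measure" and M0 :: "real measure"
 assumes X: "levy_process P X S b \<mu>" and L: "levy_measure \<mu>" and W0: "prob_space M0" "wiener_process M0 S W0"
  and F: "finite F" "F \<subseteq> {0..T}" and T: "0 \<le> T"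
 shows "(LINT w|P. cis (\<Sum>t\<in>F. u t \<bullet> X w t)) =
  (LINT w|M0. cis (\<Sum>t\<in>F. u t \<bullet> W0 t w)) * cis (\<Sum>t\<in>F. t * (u t \<bullet> b)) * exp (LINT p|intensity_upto T \<mu>. compensated u F p)"
proof -
 have Xm: "X \<in> measurable P path_space" using X by (simp add: levy_process_def)
 obtain M :: "real measure" and Y where Y: "levy_ito_process M S b \<mu> Y"
  and d: "distr P (Pi\<^sub>M {0..} (\<lambda>_. borel)) X = distr M (Pi\<^sub>M {0..} (\<lambda>_. borel)) (\<lambda>w. \<lambda>t\<in>{0..}. Y t w)"
  using X unfolding levy_process_def by blast
 obtain W \<Phi> J where M: "prob_space M" and W: "wiener_process M S W" and Po: "poisson_process M (jump_intensity \<mu>) \<Phi>"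
  and I: "independent_elements M
     (Pi\<^sub>M {0..} (\<lambda>_. borel)) (\<lambda>w. \<lambda>t\<in>{0..}. W t w)
     (Pi\<^sub>M (sets (jump_intensity \<mu>)) (\<lambda>_. borel))
      (\<lambda>w. \<lambda>B\<in>sets (jump_intensity \<mu>). emeasure (\<Phi> w) B)"
  and J: "\<And>t. 0 \<le> t ==> converges_in_probability M
     (\<lambda>\<epsilon> w. (LINT p:{0..t} \<times> {x. \<epsilon> < norm x \<and> norm x \<le> 1}|\<Phi> w. snd p)
         - (LINT p:{0..t} \<times> {x. \<epsilon> < norm x \<and> norm x \<le> 1}|jump_intensity \<mu>. snd p))
     (J t) (at_right 0)"
  and Yt: "\<And>t w. 0 \<le> t ==> w \<in> space M ==>
     Y t w = t *\<^sub>R b + W t w + J t w + (LINT p:{0..t} \<times> {x. 1 < norm x}|\<Phi> w. snd p)"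
  using Y unfolding levy_ito_process_def by blast
 interpret K: jump_measure "jump_intensity \<mu>" by (rule jump_measure_jump_intensity[OF L])
 have Ym: "Y t \<in> borel_measurable M" if t: "0 \<le> t" for t
 proof -
  have sm: "snd \<in> borel_measurable (jump_intensity \<mu>)" by (rule measurable_compose[OF K.measurable_jump_id]) measurable
  have "{x::real^'d. 1 < norm x} \<in> sets borel" by measurable
  then have "(\<lambda>p. indicator ({0..t} \<times> {x. 1 < norm x}) p *\<^sub>R snd p) \<in> borel_measurable (jump_intensity \<mu>)"
   using jump_box(1)[OF L t] sm by (intro borel_measurable_scaleR borel_measurable_indicator)
  then have "(\<lambda>w. LINT p:{0..t} \<times> {x. 1 < norm x}|\<Phi> w. snd p) \<in> borel_measurable M"
   unfolding set_lebesgue_integral_def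
   by (intro measurable_integral_random_measure[OF poisson_sets[OF M Po] poisson_measurable[OF M Po]])
  moreover have "W t \<in> borel_measurable M" "J t \<in> borel_measurable M"
   using W J t by (auto simp: wiener_process_def converges_in_probability_def)
  ultimately have "(\<lambda>w. t *\<^sub>R b + W t w + J t w + (LINT p:{0..t} \<times> {x. 1 < norm x}|\<Phi> w. snd p)) \<in> borel_measurable M"
   by measurable
  moreover have "Y t \<in> borel_measurable M \<longleftrightarrow> (\<lambda>w. t *\<^sub>R b + W t w + J t w + (LINT p:{0..t} \<times> {x. 1 < norm x}|\<Phi> w. snd p)) \<in> borel_measurable M"
   by (rule measurable_cong) (rule Yt[OF t])
  ultimately show ?thesis by blast
 qed
 have Ymp: "(\<lambda>w. \<lambda>t\<in>{0..}. Y t w) \<in> measurable M (Pi\<^sub>M {0..} (\<lambda>_. borel))"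
  by (rule measurable_restrict) (use Ym in auto)
 have F0: "t \<in> {0..}" if "t \<in> F" for t using F(2) that by auto
 have "(\<lambda>w. \<Sum>t\<in>F. u t \<bullet> w t) \<in> borel_measurable (Pi\<^sub>M {0..} (\<lambda>_. borel :: (real^'d) measure))"
  by (intro borel_measurable_sum borel_measurable_inner borel_measurable_const measurable_component_singleton F0)
 from measurable_compose[OF this measurable_cis]
 have c: "(\<lambda>w. cis (\<Sum>t\<in>F. u t \<bullet> w t)) \<in> borel_measurable (Pi\<^sub>M {0..} (\<lambda>_. borel :: (real^'d) measure))" .
 have "(LINT w|P. cis (\<Sum>t\<in>F. u t \<bullet> X w t)) = (LINT w|distr P (Pi\<^sub>M {0..} (\<lambda>_. borel)) X. cis (\<Sum>t\<in>F. u t \<bullet> w t))"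
  by (rule integral_distr[symmetric, OF measurable_path_space_PiM[OF Xm] c])
 also have "\<dots> = (LINT w|M. cis (\<Sum>t\<in>F. u t \<bullet> (\<lambda>t\<in>{0..}. Y t w) t))"
  unfolding d by (rule integral_distr[OF Ymp c])
 also have "\<dots> = (LINT w|M. cis (\<Sum>t\<in>F. u t \<bullet> Y t w))" using F0 by simp
 also have "\<dots> = (LINT w|M. cis (\<Sum>t\<in>F. u t \<bullet> W t w)) * cis (\<Sum>t\<in>F. t * (u t \<bullet> b)) * exp (LINT p|intensity_upto T \<mu>. compensated u F p)"
  by (rule levy_ito_char_aux[OF M W Po I J Yt L F T])
 also have "(LINT w|M. cis (\<Sum>t\<in>F. u t \<bullet> W t w)) = (LINT w|M0. cis (\<Sum>t\<in>F. u t \<bullet> W0 t w))"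
  by (rule wiener_char_unique[OF M W0(1) W W0(2) F(1)]) (use F0 in auto)
 finally show ?thesis .
qed

text \<open>(1 + v) min (|x|^2, 1) is at most min (|x|^2, 1) + |v| min (|x|, 1), because min (|x|^2,
  1) \<le> min (|x|, 1).\<close>

lemma levy_measure_tilted:
 fixes \<nu> :: "'a::euclidean_space measure"
 assumes L: "levy_measure \<nu>" and v: "admissible \<nu> v" shows "levy_measure (density \<nu> (\<lambda>x. ennreal (1 + v x)))"
 unfolding levy_measure_def
proof (intro conjI)
 note s[measurable_cong] = levy_measure_sets[OF L]
 have [measurable]: "v \<in> borel_measurable borel" using v by (simp add: admissible_def)
 then have vm: "v \<in> borel_measurable \<nu>" using measurable_cong_sets[OF s refl] by blast
 note [measurable] = vm
 show "sets (density \<nu> (\<lambda>x. ennreal (1 + v x))) = sets borel" using s by simp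
 have "AE x in \<nu>. ennreal (1 + v x) * indicator {0} x = 0" using levy_measure_AE_nonzero[OF L] by eventually_elim simp
 then have "(\<integral>\<^sup>+x. ennreal (1 + v x) * indicator {0} x \<partial>\<nu>) = (\<integral>\<^sup>+x. 0 \<partial>\<nu>)" by (rule nn_integral_cong_AE)
 then show "emeasure (density \<nu> (\<lambda>x. ennreal (1 + v x))) {0} = 0" using s by (subst emeasure_density) auto
 have mm: "(\<lambda>x. ennreal (min ((norm x)\<^sup>2) 1)) \<in> borel_measurable \<nu>" by measurable
 have "(\<integral>\<^sup>+x. ennreal (min ((norm x)\<^sup>2) 1) \<partial>density \<nu> (\<lambda>x. ennreal (1 + v x))) = (\<integral>\<^sup>+x. ennreal (1 + v x) * ennreal (min ((norm x)\<^sup>2) 1) \<partial>\<nu>)"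
  using mm by (subst nn_integral_density) auto
 also have "\<dots> \<le> (\<integral>\<^sup>+x. ennreal (min ((norm x)\<^sup>2) 1) + ennreal (norm (min (norm x) 1 * v x)) \<partial>\<nu>)"
 proof (rule nn_integral_mono)
  fix x :: 'a
  have "(norm x)\<^sup>2 \<le> norm x" if "norm x \<le> 1" using that by (simp add: power2_eq_square mult_left_le_one_le)
  moreover have "1 \<le> (norm x)\<^sup>2" if "\<not> norm x \<le> 1" using that by (simp add: one_le_power)
  ultimately have m: "min ((norm x)\<^sup>2) 1 \<le> min (norm x) 1" by (cases "norm x \<le> 1") auto
  have "(1 + v x) * min ((norm x)\<^sup>2) 1 \<le> min ((norm x)\<^sup>2) 1 + \<bar>v x\<bar> * min ((norm x)\<^sup>2) 1"
   using mult_right_mono[OF abs_ge_self[of "v x"], of "min ((norm x)\<^sup>2) 1"] by (simp add: distrib_right)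
  also have "\<dots> \<le> min ((norm x)\<^sup>2) 1 + norm (min (norm x) 1 * v x)"
   using mult_left_mono[OF m, of "\<bar>v x\<bar>"] by (simp add: abs_mult mult.commute)
  finally have le: "(1 + v x) * min ((norm x)\<^sup>2) 1 \<le> min ((norm x)\<^sup>2) 1 + norm (min (norm x) 1 * v x)" .
  have "ennreal (1 + v x) * ennreal (min ((norm x)\<^sup>2) 1) = ennreal ((1 + v x) * min ((norm x)\<^sup>2) 1)"
   by (rule ennreal_mult''[symmetric]) simp
  also have "\<dots> \<le> ennreal (min ((norm x)\<^sup>2) 1 + norm (min (norm x) 1 * v x))" by (rule ennreal_leI[OF le])
  also have "\<dots> = ennreal (min ((norm x)\<^sup>2) 1) + ennreal (norm (min (norm x) 1 * v x))" by (rule ennreal_plus) simp_all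
  finally show "ennreal (1 + v x) * ennreal (min ((norm x)\<^sup>2) 1) \<le> ennreal (min ((norm x)\<^sup>2) 1) + ennreal (norm (min (norm x) 1 * v x))" .
 qed
 also have "\<dots> = (\<integral>\<^sup>+x. ennreal (min ((norm x)\<^sup>2) 1) \<partial>\<nu>) + (\<integral>\<^sup>+x. ennreal (norm (min (norm x) 1 * v x)) \<partial>\<nu>)"
  by (rule nn_integral_add) measurable
 also have "\<dots> < \<infinity>"
  using L v by (simp add: levy_measure_def admissible_def integrable_iff_bounded)
 finally show "(\<integral>\<^sup>+x. ennreal (min ((norm x)\<^sup>2) 1) \<partial>density \<nu> (\<lambda>x. ennreal (1 + v x))) < \<infinity>" .
qed

lemma intensity_upto_tilted:
 fixes \<nu> :: "'a::euclidean_space measure"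
 assumes L: "levy_measure \<nu>" and v: "admissible \<nu> v" and T: "0 \<le> T"
 shows "intensity_upto T (density \<nu> (\<lambda>x. ennreal (1 + v x))) = density (intensity_upto T \<nu>) (\<lambda>p. ennreal (1 + v (snd p)))"
proof -
 have "v \<in> borel_measurable borel" using v by (simp add: admissible_def)
 then have [measurable]: "v \<in> borel_measurable \<nu>" using measurable_cong_sets[OF levy_measure_sets[OF L] refl] by blast
 have s: "sigma_finite_measure (density \<nu> (\<lambda>x. ennreal (1 + v x)))"
  by (rule levy_measure_sigma_finite[OF levy_measure_tilted[OF L v]])
 have "density (horizon T) (\<lambda>_. 1) \<Otimes>\<^sub>M density \<nu> (\<lambda>x. ennreal (1 + v x)) = density (horizon T \<Otimes>\<^sub>M \<nu>) (\<lambda>(x, y). 1 * ennreal (1 + v y))"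
  by (rule pair_measure_density) (use s levy_measure_sigma_finite[OF L] in auto)
 then show ?thesis
  unfolding intensity_upto_eq_pair[OF T s] intensity_upto_eq_pair[OF T levy_measure_sigma_finite[OF L]]
  by (simp add: density_1 case_prod_beta')
qed

text \<open>The path at time s has seen the jumps up to s; this gives the compensator belonging to a
  single evaluation time.\<close>

lemma integral_intensity_le:
 fixes k :: "'a::euclidean_space => real"
 assumes L: "levy_measure \<nu>" and s: "0 \<le> s" "s \<le> T" and k: "integrable \<nu> k" "k \<in> borel_measurable borel"
 shows "integrable (intensity_upto T \<nu>) (\<lambda>p. if fst p \<le> s then k (snd p) else 0)"
  "(LINT p|intensity_upto T \<nu>. (if fst p \<le> s then k (snd p) else 0)) = s * (LINT x|\<nu>. k x)"
proof -
 interpret K: jump_measure "jump_intensity \<nu>" by (rule jump_measure_jump_intensity[OF L])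
 note [measurable] = k(2)
 have [measurable]: "(\<lambda>p. k (snd p)) \<in> borel_measurable (jump_intensity \<nu>)" "fst \<in> borel_measurable (jump_intensity \<nu>)"
  by (rule measurable_compose[OF K.measurable_jump_id], measurable)+
 have e: "indicator {..T} (fst p) *\<^sub>R (if fst p \<le> s then k (snd p) else 0) = indicator {..s} (fst p) *\<^sub>R k (snd p)" for p
  using s by (auto simp: indicator_def)
 have im: "(\<lambda>p. indicator {..r} (fst p) :: real) \<in> borel_measurable (jump_intensity \<nu>)" for r by measurable
 have fm: "(\<lambda>p. if fst p \<le> s then k (snd p) else 0) \<in> borel_measurable (jump_intensity \<nu>)" by measurable
 have km: "(\<lambda>p. k (snd p)) \<in> borel_measurable (jump_intensity \<nu>)" by measurable
 note i = integral_intensity_snd[OF L s(1) k(1)]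
 have "integrable (jump_intensity \<nu>) (\<lambda>p. indicator {..s} (fst p) *\<^sub>R k (snd p))"
  using i(1) unfolding intensity_upto_def by (subst (asm) integrable_density[OF km im]) auto
 then show "integrable (intensity_upto T \<nu>) (\<lambda>p. if fst p \<le> s then k (snd p) else 0)"
  unfolding intensity_upto_def by (subst integrable_density[OF fm im]) (auto simp only: e indicator_pos_le intro!: AE_I2)
 have "(LINT p|intensity_upto T \<nu>. (if fst p \<le> s then k (snd p) else 0)) = (LINT p|jump_intensity \<nu>. indicator {..s} (fst p) *\<^sub>R k (snd p))"
  unfolding intensity_upto_def by (subst integral_density[OF fm im]) (auto simp only: e indicator_pos_le intro!: AE_I2)
 also have "\<dots> = (LINT p|intensity_upto s \<nu>. k (snd p))"
  unfolding intensity_upto_def by (rule integral_density[OF km im, symmetric]) auto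
 finally show "(LINT p|intensity_upto T \<nu>. (if fst p \<le> s then k (snd p) else 0)) = s * (LINT x|\<nu>. k x)"
  unfolding i(2) by simp
qed

text \<open>The drift is chosen so that it cancels the compensator of the additional jumps.\<close>

lemma tilted_exponent:
 fixes \<nu> :: "'a::euclidean_space measure"
 assumes L: "levy_measure \<nu>" and v: "admissible \<nu> v" and T: "0 \<le> T" and F: "finite F" "F \<subseteq> {0..T}"
 shows "cis (\<Sum>t\<in>F. t * (u t \<bullet> (b + (LINT x:{x. norm x \<le> 1}|\<nu>. v x *\<^sub>R x)))) *
   exp (LINT p|intensity_upto T (density \<nu> (\<lambda>x. ennreal (1 + v x))). compensated u F p) =
  cis (\<Sum>t\<in>F. t * (u t \<bullet> b)) * exp (LINT p|intensity_upto T \<nu>. compensated u F p) *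
   exp (LINT p|intensity_upto T \<nu>. v (snd p) *\<^sub>R (cis (phase u F p) - 1))"
proof -
 interpret K: jump_measure "intensity_upto T \<nu>" by (rule jump_measure_intensity_upto[OF L T])
 let ?K = "intensity_upto T \<nu>" and ?B = "{x::'a. norm x \<le> 1}"
 have vb[measurable]: "v \<in> borel_measurable borel" and vi: "integrable \<nu> (\<lambda>x. min (norm x) 1 * v x)" and v1: "AE x in \<nu>. - 1 \<le> v x"
  using v by (auto simp: admissible_def)
 note vK = measurable_intensity_snd[OF L T vb]
 define m where "m = (LINT x:?B|\<nu>. v x *\<^sub>R x)"
 have dr: "(\<Sum>t\<in>F. t * (u t \<bullet> (b + m))) = (\<Sum>t\<in>F. t * (u t \<bullet> b)) + (\<Sum>t\<in>F. t * (u t \<bullet> m))"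
  by (simp add: inner_add_right distrib_left sum.distrib)
 have Bb: "?B \<in> sets borel" by measurable
 have bi: "integrable \<nu> (\<lambda>x. indicator ?B x *\<^sub>R (v x *\<^sub>R x))"
 proof (rule integrable_le[OF vi])
  have "(\<lambda>x. indicator ?B x *\<^sub>R (v x *\<^sub>R x)) \<in> borel_measurable borel"
   using Bb by (intro borel_measurable_scaleR borel_measurable_indicator vb) auto
  then show "(\<lambda>x. indicator ?B x *\<^sub>R (v x *\<^sub>R x)) \<in> borel_measurable \<nu>"
   using measurable_cong_sets[OF levy_measure_sets[OF L] refl] by blast
 qed (auto simp: indicator_def abs_mult)
 define k where "k t x = u t \<bullet> (indicator ?B x *\<^sub>R (v x *\<^sub>R x))" for t x
 have ki: "integrable \<nu> (k t)" for t
  unfolding k_def by (rule integrable_inner_right) (rule bi)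
 have kb: "k t \<in> borel_measurable borel" for t
  unfolding k_def using Bb by (auto intro!: borel_measurable_inner borel_measurable_scaleR borel_measurable_indicator)
 have km: "(LINT x|\<nu>. k t x) = u t \<bullet> m" for t
  unfolding k_def m_def set_lebesgue_integral_def using bi by (intro integral_inner_right) auto
 \<comment> \<open>The compensator of the additional jumps. An evaluation time t sees the jumps
   during [0, t], which yields the factor t in its integral and hence exactly the drift
   correction.\<close>
 define c where "c p = v (snd p) * (indicator ?B (snd p) * phase u F p)" for p
 have c: "c p = (\<Sum>t\<in>F. if fst p \<le> t then k t (snd p) else 0)" for p
  unfolding c_def phase_eq_sum[OF F(1)] k_def sum_distrib_left by (intro sum.cong refl) auto
 have F0: "0 \<le> t" "t \<le> T" if "t \<in> F" for t using F(2) that by auto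
 have ci: "integrable ?K c" unfolding c[abs_def] by (intro Bochner_Integration.integrable_sum integral_intensity_le(1)[OF L F0 ki kb])
 have cv: "(LINT p|?K. c p) = (\<Sum>t\<in>F. t * (u t \<bullet> m))"
 proof -
  have "(LINT p|?K. c p) = (\<Sum>t\<in>F. \<integral>p. (if fst p \<le> t then k t (snd p) else 0) \<partial>?K)"
   unfolding c by (intro Bochner_Integration.integral_sum integral_intensity_le(1)[OF L F0 ki kb])
  also have "\<dots> = (\<Sum>t\<in>F. t * (LINT x|\<nu>. k t x))"
   by (intro sum.cong refl integral_intensity_le(2)[OF L F0 ki kb])
  finally show ?thesis by (simp only: km)
 qed
 note comp = compensated_integrable[OF L T F(1), of u]
 have comp': "integrable ?K (\<lambda>p. v (snd p) *\<^sub>R compensated u F p)" and val: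
  "(LINT p|intensity_upto T (density \<nu> (\<lambda>x. ennreal (1 + v x))). compensated u F p) = (LINT p|?K. compensated u F p) + (LINT p|?K. v (snd p) *\<^sub>R compensated u F p)"
 proof -
  have a: "AE p in ?K. 0 \<le> 1 + v (snd p)" using AE_intensity_snd[OF L T v1] by eventually_elim simp
  have vm: "(\<lambda>p. 1 + v (snd p)) \<in> borel_measurable ?K" using vK by measurable
  note cm = K.measurable_compensated[OF F(1), of u]
  have "integrable (density ?K (\<lambda>p. ennreal (1 + v (snd p)))) (compensated u F)"
   using compensated_integrable[OF levy_measure_tilted[OF L v] T F(1), of u] unfolding intensity_upto_tilted[OF L v T] .
  then have i: "integrable ?K (\<lambda>p. (1 + v (snd p)) *\<^sub>R compensated u F p)"
   by (subst (asm) integrable_density[OF cm vm a])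
  from Bochner_Integration.integrable_diff[OF i comp] show ci': "integrable ?K (\<lambda>p. v (snd p) *\<^sub>R compensated u F p)"
   by (simp add: scaleR_add_left)
  have "(LINT p|intensity_upto T (density \<nu> (\<lambda>x. ennreal (1 + v x))). compensated u F p) = (LINT p|?K. (1 + v (snd p)) *\<^sub>R compensated u F p)"
   unfolding intensity_upto_tilted[OF L v T] by (rule integral_density[OF cm vm a])
  also have "\<dots> = (LINT p|?K. compensated u F p) + (LINT p|?K. v (snd p) *\<^sub>R compensated u F p)"
   using lint_add[OF comp ci'] by (simp add: scaleR_add_left)
  finally show "(LINT p|intensity_upto T (density \<nu> (\<lambda>x. ennreal (1 + v x))). compensated u F p) = (LINT p|?K. compensated u F p) + (LINT p|?K. v (snd p) *\<^sub>R compensated u F p)" .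
 qed
 have cci: "integrable ?K (\<lambda>p. \<i> * of_real (c p))" using ci by simp
 have split: "v (snd p) *\<^sub>R (cis (phase u F p) - 1) = v (snd p) *\<^sub>R compensated u F p + \<i> * of_real (c p)" for p
  by (simp add: compensated_def c_def scaleR_conv_of_real algebra_simps)
 have "(LINT p|?K. v (snd p) *\<^sub>R (cis (phase u F p) - 1)) = (LINT p|?K. v (snd p) *\<^sub>R compensated u F p) + \<i> * of_real (\<Sum>t\<in>F. t * (u t \<bullet> m))"
  unfolding split lint_add[OF comp' cci] using ci by (simp add: cv)
 then show ?thesis
  unfolding m_def[symmetric] dr val by (simp add: cis_mult[symmetric] cis_conv_exp exp_add algebra_simps)
qed

section \<open>Stopped functionals\<close>

lemma stopped_stopped: "0 \<le> s ==> stopped s (stopped s w) = stopped s w"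
 by (auto simp: stopped_def fun_eq_iff)

lemma stopped_add_jump:
 assumes "0 \<le> s" shows "stopped s (add_jump p (stopped s w)) = stopped s (add_jump p w)"
 using assms by (auto simp: stopped_def add_jump_def fun_eq_iff)

lemma stopped_add_late_jump:
 assumes "0 \<le> s" "s < fst p" shows "stopped s (add_jump p w) = stopped s (w :: real => 'a::monoid_add)"
 using assms by (auto simp: stopped_def add_jump_def fun_eq_iff)

text \<open>The preimage of any Borel set under f is a preimage under \<open>stopped s\<close>.
  Applied to the singleton of f w, it contains with w also the stopped path, because stopping is
  idempotent.\<close>

lemma stopped_algebra_measurable:
 fixes f :: "(real => 'a::real_normed_vector) => real"
 assumes s: "0 \<le> s" and f: "f \<in> borel_measurable (stopped_algebra s)"
 shows "f \<in> borel_measurable path_space" and "w \<in> cadlag ==> f (stopped s w) = f w"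
proof -
 have st: "stopped s \<in> (cadlag :: (real => 'a) set) \<rightarrow> space path_space" using stopped_cadlag s by (auto simp: space_path_space)
 have pre: "\<exists>A\<in>sets path_space. f -` B \<inter> cadlag = stopped s -` A \<inter> cadlag" if "B \<in> sets borel" for B
  using measurable_sets[OF f that] by (auto simp: stopped_algebra_def sets_vimage_algebra2[OF st])
 show "f \<in> borel_measurable path_space"
 proof (rule measurableI)
  fix B :: "real set" assume "B \<in> sets borel"
  then obtain A where A: "A \<in> sets path_space" "f -` B \<inter> cadlag = stopped s -` A \<inter> cadlag" using pre by blast
  show "f -` B \<inter> space path_space \<in> sets path_space"
   using measurable_sets[OF stopped_measurable[OF s] A(1)] A(2) by (simp add: space_path_space)
 qed simp
 show "f (stopped s w) = f w" if w: "w \<in> cadlag"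
 proof -
  obtain A where A: "f -` {f w} \<inter> cadlag = stopped s -` A \<inter> cadlag" using pre[of "{f w}"] by auto
  have "w \<in> f -` {f w} \<inter> cadlag" using w by simp
  then have "w \<in> stopped s -` A \<inter> cadlag" by (simp only: A)
  then have "stopped s w \<in> stopped s -` A \<inter> cadlag" using stopped_cadlag[OF w s] by (simp add: stopped_stopped[OF s])
  then have "stopped s w \<in> f -` {f w} \<inter> cadlag" by (simp only: A)
  then show ?thesis by simp
 qed
qed

section \<open>Differences of functionals of stopped paths\<close>

lemma jump_diffs_measurable:
 fixes f :: "(real => 'a::euclidean_space) => real"
 assumes f: "f \<in> borel_measurable path_space" shows "jump_diffs ps f \<in> borel_measurable path_space"
proof (induction ps)
 case (Cons p ps)
 have "(\<lambda>w. add_jump p w) \<in> measurable path_space path_space"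
  by (intro measurable_add_jump measurable_const measurable_ident_sets refl) (simp add: space_pair_measure)
 from measurable_compose[OF this Cons] Cons show ?case
  by (simp add: jump_diff_def[abs_def])
qed (simp add: f)

context
 fixes f :: "(real => 'a::real_normed_vector) => real" and s :: real
 assumes s: "0 \<le> s" and f: "\<And>w. w \<in> cadlag ==> f (stopped s w) = f w"
begin

lemma jump_diffs_stopped: "w \<in> cadlag ==> jump_diffs ps f (stopped s w) = jump_diffs ps f w"
proof (induction ps arbitrary: w)
 case (Cons p ps)
 note c = stopped_cadlag[OF Cons.prems s]
 have "jump_diffs ps f (add_jump p (stopped s w)) = jump_diffs ps f (stopped s (add_jump p (stopped s w)))"
  by (rule Cons.IH[symmetric]) (rule add_jump_cadlag[OF c])
 also have "\<dots> = jump_diffs ps f (add_jump p w)"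
  unfolding stopped_add_jump[OF s] by (rule Cons.IH) (rule add_jump_cadlag[OF Cons.prems])
 finally show ?case using Cons.IH[OF Cons.prems] by (simp add: jump_diff_def)
qed (simp add: f)

text \<open>A jump after s does not change the stopped path, so its difference is zero. This reduces
  integrals over all jump times to integrals over [0, s].\<close>

lemma jump_diffs_late: "w \<in> cadlag ==> p \<in> set ps ==> s < fst p ==> jump_diffs ps f w = 0"
proof (induction ps arbitrary: w)
 case (Cons q ps)
 show ?case
 proof (cases "p \<in> set ps")
  case True
  then show ?thesis using Cons.IH Cons.prems add_jump_cadlag[OF Cons.prems(1)] by (simp add: jump_diff_def)
 next
  case False
  then have q: "s < fst q" using Cons.prems by auto
  have "jump_diffs ps f (add_jump q w) = jump_diffs ps f (stopped s (add_jump q w))"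
   by (rule jump_diffs_stopped[symmetric]) (rule add_jump_cadlag[OF Cons.prems(1)])
  also have "\<dots> = jump_diffs ps f w"
   unfolding stopped_add_late_jump[OF s q] by (rule jump_diffs_stopped[OF Cons.prems(1)])
  finally show ?thesis by (simp add: jump_diff_def)
 qed
qed simp

end

section \<open>The laws of the stopped processes\<close>

text \<open>The drift moves with v by the integral of v x over the unit ball; for the v that belongs
  to \<theta> this is the drift \<open>b\<theta> \<theta>\<close> of the theorem.\<close>

definition stopped_law ::
  "('a::euclidean_space => 'a measure => 'w measure) => ('w => real => 'a) => 'a => 'a measure => real => ('a => real) => (real => 'a) measure" where
 "stopped_law P X b \<nu> T v = distr (P (b + (LINT x:{x. norm x \<le> 1}|\<nu>. v x *\<^sub>R x)) (density \<nu> (\<lambda>x. ennreal (1 + v x))))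
  path_space (\<lambda>w. stopped T (X w))"

text \<open>Evaluating the stopped path at the times in \<open>F\<close> amounts to evaluating the path at the times
 \<open>min t T\<close>, with the coefficients of coinciding times added up.\<close>

lemma stopped_times:
 fixes u x :: "real => 'a::real_inner"
 assumes F: "finite F" shows "(\<Sum>s\<in>(\<lambda>t. min t T) ` F. (\<Sum>t | t \<in> F \<and> min t T = s. u t) \<bullet> x s) = (\<Sum>t\<in>F. u t \<bullet> x (min t T))"
 unfolding sum.image_gen[OF F, of "\<lambda>t. u t \<bullet> x (min t T)" "\<lambda>t. min t T"] inner_sum_left
 by (intro sum.cong refl) auto

text \<open>For a jump up to T, replacing t by \<open>min t T\<close> does not change whether the
  time lies before the jump.\<close>

lemma phase_stopped_times:
 fixes u :: "real => 'a::real_inner"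
 assumes F: "finite F" and p: "fst p \<le> T"
 shows "phase (\<lambda>s. \<Sum>t | t \<in> F \<and> min t T = s. u t) ((\<lambda>t. min t T) ` F) p = phase u F p"
proof -
 have "phase (\<lambda>s. \<Sum>t | t \<in> F \<and> min t T = s. u t) ((\<lambda>t. min t T) ` F) p =
   (\<Sum>s\<in>(\<lambda>t. min t T) ` F. (\<Sum>t | t \<in> F \<and> min t T = s. u t) \<bullet> (if fst p \<le> s then snd p else 0))"
  using F by (subst phase_eq_sum) (auto intro!: sum.cong)
 also have "\<dots> = (\<Sum>t\<in>F. u t \<bullet> (if fst p \<le> min t T then snd p else 0))" by (rule stopped_times[OF F])
 also have "\<dots> = phase u F p" unfolding phase_eq_sum[OF F] using p by (intro sum.cong refl) auto
 finally show ?thesis .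
qed

text \<open>\<open>C\<close> collects the Gaussian factor, the drift and the jump exponent of the
  unperturbed triplet at the truncated times, which are the factors free of v.\<close>

lemma stopped_law_perturbed_family:
 fixes P :: "real^'d => (real^'d) measure => 'w measure"
 assumes P: "\<And>c \<mu>. levy_measure \<mu> ==> levy_process (P c \<mu>) X S c \<mu>" and L: "levy_measure \<nu>" and T: "0 \<le> T"
 obtains C where "perturbed_family \<nu> T (stopped_law P X b \<nu> T) C"
proof -
 obtain M0 :: "real measure" and W0 where W0: "prob_space M0" "wiener_process M0 S W0"
  using P[OF L, of 0] unfolding levy_process_def levy_ito_process_def by blast
 define R where "R F = (\<lambda>t. min t T) ` F" for F :: "real set"
 define r where "r u F = (\<lambda>s. \<Sum>t | t \<in> F \<and> min t T = s. u t)" for u :: "real => real^'d" and F :: "real set"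
 define C where "C u F = (LINT w|M0. cis (\<Sum>t\<in>R F. r u F t \<bullet> W0 t w)) * (cis (\<Sum>t\<in>R F. t * (r u F t \<bullet> b)) * exp (LINT p|intensity_upto T \<nu>. compensated (r u F) (R F) p))" for u F
 have main: "prob_space (stopped_law P X b \<nu> T v) \<and> sets (stopped_law P X b \<nu> T v) = sets path_space \<and>
   (\<forall>F u c. finite F \<longrightarrow> F \<subseteq> {0..} \<longrightarrow> (LINT w|stopped_law P X b \<nu> T v. trig u F c w) =
    Re (C u F * exp (LINT p|intensity_upto T \<nu>. v (snd p) *\<^sub>R (cis (phase u F p) - 1)) * cis c))"
  if v: "admissible \<nu> v" for v
 proof (intro conjI allI impI)
  let ?c = "b + (LINT x:{x. norm x \<le> 1}|\<nu>. v x *\<^sub>R x)" and ?m = "density \<nu> (\<lambda>x. ennreal (1 + v x))"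
  let ?P = "P ?c ?m"
  note Lv = levy_measure_tilted[OF L v]
  note Pv = P[OF Lv, of ?c]
  interpret p: prob_space ?P using Pv by (simp add: levy_process_def)
  have Xm: "X \<in> measurable ?P path_space" using Pv by (simp add: levy_process_def)
  note Xs = measurable_compose[OF Xm stopped_measurable[OF T]]
  show "prob_space (stopped_law P X b \<nu> T v)" unfolding stopped_law_def by (rule p.prob_space_distr[OF Xs])
  show "sets (stopped_law P X b \<nu> T v) = sets path_space" by (simp add: stopped_law_def)
  fix F :: "real set" and u and c :: real
  assume F: "finite F" "F \<subseteq> {0..}"
  have RF: "finite (R F)" "R F \<subseteq> {0..T}" using F T by (auto simp: R_def)
  have rs: "(\<Sum>t\<in>R F. r u F t \<bullet> x t) = (\<Sum>t\<in>F. u t \<bullet> x (min t T))" for x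
   using stopped_times[OF F(1), where T = T and u = u and x = x] by (simp only: R_def r_def)
  have tm: "(\<lambda>w. \<Sum>t\<in>R F. r u F t \<bullet> w t) \<in> borel_measurable path_space"
   by (intro borel_measurable_sum borel_measurable_inner borel_measurable_const measurable_path_eval)
  have cm: "(\<lambda>w. cis (\<Sum>t\<in>R F. r u F t \<bullet> X w t)) \<in> borel_measurable ?P"
   by (rule measurable_compose[OF measurable_compose[OF Xm tm] measurable_cis])
  have ci: "integrable ?P (\<lambda>w. cis (\<Sum>t\<in>R F. r u F t \<bullet> X w t) * cis c)"
   by (rule p.integrable_const_bound[where B = 1]) (use cm in \<open>auto simp: norm_mult\<close>)
  have "(LINT w|stopped_law P X b \<nu> T v. trig u F c w) = (LINT w|?P. trig u F c (stopped T (X w)))"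
   unfolding stopped_law_def by (rule integral_distr[OF Xs]) (rule bmf_measurable[OF trig_bmf])
  also have "\<dots> = (LINT w|?P. Re (cis (\<Sum>t\<in>R F. r u F t \<bullet> X w t) * cis c))"
  proof (rule lint_cong[OF refl])
   fix w
   have "(\<Sum>t\<in>F. u t \<bullet> stopped T (X w) t) = (\<Sum>t\<in>F. u t \<bullet> X w (min t T))"
    using F(2) by (intro sum.cong refl) (auto simp: stopped_def)
   then show "trig u F c (stopped T (X w)) = Re (cis (\<Sum>t\<in>R F. r u F t \<bullet> X w t) * cis c)"
    unfolding trig_def rs cis_mult by simp
  qed
  also have "\<dots> = Re ((LINT w|?P. cis (\<Sum>t\<in>R F. r u F t \<bullet> X w t)) * cis c)"
   unfolding integral_mult_left_zero[symmetric] by (rule integral_bounded_linear[OF bounded_linear_Re ci])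
  also have "(LINT w|?P. cis (\<Sum>t\<in>R F. r u F t \<bullet> X w t)) = (LINT w|M0. cis (\<Sum>t\<in>R F. r u F t \<bullet> W0 t w)) *
    (cis (\<Sum>t\<in>R F. t * (r u F t \<bullet> ?c)) * exp (LINT p|intensity_upto T ?m. compensated (r u F) (R F) p))"
   unfolding levy_process_char[OF Pv Lv W0 RF T] by (simp only: mult.assoc)
  also have "\<dots> = C u F * exp (LINT p|intensity_upto T \<nu>. v (snd p) *\<^sub>R (cis (phase (r u F) (R F) p) - 1))"
   unfolding tilted_exponent[OF L v T RF] C_def by (simp only: mult.assoc)
  also have "(LINT p|intensity_upto T \<nu>. v (snd p) *\<^sub>R (cis (phase (r u F) (R F) p) - 1)) = (LINT p|intensity_upto T \<nu>. v (snd p) *\<^sub>R (cis (phase u F p) - 1))"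
  proof (rule integral_cong_AE)
   interpret K: jump_measure "intensity_upto T \<nu>" by (rule jump_measure_intensity_upto[OF L T])
   interpret J: jump_measure "jump_intensity \<nu>" by (rule jump_measure_jump_intensity[OF L])
   have vm: "(\<lambda>p. v (snd p)) \<in> borel_measurable (intensity_upto T \<nu>)"
    using v by (intro measurable_intensity_snd[OF L T]) (simp add: admissible_def)
   show "(\<lambda>p. v (snd p) *\<^sub>R (cis (phase (r u F) (R F) p) - 1)) \<in> borel_measurable (intensity_upto T \<nu>)"
    "(\<lambda>p. v (snd p) *\<^sub>R (cis (phase u F p) - 1)) \<in> borel_measurable (intensity_upto T \<nu>)"
    by (intro borel_measurable_scaleR vm borel_measurable_diff borel_measurable_const measurable_compose[OF K.measurable_phase measurable_cis] RF F)+
   have [measurable]: "fst \<in> borel_measurable (jump_intensity \<nu>)" by (rule measurable_compose[OF J.measurable_jump_id]) measurable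
   have "AE p in intensity_upto T \<nu>. fst p \<le> T"
    unfolding intensity_upto_def by (subst AE_density) (auto simp: indicator_def)
   then show "AE p in intensity_upto T \<nu>. v (snd p) *\<^sub>R (cis (phase (r u F) (R F) p) - 1) = v (snd p) *\<^sub>R (cis (phase u F p) - 1)"
    by eventually_elim (simp add: phase_stopped_times[OF F(1)] R_def r_def)
  qed
  finally show "(LINT w|stopped_law P X b \<nu> T v. trig u F c w) =
   Re (C u F * exp (LINT p|intensity_upto T \<nu>. v (snd p) *\<^sub>R (cis (phase u F p) - 1)) * cis c)" .
 qed
 show ?thesis by (rule that[of C], rule perturbed_family.intro) (use main L T in auto)
qed

lemma PiM_intensity_upto:
 fixes \<nu> :: "'a::euclidean_space measure"
 assumes L: "levy_measure \<nu>" and T: "0 \<le> T"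
 shows "PiN n (intensity_upto T \<nu>) = density (jump_intensity_power n \<nu>) (\<lambda>z. ennreal (\<Prod>i<n. indicator {..T} (fst (z i))))"
  "(\<lambda>z. \<Prod>i<n. indicator {..T} (fst (z i)) :: real) \<in> borel_measurable (jump_intensity_power n \<nu>)"
proof -
 interpret K: jump_measure "intensity_upto T \<nu>" by (rule jump_measure_intensity_upto[OF L T])
 interpret J: jump_measure "jump_intensity \<nu>" by (rule jump_measure_jump_intensity[OF L])
 let ?k = "\<lambda>p::real \<times> 'a. ennreal (indicator {..T} (fst p))"
 have [measurable]: "fst \<in> borel_measurable (jump_intensity \<nu>)" by (rule measurable_compose[OF J.measurable_jump_id]) measurable
 have k: "?k \<in> borel_measurable (jump_intensity \<nu>)" by measurable
 have i: "(\<lambda>p. indicator {..T} (fst p) :: real) \<in> borel_measurable (jump_intensity \<nu>)" by measurable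
 show m: "(\<lambda>z. \<Prod>i<n. indicator {..T} (fst (z i)) :: real) \<in> borel_measurable (jump_intensity_power n \<nu>)"
  unfolding jump_intensity_power_def
  by (intro borel_measurable_prod measurable_compose[OF measurable_component_singleton[where M = "\<lambda>_. jump_intensity \<nu>"] i])
 have sets: "sets (PiN n (intensity_upto T \<nu>)) = sets (jump_intensity_power n \<nu>)"
  unfolding jump_intensity_power_def by (intro sets_PiM_cong) (auto simp: intensity_upto_def)
 show "PiN n (intensity_upto T \<nu>) = density (jump_intensity_power n \<nu>) (\<lambda>z. ennreal (\<Prod>i<n. indicator {..T} (fst (z i))))"
 proof (rule measure_eqI)
  fix A assume "A \<in> sets (PiN n (intensity_upto T \<nu>))"
  then have A: "A \<in> sets (jump_intensity_power n \<nu>)" using sets by simp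
  have "emeasure (PiN n (intensity_upto T \<nu>)) A = (\<integral>\<^sup>+z. indicator A z \<partial>PiN n (intensity_upto T \<nu>))"
   using A sets by simp
  also have "\<dots> = (\<integral>\<^sup>+z. indicator A z * (\<Prod>i<n. ?k (z i)) \<partial>jump_intensity_power n \<nu>)"
   unfolding jump_intensity_power_def intensity_upto_def
   by (rule nn_integral_PiM_density[OF _ _ k])
    (use A J.sigma_finite_measure_axioms K.sigma_finite_measure_axioms in \<open>auto simp: intensity_upto_def jump_intensity_power_def\<close>)
  also have "\<dots> = (\<integral>\<^sup>+z. ennreal (\<Prod>i<n. indicator {..T} (fst (z i))) * indicator A z \<partial>jump_intensity_power n \<nu>)"
   by (simp add: prod_ennreal mult.commute)
  also have "\<dots> = emeasure (density (jump_intensity_power n \<nu>) (\<lambda>z. ennreal (\<Prod>i<n. indicator {..T} (fst (z i))))) A"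
   using m A by (intro emeasure_density[symmetric]) auto
  finally show "emeasure (PiN n (intensity_upto T \<nu>)) A = emeasure (density (jump_intensity_power n \<nu>) (\<lambda>z. ennreal (\<Prod>i<n. indicator {..T} (fst (z i))))) A" .
 qed (simp add: sets)
qed

text \<open>The integrand vanishes as soon as one jump time exceeds T, so the product density may be
  inserted without changing it.\<close>

lemma integral_PiM_intensity_upto:
 fixes \<nu> :: "'a::euclidean_space measure" and G :: "(nat => real \<times> 'a) => real"
 assumes L: "levy_measure \<nu>" and T: "0 \<le> T"
  and G: "G \<in> borel_measurable (PiN n (intensity_upto T \<nu>))" and z: "\<And>z i. i < n ==> T < fst (z i) ==> G z = 0"
 shows "integrable (PiN n (intensity_upto T \<nu>)) G \<longleftrightarrow> integrable (jump_intensity_power n \<nu>) G"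
  "(LINT z|PiN n (intensity_upto T \<nu>). G z) = (LINT z|jump_intensity_power n \<nu>. G z)"
proof -
 note e = PiM_intensity_upto[OF L T, of n]
 have Gm: "G \<in> borel_measurable (jump_intensity_power n \<nu>)" using G unfolding e(1) by simp
 have i: "(\<Prod>i<n. indicator {..T} (fst (z i))) *\<^sub>R G z = G z" for z
 proof (cases "\<exists>i<n. T < fst (z i)")
  case True
  then show ?thesis using assms(4) by auto
 next
  case False
  then have "\<forall>i<n. fst (z i) \<le> T" using leI by blast
  then have "(\<Prod>i<n. indicator {..T} (fst (z i))) = (1::real)" by (intro prod.neutral ballI) (auto simp: indicator_def not_less)
  then show ?thesis by simp
 qed
 have nn: "AE z in jump_intensity_power n \<nu>. 0 \<le> (\<Prod>i<n. indicator {..T} (fst (z i)) :: real)" by (intro AE_I2 prod_nonneg) auto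
 show "integrable (PiN n (intensity_upto T \<nu>)) G \<longleftrightarrow> integrable (jump_intensity_power n \<nu>) G"
  unfolding e(1) integrable_density[OF Gm e(2) nn] i ..
 show "(LINT z|PiN n (intensity_upto T \<nu>). G z) = (LINT z|jump_intensity_power n \<nu>. G z)"
  unfolding e(1) integral_density[OF Gm e(2) nn] i ..
qed

text \<open>The reference measure is \<open>\<nu>s\<close> and the horizon \<open>t0\<close>; the
  laws in question are the members of the family for the indices 0, u and u + (\<theta> - \<theta>0)
  g with u = \<open>g\<nu>\<close> - 1. As f and its differences depend only on the path stopped at
  \<open>t0\<close>, their integrals may be computed under the stopped laws.\<close>

theorem theorem7p5:
  fixes S :: "real^'d^'d"
    and P :: "real^'d \<Rightarrow> (real^'d) measure \<Rightarrow> 'w measure"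
    and X :: "'w \<Rightarrow> real \<Rightarrow> real^'d"
    and \<nu> \<nu>s :: "(real^'d) measure"
    and g\<nu> g :: "real^'d \<Rightarrow> real"
    and b bs :: "real^'d"
    and \<theta>0 t0 :: real
    and I :: "real set"
    and b\<theta> :: "real \<Rightarrow> real^'d"
    and \<nu>\<theta> :: "real \<Rightarrow> (real^'d) measure"
    and f :: "(real \<Rightarrow> real^'d) \<Rightarrow> real"
  assumes "covariance_matrix S"
    and "\<And>c \<mu>. levy_measure \<mu> \<Longrightarrow> levy_process (P c \<mu>) X S c \<mu>"
    and "levy_measure \<nu>" and "levy_measure \<nu>s"
    and "g\<nu> \<in> borel_measurable borel" and "AE x in \<nu>s. 0 \<le> g\<nu> x"
    and "\<nu> = density \<nu>s (\<lambda>x. ennreal (g\<nu> x))"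
    and "g \<in> borel_measurable borel"
    and "integrable \<nu>s (\<lambda>x. (1 - g\<nu> x)\<^sup>2)"
    and "integrable \<nu>s (\<lambda>x. (g x)\<^sup>2)"
    and "integrable \<nu>s (\<lambda>x. min (norm x) 1 * \<bar>g x\<bar>)"
    and "set_integrable \<nu>s {x. norm x \<le> 1} (\<lambda>x. norm x * \<bar>1 - g\<nu> x\<bar>)"
    and "b = bs + (LINT x:{x. norm x \<le> 1}|\<nu>s. (g\<nu> x - 1) *\<^sub>R x)"
    and "is_interval I" and "interior I \<noteq> {}" and "\<theta>0 \<in> I"
    and "\<And>\<theta>. \<theta> \<in> I \<Longrightarrow> AE x in \<nu>s. 0 \<le> g\<nu> x + (\<theta> - \<theta>0) * g x"
    and "\<And>\<theta>. \<theta> \<in> I \<Longrightarrow> b\<theta> \<theta> = b + (\<theta> - \<theta>0) *\<^sub>R (LINT x:{x. norm x \<le> 1}|\<nu>s. g x *\<^sub>R x)"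
    and "\<And>\<theta>. \<theta> \<in> I \<Longrightarrow> \<nu>\<theta> \<theta> = density \<nu>s (\<lambda>x. ennreal (g\<nu> x + (\<theta> - \<theta>0) * g x))"
    and "0 < t0" and "f \<in> borel_measurable (stopped_algebra t0)"
    and "integrable (P bs \<nu>s) (\<lambda>\<omega>. (f (X \<omega>))\<^sup>2)"
  shows "(\<forall>\<theta>\<in>I. integrable (P (b\<theta> \<theta>) (\<nu>\<theta> \<theta>)) (\<lambda>\<omega>. f (X \<omega>)))
    \<and> integrable (P b \<nu>) (\<lambda>\<omega>. f (X \<omega>))
    \<and> (\<forall>n\<ge>1.
         (AE z in density (jump_intensity_power n \<nu>s) (\<lambda>z. ennreal \<bar>tensor_power g n z\<bar>).
            integrable (P b \<nu>) (\<lambda>\<omega>. jump_diff_n n z f (X \<omega>))) \<and>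
         integrable (jump_intensity_power n \<nu>s)
           (\<lambda>z. (\<integral>\<omega>. jump_diff_n n z f (X \<omega>) \<partial>P b \<nu>) * tensor_power g n z))
    \<and> (\<forall>\<theta>\<in>I.
         let a = (\<lambda>n. (\<theta> - \<theta>0) ^ n / fact n *
                   (\<integral>z. (\<integral>\<omega>. jump_diff_n n z f (X \<omega>) \<partial>P b \<nu>) * tensor_power g n z
                      \<partial>jump_intensity_power n \<nu>s))
         in summable (\<lambda>n. \<bar>a (Suc n)\<bar>) \<and>
            (\<integral>\<omega>. f (X \<omega>) \<partial>P (b\<theta> \<theta>) (\<nu>\<theta> \<theta>)) = (\<integral>\<omega>. f (X \<omega>) \<partial>P b \<nu>) + (\<Sum>n. a (Suc n)))
    \<and> ((\<lambda>\<theta>. \<integral>\<omega>. f (X \<omega>) \<partial>P (b\<theta> \<theta>) (\<nu>\<theta> \<theta>)) has_real_derivative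
         (\<integral>x. (\<integral>t. (\<integral>\<omega>. jump_diff (t, x) f (X \<omega>) \<partial>P b \<nu>) * g x \<partial>half_line_lebesgue) \<partial>\<nu>s))
         (at \<theta>0 within I)"
proof -
 note proc = assms(2) and L\<nu> = assms(3) and L = assms(4) and g\<nu>b[measurable] = assms(5) and \<nu> = assms(7) and gb[measurable] = assms(8)
  and g2 = assms(10) and \<theta>0 = assms(16)
 have t0: "0 \<le> t0" using assms(20) by simp
 define u where "u x = g\<nu> x - 1" for x
 have ub[measurable]: "u \<in> borel_measurable borel" unfolding u_def[abs_def] by measurable
 let ?Q = "stopped_law P X bs \<nu>s t0"
 obtain C where "perturbed_family \<nu>s t0 ?Q C"
  using stopped_law_perturbed_family[OF proc L t0] by blast
 then interpret perturbed_family \<nu>s t0 ?Q C .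
 have u2: "integrable \<nu>s (\<lambda>x. u x * u x)"
  using assms(9) by (rule Bochner_Integration.integrable_cong[THEN iffD1, rotated -1]) (auto simp: u_def power2_eq_square algebra_simps)
 \<comment> \<open>For norm at most 1 this is the hypothesis on 1 - \<open>g\<nu>\<close>. For
   larger norm |u| \<le> 1 + u^2 is used, on a region of finite measure.\<close>
 have um: "integrable \<nu>s (\<lambda>x. min (norm x) 1 * u x)"
 proof (rule integrable_le)
  have "{x::real^'d. 1 < norm x} \<in> sets \<nu>s" unfolding levy_measure_sets[OF L] by measurable
  then have "integrable \<nu>s (\<lambda>x. indicator {x. 1 < norm x} x :: real)"
   using levy_measure_emeasure_norm_gt[OF L, of 1] by (intro integrable_real_indicator) auto
  then show "integrable \<nu>s (\<lambda>x. indicator {x. norm x \<le> 1} x *\<^sub>R (norm x * \<bar>1 - g\<nu> x\<bar>) + (indicator {x. 1 < norm x} x + u x * u x))"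
   using assms(12) u2 unfolding set_integrable_def by (intro integrable_plus)
  have "(\<lambda>x. min (norm x) 1 * u x) \<in> borel_measurable borel" by measurable
  then show "(\<lambda>x. min (norm x) 1 * u x) \<in> borel_measurable \<nu>s" by (rule borel_nu)
  have "\<bar>min (norm x) 1 * u x\<bar> \<le> indicator {x. norm x \<le> 1} x *\<^sub>R (norm x * \<bar>1 - g\<nu> x\<bar>) + (indicator {x. 1 < norm x} x + u x * u x)" for x
  proof (cases "norm x \<le> 1")
   case True
   then show ?thesis by (simp add: u_def abs_mult abs_minus_commute)
  next
   case False
   have "0 \<le> (\<bar>u x\<bar> - 1)\<^sup>2" "0 \<le> \<bar>u x\<bar>" by simp_all
   then have "\<bar>u x\<bar> \<le> 1 + u x * u x" by (simp add: power2_diff) (simp add: power2_eq_square)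
   then show ?thesis using False by simp
  qed
  then show "AE x in \<nu>s. norm (min (norm x) 1 * u x) \<le> norm (indicator {x. norm x \<le> 1} x *\<^sub>R (norm x * \<bar>1 - g\<nu> x\<bar>) + (indicator {x. 1 < norm x} x + u x * u x))"
   by (intro AE_I2) (metis abs_ge_self order_trans real_norm_def)
 qed
 have gm: "integrable \<nu>s (\<lambda>x. min (norm x) 1 * g x)"
 proof (rule integrable_le[OF assms(11)])
  have "(\<lambda>x. min (norm x) 1 * g x) \<in> borel_measurable borel" by measurable
  then show "(\<lambda>x. min (norm x) 1 * g x) \<in> borel_measurable \<nu>s" by (rule borel_nu)
 qed (simp add: abs_mult)
 have au: "admissible \<nu>s u"
  using assms(6) um ub by (intro admissibleI) (auto simp: u_def)
 have ag: "admissible \<nu>s (\<lambda>x. u x + (\<theta> - \<theta>0) * g x)" if "\<theta> \<in> I" for \<theta>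
 proof (rule admissibleI)
  show "AE x in \<nu>s. - 1 \<le> u x + (\<theta> - \<theta>0) * g x" using assms(17)[OF that] by eventually_elim (simp add: u_def)
  have "integrable \<nu>s (\<lambda>x. min (norm x) 1 * u x + (\<theta> - \<theta>0) * (min (norm x) 1 * g x))"
   by (intro integrable_plus integrable_mult_right um gm)
  then show "integrable \<nu>s (\<lambda>x. min (norm x) 1 * (u x + (\<theta> - \<theta>0) * g x))" by (simp add: algebra_simps)
 qed measurable
 have vi: "set_integrable \<nu>s {x. norm x \<le> 1} (\<lambda>x. v x *\<^sub>R x)" if "v \<in> borel_measurable borel" "integrable \<nu>s (\<lambda>x. min (norm x) 1 * v x)" for v
  unfolding set_integrable_def
 proof (rule integrable_le[OF that(2)])
  have "{x::real^'d. norm x \<le> 1} \<in> sets borel" by measurable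
  then have "(\<lambda>x. indicator {x. norm x \<le> 1} x *\<^sub>R (v x *\<^sub>R x)) \<in> borel_measurable borel"
   using that(1) by (intro borel_measurable_scaleR borel_measurable_indicator) auto
  then show "(\<lambda>x. indicator {x. norm x \<le> 1} x *\<^sub>R (v x *\<^sub>R x)) \<in> borel_measurable \<nu>s" by (rule borel_nu)
 qed (auto simp: indicator_def abs_mult)
 have Q0: "?Q (\<lambda>_. 0) = distr (P bs \<nu>s) path_space (\<lambda>w. stopped t0 (X w))"
  by (simp add: stopped_law_def set_lebesgue_integral_def density_1)
 have Qu: "?Q u = distr (P b \<nu>) path_space (\<lambda>w. stopped t0 (X w))"
  unfolding stopped_law_def assms(13) \<nu> by (simp add: u_def)
 \<comment> \<open>The drift of the index u + (\<theta> - \<theta>0) g is affine in \<theta>; its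
   constant part is b by the relation between b and \<open>bs\<close>, so it equals
   \<open>b\<theta> \<theta>\<close>.\<close>
 have Q\<theta>: "?Q (\<lambda>x. u x + (\<theta> - \<theta>0) * g x) = distr (P (b\<theta> \<theta>) (\<nu>\<theta> \<theta>)) path_space (\<lambda>w. stopped t0 (X w))"
  and L\<theta>: "levy_measure (\<nu>\<theta> \<theta>)" if "\<theta> \<in> I" for \<theta>
 proof -
  have m: "density \<nu>s (\<lambda>x. ennreal (1 + (u x + (\<theta> - \<theta>0) * g x))) = \<nu>\<theta> \<theta>"
   unfolding assms(19)[OF that] by (simp add: u_def)
  then show "levy_measure (\<nu>\<theta> \<theta>)" using levy_measure_tilted[OF L ag[OF that]] by simp
  have "(LINT x:{x. norm x \<le> 1}|\<nu>s. (u x + (\<theta> - \<theta>0) * g x) *\<^sub>R x) = (LINT x:{x. norm x \<le> 1}|\<nu>s. u x *\<^sub>R x + (\<theta> - \<theta>0) *\<^sub>R (g x *\<^sub>R x))"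
   by (simp add: scaleR_add_left)
  also have "\<dots> = (LINT x:{x. norm x \<le> 1}|\<nu>s. u x *\<^sub>R x) + (\<theta> - \<theta>0) *\<^sub>R (LINT x:{x. norm x \<le> 1}|\<nu>s. g x *\<^sub>R x)"
   unfolding set_integral_scaleR_right[symmetric]
   by (rule set_integral_add(2)[OF vi[OF ub um] set_integrable_scaleR_right[OF vi[OF gb gm]]])
  finally have "bs + (LINT x:{x. norm x \<le> 1}|\<nu>s. (u x + (\<theta> - \<theta>0) * g x) *\<^sub>R x) = b\<theta> \<theta>"
   unfolding assms(18)[OF that] assms(13) by (simp add: u_def)
  with m show "?Q (\<lambda>x. u x + (\<theta> - \<theta>0) * g x) = distr (P (b\<theta> \<theta>) (\<nu>\<theta> \<theta>)) path_space (\<lambda>w. stopped t0 (X w))"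
   by (simp add: stopped_law_def)
 qed
 note fm = stopped_algebra_measurable(1)[OF t0 assms(21)] and fs = stopped_algebra_measurable(2)[OF t0 assms(21)]
 have Xm: "X \<in> measurable (P c \<mu>) path_space" if "levy_measure \<mu>" for c \<mu> using proc[OF that, of c] by (simp add: levy_process_def)
 have Xc: "X w \<in> cadlag" if "levy_measure \<mu>" "w \<in> space (P c \<mu>)" for c \<mu> w
  using measurable_space[OF Xm[OF that(1)] that(2)] by (simp add: space_path_space)
 have D: "integrable (distr (P c \<mu>) path_space (\<lambda>w. stopped t0 (X w))) h \<longleftrightarrow> integrable (P c \<mu>) (\<lambda>w. h (X w))"
  "(LINT w|distr (P c \<mu>) path_space (\<lambda>w. stopped t0 (X w)). h w) = (LINT w|P c \<mu>. h (X w))"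
  if \<mu>: "levy_measure \<mu>" and h: "h \<in> borel_measurable path_space" "\<And>w. w \<in> cadlag ==> h (stopped t0 w) = h w" for c \<mu> and h :: "(real => real^'d) => real"
 proof -
  note m = measurable_compose[OF Xm[OF \<mu>] stopped_measurable[OF t0]]
  have e: "h (stopped t0 (X w)) = h (X w)" if "w \<in> space (P c \<mu>)" for w by (rule h(2)[OF Xc[OF \<mu> that]])
  show "integrable (distr (P c \<mu>) path_space (\<lambda>w. stopped t0 (X w))) h \<longleftrightarrow> integrable (P c \<mu>) (\<lambda>w. h (X w))"
   unfolding integrable_distr_eq[OF m h(1)] by (rule Bochner_Integration.integrable_cong[OF refl e])
  show "(LINT w|distr (P c \<mu>) path_space (\<lambda>w. stopped t0 (X w)). h w) = (LINT w|P c \<mu>. h (X w))"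
   unfolding integral_distr[OF m h(1)] by (rule lint_cong[OF refl e])
 qed
 have f2: "integrable (?Q (\<lambda>_. 0)) (\<lambda>w. (f w)\<^sup>2)"
  unfolding Q0 using D(1)[OF L, of "\<lambda>w. (f w)\<^sup>2" bs] assms(22) fm fs by simp
 note au' = ub au u2
 note jm = jump_diffs_measurable[OF fm]
 have js: "jump_diffs ps f (stopped t0 w) = jump_diffs ps f w" if "w \<in> cadlag" for ps w
  by (rule jump_diffs_stopped[where f = f]) (use t0 fs that in auto)
 have jl: "jump_diffs ps f w = 0" if "w \<in> cadlag" "p \<in> set ps" "t0 < fst p" for ps w p
  by (rule jump_diffs_late[where f = f and s = t0 and p = p]) (use t0 fs that in auto)
 have dm: "jump_diff_n n z f \<in> borel_measurable path_space"
  and ds: "\<And>w. w \<in> cadlag ==> jump_diff_n n z f (stopped t0 w) = jump_diff_n n z f w" for n z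
  unfolding jump_diff_n_def using jm js by auto
 have dl: "jump_diff_n n z f w = 0" if "w \<in> cadlag" "i < n" "t0 < fst (z i)" for n z w i
  unfolding jump_diff_n_def by (rule jl[OF that(1) _ that(3)]) (use that(2) in auto)
 define ed where "ed n z = (LINT w|P b \<nu>. jump_diff_n n z f (X w))" for n z
 have ed: "expected_diff u f n z = ed n z" for n z
  unfolding expected_diff_def[OF au'] ed_def jump_diff_n_eq_shift_diffs[symmetric] Qu by (rule D(2)[OF L\<nu> dm ds])
 have edl: "ed n z = 0" if "i < n" "t0 < fst (z i)" for n z i
 proof -
  have "ed n z = (LINT w|P b \<nu>. 0)" unfolding ed_def
   by (rule lint_cong[OF refl]) (rule dl[where z = z and i = i], rule Xc[OF L\<nu>], use that in auto)
  then show ?thesis by simp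
 qed
 have coef: "integrable (jump_intensity_power n \<nu>s) (\<lambda>z. ed n z * tensor_power g n z) \<longleftrightarrow>
    integrable (PiN n (intensity_upto t0 \<nu>s)) (\<lambda>z. expected_diff u f n z * (\<Prod>i<n. g (snd (z i))))"
  "coefficient u f g n = (LINT z|jump_intensity_power n \<nu>s. ed n z * tensor_power g n z)" for n
 proof -
  have m: "(\<lambda>z. ed n z * tensor_power g n z) \<in> borel_measurable (PiN n (intensity_upto t0 \<nu>s))"
   unfolding tensor_power_def ed[symmetric]
   by (intro borel_measurable_times expected_diff_measurable[OF au' fm] Lam_prod_measurable[OF au' gb])
  note c = integral_PiM_intensity_upto[OF L t0 m]
  have "integrable (PiN n (intensity_upto t0 \<nu>s)) (\<lambda>z. ed n z * tensor_power g n z) \<longleftrightarrow> integrable (jump_intensity_power n \<nu>s) (\<lambda>z. ed n z * tensor_power g n z)"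
   by (rule c(1)) (simp add: edl)
  then show "integrable (jump_intensity_power n \<nu>s) (\<lambda>z. ed n z * tensor_power g n z) \<longleftrightarrow>
    integrable (PiN n (intensity_upto t0 \<nu>s)) (\<lambda>z. expected_diff u f n z * (\<Prod>i<n. g (snd (z i))))"
   by (simp add: ed tensor_power_def)
  have "(LINT z|PiN n (intensity_upto t0 \<nu>s). ed n z * tensor_power g n z) = (LINT z|jump_intensity_power n \<nu>s. ed n z * tensor_power g n z)"
   by (rule c(2)) (simp add: edl)
  then show "coefficient u f g n = (LINT z|jump_intensity_power n \<nu>s. ed n z * tensor_power g n z)"
   unfolding coefficient_def[OF au'] by (simp add: ed tensor_power_def)
 qed
 define cf where "cf n = (LINT z|jump_intensity_power n \<nu>s. ed n z * tensor_power g n z)" for n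
 have cf: "coefficient u f g n = cf n" for n unfolding cf_def by (rule coef(2))
 have edi: "integrable (jump_intensity_power n \<nu>s) (\<lambda>z. ed n z * tensor_power g n z)" if "1 \<le> n" for n
  unfolding coef(1) using that by (intro coefficient_bound(1)[OF au' fm f2 _ gb g2]) simp
 \<comment> \<open>Two kinds of z: if all jump times are at most \<open>t0\<close>, the family gives
   integrability almost everywhere; if one of them is later, the difference vanishes
   identically.\<close>
 have ae: "AE z in density (jump_intensity_power n \<nu>s) (\<lambda>z. ennreal \<bar>tensor_power g n z\<bar>). integrable (P b \<nu>) (\<lambda>w. jump_diff_n n z f (X w))" for n
 proof -
  interpret J: jump_measure "jump_intensity \<nu>s" by (rule jump_measure_jump_intensity[OF L])
  have i: "integrable (?Q u) (shift_diffs 1 n z f) \<longleftrightarrow> integrable (P b \<nu>) (\<lambda>w. jump_diff_n n z f (X w))" for z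
   unfolding Qu jump_diff_n_eq_shift_diffs[symmetric] by (rule D(1)[OF L\<nu> dm ds])
  have gs: "(\<lambda>p. g (snd p)) \<in> borel_measurable (jump_intensity \<nu>s)" by (rule measurable_compose[OF J.measurable_jump_id]) measurable
  have tm: "(\<lambda>z. ennreal \<bar>tensor_power g n z\<bar>) \<in> borel_measurable (jump_intensity_power n \<nu>s)"
   unfolding tensor_power_def jump_intensity_power_def
   by (intro measurable_compose[OF _ measurable_ennreal] borel_measurable_abs borel_measurable_prod
     measurable_compose[OF measurable_component_singleton[where M = "\<lambda>_. jump_intensity \<nu>s"] gs])
  have "AE z in density (jump_intensity_power n \<nu>s) (\<lambda>z. ennreal (\<Prod>i<n. indicator {..t0} (fst (z i)))). integrable (P b \<nu>) (\<lambda>w. jump_diff_n n z f (X w))"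
   using AE_integrable_jump_diffs[OF au' fm f2, of n] unfolding i PiM_intensity_upto(1)[OF L t0] .
  then have "AE z in jump_intensity_power n \<nu>s. 0 < ennreal (\<Prod>i<n. indicator {..t0} (fst (z i))) \<longrightarrow> integrable (P b \<nu>) (\<lambda>w. jump_diff_n n z f (X w))"
   using PiM_intensity_upto(2)[OF L t0, of n] by (subst (asm) AE_density) auto
  then have "AE z in jump_intensity_power n \<nu>s. 0 < ennreal \<bar>tensor_power g n z\<bar> \<longrightarrow> integrable (P b \<nu>) (\<lambda>w. jump_diff_n n z f (X w))"
  proof eventually_elim
   case (elim z)
   show ?case
   proof (cases "\<exists>i<n. t0 < fst (z i)")
    case True
    then obtain i where z: "i < n" "t0 < fst (z i)" by blast
    have "integrable (P b \<nu>) (\<lambda>w. jump_diff_n n z f (X w)) \<longleftrightarrow> integrable (P b \<nu>) (\<lambda>w. 0 :: real)"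
     by (rule Bochner_Integration.integrable_cong[OF refl]) (rule dl[where z = z and i = i], rule Xc[OF L\<nu>], use z in auto)
    then show ?thesis by simp
   next
    case False
    then have "\<forall>i<n. fst (z i) \<le> t0" using leI by blast
    then have "(\<Prod>i<n. indicator {..t0} (fst (z i))) = (1::real)" by (intro prod.neutral ballI) (auto simp: indicator_def)
    then show ?thesis using elim by simp
   qed
  qed
  then show ?thesis using tm by (subst AE_density)
 qed
 have int\<theta>: "integrable (P (b\<theta> \<theta>) (\<nu>\<theta> \<theta>)) (\<lambda>w. f (X w))" if "\<theta> \<in> I" for \<theta>
 proof -
  have "integrable (?Q (\<lambda>x. u x + (\<theta> - \<theta>0) * g x)) f"
   by (rule integrable_L2[OF fm f2 _ ag[OF that] perturbed_square[OF au' gb g2 gm ag[OF that]]]) measurable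
  then show ?thesis unfolding Q\<theta>[OF that] using D(1)[OF L\<theta>[OF that] fm fs] by blast
 qed
 have int0: "integrable (P b \<nu>) (\<lambda>w. f (X w))"
  using integrable_L2[OF fm f2 au'] D(1)[OF L\<nu> fm fs, of b] unfolding Qu by blast
 have cf0: "cf 0 = (LINT w|P b \<nu>. f (X w))"
  unfolding cf[symmetric] coefficient_0[OF au'] Qu by (rule D(2)[OF L\<nu> fm fs])
 \<comment> \<open>This holds for every real t, since the majorant involves g only through its norm
   in L^2; the coefficients therefore define an entire power series.\<close>
 have sm: "summable (\<lambda>n. \<bar>t ^ n / fact n * cf n\<bar>)" for t
 proof (rule summable_comparison_test'[where N = 1])
  show "summable (term_bound u (LINT w|?Q (\<lambda>_. 0). (f w)\<^sup>2) (t0 * (LINT x|\<nu>s. (g x)\<^sup>2)) t)"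
   using t0 by (intro summable_term_bound[OF au']) simp
  show "norm \<bar>t ^ n / fact n * cf n\<bar> \<le> term_bound u (LINT w|?Q (\<lambda>_. 0). (f w)\<^sup>2) (t0 * (LINT x|\<nu>s. (g x)\<^sup>2)) t n" if "1 \<le> n" for n
   using term_le[OF au' fm f2 _ gb g2, of n t] that by (simp add: cf)
 qed
 have ser: "(LINT w|P (b\<theta> \<theta>) (\<nu>\<theta> \<theta>). f (X w)) = (\<Sum>n. (\<theta> - \<theta>0) ^ n / fact n * cf n)" if "\<theta> \<in> I" for \<theta>
  using perturbation_series[OF au' gb g2 gm ag[OF that] fm f2] D(2)[OF L\<theta>[OF that] fm fs, of "b\<theta> \<theta>"]
  unfolding Q\<theta>[OF that] cf by simp
 have ser': "(LINT w|P (b\<theta> \<theta>) (\<nu>\<theta> \<theta>). f (X w)) = (LINT w|P b \<nu>. f (X w)) + (\<Sum>n. (\<theta> - \<theta>0) ^ Suc n / fact (Suc n) * cf (Suc n))" if "\<theta> \<in> I" for \<theta>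
  unfolding ser[OF that] using suminf_split_head[OF summable_rabs_cancel[OF sm[of "\<theta> - \<theta>0"]]] by (simp add: cf0)
 \<comment> \<open>Evaluation at coordinate 0 carries the one-fold product to
   \<open>jump_intensity\<close>; Fubini, with time as the inner variable, then gives the iterated
   integral.\<close>
 have cf1: "cf 1 = (LINT x|\<nu>s. (LINT t|half_line_lebesgue. (LINT w|P b \<nu>. jump_diff (t, x) f (X w)) * g x))"
 proof -
  interpret J: jump_measure "jump_intensity \<nu>s" by (rule jump_measure_jump_intensity[OF L])
  interpret PJ: product_sigma_finite "\<lambda>_::nat. jump_intensity \<nu>s" by (rule J.product_sigma_finite_jump)
  interpret pair_sigma_finite half_line_lebesgue \<nu>s
   using sigma_finite_half_line levy_measure_sigma_finite[OF L] by (simp add: pair_sigma_finite_def)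
  define H where "H p = (LINT w|P b \<nu>. jump_diff p f (X w)) * g (snd p)" for p
  have one: "jump_intensity_power 1 \<nu>s = Pi\<^sub>M {0} (\<lambda>_. jump_intensity \<nu>s)" by (simp add: jump_intensity_power_def lessThan_Suc)
  have H: "ed 1 z * tensor_power g 1 z = H (z 0)" for z
   by (simp add: ed_def H_def tensor_power_def jump_diff_n_def)
  have Hm: "H \<in> borel_measurable (jump_intensity \<nu>s)"
  proof -
   have "(\<lambda>p. \<lambda>i\<in>{0}. p) \<in> measurable (jump_intensity \<nu>s) (Pi\<^sub>M {0::nat} (\<lambda>_. jump_intensity \<nu>s))" by (rule measurable_restrict) simp
   moreover have "(\<lambda>z. ed 1 z * tensor_power g 1 z) \<in> borel_measurable (Pi\<^sub>M {0} (\<lambda>_. jump_intensity \<nu>s))"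
    using edi[of 1] unfolding one by auto
   ultimately have "(\<lambda>p. ed 1 (\<lambda>i\<in>{0}. p) * tensor_power g 1 (\<lambda>i\<in>{0}. p)) \<in> borel_measurable (jump_intensity \<nu>s)"
    by (rule measurable_compose)
   then show ?thesis unfolding H by simp
  qed
  have d: "jump_intensity \<nu>s = distr (Pi\<^sub>M {0::nat} (\<lambda>_. jump_intensity \<nu>s)) (jump_intensity \<nu>s) (\<lambda>z. z 0)"
   by (rule PJ.distr_singleton[symmetric])
  have cm: "(\<lambda>z. z 0) \<in> measurable (Pi\<^sub>M {0::nat} (\<lambda>_. jump_intensity \<nu>s)) (jump_intensity \<nu>s)"
   by (rule measurable_component_singleton) simp
  have Hi: "integrable (jump_intensity \<nu>s) H"
   using edi[of 1] unfolding one H by (subst d) (simp add: integrable_distr_eq[OF cm Hm])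
  have "cf 1 = (LINT p|jump_intensity \<nu>s. H p)"
   unfolding cf_def one H by (subst (2) d) (rule integral_distr[OF cm Hm, symmetric])
  also have "\<dots> = (LINT x|\<nu>s. (LINT t|half_line_lebesgue. H (t, x)))"
   using integral_snd[of "\<lambda>t x. H (t, x)"] Hi unfolding jump_intensity_def by (simp add: case_prod_beta')
  finally show ?thesis by (simp add: H_def)
 qed
 \<comment> \<open>The power series is differentiable at 0 from both sides; the restriction to I
   comes afterwards, which covers the case that \<theta>0 is an endpoint.\<close>
 have der: "((\<lambda>\<theta>. \<integral>w. f (X w) \<partial>P (b\<theta> \<theta>) (\<nu>\<theta> \<theta>)) has_real_derivative cf 1) (at \<theta>0 within I)"
 proof -
  have "((\<lambda>x. \<Sum>n. (cf n / fact n) * x ^ n) has_real_derivative cf 1 / fact 1) (at 0)"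
   by (rule has_derivative_powser_0) (use summable_rabs_cancel[OF sm] in \<open>simp add: mult.commute\<close>)
  then have "((\<lambda>\<theta>. \<Sum>n. (cf n / fact n) * (\<theta> + - \<theta>0) ^ n) has_real_derivative cf 1) (at \<theta>0)"
   using DERIV_shift[of "\<lambda>x. \<Sum>n. (cf n / fact n) * x ^ n" "cf 1" \<theta>0 "- \<theta>0"] by simp
  then have "((\<lambda>\<theta>. \<Sum>n. (cf n / fact n) * (\<theta> + - \<theta>0) ^ n) has_real_derivative cf 1) (at \<theta>0 within I)"
   by (rule has_field_derivative_at_within)
  then show ?thesis
   by (rule has_field_derivative_transform_within[OF _ zero_less_one \<theta>0]) (simp add: ser mult.commute)
 qed
 have sm': "summable (\<lambda>n. \<bar>t ^ Suc n / fact (Suc n) * cf (Suc n)\<bar>)" for t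
  using sm[of t] summable_Suc_iff[of "\<lambda>n. \<bar>t ^ n / fact n * cf n\<bar>"] by blast
 show ?thesis
  unfolding Let_def ed_def[symmetric] cf_def[symmetric] cf1[symmetric]
  by (intro conjI ballI allI impI int\<theta> int0 ae edi ser' der sm')
qed

end
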